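(* Let $d=3$ and $0\le s\le2$. There exists a small absolute number $\delta>0$ such that the following holds. Let $T>0$ and, for $\hbar\in(0,1]$, let $V(t,x)\in C([0,T];W^{4,\infty}_x(\mathbb{R}^3))$ be real-valued (possibly depending on $\hbar$) and satisfy, for all $0\le t\le T$, $$\|\partial^\alpha V(t)\|_{L^\infty_x}\lesssim\begin{cases}\langle t\rangle^{-1}&|\alpha|=0,\\\langle t\rangle^{-2}&|\alpha|=1,\\\langle t\rangle^{-3+\delta}&|\alpha|=2,\\\langle t\rangle^{-4+\delta}&|\alpha|=3,\\\langle t\rangle^{-4+\delta}&|\alpha|=4,\end{cases}$$ and $$\|\partial^\alpha V(t)\|_{\mathcal{F}L^1}\lesssim\begin{cases}\langle t\rangle^{-2+\delta}&|\alpha|=1,\\\langle t\rangle^{-3+\delta}&|\alpha|=2,\\\min\big(\langle t\rangle^{-7/2+\delta},\ \hbar^{-3/2}\langle t\rangle^{-4+\delta}\big)&|\alpha|=3.\end{cases}$$ Define $$\Psi(t,\xi):=\frac1\hbar\int_0^tV(\tau,\tau\xi)\,d\tau.$$ Then, for all $0\le s\le2$, $$\sup_{\hbar\in(0,1]}\ \sup_{0\le t\le T}\Big\|\langle x\rangle^se^{i\Psi(t,-i\hbar\nabla_x)}\mathcal{W}^\hbar_V(t)\langle x\rangle^{-s}\Big\|_{\mathcal{B}}\lesssim1 .$$ Moreover, all implicit constants are independent of $T>0$.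
   Context: $\hbar\in(0,1]$, $\langle y\rangle=(1+|y|^2)^{1/2}$. $A\lesssim B$ means $A\le CB$ with $C>0$ independent of $\hbar$ (here also of $T$; the constant in the conclusion depends on the constants in the hypotheses). $\mathcal{B}$: bounded operators on $L^2(\mathbb{R}^3)$ with operator norm. $\|f\|_{\mathcal{F}L^1}=\|\widehat f\|_{L^1}$ with $\widehat f(\xi)=(2\pi)^{-3/2}\int e^{-ix\xi}f(x)dx$. $m(-i\hbar\nabla_x)$ is the Fourier multiplier with symbol $m(\hbar\xi)$. $\mathcal{U}^\hbar(t)=e^{it\hbar\Delta/2}$; $\mathcal{U}^\hbar_V(t)$ is the propagator from time $0$: $u(t)=\mathcal{U}^\hbar_V(t)\phi$ solves $i\hbar\partial_tu=-\frac{\hbar^2}2\Delta u+V(t,x)u$, $u(0)=\phi$. The finite-time wave operator is $\mathcal{W}^\hbar_V(t):=\mathcal{U}^\hbar(-t)\,\mathcal{U}^\hbar_V(t)$. *)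

theory Defs
  imports "HOL-Analysis.Analysis" "HOL-Probability.Essential_Supremum"
begin

type_synonym R3 = "real ^ 3"

text \<open>Elements of \<open>L\<^sup>2\<close>, \<open>L\<^sup>\<infinity>\<close>, \dots\ are represented by Borel functions on
  \<open>R3\<close>; objects determined only up to null sets are picked with \<open>SOME\<close>, and everything below is
  insensitive to the choice of representative.\<close>

definition japanese :: "'a::real_normed_vector \<Rightarrow> real" where
  "japanese y = sqrt (1 + (norm y)\<^sup>2)"


section \<open>Test functions and weak derivatives\<close>

type_synonym multiindex = "nat ^ 3"

definition mi_order :: "multiindex \<Rightarrow> nat" where
  "mi_order \<alpha> = (\<Sum>i\<in>UNIV. \<alpha> $ i)"

definition pderiv1 :: "3 \<Rightarrow> (R3 \<Rightarrow> complex) \<Rightarrow> R3 \<Rightarrow> complex" where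
  "pderiv1 i f x = frechet_derivative f (at x) (axis i 1)"

definition pderivs :: "multiindex \<Rightarrow> (R3 \<Rightarrow> complex) \<Rightarrow> R3 \<Rightarrow> complex" where
  "pderivs \<alpha> f = (pderiv1 1 ^^ (\<alpha> $ 1)) ((pderiv1 2 ^^ (\<alpha> $ 2)) ((pderiv1 3 ^^ (\<alpha> $ 3)) f))"

definition laplacian :: "(R3 \<Rightarrow> complex) \<Rightarrow> R3 \<Rightarrow> complex" where
  "laplacian f x = (\<Sum>i\<in>UNIV. pderiv1 i (pderiv1 i f) x)"

text \<open>Differentiability of every iterated partial derivative amounts to \<open>f \<in> C\<^sup>\<infinity>\<close>.\<close>

definition smooth :: "(R3 \<Rightarrow> complex) \<Rightarrow> bool" where
  "smooth f \<longleftrightarrow> (\<forall>\<alpha>. pderivs \<alpha> f differentiable_on UNIV)"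

definition test_function :: "(R3 \<Rightarrow> complex) \<Rightarrow> bool" where
  "test_function f \<longleftrightarrow> smooth f \<and> bounded {x. f x \<noteq> 0}"

definition schwartz :: "(R3 \<Rightarrow> complex) \<Rightarrow> bool" where
  "schwartz f \<longleftrightarrow> smooth f \<and>
     (\<forall>\<alpha> (k::nat). \<exists>C. \<forall>x. japanese x ^ k * norm (pderivs \<alpha> f x) \<le> C)"

definition locally_integrable :: "(R3 \<Rightarrow> complex) \<Rightarrow> bool" where
  "locally_integrable f \<longleftrightarrow>
     f \<in> borel_measurable lborel \<and> (\<forall>K. compact K \<longrightarrow> set_integrable lborel K f)"

definition is_weak_deriv :: "multiindex \<Rightarrow> (R3 \<Rightarrow> complex) \<Rightarrow> (R3 \<Rightarrow> complex) \<Rightarrow> bool" where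
  "is_weak_deriv \<alpha> f g \<longleftrightarrow> locally_integrable f \<and> locally_integrable g \<and>
     (\<forall>\<phi>. test_function \<phi> \<longrightarrow>
        (LINT x|lborel. f x * pderivs \<alpha> \<phi> x) = (-1) ^ mi_order \<alpha> * (LINT x|lborel. g x * \<phi> x))"

definition weak_deriv :: "multiindex \<Rightarrow> (R3 \<Rightarrow> complex) \<Rightarrow> R3 \<Rightarrow> complex" where
  "weak_deriv \<alpha> f = (SOME g. is_weak_deriv \<alpha> f g)"


section \<open>Norms and function spaces\<close>

definition Linf_norm :: "(R3 \<Rightarrow> complex) \<Rightarrow> ennreal" where
  "Linf_norm f = esssup lborel (\<lambda>x. ennreal (norm (f x)))"

definition W_inf :: "nat \<Rightarrow> (R3 \<Rightarrow> complex) \<Rightarrow> bool" where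
  "W_inf k f \<longleftrightarrow> (\<forall>\<alpha>. mi_order \<alpha> \<le> k \<longrightarrow> (\<exists>g. is_weak_deriv \<alpha> f g \<and> Linf_norm g < \<infinity>))"

definition W_inf_norm :: "nat \<Rightarrow> (R3 \<Rightarrow> complex) \<Rightarrow> ennreal" where
  "W_inf_norm k f = (SUP \<alpha>\<in>{\<alpha>. mi_order \<alpha> \<le> k}. Linf_norm (weak_deriv \<alpha> f))"

text \<open>\<open>C([0,T]; W\<^bsup>k,\<infinity>\<^esup>)\<close> for real-valued potentials. For \<open>k \<ge> 1\<close> each \<open>V t\<close> has a unique continuous
  representative; it is the one meant, because \<open>V\<close> is evaluated pointwise in \<open>phase\<close>.\<close>

definition C_W_inf :: "nat \<Rightarrow> real \<Rightarrow> (real \<Rightarrow> R3 \<Rightarrow> real) \<Rightarrow> bool" where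
  "C_W_inf k T V \<longleftrightarrow>
     (\<forall>t\<in>{0..T}. continuous_on UNIV (V t) \<and> W_inf k (\<lambda>x. of_real (V t x)) \<and>
        ((\<lambda>\<tau>. W_inf_norm k (\<lambda>x. of_real (V \<tau> x - V t x))) \<longlongrightarrow> 0) (at t within {0..T}))"

definition L2 :: "(R3 \<Rightarrow> complex) set" where
  "L2 = {f. f \<in> borel_measurable lborel \<and> integrable lborel (\<lambda>x. (norm (f x))\<^sup>2)}"

definition L2_norm :: "(R3 \<Rightarrow> complex) \<Rightarrow> real" where
  "L2_norm f = sqrt (LINT x|lborel. (norm (f x))\<^sup>2)"

text \<open>Operator norm on \<open>L\<^sup>2\<close>; it is \<open>\<infinity>\<close> if the operator does not map \<open>L\<^sup>2\<close> boundedly into \<open>L\<^sup>2\<close>.\<close>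

definition L2_opnorm :: "((R3 \<Rightarrow> complex) \<Rightarrow> R3 \<Rightarrow> complex) \<Rightarrow> ennreal" where
  "L2_opnorm A = Inf {ennreal C | C. 0 \<le> C \<and> (\<forall>f\<in>L2. A f \<in> L2 \<and> L2_norm (A f) \<le> C * L2_norm f)}"


section \<open>Fourier transform\<close>

definition fourier_integral :: "(R3 \<Rightarrow> complex) \<Rightarrow> R3 \<Rightarrow> complex" where
  "fourier_integral f \<xi> =
     of_real ((2 * pi) powr (-3/2)) * (LINT x|lborel. cis (- (x \<bullet> \<xi>)) * f x)"

definition tempered_function :: "(R3 \<Rightarrow> complex) \<Rightarrow> bool" where
  "tempered_function f \<longleftrightarrow> f \<in> borel_measurable lborel \<and>
     (\<forall>\<phi>. schwartz \<phi> \<longrightarrow> integrable lborel (\<lambda>x. f x * \<phi> x))"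

text \<open>The defining integral does not converge for a general \<open>f\<close> in \<open>L\<^sup>2\<close> or \<open>L\<^sup>\<infinity>\<close>, so the Fourier
  transform is extended by duality, as for tempered distributions. On \<open>L\<^sup>1\<close> it agrees with
  \<open>fourier_integral\<close>, and on \<open>L\<^sup>2\<close> with the Plancherel transform.\<close>

definition is_fourier :: "(R3 \<Rightarrow> complex) \<Rightarrow> (R3 \<Rightarrow> complex) \<Rightarrow> bool" where
  "is_fourier f g \<longleftrightarrow> tempered_function f \<and> tempered_function g \<and>
     (\<forall>\<phi>. schwartz \<phi> \<longrightarrow>
        (LINT \<xi>|lborel. g \<xi> * \<phi> \<xi>) = (LINT x|lborel. f x * fourier_integral \<phi> x))"

definition fourier :: "(R3 \<Rightarrow> complex) \<Rightarrow> R3 \<Rightarrow> complex" where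
  "fourier f = (SOME g. is_fourier f g)"

definition inv_fourier :: "(R3 \<Rightarrow> complex) \<Rightarrow> R3 \<Rightarrow> complex" where
  "inv_fourier g = (SOME f. is_fourier f g)"

definition FL1_norm :: "(R3 \<Rightarrow> complex) \<Rightarrow> ennreal" where
  "FL1_norm f =
     (if \<exists>g. is_fourier f g then \<integral>\<^sup>+ \<xi>. ennreal (norm (fourier f \<xi>)) \<partial>lborel else \<infinity>)"

definition fourier_multiplier :: "(R3 \<Rightarrow> complex) \<Rightarrow> (R3 \<Rightarrow> complex) \<Rightarrow> R3 \<Rightarrow> complex" where
  "fourier_multiplier m f = inv_fourier (\<lambda>\<xi>. m \<xi> * fourier f \<xi>)"

text \<open>The operator \<open>m(-i\<hbar>\<nabla>)\<close>.\<close>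

definition semiclassical_multiplier ::
    "real \<Rightarrow> (R3 \<Rightarrow> complex) \<Rightarrow> (R3 \<Rightarrow> complex) \<Rightarrow> R3 \<Rightarrow> complex" where
  "semiclassical_multiplier h m = fourier_multiplier (\<lambda>\<xi>. m (h *\<^sub>R \<xi>))"


section \<open>Propagators and the finite-time wave operator\<close>

text \<open>\<open>e\<^bsup>it\<hbar>\<Delta>/2\<^esup>\<close>, using that \<open>\<Delta>\<close> has symbol \<open>-|\<xi>|\<^sup>2\<close>.\<close>

definition free_propagator :: "real \<Rightarrow> real \<Rightarrow> (R3 \<Rightarrow> complex) \<Rightarrow> R3 \<Rightarrow> complex" where
  "free_propagator h t = fourier_multiplier (\<lambda>\<xi>. cis (- (t * h * (norm \<xi>)\<^sup>2 / 2)))"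

text \<open>\<open>u \<in> C([0,T]; L\<^sup>2)\<close> with \<open>u(0) = \<phi>\<close> and
  \<open>i\<hbar> \<partial>\<^sub>t u = - \<hbar>\<^sup>2/2 \<Delta> u + V u\<close> in the sense of distributions in \<open>x\<close>
  (for \<open>\<phi>\<close> merely in \<open>L\<^sup>2\<close>, \<open>\<Delta> u\<close> is not a function).\<close>

definition schrodinger_solution ::
    "real \<Rightarrow> real \<Rightarrow> (real \<Rightarrow> R3 \<Rightarrow> real) \<Rightarrow> (R3 \<Rightarrow> complex) \<Rightarrow> (real \<Rightarrow> R3 \<Rightarrow> complex) \<Rightarrow> bool" where
  "schrodinger_solution h T V \<phi> u \<longleftrightarrow>
     (\<forall>t\<in>{0..T}. u t \<in> L2 \<and>
        ((\<lambda>\<tau>. L2_norm (\<lambda>x. u \<tau> x - u t x)) \<longlongrightarrow> 0) (at t within {0..T})) \<and>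
     (AE x in lborel. u 0 x = \<phi> x) \<and>
     (\<forall>\<psi>. test_function \<psi> \<longrightarrow> (\<forall>t\<in>{0..T}.
        ((\<lambda>\<tau>. \<i> * of_real h * (LINT x|lborel. u \<tau> x * \<psi> x)) has_vector_derivative
           (LINT x|lborel. u t x * (- of_real (h\<^sup>2 / 2) * laplacian \<psi> x + of_real (V t x) * \<psi> x)))
        (at t within {0..T})))"

definition propagator ::
    "real \<Rightarrow> real \<Rightarrow> (real \<Rightarrow> R3 \<Rightarrow> real) \<Rightarrow> real \<Rightarrow> (R3 \<Rightarrow> complex) \<Rightarrow> R3 \<Rightarrow> complex" where
  "propagator h T V t \<phi> = (SOME u. schrodinger_solution h T V \<phi> u) t"

definition wave_operator ::
    "real \<Rightarrow> real \<Rightarrow> (real \<Rightarrow> R3 \<Rightarrow> real) \<Rightarrow> real \<Rightarrow> (R3 \<Rightarrow> complex) \<Rightarrow> R3 \<Rightarrow> complex" where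
  "wave_operator h T V t \<phi> = free_propagator h (- t) (propagator h T V t \<phi>)"

definition phase :: "real \<Rightarrow> (real \<Rightarrow> R3 \<Rightarrow> real) \<Rightarrow> real \<Rightarrow> R3 \<Rightarrow> real" where
  "phase h V t \<xi> = 1 / h * integral {0..t} (\<lambda>\<tau>. V \<tau> (\<tau> *\<^sub>R \<xi>))"

text \<open>\<open>\<langle>x\<rangle>\<^sup>s e\<^bsup>i\<Psi>(t, -i\<hbar>\<nabla>)\<^esup> \<W>(t) \<langle>x\<rangle>\<^bsup>-s\<^esup>\<close>, with \<open>\<Psi>\<close> the \<open>phase\<close>.\<close>

definition weighted_wave_operator ::
    "real \<Rightarrow> real \<Rightarrow> real \<Rightarrow> (real \<Rightarrow> R3 \<Rightarrow> real) \<Rightarrow> real \<Rightarrow> (R3 \<Rightarrow> complex) \<Rightarrow> R3 \<Rightarrow> complex" where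
  "weighted_wave_operator s h T V t f =
     (\<lambda>x. of_real (japanese x powr s) *
        semiclassical_multiplier h (\<lambda>\<xi>. cis (phase h V t \<xi>))
          (wave_operator h T V t (\<lambda>y. of_real (japanese y powr (- s)) * f y)) x)"

end

theory Submission
 imports Defs "HOL-Probability.Characteristic_Functions" "HOL-Probability.Sinc_Integral"
begin

text \<open>In Fourier variables and in the interaction picture, the modified wave operator becomes a flow
\<open>v' = H v\<close> with skew-adjoint \<open>H\<close>, in which \<open>V(t, t\<xi>)\<close> has been subtracted from the potential by the phase \<open>\<Psi>\<close>.
The weights \<open>|x|\<close> and \<open>|x|\<^sup>2\<close> become first and second differences of \<open>v\<close> in \<open>\<xi>\<close>. The commutators of \<open>H\<close> with
translations are integrals against the Fourier transform of \<open>V\<close> whose low order terms cancel against the phase; the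
remainders are bounded by moments of that transform and decay like \<open>\<langle>t\<rangle>\<^bsup>-5/4\<^esup>\<close>, so that Gronwall's lemma bounds the
differences uniformly in \<open>t\<close> and \<open>\<hbar>\<close>. The case \<open>0 < s < 2\<close> follows by interpolation.\<close>

text \<open>The hypotheses control the transforms of derivatives of V but not of V itself, so the
  density \<nu> in V(x) - V(y) = \<integral> \<nu>(\<eta>) (e^(i\<eta>x) - e^(i\<eta>y)) d\<eta> may
  be too singular at \<eta> = 0 to be integrable. The generator is therefore never written as an
  integral over \<nu>; only combinations of total mass zero are estimated, and the term subtracted
  by the phase makes the mass vanish. Finite differences replace derivatives because for fixed h the
  generator is bounded: all differences of the solution stay in L^2, and no domain has to be
  propagated. The kinetic part of the phase is the delicate one. The factor e^(-i t h |\<eta>|^2 /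
  2) - 1 is bounded by sqrt(t h) |\<eta>|, which in second differences costs t^(5/2) h^(3/2) times
  the third moment; this is where the bound h^(-3/2) <t>^(-4+\<delta>) is spent. The propagator is
  an unspecified solution of a distributional equation, so every such solution has to be converted
  into the flow; the unbounded |\<xi>|^2 is tamed for this by the factor 1 / (1 +
  |\<xi>|^2).\<close>

abbreviation "bmeas \<equiv> borel_measurable borel"

section \<open>The Hilbert space of square integrable functions\<close>

lemma cnj_measurable[measurable]: "cnj \<in> bmeas"
 by (intro borel_measurable_continuous_onI continuous_intros)

lemma L2_measurable[measurable_dest]: "f \<in> L2 ==> f \<in> bmeas"
 by (simp add: L2_def)

lemma L2_cong_AE:
 assumes "f \<in> L2" "g \<in> bmeas" "AE x in lborel. f x = g x"
 shows "g \<in> L2"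
proof -
 have "integrable lborel (\<lambda>x. (norm (f x))\<^sup>2) \<longleftrightarrow> integrable lborel (\<lambda>x. (norm (g x))\<^sup>2)"
  using assms L2_measurable[OF assms(1)] by (intro integrable_cong_AE) auto
 thus ?thesis using assms by (simp add: L2_def)
qed

lemma L2_bound:
 assumes "f \<in> L2" and [measurable]: "g \<in> bmeas" and "AE x in lborel. norm (g x) \<le> C * norm (f x)"
 shows "g \<in> L2"
proof -
 have "integrable lborel (\<lambda>x. C\<^sup>2*(norm (f x))^2)"
  using assms by (intro integrable_mult_right) (simp add: L2_def)
 hence "integrable lborel (\<lambda>x. (norm (g x))\<^sup>2)"
 proof (rule Bochner_Integration.integrable_bound)
  show "AE x in lborel. norm ((norm (g x))^2) \<le> norm (C\<^sup>2*(norm (f x))^2)"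
   using assms(3) by eventually_elim (smt (verit) norm_power norm_ge_zero power_mono power_mult_distrib real_norm_def abs_power2 zero_le_power2)
 qed measurable
 thus ?thesis by (simp add: L2_def)
qed

lemma L2_zero[simp]: "(\<lambda>x. 0) \<in> L2" by (simp add: L2_def)

lemma norm_add_squared_le: "(norm (a + b :: 'a::real_normed_vector))^2 \<le> 2*(norm a)^2 + 2*(norm b)^2"
proof -
 have "(norm (a + b))^2 \<le> (norm a + norm b)^2" by (intro power_mono norm_triangle_ineq) auto
 also have "... \<le> 2*(norm a)^2 + 2*(norm b)^2"
  using zero_le_power2[of "norm a - norm b"] by (simp add: power2_eq_square algebra_simps)
 finally show ?thesis .
qed

lemma L2_add: assumes "f \<in> L2" "g \<in> L2" shows "(\<lambda>x. f x + g x) \<in> L2"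
proof -
 have [measurable]: "f \<in> bmeas" "g \<in> bmeas" using assms by (auto dest: L2_measurable)
 have "integrable lborel (\<lambda>x. 2*(norm (f x))^2 + 2*(norm (g x))^2)"
  using assms by (auto simp: L2_def)
 hence "integrable lborel (\<lambda>x. (norm (f x + g x))\<^sup>2)"
  by (rule Bochner_Integration.integrable_bound) (auto intro!: AE_I2 norm_add_squared_le simp: )
 thus ?thesis by (simp add: L2_def)
qed

lemma L2_cmult: "f \<in> L2 ==> (\<lambda>x. c * f x) \<in> L2"
 by (rule L2_bound[where C="norm c" and f=f]) (auto dest!: L2_measurable simp: norm_mult)

lemma L2_scaleR: "f \<in> L2 ==> (\<lambda>x. c *\<^sub>R f x) \<in> L2"
 using L2_cmult[of f "of_real c"] by (simp add: scaleR_conv_of_real)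

lemma L2_uminus: "f \<in> L2 ==> (\<lambda>x. - f x) \<in> L2"
 using L2_cmult[of f "-1"] by simp

lemma L2_diff: "f \<in> L2 ==> g \<in> L2 ==> (\<lambda>x. f x - g x) \<in> L2"
 using L2_add[of f "\<lambda>x. - g x"] L2_uminus[of g] by simp

lemma L2_cnj: "f \<in> L2 ==> (\<lambda>x. cnj (f x)) \<in> L2"
 by (rule L2_bound[where C=1 and f=f]) (auto dest!: L2_measurable intro: measurable_compose[OF _ cnj_measurable])

lemma L2_mult_integrable: assumes "f \<in> L2" "g \<in> L2" shows "integrable lborel (\<lambda>x. f x * g x)"
proof -
 have [measurable]: "f \<in> bmeas" "g \<in> bmeas" using assms by (auto dest: L2_measurable)
 have "integrable lborel (\<lambda>x. (norm (f x))\<^sup>2 + (norm (g x))^2)"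
  using assms by (auto simp: L2_def)
 thus ?thesis
 proof (rule Bochner_Integration.integrable_bound)
  have "norm (f x * g x) \<le> norm ((norm (f x))^2 + (norm (g x))^2)" for x
   using sum_squares_bound[of "norm (f x)" "norm (g x)"] mult_nonneg_nonneg[OF norm_ge_zero[of "f x"] norm_ge_zero[of "g x"]]
   unfolding norm_mult real_norm_def abs_of_nonneg[OF add_nonneg_nonneg[OF zero_le_power2 zero_le_power2]]
   by linarith
  thus "AE x in lborel. norm (f x * g x) \<le> norm ((norm (f x))^2 + (norm (g x))^2)" by simp
 qed measurable
qed

text \<open>Only a partial equivalence: a function outside \<open>L2\<close> is not related even to
  itself. Hence \<open>mk f\<close> is controlled only for \<open>f\<close> in \<open>L2\<close>,
  and that premise accompanies nearly every rule about \<open>mk\<close>.\<close>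

definition l2rel :: "(R3 => complex) => (R3 => complex) => bool" where
 "l2rel f g \<longleftrightarrow> f \<in> L2 \<and> g \<in> L2 \<and> (AE x in lborel. f x = g x)"

quotient_type l2 = "R3 => complex" / partial: l2rel
proof (rule part_equivpI)
 show "\<exists>x. l2rel x x" by (intro exI[of _ "\<lambda>x. 0"]) (simp add: l2rel_def)
 show "symp l2rel" by (auto simp: l2rel_def symp_def)
 show "transp l2rel"
  by (rule transpI) (auto simp: l2rel_def elim: eventually_elim2)
qed

abbreviation mk :: "(R3 => complex) => l2" where "mk \<equiv> abs_l2"
abbreviation rep :: "l2 => R3 => complex" where "rep \<equiv> rep_l2"

lemma rep_L2[simp, intro]: "rep v \<in> L2"
 using Quotient3_rel_rep[OF Quotient3_l2, of v v] by (simp add: l2rel_def)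

lemma rep_measurable[measurable]: "rep v \<in> bmeas"
 using L2_measurable[OF rep_L2] .

lemma mk_rep[simp]: "mk (rep v) = v"
 by (rule Quotient3_abs_rep[OF Quotient3_l2])

lemma mk_eq_iff: "f \<in> L2 ==> g \<in> L2 ==> mk f = mk g \<longleftrightarrow> (AE x in lborel. f x = g x)"
 using Quotient3_rel[OF Quotient3_l2, of f g] by (auto simp: l2rel_def)

lemma mk_eqI: "f \<in> L2 ==> g \<in> bmeas ==> (AE x in lborel. f x = g x) ==> mk f = mk g"
 using mk_eq_iff L2_cong_AE by blast

lemma rep_mk: "f \<in> L2 ==> AE x in lborel. rep (mk f) x = f x"
 using mk_eq_iff[of "rep (mk f)" f] by simp

lemma l2_eq_iff: "u = v \<longleftrightarrow> (AE x in lborel. rep u x = rep v x)"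
 using mk_eq_iff[of "rep u" "rep v"] by simp

text \<open>Conjugate-linear in the first argument. The type class admits only real scalars, so
  \<open>inner\<close> keeps the real part of \<open>cip\<close>, and the complex structure is
  carried separately by \<open>cmul\<close>.\<close>

definition cip :: "l2 => l2 => complex" where
 "cip u v = (LBINT x. cnj (rep u x) * rep v x)"

instantiation l2 :: real_inner
begin

definition "(0::l2) = mk (\<lambda>x. 0)"
definition "(u::l2) + v = mk (\<lambda>x. rep u x + rep v x)"
definition "(u::l2) - v = mk (\<lambda>x. rep u x - rep v x)"
definition "- (u::l2) = mk (\<lambda>x. - rep u x)"
definition "c *\<^sub>R (u::l2) = mk (\<lambda>x. c *\<^sub>R rep u x)"
definition "inner (u::l2) v = Re (cip u v)"
definition "norm (u::l2) = sqrt (inner u u)"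
definition "dist (u::l2) v = norm (u - v)"
definition "sgn (u::l2) = inverse (norm u) *\<^sub>R u"
definition "(uniformity :: (l2 \<times> l2) filter) = (INF e\<in>{0<..}. principal {(x, y). dist x y < e})"
definition "open (U :: l2 set) \<longleftrightarrow> (\<forall>x\<in>U. eventually (\<lambda>(x', y). x' = x \<longrightarrow> y \<in> U) uniformity)"

lemma rep_zero: "AE x in lborel. rep 0 x = 0" unfolding zero_l2_def by (rule rep_mk) simp
lemma rep_add: "AE x in lborel. rep (u + v) x = rep u x + rep v x"
 unfolding plus_l2_def by (rule rep_mk) (simp add: L2_add)
lemma rep_diff: "AE x in lborel. rep (u - v) x = rep u x - rep v x"
 unfolding minus_l2_def by (rule rep_mk) (simp add: L2_diff)
lemma rep_uminus: "AE x in lborel. rep (- u) x = - rep u x"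
 unfolding uminus_l2_def by (rule rep_mk) (simp add: L2_uminus)
lemma rep_scaleR: "AE x in lborel. rep (c *\<^sub>R u) x = c *\<^sub>R rep u x"
 unfolding scaleR_l2_def by (rule rep_mk) (simp add: L2_scaleR)

lemma cip_integrable: "integrable lborel (\<lambda>x. cnj (rep u x) * rep v x)"
 by (intro L2_mult_integrable L2_cnj) auto

lemma cip_cong:
 assumes "AE x in lborel. rep u x = f x" "AE x in lborel. rep v x = g x"
  "f \<in> bmeas" "g \<in> bmeas"
 shows "cip u v = (LBINT x. cnj (f x) * g x)"
 unfolding cip_def using assms by (intro integral_cong_AE) auto

lemma cip_add_left: "cip (u + v) w = cip u w + cip v w"
proof -
 have "cip (u + v) w = (LBINT x. cnj (rep u x) * rep w x + cnj (rep v x) * rep w x)"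
  unfolding cip_def by (intro integral_cong_AE) (use rep_add[of u v] in \<open>auto simp: algebra_simps elim!: eventually_mono\<close>)
 thus ?thesis by (simp add: cip_def cip_integrable)
qed

lemma cip_scaleR_left: "cip (c *\<^sub>R u) w = of_real c * cip u w"
proof -
 have "cip (c *\<^sub>R u) w = (LBINT x. of_real c*(cnj (rep u x) * rep w x))"
  unfolding cip_def by (intro integral_cong_AE) (use rep_scaleR[of c u] in \<open>auto simp: scaleR_conv_of_real elim!: eventually_mono\<close>)
 thus ?thesis by (simp add: cip_def)
qed

lemma cip_cnj: "cnj (cip u v) = cip v u"
 using Bochner_Integration.integral_cnj[of lborel "\<lambda>x. cnj (rep u x) * rep v x"] by (simp add: cip_def mult.commute)

lemma cip_self: "cip u u = of_real (LBINT x. (norm (rep u x))\<^sup>2)"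
proof -
 have "cip u u = (LBINT x. of_real ((norm (rep u x))^2))"
  unfolding cip_def
  by (intro Bochner_Integration.integral_cong refl) (simp only: complex_norm_square mult.commute)
 thus ?thesis by (simp only: integral_complex_of_real)
qed

instance
proof
 fix a b c :: l2 and r s :: real
 note reps = rep_zero rep_add rep_diff rep_uminus rep_scaleR
 show "a + b + c = a + (b + c)"
  unfolding l2_eq_iff using rep_add[of "a + b" c] rep_add[of a b] rep_add[of a "b + c"] rep_add[of b c]
  by eventually_elim simp
 show "a + b = b + a" unfolding l2_eq_iff using rep_add[of a b] rep_add[of b a] by eventually_elim simp
 show "0 + a = a" unfolding l2_eq_iff using rep_add[of 0 a] rep_zero by eventually_elim simp
 show "- a + a = 0" unfolding l2_eq_iff using rep_add[of "- a" a] rep_zero rep_uminus[of a] by eventually_elim simp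
 show "a - b = a + - b" unfolding l2_eq_iff using rep_add[of a "- b"] rep_uminus[of b] rep_diff[of a b] by eventually_elim simp
 show "r *\<^sub>R (a + b) = r *\<^sub>R a + r *\<^sub>R b"
  unfolding l2_eq_iff using rep_scaleR[of r "a + b"] rep_add[of a b] rep_add[of "r *\<^sub>R a" "r *\<^sub>R b"] rep_scaleR[of r a] rep_scaleR[of r b]
  by eventually_elim (simp add: algebra_simps)
 show "(r + s) *\<^sub>R a = r *\<^sub>R a + s *\<^sub>R a"
  unfolding l2_eq_iff using rep_scaleR[of "r + s" a] rep_add[of "r *\<^sub>R a" "s *\<^sub>R a"] rep_scaleR[of r a] rep_scaleR[of s a]
  by eventually_elim (simp add: algebra_simps)
 show "r *\<^sub>R s *\<^sub>R a = (r * s) *\<^sub>R a"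
  unfolding l2_eq_iff using rep_scaleR[of r "s *\<^sub>R a"] rep_scaleR[of s a] rep_scaleR[of "r * s" a]
  by eventually_elim simp
 show "1 *\<^sub>R a = a" unfolding l2_eq_iff using rep_scaleR[of 1 a] by eventually_elim simp
 show "dist a b = norm (a - b)" by (rule dist_l2_def)
 show "sgn a = inverse (norm a) *\<^sub>R a" by (rule sgn_l2_def)
 show "(uniformity :: (l2 \<times> l2) filter) = (INF e\<in>{0<..}. principal {(x, y). dist x y < e})" by (rule uniformity_l2_def)
 show "open U \<longleftrightarrow> (\<forall>x\<in>U. eventually (\<lambda>(x', y). x' = x \<longrightarrow> y \<in> U) uniformity)" for U :: "l2 set" by (rule open_l2_def)
 show "inner a b = inner b a" unfolding inner_l2_def cip_cnj[of b a, symmetric] by simp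
 show "inner (a + b) c = inner a c + inner b c" by (simp add: inner_l2_def cip_add_left)
 show "inner (r *\<^sub>R a) b = r * inner a b" by (simp add: inner_l2_def cip_scaleR_left)
 show "0 \<le> inner a a" by (simp add: inner_l2_def cip_self)
 have "inner a a = 0 \<longleftrightarrow> (LBINT x. (norm (rep a x))\<^sup>2) = 0" by (simp add: inner_l2_def cip_self)
 also have "... \<longleftrightarrow> (AE x in lborel. (norm (rep a x))\<^sup>2 = 0)"
  by (intro integral_nonneg_eq_0_iff_AE) (use rep_L2[of a] in \<open>auto simp: L2_def\<close>)
 also have "... \<longleftrightarrow> a = 0"
 proof
  assume "AE x in lborel. (norm (rep a x))\<^sup>2 = 0"
  thus "a = 0" unfolding l2_eq_iff using rep_zero by eventually_elim simp
 next
  assume "a = 0"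
  thus "AE x in lborel. (norm (rep a x))\<^sup>2 = 0" using rep_zero by (auto elim!: eventually_mono)
 qed
 finally show "inner a a = 0 \<longleftrightarrow> a = 0" .
 show "norm a = sqrt (inner a a)" by (rule norm_l2_def)
qed

end

lemma L2_norm_cong:
 "f \<in> bmeas ==> g \<in> bmeas ==> (AE x in lborel. f x = g x) ==> L2_norm f = L2_norm g"
 unfolding L2_norm_def by (intro arg_cong[where f=sqrt] integral_cong_AE) auto

lemma norm_l2: "norm v = L2_norm (rep v)"
 by (simp add: norm_l2_def inner_l2_def cip_self L2_norm_def)

lemma norm_mk: "f \<in> L2 ==> norm (mk f) = L2_norm f"
 unfolding norm_l2 by (intro L2_norm_cong rep_mk) (auto dest: L2_measurable)

lemma norm_l2_sq: "(norm v)^2 = (LBINT x. (norm (rep v x))\<^sup>2)"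
 by (simp add: norm_l2 L2_norm_def)

lemma norm_l2_nn: "ennreal ((norm v)^2) = (\<integral>\<^sup>+x. ennreal ((norm (rep v x))^2) \<partial>lborel)"
 unfolding norm_l2_sq by (rule nn_integral_eq_integral[symmetric]) (use rep_L2[of v] in \<open>auto simp: L2_def\<close>)

lemma L2_iff_nn: "f \<in> L2 \<longleftrightarrow> f \<in> bmeas \<and> (\<integral>\<^sup>+x. ennreal ((norm (f x))^2) \<partial>lborel) < \<infinity>"
 unfolding L2_def integrable_iff_bounded by auto

lemma mk_add: assumes "f \<in> L2" "g \<in> L2" shows "mk f + mk g = mk (\<lambda>x. f x + g x)"
proof -
 have "AE x in lborel. rep (mk f) x + rep (mk g) x = f x + g x"
  using rep_mk[OF assms(1)] rep_mk[OF assms(2)] by eventually_elim simp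
 thus ?thesis unfolding plus_l2_def using assms by (subst mk_eq_iff) (simp_all add: L2_add)
qed

lemma mk_diff: assumes "f \<in> L2" "g \<in> L2" shows "mk f - mk g = mk (\<lambda>x. f x - g x)"
proof -
 have "AE x in lborel. rep (mk f) x - rep (mk g) x = f x - g x"
  using rep_mk[OF assms(1)] rep_mk[OF assms(2)] by eventually_elim simp
 thus ?thesis unfolding minus_l2_def using assms by (subst mk_eq_iff) (simp_all add: L2_diff)
qed

lemma cip_add_right: "cip w (u + v) = cip w u + cip w v"
 using arg_cong[OF cip_add_left[of u v w], of cnj] by (simp add: cip_cnj)
lemma cip_scaleR_right: "cip w (c *\<^sub>R u) = of_real c * cip w u"
 using arg_cong[OF cip_scaleR_left[of c u w], of cnj] by (simp add: cip_cnj)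
lemma cip_diff_left: "cip (u - v) w = cip u w - cip v w"
 using cip_add_left[of u "(-1) *\<^sub>R v" w] unfolding cip_scaleR_left by simp
lemma cip_diff_right: "cip w (u - v) = cip w u - cip w v"
 using arg_cong[OF cip_diff_left[of u v w], of cnj] by (simp add: cip_cnj)
lemma cip_zero[simp]: "cip 0 w = 0" "cip w 0 = 0"
 using cip_diff_left[of 0 0 w] cip_diff_right[of w 0 0] by auto

text \<open>Complex multiples; the type class only provides real scaling.\<close>

definition cmul :: "complex => l2 => l2" where "cmul c v = mk (\<lambda>x. c * rep v x)"

lemma rep_cmul: "AE x in lborel. rep (cmul c v) x = c * rep v x"
 unfolding cmul_def by (rule rep_mk) (simp add: L2_cmult)

lemma cip_cmul_right: "cip w (cmul c u) = c * cip w u"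
proof -
 have "cip w (cmul c u) = (LBINT x. c*(cnj (rep w x) * rep u x))"
  unfolding cip_def by (intro integral_cong_AE) (use rep_cmul[of c u] in \<open>auto simp: algebra_simps elim!: eventually_mono\<close>)
 thus ?thesis by (simp add: cip_def)
qed
lemma cip_cmul_left: "cip (cmul c u) w = cnj c * cip u w"
 using arg_cong[OF cip_cmul_right[of w c u], of cnj] by (simp add: cip_cnj)

lemma cip_self_norm: "cip u u = of_real ((norm u)^2)" by (simp add: cip_self norm_l2_sq)

lemma norm_cmul: "norm (cmul c u) = norm c * norm u"
proof -
 have "(norm (cmul c u))^2 = (norm c * norm u)^2"
 proof -
  have "complex_of_real ((norm (cmul c u))^2) = c * cnj c * of_real ((norm u)^2)"
   unfolding cip_self_norm[symmetric] by (simp add: cip_cmul_left cip_cmul_right)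
  also have "... = of_real ((norm c * norm u)^2)" by (simp add: complex_norm_square[symmetric] power_mult_distrib)
  finally show ?thesis using of_real_eq_iff by blast
 qed
 thus ?thesis using power2_eq_imp_eq by (metis mult_nonneg_nonneg norm_ge_zero)
qed

lemma cip_norm_le: "norm (cip u v) \<le> norm u * norm v"
proof (cases "cip u v = 0")
 case False
 define c where "c = cnj (cip u v)/of_real (norm (cip u v))"
 have "norm c = 1" using False by (simp add: c_def norm_divide)
 have "cip u (cmul c v) = of_real (norm (cip u v))"
  using False unfolding c_def cip_cmul_right
  by (simp add: complex_norm_square[symmetric] power2_eq_square mult.commute)
 hence "norm (cip u v) = inner u (cmul c v)" by (simp add: inner_l2_def)
 also have "... \<le> norm u * norm (cmul c v)" by (rule norm_cauchy_schwarz)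
 also have "... = norm u * norm v" using \<open>norm c = 1\<close> by (simp add: norm_cmul)
 finally show ?thesis .
qed simp

lemma norm_le_by_cip:
 assumes "\<And>y. norm (cip y u) \<le> C * norm y" "0 \<le> C" shows "norm u \<le> C"
proof (cases "u = 0")
 case False
 have "(norm u)^2 \<le> C * norm u" using assms(1)[of u] by (simp add: cip_self_norm norm_power)
 thus ?thesis using False by (simp add: power2_eq_square)
qed (use assms in auto)

lemma l2_eq_by_cip: "(\<And>y. cip y u = cip y v) ==> u = v"
 using norm_le_by_cip[of "u - v" 0] by (simp add: cip_diff_right)

lemma bounded_linear_cip_right: "bounded_linear (cip y)"
 by (rule bounded_linear_intro[where K="norm y"])
  (auto simp: cip_add_right cip_scaleR_right scaleR_conv_of_real intro: order_trans[OF cip_norm_le] simp: mult.commute)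

lemma bounded_linear_cmul: "bounded_linear (cmul c)"
 by (rule bounded_linear_intro[where K="norm c"])
  (auto simp: norm_cmul mult.commute intro!: l2_eq_by_cip simp: cip_cmul_right cip_add_right cip_scaleR_right algebra_simps)

lemma cip_uminus_left: "cip (- u) v = - cip u v" using cip_diff_left[of 0 u v] by simp
lemma cip_uminus_right: "cip u (- v) = - cip u v" using cip_diff_right[of u 0 v] by simp
lemmas cip_simps = cip_add_left cip_add_right cip_diff_left cip_diff_right cip_scaleR_left cip_scaleR_right
 cip_cmul_left cip_cmul_right cip_uminus_left cip_uminus_right

subsection \<open>Completeness\<close>

text \<open>Riesz-Fischer along a fast Cauchy sequence. The squared increments have integral at most
  4^(-k), so even with weights 2^k their sum is integrable and hence finite almost everywhere;
  pointwise the increments are then dominated by a geometric series. Fatou's lemma gives the rate in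
  norm.\<close>

lemma L2_fast_Cauchy_limit:
 fixes X :: "nat => l2"
 assumes fast: "\<And>m n. n \<le> m ==> norm (X m - X n) \<le> (1/2)^n"
 obtains f where "\<And>n. norm (f - X n) \<le> (1/2)^n" "AE x in lborel. (\<lambda>n. rep (X n) x) \<longlonglongrightarrow> rep f x"
proof -
 define g where "g k x = (norm (rep (X (Suc k)) x - rep (X k) x))^2" for k x
 have [measurable]: "g k \<in> bmeas" for k unfolding g_def by measurable
 have g: "(\<integral>\<^sup>+x. ennreal (g k x) \<partial>lborel) \<le> ennreal ((1/4)^k)" for k
 proof -
  have "(\<integral>\<^sup>+x. ennreal (g k x) \<partial>lborel) = (\<integral>\<^sup>+x. ennreal ((norm (rep (X (Suc k) - X k) x))^2) \<partial>lborel)"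
   by (intro nn_integral_cong_AE) (use rep_diff[of "X (Suc k)" "X k"] in \<open>auto simp: g_def elim!: eventually_mono\<close>)
  also have "... = ennreal ((norm (X (Suc k) - X k))^2)" by (rule norm_l2_nn[symmetric])
  also have "... \<le> ennreal (((1/2)^k)^2)" by (intro ennreal_leI power_mono fast) auto
  also have "((1/2::real)^k)^2 = (1/4)^k" by (simp add: power2_eq_square flip: power_mult_distrib)
  finally show ?thesis .
 qed
 have "(\<integral>\<^sup>+x. (\<Sum>k. ennreal (2^k * g k x)) \<partial>lborel) = (\<Sum>k. \<integral>\<^sup>+x. ennreal (2^k * g k x) \<partial>lborel)"
  by (rule nn_integral_suminf) measurable
 also have "... = (\<Sum>k. ennreal (2^k)*(\<integral>\<^sup>+x. ennreal (g k x) \<partial>lborel))"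
  by (intro arg_cong[where f=suminf] ext) (simp add: ennreal_mult g_def nn_integral_cmult)
 also have "... \<le> (\<Sum>k. ennreal (2^k) * ennreal ((1/4)^k))" by (intro suminf_le mult_left_mono g) auto
 also have "... = (\<Sum>k. ennreal ((1/2)^k))"
  by (intro arg_cong[where f=suminf] ext) (simp flip: ennreal_mult power_mult_distrib)
 also have "... = ennreal (\<Sum>k. (1/2)^k)"
  by (rule suminf_ennreal2) (auto intro: summable_geometric)
 finally have "(\<integral>\<^sup>+x. (\<Sum>k. ennreal (2^k * g k x)) \<partial>lborel) \<noteq> \<infinity>" by (auto simp: top_unique)
 hence "AE x in lborel. (\<Sum>k. ennreal (2^k * g k x)) \<noteq> \<infinity>"
  by (intro nn_integral_noteq_infinite) auto
 hence conv: "AE x in lborel. convergent (\<lambda>n. rep (X n) x)"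
 proof eventually_elim
  case (elim x)
  hence "summable (\<lambda>k. 2^k * g k x)" by (intro summable_suminf_not_top) (auto simp: g_def)
  hence "(\<lambda>k. 2^k * g k x) \<longlonglongrightarrow> 0" by (rule summable_LIMSEQ_zero)
  hence "Bseq (\<lambda>k. 2^k * g k x)" by (intro convergent_imp_Bseq convergentI)
  then obtain C where "C > 0" and "\<forall>k. norm (2^k * g k x) \<le> C" by (rule BseqE)
  hence C: "2^k * g k x \<le> C" for k by (metis abs_le_D1 real_norm_def)
  have b: "norm (rep (X (Suc k)) x - rep (X k) x) \<le> sqrt C*(sqrt (1/2))^k" for k
  proof -
   have "g k x \<le> C*(1/2)^k" using C[of k] by (simp add: field_simps)
   hence "sqrt (g k x) \<le> sqrt (C*(1/2)^k)" by (rule real_sqrt_le_mono)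
   thus ?thesis unfolding g_def real_sqrt_mult real_sqrt_power by simp
  qed
  have "summable (\<lambda>k. sqrt C*(sqrt (1/2))^k)"
  proof (intro summable_mult summable_geometric)
   have "sqrt (1/2) < sqrt 1" by (rule real_sqrt_less_mono) simp
   thus "norm (sqrt (1/2)) < 1" unfolding real_norm_def by (subst abs_of_nonneg) auto
  qed
  hence "summable (\<lambda>k. rep (X (Suc k)) x - rep (X k) x)"
   by (rule summable_comparison_test'[where N=0]) (rule b)
  hence "convergent (\<lambda>n. \<Sum>k<n. rep (X (Suc k)) x - rep (X k) x)"
   by (simp add: summable_iff_convergent)
  hence "convergent (\<lambda>n. rep (X n) x - rep (X 0) x)" unfolding sum_lessThan_telescope[of "\<lambda>k. rep (X k) x"] .
  from convergent_add[OF this convergent_const[of "rep (X 0) x"]] show ?case by simp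
 qed
 define f where "f x = lim (\<lambda>n. rep (X n) x)" for x
 have [measurable]: "f \<in> bmeas" unfolding f_def by measurable
 have lim: "AE x in lborel. (\<lambda>n. rep (X n) x) \<longlonglongrightarrow> f x"
  using conv by eventually_elim (simp add: f_def convergent_LIMSEQ_iff)
 have Fat: "(\<integral>\<^sup>+x. ennreal ((norm (f x - rep (X n) x))^2) \<partial>lborel) \<le> ennreal (((1/2)^n)^2)" for n
 proof -
  have "(\<integral>\<^sup>+x. ennreal ((norm (f x - rep (X n) x))^2) \<partial>lborel)
   = (\<integral>\<^sup>+x. liminf (\<lambda>m. ennreal ((norm (rep (X m) x - rep (X n) x))^2)) \<partial>lborel)"
  proof (rule nn_integral_cong_AE, use lim in eventually_elim)
   case (elim x)
   have "(\<lambda>m. ennreal ((norm (rep (X m) x - rep (X n) x))^2)) \<longlonglongrightarrow> ennreal ((norm (f x - rep (X n) x))^2)"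
    by (intro tendsto_intros elim tendsto_ennrealI)
   thus ?case by (intro lim_imp_Liminf[symmetric]) auto
  qed
  also have "... \<le> liminf (\<lambda>m. \<integral>\<^sup>+x. ennreal ((norm (rep (X m) x - rep (X n) x))^2) \<partial>lborel)"
   by (rule nn_integral_liminf) measurable
  also have "... \<le> liminf (\<lambda>m. ennreal (((1/2)^n)^2))"
  proof (intro Liminf_mono eventually_sequentiallyI[of n])
   fix m assume "n \<le> m"
   have "(\<integral>\<^sup>+x. ennreal ((norm (rep (X m) x - rep (X n) x))^2) \<partial>lborel) = (\<integral>\<^sup>+x. ennreal ((norm (rep (X m - X n) x))^2) \<partial>lborel)"
    by (intro nn_integral_cong_AE) (use rep_diff[of "X m" "X n"] in \<open>auto elim!: eventually_mono\<close>)
   also have "... = ennreal ((norm (X m - X n))^2)" by (rule norm_l2_nn[symmetric])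
   also have "... \<le> ennreal (((1/2)^n)^2)" by (intro ennreal_leI power_mono fast \<open>n \<le> m\<close>) auto
   finally show "(\<integral>\<^sup>+x. ennreal ((norm (rep (X m) x - rep (X n) x))^2) \<partial>lborel) \<le> ennreal (((1/2)^n)^2)" .
  qed
  finally show ?thesis by (simp add: Liminf_const)
 qed
 have L2n: "(\<lambda>x. f x - rep (X n) x) \<in> L2" for n
  unfolding L2_iff_nn using Fat[of n] by (auto simp: less_top[symmetric] top_unique)
 have fL2: "f \<in> L2" using L2_add[OF L2n[of 0] rep_L2[of "X 0"]] by simp
 show thesis
 proof
  show "norm (mk f - X n) \<le> (1/2)^n" for n
  proof -
   have "mk f - X n = mk (\<lambda>x. f x - rep (X n) x)" using mk_diff[OF fL2 rep_L2[of "X n"]] by simp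
   hence "ennreal ((norm (mk f - X n))^2) = (\<integral>\<^sup>+x. ennreal ((norm (f x - rep (X n) x))^2) \<partial>lborel)"
    unfolding norm_l2_nn by (intro nn_integral_cong_AE) (use rep_mk[OF L2n[of n]] in \<open>auto elim!: eventually_mono\<close>)
   with Fat[of n] have "ennreal ((norm (mk f - X n))^2) \<le> ennreal (((1/2)^n)^2)" by (simp only:)
   hence "(norm (mk f - X n))^2 \<le> ((1/2)^n)^2" unfolding ennreal_le_iff[OF zero_le_power2] .
   thus ?thesis by (rule power2_le_imp_le) simp
  qed
  show "AE x in lborel. (\<lambda>n. rep (X n) x) \<longlonglongrightarrow> rep (mk f) x"
   using lim rep_mk[OF fL2] by eventually_elim simp
 qed
qed

lemma fast_subseq:
 fixes X :: "nat => 'a::real_normed_vector"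
 assumes "Cauchy X"
 obtains r :: "nat => nat" where "strict_mono r" "\<And>m n. n \<le> m ==> norm (X (r m) - X (r n)) \<le> (1/2)^n"
proof -
 have "\<exists>N. \<forall>m\<ge>N. \<forall>k\<ge>N. norm (X m - X k) < (1/2)^n" for n
  using CauchyD[OF assms, of "(1/2)^n"] by simp
 then obtain N where N: "\<And>n m k. m \<ge> N n ==> k \<ge> N n ==> norm (X m - X k) < (1/2)^n" by metis
 define r where "r n = n + (\<Sum>i\<le>n. N i)" for n
 have "strict_mono r" unfolding strict_mono_Suc_iff r_def by auto
 moreover have "r m \<ge> N n" if "n \<le> m" for m n
  using member_le_sum[of n "{..m}" N] that by (simp add: r_def)
 ultimately show thesis using that N by (meson less_imp_le order_refl)
qed

instance l2 :: banach
proof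
 fix X :: "nat => l2" assume "Cauchy X"
 then obtain r where r: "strict_mono r" "\<And>m n. n \<le> m ==> norm (X (r m) - X (r n)) \<le> (1/2)^n"
  by (rule fast_subseq) blast
 obtain f where f: "\<And>n. norm (f - X (r n)) \<le> (1/2)^n" "AE x in lborel. (\<lambda>n. rep (X (r n)) x) \<longlonglongrightarrow> rep f x"
  by (rule L2_fast_Cauchy_limit[of "\<lambda>n. X (r n)"]) (use r in blast)+
 have "(\<lambda>n. X (r n)) \<longlonglongrightarrow> f"
 proof (rule LIM_zero_cancel, rule Lim_null_comparison)
  show "eventually (\<lambda>n. norm (X (r n) - f) \<le> (1/2)^n) sequentially" using f(1) by (simp add: norm_minus_commute)
  show "(\<lambda>n. (1/2::real)^n) \<longlonglongrightarrow> 0" by (intro LIMSEQ_power_zero) auto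
 qed
 hence "X \<longlonglongrightarrow> f" using Cauchy_converges_subseq[OF \<open>Cauchy X\<close> r(1)] by (simp add: o_def)
 thus "convergent X" by (rule convergentI)
qed

section \<open>Bounded operators\<close>

subsection \<open>Changes of variables\<close>

text \<open>The factor c^3 is the Jacobian in dimension 3. Functions that are not integrable are
  included, since both sides are then 0 by convention; later rewriting needs no integrability side
  condition.\<close>

lemma lborel_scale_R3:
 fixes f :: "R3 => 'b::{banach, second_countable_topology}"
 assumes c: "c > 0"
 shows "(LBINT x. f x) = c^3 *\<^sub>R (LBINT x. f (t + c *\<^sub>R x))"
  and "integrable lborel (\<lambda>x. f (t + c *\<^sub>R x)) \<longleftrightarrow> integrable lborel f"
proof -
 have eq: "lborel = density (distr lborel borel (\<lambda>x::R3. t + c *\<^sub>R x)) (\<lambda>_. ennreal (c^3))"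
  using lborel_affine[of c t] c by simp
 have c3: "0 < c^3" using c by simp
 have inv: "f = (\<lambda>x. (\<lambda>y. f (t + c *\<^sub>R y)) ((1/c) *\<^sub>R (x - t)))" using c by (simp add: fun_eq_iff)
 have meas: "(\<lambda>x. f (t + c *\<^sub>R x)) \<in> bmeas \<longleftrightarrow> f \<in> bmeas"
 proof
  assume [measurable]: "(\<lambda>x. f (t + c *\<^sub>R x)) \<in> bmeas"
  show "f \<in> bmeas" by (subst inv) measurable
 qed (erule measurable_compose[rotated], simp)
 show int: "integrable lborel (\<lambda>x. f (t + c *\<^sub>R x)) \<longleftrightarrow> integrable lborel f"
 proof (cases "f \<in> bmeas")
  case [measurable]: True
  have "integrable lborel f \<longleftrightarrow> integrable (density (distr lborel borel (\<lambda>x::R3. t + c *\<^sub>R x)) (\<lambda>_. ennreal (c^3))) f"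
   by (subst eq) simp
  also have "... \<longleftrightarrow> integrable lborel (\<lambda>x. f (t + c *\<^sub>R x))"
   using c3 c integrable_scaleR_right[of "1/c^3" lborel "\<lambda>x. c^3 *\<^sub>R f (t + c *\<^sub>R x)"]
   by (subst integrable_density) (auto simp: integrable_distr_eq)
  finally show ?thesis by simp
 next
  case False
  thus ?thesis using meas by (auto dest!: borel_measurable_integrable)
 qed
 show "(LBINT x. f x) = c^3 *\<^sub>R (LBINT x. f (t + c *\<^sub>R x))"
 proof (cases "integrable lborel f")
  case True
  hence [measurable]: "f \<in> bmeas" by auto
  show ?thesis using c3 by (subst eq) (simp add: integral_density integral_distr)
 next
  case False
  thus ?thesis using int by (simp add: not_integrable_integral_eq)
 qed
qed

lemma lborel_shift_R3:
 fixes f :: "R3 => 'b::{banach, second_countable_topology}"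
 shows "(LBINT x. f (x + a)) = (LBINT x. f x)"
  and "integrable lborel (\<lambda>x. f (x + a)) \<longleftrightarrow> integrable lborel f"
 using lborel_scale_R3[of 1 f a] by (simp_all add: add.commute)

lemma AE_shift_R3:
 fixes a :: R3
 assumes "AE x in lborel. P x" shows "AE x in lborel. P (x + a)"
proof -
 obtain N where N: "N \<in> null_sets lborel" "{x. \<not> P x} \<subseteq> N"
  using assms by (auto simp: eventually_ae_filter)
 have "AE x in lborel. x \<notin> N" using N(1) by (rule AE_not_in)
 hence "AE x in distr lborel borel ((+) a). x \<notin> N" unfolding lborel_distr_plus .
 hence "AE x in lborel. a + x \<notin> N"
  using N(1) by (subst (asm) AE_distr_iff) auto
 thus ?thesis by eventually_elim (use N(2) in \<open>auto simp: add.commute\<close>)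
qed

lemma lborel_eq_distr_uminus: "distr lborel borel uminus = (lborel :: R3 measure)"
proof -
 have "lborel = density (distr lborel borel (\<lambda>x::R3. 0 + (-1) *\<^sub>R x)) (\<lambda>_. ennreal (\<bar>-1\<bar>^DIM(R3)))"
  by (rule lborel_affine) simp
 thus ?thesis by (simp add: density_1 one_ennreal_def[symmetric])
qed

lemma lborel_reflect_R3:
 fixes f :: "R3 => 'b::{banach, second_countable_topology}"
 shows "(LBINT x. f (- x)) = (LBINT x. f x)"
  and "integrable lborel (\<lambda>x. f (- x)) \<longleftrightarrow> integrable lborel f"
proof -
 have m: "(\<lambda>x. f (- x)) \<in> bmeas \<longleftrightarrow> f \<in> bmeas"
 proof
  assume "(\<lambda>x. f (- x)) \<in> bmeas"
  from measurable_compose[OF borel_measurable_uminus[OF measurable_ident_sets[OF refl]] this]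
  show "f \<in> bmeas" by simp
 next
  assume "f \<in> bmeas"
  from measurable_compose[OF borel_measurable_uminus[OF measurable_ident_sets[OF refl]] this]
  show "(\<lambda>x. f (- x)) \<in> bmeas" by simp
 qed
 show I: "integrable lborel (\<lambda>x. f (- x)) \<longleftrightarrow> integrable lborel f"
 proof (cases "f \<in> bmeas")
  case True
  thus ?thesis using integrable_distr_eq[of uminus lborel borel f] by (simp add: lborel_eq_distr_uminus)
 qed (use m in \<open>auto dest!: borel_measurable_integrable\<close>)
 show "(LBINT x. f (- x)) = (LBINT x. f x)"
 proof (cases "f \<in> bmeas")
  case True
  thus ?thesis using integral_distr[of uminus lborel borel f] by (simp add: lborel_eq_distr_uminus)
 next
  case False
  hence "\<not> integrable lborel f" by (auto dest!: borel_measurable_integrable)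
  thus ?thesis using I by (simp add: not_integrable_integral_eq)
 qed
qed

lemma AE_reflect_R3:
 assumes "AE x::R3 in lborel. P x" shows "AE x in lborel. P (- x)"
proof -
 obtain N where N: "N \<in> null_sets lborel" "{x. \<not> P x} \<subseteq> N"
  using assms by (auto simp: eventually_ae_filter)
 have "AE x in lborel. x \<notin> N" using N(1) by (rule AE_not_in)
 hence "AE x in distr lborel borel uminus. x \<notin> N" unfolding lborel_eq_distr_uminus .
 hence "AE x in lborel. - x \<notin> N"
  using N(1) by (subst (asm) AE_distr_iff) auto
 thus ?thesis by eventually_elim (use N(2) in auto)
qed

subsection \<open>Multiplication, translation and reflection\<close>

definition bm :: "(R3 => complex) => bool" where
 "bm m \<longleftrightarrow> m \<in> bmeas \<and> (\<exists>C. \<forall>x. norm (m x) \<le> C)"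

lemma bmI: "m \<in> bmeas ==> (\<And>x. norm (m x) \<le> C) ==> bm m" by (auto simp: bm_def)
lemma bm_measurable: "bm m ==> m \<in> bmeas" by (simp add: bm_def)

lemma bmE: assumes "bm m" obtains C where "C \<ge> 0" "\<forall>x. norm (m x) \<le> C"
 using assms unfolding bm_def by (meson norm_ge_zero order_trans)

lemma bm_mult: assumes "bm m" "bm n" shows "bm (\<lambda>x. m x * n x)"
proof -
 obtain C where C: "C \<ge> 0" "\<forall>x. norm (m x) \<le> C" using assms(1) by (rule bmE)
 obtain D where D: "D \<ge> 0" "\<forall>x. norm (n x) \<le> D" using assms(2) by (rule bmE)
 from C D have "norm (m x * n x) \<le> C * D" for x by (simp add: norm_mult mult_mono)
 thus ?thesis using assms by (intro bmI[where C="C * D"]) (auto simp: bm_def)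
qed

lemma bm_add: assumes "bm m" "bm n" shows "bm (\<lambda>x. m x + n x)"
proof -
 obtain C where C: "C \<ge> 0" "\<forall>x. norm (m x) \<le> C" using assms(1) by (rule bmE)
 obtain D where D: "D \<ge> 0" "\<forall>x. norm (n x) \<le> D" using assms(2) by (rule bmE)
 from C D have "norm (m x + n x) \<le> C + D" for x by (meson add_mono norm_triangle_ineq order_trans)
 thus ?thesis using assms by (intro bmI[where C="C + D"]) (auto simp: bm_def)
qed

lemma bm_const[simp]: "bm (\<lambda>x. c)" by (rule bmI[where C="norm c"]) auto
lemma bm_diff: "bm m ==> bm n ==> bm (\<lambda>x. m x - n x)"
 using bm_add[of m "\<lambda>x. -1 * n x"] bm_mult[of "\<lambda>x. -1" n] by simp
lemma bm_cnj: "bm m ==> bm (\<lambda>x. cnj (m x))"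
 unfolding bm_def by (auto intro: measurable_compose[OF _ cnj_measurable])
lemma bm_shift: "bm m ==> bm (\<lambda>x. m (x + a))" unfolding bm_def by (auto intro: measurable_compose[rotated])
lemma bm_cis: "f \<in> bmeas ==> bm (\<lambda>x. cis (f x))"
 by (rule bmI[where C=1]) (auto simp: cis_conv_exp intro!: measurable_compose[OF _ borel_measurable_exp])

definition Mul :: "(R3 => complex) => l2 => l2" where "Mul m v = mk (\<lambda>x. m x * rep v x)"

lemma bm_mult_L2: assumes "bm m" "f \<in> L2" shows "(\<lambda>x. m x * f x) \<in> L2"
proof -
 obtain C where C: "C \<ge> 0" "\<forall>x. norm (m x) \<le> C" using assms(1) by (rule bmE)
 show ?thesis using assms(2)
 proof (rule L2_bound)
  show "(\<lambda>x. m x * f x) \<in> bmeas" using bm_measurable[OF assms(1)] L2_measurable[OF assms(2)] by measurable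
  show "AE x in lborel. norm (m x * f x) \<le> C * norm (f x)"
   using C(2) by (intro AE_I2) (simp add: norm_mult mult_right_mono)
 qed
qed

lemma rep_Mul: "bm m ==> AE x in lborel. rep (Mul m v) x = m x * rep v x"
 unfolding Mul_def by (rule rep_mk) (simp add: bm_mult_L2)

lemma Mul_mk: assumes "bm m" "f \<in> L2" shows "Mul m (mk f) = mk (\<lambda>x. m x * f x)"
proof -
 have "AE x in lborel. m x * rep (mk f) x = m x * f x" using rep_mk[OF assms(2)] by eventually_elim simp
 thus ?thesis unfolding Mul_def using assms by (subst mk_eq_iff) (simp_all add: bm_mult_L2)
qed

lemma cip_Mul_right: assumes "bm m" shows "cip u (Mul m v) = (LBINT x. cnj (rep u x)*(m x * rep v x))"
 using assms by (intro cip_cong rep_Mul) (auto dest: bm_measurable)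

lemma cip_Mul_left: assumes "bm m" shows "cip (Mul m u) v = (LBINT x. cnj (m x * rep u x) * rep v x)"
 using assms by (intro cip_cong rep_Mul) (auto dest: bm_measurable)

lemma cip_Mul: "bm m ==> cip (Mul m u) v = cip u (Mul (\<lambda>x. cnj (m x)) v)"
 by (simp add: cip_Mul_right cip_Mul_left bm_cnj algebra_simps)

lemma Mul_add: assumes "bm m" shows "Mul m (u + v) = Mul m u + Mul m v"
proof (rule l2_eq_by_cip)
 fix y
 have r: "cip y (Mul m w) = cip (Mul (\<lambda>x. cnj (m x)) y) w" for w
  using cip_Mul[OF bm_cnj[OF assms], of y w] by simp
 show "cip y (Mul m (u + v)) = cip y (Mul m u + Mul m v)" by (simp add: r cip_add_right)
qed

lemma norm_Mul_le: assumes "bm m" "\<And>x. norm (m x) \<le> C" shows "norm (Mul m v) \<le> C * norm v"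
proof -
 have "C \<ge> 0" using assms(2) norm_ge_zero order_trans by blast
 have "(norm (Mul m v))^2 \<le> (LBINT x. C\<^sup>2*(norm (rep v x))^2)"
  unfolding norm_l2_sq
 proof (rule integral_mono_AE)
  show "integrable lborel (\<lambda>x. (norm (rep (Mul m v) x))\<^sup>2)" using rep_L2[of "Mul m v"] by (simp add: L2_def)
  show "integrable lborel (\<lambda>x. C\<^sup>2*(norm (rep v x))^2)" using rep_L2[of "v"] by (simp add: L2_def)
  show "AE x in lborel. (norm (rep (Mul m v) x))\<^sup>2 \<le> C\<^sup>2*(norm (rep v x))^2"
   using rep_Mul[OF assms(1), of v]
   by eventually_elim (use assms(2) in \<open>simp add: norm_mult power_mult_distrib mult_right_mono power_mono\<close>)
 qed
 also have "... = (C * norm v)^2" unfolding power_mult_distrib norm_l2_sq by simp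
 finally show ?thesis by (rule power2_le_imp_le) (simp add: \<open>C \<ge> 0\<close>)
qed

lemma Mul_Mul: assumes "bm m" "bm n" shows "Mul m (Mul n v) = Mul (\<lambda>x. m x * n x) v"
proof -
 have "Mul m (Mul n v) = Mul m (mk (\<lambda>x. n x * rep v x))" by (simp add: Mul_def)
 also have "... = mk (\<lambda>x. m x*(n x * rep v x))" using assms by (simp add: Mul_mk bm_mult_L2)
 finally show ?thesis by (simp add: Mul_def mult.assoc)
qed

lemma Mul_one[simp]: "Mul (\<lambda>x. 1) v = v" by (simp add: Mul_def)
lemma cmul_Mul: "cmul c = Mul (\<lambda>x. c)" by (simp add: cmul_def Mul_def fun_eq_iff)
lemma scaleR_Mul: "c *\<^sub>R v = Mul (\<lambda>x. of_real c) v" by (simp add: scaleR_l2_def Mul_def scaleR_conv_of_real)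

lemma bounded_linear_Mul: assumes "bm m" shows "bounded_linear (Mul m)"
proof -
 obtain C where C: "C \<ge> 0" "\<forall>x. norm (m x) \<le> C" using assms by (rule bmE)
 show ?thesis
  by (rule bounded_linear_intro[where K=C])
   (simp_all add: Mul_add scaleR_Mul Mul_Mul assms mult.commute[of _ C] norm_Mul_le[OF assms C(2)[rule_format]], simp add: mult.commute)
qed

lemma Mul_diff: "bm m ==> Mul m (u - v) = Mul m u - Mul m v"
 using bounded_linear_Mul bounded_linear.linear linear_diff by blast

lemma Mul_cmul: "bm m ==> Mul m (cmul c v) = cmul c (Mul m v)" by (simp add: cmul_Mul Mul_Mul mult.commute)

lemma Mul_add_fun: assumes "bm m" "bm n" shows "Mul m v + Mul n v = Mul (\<lambda>x. m x + n x) v"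
 unfolding Mul_def using assms by (subst mk_add) (auto simp: bm_mult_L2 algebra_simps)

lemma Mul_diff_fun: assumes "bm m" "bm n" shows "Mul m v - Mul n v = Mul (\<lambda>x. m x - n x) v"
 unfolding Mul_def using assms by (subst mk_diff) (auto simp: bm_mult_L2 algebra_simps)

lemma norm_Mul_unit: assumes "bm m" "\<And>x. norm (m x) = 1" shows "norm (Mul m v) = norm v"
proof (rule antisym)
 show "norm (Mul m v) \<le> norm v" using norm_Mul_le[of m 1 v] assms by simp
 have "m x * cnj (m x) = 1" for x using assms(2)[of x] by (simp add: complex_norm_square[symmetric])
 hence "v = Mul (\<lambda>x. cnj (m x)) (Mul m v)" using assms by (simp add: Mul_Mul bm_cnj mult.commute)
 also have "norm ... \<le> 1 * norm (Mul m v)" using assms by (intro norm_Mul_le bm_cnj) auto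
 finally show "norm v \<le> norm (Mul m v)" by simp
qed

text \<open>Dominated convergence in L^2: with a square integrable majorant \<open>w\<close>, the
  square of \<open>f n - g\<close> is at most 4 |w|^2. The majorant later decides on which vectors
  the phases can be differentiated in time.\<close>

lemma L2_dct:
 assumes w: "w \<in> L2" and [measurable]: "\<And>n. f n \<in> bmeas" "g \<in> bmeas"
  and le: "\<And>n. AE x in lborel. norm (f n x) \<le> norm (w x)"
  and lim: "AE x in lborel. (\<lambda>n. f n x) \<longlonglongrightarrow> g x"
 shows "g \<in> L2" "(\<lambda>n. mk (f n)) \<longlonglongrightarrow> mk g"
proof -
 have [measurable]: "w \<in> bmeas" using w by (rule L2_measurable)
 have fL2: "f n \<in> L2" for n using le[of n] by (intro L2_bound[where C=1, OF w]) auto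
 have le': "AE x in lborel. \<forall>n. norm (f n x) \<le> norm (w x)" using le by (simp add: AE_all_countable)
 have gle: "AE x in lborel. norm (g x) \<le> norm (w x)"
  using le' lim by eventually_elim (rule LIMSEQ_le_const2[OF tendsto_norm], auto)
 show gL2: "g \<in> L2" using gle by (intro L2_bound[where C=1, OF w]) auto
 have "(\<lambda>n. LBINT x. (norm (f n x - g x))\<^sup>2) \<longlonglongrightarrow> (LINT x|(lborel::R3 measure). 0)"
 proof (rule integral_dominated_convergence)
  show "integrable lborel (\<lambda>x. 4*(norm (w x))^2)" using w by (simp add: L2_def)
  show "AE x in lborel. (\<lambda>n. (norm (f n x - g x))\<^sup>2) \<longlonglongrightarrow> 0"
   using lim by eventually_elim (auto intro!: tendsto_eq_intros simp: tendsto_norm_zero LIM_zero)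
  show "AE x in lborel. norm ((norm (f n x - g x))^2) \<le> 4*(norm (w x))^2" for n
   using le[of n] gle
  proof eventually_elim
   case (elim x)
   have "norm (f n x - g x) \<le> 2 * norm (w x)" using elim norm_triangle_ineq4[of "f n x" "g x"] by linarith
   hence "(norm (f n x - g x))^2 \<le> (2 * norm (w x))^2" by (rule power_mono) simp
   thus ?case by (simp add: power_mult_distrib)
  qed
 qed measurable
 moreover have "(LBINT x. (norm (f n x - g x))\<^sup>2) = (norm (mk (f n) - mk g))^2" for n
  using fL2 gL2 by (subst mk_diff) (auto simp: norm_mk L2_diff L2_norm_def)
 ultimately have "(\<lambda>n. (norm (mk (f n) - mk g))\<^sup>2) \<longlonglongrightarrow> 0" by simp
 hence "(\<lambda>n. sqrt ((norm (mk (f n) - mk g))^2)) \<longlonglongrightarrow> sqrt 0" by (rule tendsto_real_sqrt)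
 hence "(\<lambda>n. norm (mk (f n) - mk g)) \<longlonglongrightarrow> 0" by simp
 thus "(\<lambda>n. mk (f n)) \<longlonglongrightarrow> mk g" using tendsto_norm_zero_iff LIM_zero_iff by blast
qed

lemma Mul_tendsto:
 assumes "\<And>n. m n \<in> bmeas" "\<And>n x. norm (m n x) \<le> C" "\<And>x. (\<lambda>n. m n x) \<longlonglongrightarrow> k x"
  "k \<in> bmeas"
 shows "(\<lambda>n. Mul (m n) v) \<longlonglongrightarrow> Mul k v"
 unfolding Mul_def
proof (rule L2_dct(2)[where w="\<lambda>x. of_real C * rep v x"])
 have "C \<ge> 0" using assms(2) norm_ge_zero order_trans by blast
 show "(\<lambda>x. of_real C * rep v x) \<in> L2" by (rule L2_cmult) simp
 show "AE x in lborel. norm (m n x * rep v x) \<le> norm (of_real C * rep v x)" for n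
  using assms(2) \<open>C \<ge> 0\<close> by (auto simp: norm_mult intro!: mult_right_mono)
 show "AE x in lborel. (\<lambda>n. m n x * rep v x) \<longlonglongrightarrow> k x * rep v x"
  using assms(3) by (auto intro!: tendsto_intros)
qed (use assms in \<open>auto\<close>)

definition Shift :: "R3 => l2 => l2" where "Shift a v = mk (\<lambda>x. rep v (x + a))"
definition Refl :: "l2 => l2" where "Refl v = mk (\<lambda>x. rep v (- x))"

lemma L2_shift: "f \<in> L2 ==> (\<lambda>x. f (x + a)) \<in> L2"
 using lborel_shift_R3(2)[of "\<lambda>x. (norm (f x))\<^sup>2" a] by (auto simp: L2_def intro: measurable_compose[rotated])
lemma L2_reflect: "f \<in> L2 ==> (\<lambda>x. f (- x)) \<in> L2"
 using lborel_reflect_R3(2)[of "\<lambda>x. (norm (f x))\<^sup>2"] by (auto simp: L2_def intro: measurable_compose[rotated])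

lemma rep_Shift: "AE x in lborel. rep (Shift a v) x = rep v (x + a)"
 unfolding Shift_def by (rule rep_mk) (simp add: L2_shift)
lemma rep_Refl: "AE x in lborel. rep (Refl v) x = rep v (- x)"
 unfolding Refl_def by (rule rep_mk) (simp add: L2_reflect)

lemma Shift_mk: assumes "f \<in> L2" shows "Shift a (mk f) = mk (\<lambda>x. f (x + a))"
 unfolding Shift_def using assms AE_shift_R3[OF rep_mk[OF assms], of a]
 by (subst mk_eq_iff) (simp_all add: L2_shift)
lemma Refl_mk: assumes "f \<in> L2" shows "Refl (mk f) = mk (\<lambda>x. f (- x))"
 unfolding Refl_def using assms AE_reflect_R3[OF rep_mk[OF assms]]
 by (subst mk_eq_iff) (simp_all add: L2_reflect)

lemma Shift_Shift[simp]: "Shift a (Shift b v) = Shift (a + b) v"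
proof -
 have "Shift a (Shift b v) = Shift a (mk (\<lambda>x. rep v (x + b)))" by (simp only: Shift_def)
 thus ?thesis by (subst (asm) Shift_mk) (simp_all add: L2_shift Shift_def add.assoc)
qed
lemma Shift_0[simp]: "Shift 0 v = v" by (simp add: Shift_def)
lemma Refl_Refl[simp]: "Refl (Refl v) = v"
proof -
 have "Refl (Refl v) = Refl (mk (\<lambda>x. rep v (- x)))" by (simp only: Refl_def)
 thus ?thesis by (subst (asm) Refl_mk) (simp_all add: L2_reflect)
qed

lemma cip_Shift: "cip (Shift a u) (Shift a v) = cip u v"
proof -
 have "cip (Shift a u) (Shift a v) = (LBINT x. cnj (rep u (x + a)) * rep v (x + a))"
  by (intro cip_cong rep_Shift) measurable
 thus ?thesis using lborel_shift_R3(1)[of "\<lambda>x. cnj (rep u x) * rep v x" a] by (simp add: cip_def)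
qed
lemma cip_Refl: "cip (Refl u) (Refl v) = cip u v"
proof -
 have "cip (Refl u) (Refl v) = (LBINT x. cnj (rep u (- x)) * rep v (- x))"
  by (intro cip_cong rep_Refl) measurable
 thus ?thesis using lborel_reflect_R3(1)[of "\<lambda>x. cnj (rep u x) * rep v x"] by (simp add: cip_def)
qed
lemma norm_Shift[simp]: "norm (Shift a v) = norm v"
 by (simp add: norm_eq_sqrt_inner inner_l2_def cip_Shift)
lemma norm_Refl[simp]: "norm (Refl v) = norm v"
 by (simp add: norm_eq_sqrt_inner inner_l2_def cip_Refl)
lemma cip_Shift_right: "cip u (Shift a v) = cip (Shift (- a) u) v"
 using cip_Shift[of "- a" u "Shift a v"] by simp
lemma cip_Refl_left: "cip (Refl u) v = cip u (Refl v)"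
 using cip_Refl[of "Refl u" v] by simp

lemma Shift_add: "Shift a (u + v) = Shift a u + Shift a v"
 by (rule l2_eq_by_cip) (simp add: cip_Shift_right cip_add_right)
lemma Shift_cmul: "Shift a (cmul c v) = cmul c (Shift a v)"
 by (rule l2_eq_by_cip) (simp add: cip_Shift_right cip_cmul_right)
lemma Shift_scaleR: "Shift a (c *\<^sub>R v) = c *\<^sub>R (Shift a v)"
 by (rule l2_eq_by_cip) (simp add: cip_Shift_right cip_scaleR_right)
lemma Refl_add: "Refl (u + v) = Refl u + Refl v"
 by (rule l2_eq_by_cip) (simp add: cip_Refl_left[symmetric] cip_add_right)
lemma Refl_scaleR: "Refl (c *\<^sub>R v) = c *\<^sub>R Refl v"
 by (rule l2_eq_by_cip) (simp add: cip_Refl_left[symmetric] cip_scaleR_right)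
lemma bounded_linear_Shift: "bounded_linear (Shift a)"
 by (rule bounded_linear_intro[where K=1]) (auto simp: Shift_add Shift_scaleR)
lemma bounded_linear_Refl: "bounded_linear Refl"
 by (rule bounded_linear_intro[where K=1]) (auto simp: Refl_add Refl_scaleR)
lemma Shift_diff: "Shift a (u - v) = Shift a u - Shift a v"
 using bounded_linear_Shift bounded_linear.linear linear_diff by blast

lemma Shift_Mul: assumes "bm m" shows "Shift a (Mul m v) = Mul (\<lambda>x. m (x + a)) (Shift a v)"
proof -
 have "Shift a (Mul m v) = mk (\<lambda>x. m (x + a) * rep v (x + a))"
  unfolding Mul_def by (rule Shift_mk) (simp add: assms bm_mult_L2)
 also have "... = Mul (\<lambda>x. m (x + a)) (Shift a v)"
  unfolding Shift_def by (rule Mul_mk[symmetric]) (simp_all add: assms bm_shift L2_shift)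
 finally show ?thesis .
qed

section \<open>The Fourier transform\<close>

text \<open>The product |f x| B |g y| is an integrable majorant on the product space, so Fubini
  applies to every bounded measurable kernel. The two integrability claims belong to the two
  iterated integrands.\<close>

lemma kernel_Fubini:
 fixes f :: "'a => complex" and g :: "'b => complex"
 assumes M: "sigma_finite_measure M" "sigma_finite_measure N"
  and f: "integrable M f" and g: "integrable N g"
  and k: "(\<lambda>(x, y). k x y) \<in> borel_measurable (M \<Otimes>\<^sub>M N)" and B: "\<And>x y. norm (k x y) \<le> B"
 shows "(LINT x|M. f x*(LINT y|N. k x y * g y)) = (LINT y|N. (LINT x|M. f x * k x y) * g y)"
  and "integrable N (\<lambda>y. (LINT x|M. f x * k x y) * g y)"
  and "integrable M (\<lambda>x. f x*(LINT y|N. k x y * g y))"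
proof -
 interpret pair_sigma_finite M N using M by (simp add: pair_sigma_finite_def)
 have [measurable]: "f \<in> borel_measurable M" "g \<in> borel_measurable N" using f g by auto
 note k[measurable]
 define F where "F = (\<lambda>(x, y). f x * k x y * g y)"
 have [measurable]: "F \<in> borel_measurable (M \<Otimes>\<^sub>M N)"
  unfolding F_def using k by (auto simp: split_beta')
 have "B \<ge> 0" using B norm_ge_zero order_trans by blast
 have int: "integrable (M \<Otimes>\<^sub>M N) F"
 proof (rule Fubini_integrable)
  have le: "norm (F (x, y)) \<le> (norm (f x) * B) * norm (g y)" for x y
   unfolding F_def using B[of x y] by (simp add: norm_mult mult_left_mono mult_right_mono)
  have i1: "integrable N (\<lambda>y. F (x, y))" if "x \<in> space M" for x
  proof (rule Bochner_Integration.integrable_bound)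
   show "integrable N (\<lambda>y. (norm (f x) * B) * norm (g y))" using g by auto
   show "(\<lambda>y. F (x, y)) \<in> borel_measurable N"
    using that by (rule measurable_Pair2[OF \<open>F \<in> borel_measurable (M \<Otimes>\<^sub>M N)\<close>])
   show "AE y in N. norm (F (x, y)) \<le> norm (norm (f x) * B * norm (g y))"
    using le \<open>B \<ge> 0\<close> by (auto simp: abs_mult)
  qed
  thus "AE x in M. integrable N (\<lambda>y. F (x, y))" by auto
  show "integrable M (\<lambda>x. \<integral>y. norm (F (x, y)) \<partial>N)"
  proof (rule Bochner_Integration.integrable_bound)
   show "integrable M (\<lambda>x. norm (f x)*(B*(LINT y|N. norm (g y))))" using f by auto
   show "AE x in M. norm (\<integral>y. norm (F (x, y)) \<partial>N) \<le> norm (norm (f x)*(B*(LINT y|N. norm (g y))))"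
   proof (rule AE_I2)
    fix x assume x: "x \<in> space M"
    have "(\<integral>y. norm (F (x, y)) \<partial>N) \<le> (\<integral>y. (norm (f x) * B) * norm (g y) \<partial>N)"
     using i1[OF x] g le by (intro integral_mono) auto
    hence "(\<integral>y. norm (F (x, y)) \<partial>N) \<le> norm (f x)*(B*(LINT y|N. norm (g y)))" by (simp add: mult.assoc)
    thus "norm (\<integral>y. norm (F (x, y)) \<partial>N) \<le> norm (norm (f x)*(B*(LINT y|N. norm (g y))))"
     by (simp add: abs_of_nonneg)
   qed
  qed measurable
 qed measurable
 have e1: "(LINT y|N. F (x, y)) = f x*(LINT y|N. k x y * g y)" for x by (simp add: F_def mult.assoc)
 have e2: "(LINT x|M. F (x, y)) = (LINT x|M. f x * k x y) * g y" for y by (simp add: F_def)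
 have "(LINT x|M. LINT y|N. F (x, y)) = (LINT y|N. LINT x|M. F (x, y))"
  using Fubini_integral[of "\<lambda>x y. F (x, y)"] int by simp
 thus "(LINT x|M. f x*(LINT y|N. k x y * g y)) = (LINT y|N. (LINT x|M. f x * k x y) * g y)"
  by (simp only: e1 e2)
 show "integrable N (\<lambda>y. (LINT x|M. f x * k x y) * g y)" using integrable_snd[of "\<lambda>x y. F (x, y)"] int by (simp add: e2)
 show "integrable M (\<lambda>x. f x*(LINT y|N. k x y * g y))" using integrable_fst[of "\<lambda>x y. F (x, y)"] int by (simp add: e1)
qed

lemma cis_measurable[measurable]: "f \<in> borel_measurable M ==> (\<lambda>x. cis (f x)) \<in> borel_measurable M"
proof (erule measurable_compose)
 have "continuous_on UNIV (\<lambda>x::real. cis x)" by (intro continuous_on_cis continuous_on_id)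
 thus "cis \<in> bmeas" by (rule borel_measurable_continuous_onI)
qed

lemma integrable_cis_mult:
 "g \<in> borel_measurable M ==> integrable M f ==> integrable M (\<lambda>x. cis (g x) * f x)"
 by (rule Bochner_Integration.integrable_bound[where f=f]) (auto simp: norm_mult)

definition c0 :: real where "c0 = (2 * pi) powr (-3/2)"
lemma c0_pos: "c0 > 0" by (simp add: c0_def)

lemma fourier_integral_c0: "fourier_integral f \<xi> = of_real c0*(LBINT x. cis (- (x\<bullet>\<xi>)) * f x)"
 by (simp add: fourier_integral_def c0_def)

lemma norm_fourier_integral_le: "norm (fourier_integral f \<xi>) \<le> c0*(LBINT x. norm (f x))"
proof -
 have "norm (LBINT x. cis (- (x\<bullet>\<xi>)) * f x) \<le> (LBINT x. norm (cis (- (x\<bullet>\<xi>)) * f x))"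
  by (rule integral_norm_bound)
 thus ?thesis using c0_pos by (simp add: fourier_integral_c0 norm_mult)
qed

lemma fourier_integral_measurable[measurable]:
 assumes [measurable]: "f \<in> bmeas"
 shows "fourier_integral f \<in> bmeas"
 unfolding fourier_integral_c0 by measurable

lemma fourier_multiplication_formula:
 assumes f: "integrable lborel f" and g: "integrable lborel g"
 shows "(LBINT x. fourier_integral f x * g x) = (LBINT x. f x * fourier_integral g x)"
proof -
 have "(LBINT x. f x*(LBINT y. cis (- (y\<bullet>x)) * g y)) = (LBINT y. (LBINT x. f x * cis (- (y\<bullet>x))) * g y)"
  by (rule kernel_Fubini(1)[where B=1]) (use f g in \<open>auto simp: sigma_finite_lborel\<close>)
 hence "of_real c0*(LBINT x. f x*(LBINT y. cis (- (y\<bullet>x)) * g y)) = of_real c0*(LBINT y. (LBINT x. f x * cis (- (y\<bullet>x))) * g y)"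
  by simp
 from this[symmetric] show ?thesis
  unfolding fourier_integral_c0 integral_mult_right_zero[symmetric]
  by (simp add: algebra_simps inner_commute)
qed

subsection \<open>Gaussians\<close>

lemma R3_product_integral:
 fixes f :: "R3 => real => complex"
 assumes "\<And>b. b \<in> Basis ==> integrable lborel (f b)"
 shows "integrable lborel (\<lambda>x::R3. \<Prod>b\<in>Basis. f b (x\<bullet>b))"
  and "(LBINT x. (\<Prod>b\<in>Basis. f b ((x::R3)\<bullet>b))) = (\<Prod>b\<in>Basis. (LBINT t. f b t))"
proof -
 interpret product_sigma_finite "\<lambda>_::R3. lborel :: real measure"
  by standard
 have [measurable]: "b \<in> Basis ==> f b \<in> bmeas" for b using assms[of b] by auto
 have m: "(\<lambda>x::R3. \<Prod>b\<in>Basis. f b (x\<bullet>b)) \<in> bmeas" by measurable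
 have T: "(\<lambda>f. \<Sum>b\<in>Basis. f b *\<^sub>R b) \<in> measurable (\<Pi>\<^sub>M b\<in>Basis. lborel) (borel :: R3 measure)" by measurable
 have eq: "(\<Prod>b\<in>Basis. f b ((\<Sum>c\<in>Basis. x c *\<^sub>R c)\<bullet>b)) = (\<Prod>b\<in>Basis. f b (x b))" for x
  by (intro prod.cong refl) simp
 show "integrable lborel (\<lambda>x::R3. \<Prod>b\<in>Basis. f b (x\<bullet>b))"
  apply (subst lborel_eq) apply (subst integrable_distr_eq[OF T m]) unfolding eq
  by (rule product_integrable_prod) (use assms in auto)
 show "(LBINT x. (\<Prod>b\<in>Basis. f b ((x::R3)\<bullet>b))) = (\<Prod>b\<in>Basis. (LBINT t. f b t))"
  apply (subst lborel_eq) apply (subst integral_distr[OF T m]) unfolding eq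
  by (rule product_integral_prod) (use assms in auto)
qed

definition gau :: "R3 => complex" where "gau x = of_real (exp (- (norm x)\<^sup>2/2))"

lemma gau_prod: "gau x = (\<Prod>b\<in>Basis. of_real (exp (- (x\<bullet>b)\<^sup>2/2)))"
proof -
 have "(norm x)^2 = (\<Sum>b\<in>Basis. (x\<bullet>b)\<^sup>2)"
  unfolding power2_norm_eq_inner by (subst euclidean_inner) (simp add: power2_eq_square)
 thus ?thesis by (simp add: gau_def exp_sum[symmetric] sum_negf sum_divide_distrib flip: of_real_prod)
qed

lemma cis_inner_prod: "cis ((x::R3)\<bullet>y) = (\<Prod>b\<in>Basis. cis ((x\<bullet>b)*(y\<bullet>b)))"
 by (subst euclidean_inner) (simp add: cis_conv_exp exp_sum[symmetric] sum_distrib_left)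

text \<open>The exponential integral is the characteristic function of the standard normal
  distribution, rescaled by its normalisation sqrt(2 pi).\<close>

lemma gaussian_1D: 
 "integrable lborel (\<lambda>x::real. complex_of_real (exp (- x\<^sup>2/2)))"
 "(LBINT x. cis (t * x) * complex_of_real (exp (- x\<^sup>2/2))) = of_real (sqrt (2 * pi) * exp (- t\<^sup>2/2))"
proof -
 have e: "exp (- x\<^sup>2/2) = sqrt (2 * pi) * std_normal_density x" for x :: real
  by (simp add: normal_density_def)
 have "integrable lborel std_normal_density" using prob_space_normal_density[of 1 0] integrable_normal_density by simp
 hence "integrable lborel (\<lambda>x::real. sqrt (2 * pi) * std_normal_density x)" by (rule integrable_mult_right)
 hence "integrable lborel (\<lambda>x::real. exp (- x\<^sup>2/2))" unfolding e .
 thus "integrable lborel (\<lambda>x::real. complex_of_real (exp (- x\<^sup>2/2)))" by (rule integrable_of_real)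
 have "of_real (exp (- t\<^sup>2/2)) = char std_normal_distribution t" by (simp add: char_std_normal_distribution)
 also have "... = (LBINT x. std_normal_density x *\<^sub>R iexp (t * x))"
  unfolding char_def by (subst integral_density) (auto simp: normal_density_nonneg)
 finally have *: "of_real (exp (- t\<^sup>2/2)) = (LBINT x. std_normal_density x *\<^sub>R iexp (t * x))" .
 have "(LBINT x. cis (t * x) * complex_of_real (exp (- x\<^sup>2/2))) = (LBINT x. of_real (sqrt (2 * pi))*(std_normal_density x *\<^sub>R iexp (t * x)))"
  unfolding e by (simp add: cis_conv_exp scaleR_conv_of_real algebra_simps)
 also have "... = of_real (sqrt (2 * pi))*(LBINT x. std_normal_density x *\<^sub>R iexp (t * x))"
  by (rule integral_mult_right_zero)
 finally show "(LBINT x. cis (t * x) * complex_of_real (exp (- x\<^sup>2/2))) = of_real (sqrt (2 * pi) * exp (- t\<^sup>2/2))"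
  unfolding *[symmetric] by simp
qed

lemma gau_integrable: "integrable lborel gau"
 using R3_product_integral(1)[of "\<lambda>b x. complex_of_real (exp (- x\<^sup>2/2))"] gaussian_1D(1)
 by (simp add: gau_prod[abs_def])

lemma gau_measurable[measurable]: "gau \<in> bmeas"
 using gau_integrable by auto

lemma fourier_gau: "fourier_integral gau \<xi> = gau \<xi>"
proof -
 have "cis (- (x\<bullet>\<xi>)) * gau x = (\<Prod>b\<in>Basis. cis (- (\<xi>\<bullet>b)*(x\<bullet>b)) * of_real (exp (- (x\<bullet>b)\<^sup>2/2)))" for x
  using cis_inner_prod[of "- \<xi>" x] by (simp add: gau_prod prod.distrib[symmetric] inner_commute)
 hence "(LBINT x. cis (- (x\<bullet>\<xi>)) * gau x)
   = (LBINT x. (\<Prod>b\<in>Basis. cis (- (\<xi>\<bullet>b)*(x\<bullet>b)) * of_real (exp (- (x\<bullet>b)\<^sup>2/2))))" by simp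
 also have "... = (\<Prod>b\<in>Basis. (LBINT t. cis (- (\<xi>\<bullet>b) * t) * of_real (exp (- t\<^sup>2/2))))"
  by (rule R3_product_integral) (intro integrable_cis_mult gaussian_1D, measurable)
 also have "... = (\<Prod>b\<in>Basis. of_real (sqrt (2 * pi)) * of_real (exp (- (\<xi>\<bullet>b)\<^sup>2/2)))"
  by (intro prod.cong refl) (subst gaussian_1D(2), simp)
 also have "... = of_real (sqrt (2 * pi)^3) * gau \<xi>" by (simp add: prod.distrib gau_prod)
 finally have *: "(LBINT x. cis (- (x\<bullet>\<xi>)) * gau x) = of_real (sqrt (2 * pi)^3) * gau \<xi>" .
 have "sqrt (2 * pi)^3 = (2 * pi) powr (3/2)"
  by (simp add: powr_half_sqrt[symmetric] powr_realpow[symmetric] powr_powr)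
 hence "c0 * sqrt (2 * pi)^3 = 1" by (simp add: c0_def powr_add[symmetric])
 hence "complex_of_real c0 * of_real (sqrt (2 * pi)^3) = 1" by (metis of_real_1 of_real_mult)
 thus ?thesis unfolding fourier_integral_c0 * by (metis mult.assoc mult_1)
qed

lemma fourier_integral_modulate: "fourier_integral (\<lambda>x. cis (b\<bullet>x) * f x) \<xi> = fourier_integral f (\<xi> - b)"
proof -
 have "cis (- (x\<bullet>\<xi>))*(cis (b\<bullet>x) * f x) = cis (- (x\<bullet>(\<xi> - b))) * f x" for x
  by (simp add: mult.assoc[symmetric] cis_mult inner_diff_right inner_commute[of b])
 thus ?thesis by (simp only: fourier_integral_c0)
qed

lemma fourier_integral_translate: "fourier_integral (\<lambda>x. f (x - b)) \<xi> = cis (- (b\<bullet>\<xi>)) * fourier_integral f \<xi>"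
proof -
 have "(LBINT x. cis (- (x\<bullet>\<xi>)) * f (x - b)) = (LBINT x. cis (- ((x + b)\<bullet>\<xi>)) * f (x + b - b))"
  by (rule lborel_shift_R3(1)[symmetric])
 also have "... = (LBINT x. cis (- (b\<bullet>\<xi>))*(cis (- (x\<bullet>\<xi>)) * f x))"
  by (simp add: inner_add_left mult.assoc[symmetric] cis_mult minus_diff_commute)
 also have "... = cis (- (b\<bullet>\<xi>))*(LBINT x. cis (- (x\<bullet>\<xi>)) * f x)" by (rule integral_mult_right_zero)
 finally show ?thesis by (simp add: fourier_integral_c0)
qed

lemma fourier_integral_dilate:
 assumes "c > 0" shows "fourier_integral (\<lambda>x. f (c *\<^sub>R x)) \<xi> = of_real (1/c^3) * fourier_integral f ((1/c) *\<^sub>R \<xi>)"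
proof -
 have "(LBINT x. cis (- (x\<bullet>((1/c) *\<^sub>R \<xi>))) * f x) = c^3 *\<^sub>R (LBINT x. cis (- ((0 + c *\<^sub>R x)\<bullet>((1/c) *\<^sub>R \<xi>))) * f (0 + c *\<^sub>R x))"
  by (rule lborel_scale_R3(1)[OF assms])
 also have "... = c^3 *\<^sub>R (LBINT x. cis (- (x\<bullet>\<xi>)) * f (c *\<^sub>R x))" using assms by simp
 finally show ?thesis using assms by (simp add: fourier_integral_c0 scaleR_conv_of_real field_simps)
qed

lemma norm_gau_le: "norm (gau x) \<le> 1" by (simp add: gau_def)
lemma gau_nonneg: "gau x = of_real (norm (gau x))" by (simp add: gau_def)

lemma gau_scaled_integrable: "c > 0 ==> integrable lborel (\<lambda>x. gau (c *\<^sub>R x))"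
 using lborel_scale_R3(2)[of c gau 0] gau_integrable by simp

lemma fourier_gau_scaled:
 assumes "c > 0" shows "(LBINT x. cis (- (x\<bullet>\<xi>)) * gau (c *\<^sub>R x)) = of_real (1/(c0 * c^3)) * gau ((1/c) *\<^sub>R \<xi>)"
 using fourier_integral_dilate[OF assms, of gau \<xi>] c0_pos assms
 by (simp add: fourier_integral_c0[of "\<lambda>x. gau (c *\<^sub>R x)"] fourier_gau field_simps)

lemma integral_gau: "(LBINT x. gau x) = of_real (1/c0)"
 using fourier_gau_scaled[of 1 0] by (simp add: gau_def)

text \<open>A Gaussian of width \<open>e\<close> centred at \<open>c\<close> is itself the Fourier
  integral of a modulated Gaussian. Exchanging the integrals turns the pairing into an integral of
  the vanishing transform of \<open>f\<close>.\<close>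

lemma gaussian_smoothing_eq_0:
 assumes f: "integrable lborel f" and ft: "\<And>\<xi>. fourier_integral f \<xi> = 0" and e: "e > 0"
 shows "(LBINT x. f x * gau ((1/e) *\<^sub>R (x - c))) = 0"
proof -
 have g: "of_real (1/(c0 * e^3)) * gau ((1/e) *\<^sub>R (x - c)) = (LBINT \<xi>. cis (- (x\<bullet>\<xi>))*(cis (c\<bullet>\<xi>) * gau (e *\<^sub>R \<xi>)))" for x
  using fourier_gau_scaled[OF e, of "x - c"]
  by (simp add: inner_commute[of _ "x - c"] inner_diff_left mult.assoc[symmetric] cis_mult)
 have "of_real (1/(c0 * e^3))*(LBINT x. f x * gau ((1/e) *\<^sub>R (x - c)))
   = (LBINT x. f x*(of_real (1/(c0 * e^3)) * gau ((1/e) *\<^sub>R (x - c))))"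
  by (subst integral_mult_right_zero[symmetric]) (simp add: algebra_simps)
 also have "... = (LBINT x. f x*(LBINT \<xi>. cis (- (x\<bullet>\<xi>))*(cis (c\<bullet>\<xi>) * gau (e *\<^sub>R \<xi>))))"
  by (simp only: g)
 also have "... = (LBINT \<xi>. (LBINT x. f x * cis (- (x\<bullet>\<xi>)))*(cis (c\<bullet>\<xi>) * gau (e *\<^sub>R \<xi>)))"
  by (rule kernel_Fubini(1)[where B=1])
   (use f e in \<open>auto simp: sigma_finite_lborel intro!: integrable_cis_mult gau_scaled_integrable\<close>)
 also have "... = 0"
  using ft c0_pos by (simp add: fourier_integral_c0 mult.commute[of "f _"])
 finally show ?thesis using c0_pos e by simp
qed

lemma gaussian_approximate_identity:
 fixes \<phi> :: "R3 => complex"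
 assumes "continuous_on UNIV \<phi>" "\<And>x. norm (\<phi> x) \<le> B"
 shows "(\<lambda>n. LBINT w. gau w*\<phi> (x + (1/real (Suc n)) *\<^sub>R w)) \<longlonglongrightarrow> of_real (1/c0)*\<phi> x"
proof -
 have [measurable]: "\<phi> \<in> bmeas" using assms(1) by (rule borel_measurable_continuous_onI)
 have "(\<lambda>n. LBINT w. gau w*\<phi> (x + (1/real (Suc n)) *\<^sub>R w)) \<longlonglongrightarrow> (LBINT w. gau w*\<phi> x)"
 proof (rule integral_dominated_convergence)
  show "integrable lborel (\<lambda>w. norm (gau w) * B)" using gau_integrable by auto
  show "AE w in lborel. norm (gau w*\<phi> (x + (1/real (Suc n)) *\<^sub>R w)) \<le> norm (gau w) * B" for n
   using assms(2) by (auto simp: norm_mult intro!: mult_left_mono)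
  show "AE w in lborel. (\<lambda>n. gau w*\<phi> (x + (1/real (Suc n)) *\<^sub>R w)) \<longlonglongrightarrow> gau w*\<phi> x"
  proof (rule AE_I2, rule tendsto_mult[OF tendsto_const])
   fix w
   have "(\<lambda>n. x + (1/real (Suc n)) *\<^sub>R w) \<longlonglongrightarrow> x + 0 *\<^sub>R w"
    by (intro tendsto_intros LIMSEQ_Suc lim_1_over_n)
   thus "(\<lambda>n. \<phi> (x + (1/real (Suc n)) *\<^sub>R w)) \<longlonglongrightarrow> \<phi> x"
    using continuous_on_tendsto_compose[OF assms(1)] by simp
  qed
 qed measurable
 thus ?thesis using gau_integrable by (simp add: integral_gau)
qed

text \<open>Fubini shifts the Gaussian average from \<open>\<phi>\<close> to \<open>f\<close>, where
  the smoothed pairing vanishes; as the width 1/(n+1) tends to 0, dominated convergence recovers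
  \<open>\<phi>\<close>. Boundedness of \<open>\<phi>\<close> supplies the majorant.\<close>

lemma fourier_L1_inj_continuous:
 fixes \<phi> :: "R3 => complex"
 assumes f: "integrable lborel f" and ft: "\<And>\<xi>. fourier_integral f \<xi> = 0"
  and cont: "continuous_on UNIV \<phi>" and B: "\<And>x. norm (\<phi> x) \<le> B" and \<phi>: "integrable lborel \<phi>"
 shows "(LBINT x. f x*\<phi> x) = 0"
proof -
 have [measurable]: "f \<in> bmeas" "\<phi> \<in> bmeas" using f \<phi> by auto
 define e where "e n = 1/real (Suc n)" for n
 have e: "e n > 0" for n by (simp add: e_def)
 define J where "J n x = (LBINT w. gau w*\<phi> (x + e n *\<^sub>R w))" for n x
 have [measurable]: "J n \<in> bmeas" for n unfolding J_def by measurable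
 have J: "(LBINT c. gau ((1/e n) *\<^sub>R (x - c))*\<phi> c) = of_real (e n^3) * J n x" for n x
 proof -
  have g: "gau ((1/e n) *\<^sub>R (x - (x + e n *\<^sub>R w))) = gau w" for w
   using e[of n] by (simp add: gau_def)
  have "(LBINT c. gau ((1/e n) *\<^sub>R (x - c))*\<phi> c)
   = e n^3 *\<^sub>R (LBINT w. gau ((1/e n) *\<^sub>R (x - (x + e n *\<^sub>R w)))*\<phi> (x + e n *\<^sub>R w))"
   by (rule lborel_scale_R3(1)[OF e])
  thus ?thesis unfolding g J_def by (simp add: scaleR_conv_of_real)
 qed
 have 0: "(LBINT x. f x * J n x) = 0" for n
 proof -
  have "(LBINT x. f x*(LBINT c. gau ((1/e n) *\<^sub>R (x - c))*\<phi> c)) = (LBINT c. (LBINT x. f x * gau ((1/e n) *\<^sub>R (x - c)))*\<phi> c)"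
   by (rule kernel_Fubini(1)[where B=1]) (use f \<phi> norm_gau_le in \<open>auto simp: sigma_finite_lborel\<close>)
  also have "... = 0" using gaussian_smoothing_eq_0[OF f ft e] by simp
  finally have "(LBINT x. of_real (e n^3)*(f x * J n x)) = 0" unfolding J by (simp add: mult_ac)
  thus ?thesis using e[of n] by simp
 qed
 have Jle: "norm (J n x) \<le> (LBINT w. norm (gau w)) * B" for n x
 proof -
  have "norm (J n x) \<le> (LBINT w. norm (gau w*\<phi> (x + e n *\<^sub>R w)))" unfolding J_def by (rule integral_norm_bound)
  also have "... \<le> (LBINT w. norm (gau w) * B)"
  proof (rule integral_mono)
   show i: "integrable lborel (\<lambda>w. norm (gau w) * B)" using gau_integrable by auto
   show le: "norm (gau w*\<phi> (x + e n *\<^sub>R w)) \<le> norm (gau w) * B" for w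
    using B by (simp add: norm_mult mult_left_mono)
   show "integrable lborel (\<lambda>w. norm (gau w*\<phi> (x + e n *\<^sub>R w)))"
    by (rule Bochner_Integration.integrable_bound[OF i]) (use le in \<open>auto intro: order_trans[OF _ abs_ge_self]\<close>)
  qed
  finally show ?thesis by simp
 qed
 have "(\<lambda>n. LBINT x. f x * J n x) \<longlonglongrightarrow> (LBINT x. f x*(of_real (1/c0)*\<phi> x))"
 proof (rule integral_dominated_convergence)
  show "integrable lborel (\<lambda>x. norm (f x)*((LBINT w. norm (gau w)) * B))" using f by auto
  show "AE x in lborel. norm (f x * J n x) \<le> norm (f x)*((LBINT w. norm (gau w)) * B)" for n
   using Jle by (auto simp: norm_mult intro!: mult_left_mono)
  show "AE x in lborel. (\<lambda>n. f x * J n x) \<longlonglongrightarrow> f x*(of_real (1/c0)*\<phi> x)"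
   unfolding J_def e_def by (intro AE_I2 tendsto_mult tendsto_const gaussian_approximate_identity[OF cont B])
 qed measurable
 hence "(LBINT x. f x*(of_real (1/c0)*\<phi> x)) = 0" unfolding 0 using LIMSEQ_unique tendsto_const by blast
 hence "(LBINT x. of_real (1/c0)*(f x*\<phi> x)) = 0" by (simp add: mult_ac)
 thus ?thesis using c0_pos by simp
qed

lemma integrable_indicator_box: "integrable lborel (\<lambda>x::R3. indicator (box a b) x :: real)"
 using emeasure_lborel_box_finite[of a b] by (subst integrable_indicator_iff) auto

text \<open>A density is determined by its integrals over measurable sets. Open boxes form an
  intersection-stable generator, and the indicator of a box is a limit of continuous functions, to
  which the continuous case applies. The whole space, needed for complements, is the transform at
  0.\<close>

theorem fourier_L1_inj:
 assumes f: "integrable lborel f" and ft: "\<And>\<xi>. fourier_integral f \<xi> = 0"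
 shows "AE x in lborel. f x = 0"
proof (rule sigma_finite_measure.density_zero[OF sigma_finite_lborel f])
 have [measurable]: "f \<in> bmeas" using f by auto
 have box: "set_lebesgue_integral lborel (box a b) f = 0" for a b
 proof -
  \<comment> \<open>Continuous functions increasing to the indicator of the open box: n times the
    distance to the complement, cut off at 1. They vanish outside the box, so they are
    integrable.\<close>
  define \<phi> where "\<phi> n x = complex_of_real (min 1 (real n * infdist x (- box a b)))" for n x
  have ne: "- box a b \<noteq> {}" using bounded_box[of a b] not_bounded_UNIV by (metis double_compl Compl_empty_eq)
  have cont: "continuous_on UNIV (\<phi> n)" for n unfolding \<phi>_def by (intro continuous_intros continuous_on_infdist)
  hence [measurable]: "\<phi> n \<in> bmeas" for n by (rule borel_measurable_continuous_onI)
  have le: "norm (\<phi> n x) \<le> indicator (box a b) x" for n x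
   by (cases "x \<in> box a b") (auto simp: \<phi>_def abs_of_nonneg infdist_nonneg)
  have le1: "norm (\<phi> n x) \<le> 1" for n x by (rule order_trans[OF le]) (simp add: indicator_def)
  have int: "integrable lborel (\<phi> n)" for n
   by (rule Bochner_Integration.integrable_bound[OF integrable_indicator_box[of a b]]) (use le in auto)
  have 0: "(LBINT x. f x*\<phi> n x) = 0" for n
   by (rule fourier_L1_inj_continuous[OF f ft cont le1 int])
  have "(\<lambda>n. LBINT x. f x*\<phi> n x) \<longlonglongrightarrow> (LBINT x. indicator (box a b) x *\<^sub>R f x)"
  proof (rule integral_dominated_convergence)
   show "integrable lborel (\<lambda>x. norm (f x))" using f by auto
   show "AE x in lborel. norm (f x*\<phi> n x) \<le> norm (f x)" for n
    using mult_left_mono[OF le1 norm_ge_zero] by (auto simp: norm_mult)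
   show "AE x in lborel. (\<lambda>n. f x*\<phi> n x) \<longlonglongrightarrow> indicator (box a b) x *\<^sub>R f x"
   proof (rule AE_I2)
    fix x
    have "(\<lambda>n. \<phi> n x) \<longlonglongrightarrow> of_real (indicator (box a b) x)"
    proof (cases "x \<in> box a b")
     case True
     have "infdist x (- box a b) > 0"
      using True ne by (metis Compl_iff closed_Compl infdist_nonneg in_closed_iff_infdist_zero less_eq_real_def open_box)
     then obtain N :: nat where N: "1 \<le> real N * infdist x (- box a b)"
      by (metis ex_less_of_nat_mult less_imp_le)
     have "\<phi> n x = 1" if "n \<ge> N" for n
     proof -
      have "real N * infdist x (- box a b) \<le> real n * infdist x (- box a b)"
       using that by (intro mult_right_mono) (auto simp: infdist_nonneg)
      with N show ?thesis by (simp add: \<phi>_def)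
     qed
     hence "eventually (\<lambda>n. \<phi> n x = 1) sequentially" using eventually_sequentially by blast
     thus ?thesis using True tendsto_eventually by auto
    next
     case False
     thus ?thesis using le[of _ x] by auto
    qed
    thus "(\<lambda>n. f x*\<phi> n x) \<longlonglongrightarrow> indicator (box a b) x *\<^sub>R f x"
     by (auto intro!: tendsto_eq_intros simp: scaleR_conv_of_real)
   qed
  qed measurable
  thus ?thesis unfolding 0 set_lebesgue_integral_def using LIMSEQ_unique tendsto_const by metis
 qed
 have U: "(LBINT x. f x) = 0" using ft[of 0] c0_pos by (simp add: fourier_integral_c0)
 fix A :: "R3 set" assume "A \<in> sets lborel"
 hence A: "A \<in> sigma_sets UNIV (range (\<lambda>(a, b). box a b))" by (simp add: borel_eq_box)
 have "Int_stable (range (\<lambda>(a, b). box a b :: R3 set))" by (auto simp: Int_stable_def box_Int_box)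
 moreover have "range (\<lambda>(a, b). box a b :: R3 set) \<subseteq> Pow UNIV" by simp
 ultimately show "set_lebesgue_integral lborel A f = 0"
  using A
 proof (induct A rule: sigma_sets_induct_disjoint)
  case (basic A) thus ?case using box by auto
 next
  case empty thus ?case by (simp add: set_lebesgue_integral_def)
 next
  case (compl A)
  have m: "A \<in> sets lborel" using compl(1) by (simp add: borel_eq_box)
  have "(LBINT x. f x) = (LBINT x. indicator A x *\<^sub>R f x + indicator (UNIV - A) x *\<^sub>R f x)"
   by (intro Bochner_Integration.integral_cong refl) (simp split: split_indicator)
  also have "... = set_lebesgue_integral lborel A f + set_lebesgue_integral lborel (UNIV - A) f"
   unfolding set_lebesgue_integral_def using m f
   by (intro Bochner_Integration.integral_add integrable_mult_indicator) auto
  finally show ?case using U compl(2) by simp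
 next
  case (union F)
  have m: "F i \<in> sets lborel" for i using union(2) by (auto simp: borel_eq_box)
  have "set_lebesgue_integral lborel (\<Union>i. F i) f = (\<Sum>i. set_lebesgue_integral lborel (F i) f)"
  proof (rule lebesgue_integral_countable_add)
   show "F i \<in> sets lborel" for i by (rule m)
   show "F i \<inter> F j = {}" if "i \<noteq> j" for i j using union(1) that by (auto simp: disjoint_family_on_def)
   show "set_integrable lborel (\<Union>i. F i) f"
    unfolding set_integrable_def using m f by (intro integrable_mult_indicator) auto
  qed
  thus ?case using union(3) by simp
 qed
qed

subsection \<open>The Fourier transform is a contraction\<close>

lemma nn_norm_integral_le:
 fixes f :: "'a => 'b::{banach, second_countable_topology}"
 shows "ennreal (norm (integral\<^sup>L M f)) \<le> (\<integral>\<^sup>+x. ennreal (norm (f x)) \<partial>M)"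
proof (cases "integrable M f")
 case True thus ?thesis by (rule integral_norm_bound_ennreal)
next
 case False thus ?thesis by (simp add: not_integrable_integral_eq)
qed

text \<open>Schur's test for a quadratic form: |f x| |f y| is at most half the sum of the squares,
  and each half is integrated first in the variable that it does not contain. Nonnegative integrals
  avoid having to know beforehand that the double integral converges.\<close>

lemma schur_bound:
 fixes f :: "R3 => complex" and k :: "R3 => R3 => complex"
 assumes f: "f \<in> L2" and [measurable]: "(\<lambda>(x, y). k x y) \<in> borel_measurable (borel \<Otimes>\<^sub>M borel)"
  and S: "\<And>x. (\<integral>\<^sup>+y. ennreal (norm (k x y)) \<partial>lborel) \<le> ennreal S" "\<And>y. (\<integral>\<^sup>+x. ennreal (norm (k x y)) \<partial>lborel) \<le> ennreal S"
  and "0 \<le> S"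
 shows "norm (LBINT x. f x*(LBINT y. k x y * cnj (f y))) \<le> S*(L2_norm f)^2"
proof -
 have [measurable]: "f \<in> bmeas" using f by (rule L2_measurable)
 define n where "n x = ennreal ((norm (f x))^2/2)" for x
 have [measurable]: "n \<in> bmeas" unfolding n_def by measurable
 have n: "(\<integral>\<^sup>+x. n x \<partial>lborel) = ennreal ((L2_norm f)^2/2)"
  unfolding n_def L2_norm_def using f by (subst nn_integral_eq_integral) (auto simp: L2_def)
 have "ennreal (norm (LBINT x. f x*(LBINT y. k x y * cnj (f y)))) \<le> (\<integral>\<^sup>+x. ennreal (norm (f x*(LBINT y. k x y * cnj (f y)))) \<partial>lborel)"
  by (rule nn_norm_integral_le)
 also have "... \<le> (\<integral>\<^sup>+x. (\<integral>\<^sup>+y. n x * ennreal (norm (k x y)) + n y * ennreal (norm (k x y)) \<partial>lborel) \<partial>lborel)"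
 proof (rule nn_integral_mono)
  fix x
  have "ennreal (norm (f x*(LBINT y. k x y * cnj (f y)))) \<le> ennreal (norm (f x))*(\<integral>\<^sup>+y. ennreal (norm (k x y * cnj (f y))) \<partial>lborel)"
   unfolding norm_mult[of "f x"] using nn_norm_integral_le[of lborel "\<lambda>y. k x y * cnj (f y)"] by (simp add: ennreal_mult mult_left_mono)
  also have "... = (\<integral>\<^sup>+y. ennreal (norm (f x)) * ennreal (norm (k x y * cnj (f y))) \<partial>lborel)"
   by (subst nn_integral_cmult) auto
  also have "... \<le> (\<integral>\<^sup>+y. n x * ennreal (norm (k x y)) + n y * ennreal (norm (k x y)) \<partial>lborel)"
  proof (rule nn_integral_mono)
   fix y
   have "norm (f x) * norm (k x y * cnj (f y)) \<le> (norm (f x))^2/2 * norm (k x y) + (norm (f y))^2/2 * norm (k x y)"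
    using mult_right_mono[OF sum_squares_bound[of "norm (f x)" "norm (f y)"] norm_ge_zero[of "k x y"]]
    by (simp add: norm_mult algebra_simps)
   hence "ennreal (norm (f x) * norm (k x y * cnj (f y))) \<le> ennreal ((norm (f x))^2/2 * norm (k x y) + (norm (f y))^2/2 * norm (k x y))"
    by (rule ennreal_leI)
   thus "ennreal (norm (f x)) * ennreal (norm (k x y * cnj (f y))) \<le> n x * ennreal (norm (k x y)) + n y * ennreal (norm (k x y))"
    by (simp add: n_def ennreal_mult[symmetric] ennreal_plus[symmetric] del: ennreal_plus)
  qed
  finally show "ennreal (norm (f x*(LBINT y. k x y * cnj (f y)))) \<le> (\<integral>\<^sup>+y. n x * ennreal (norm (k x y)) + n y * ennreal (norm (k x y)) \<partial>lborel)" .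
 qed
 also have "... = (\<integral>\<^sup>+x. (\<integral>\<^sup>+y. n x * ennreal (norm (k x y)) \<partial>lborel) \<partial>lborel) + (\<integral>\<^sup>+x. (\<integral>\<^sup>+y. n y * ennreal (norm (k x y)) \<partial>lborel) \<partial>lborel)"
  by (subst nn_integral_add[symmetric]) (auto intro!: nn_integral_cong nn_integral_add)
 also have "(\<integral>\<^sup>+x. (\<integral>\<^sup>+y. n y * ennreal (norm (k x y)) \<partial>lborel) \<partial>lborel) = (\<integral>\<^sup>+y. (\<integral>\<^sup>+x. n y * ennreal (norm (k x y)) \<partial>lborel) \<partial>lborel)"
  by (rule lborel_pair.Fubini'[symmetric]) measurable
 also have "(\<integral>\<^sup>+x. (\<integral>\<^sup>+y. n x * ennreal (norm (k x y)) \<partial>lborel) \<partial>lborel) + ... \<le> (\<integral>\<^sup>+x. n x * ennreal S \<partial>lborel) + (\<integral>\<^sup>+y. n y * ennreal S \<partial>lborel)"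
  by (intro add_mono nn_integral_mono) (subst nn_integral_cmult, measurable, intro mult_left_mono S, simp)+
 also have "... = ennreal (S*(L2_norm f)^2)"
 proof -
  have "(\<integral>\<^sup>+x. n x * ennreal S \<partial>lborel) = ennreal ((L2_norm f)^2/2) * ennreal S"
   by (subst nn_integral_multc) (auto simp: n)
  thus ?thesis
   using \<open>0 \<le> S\<close> by (simp add: ennreal_mult[symmetric] ennreal_plus[symmetric] field_simps del: ennreal_plus)
 qed
 finally show ?thesis using \<open>0 \<le> S\<close> by (subst (asm) ennreal_le_iff) auto
qed

text \<open>The Gaussian weight makes the integral of the squared transform finite before Plancherel
  is known. The multiplication formula rewrites it as a quadratic form of \<open>f\<close> with a
  Gaussian kernel, and Schur's test bounds that form independently of \<open>e\<close>.\<close>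

lemma L12_fourier_gauss:
 assumes f: "integrable lborel f" "f \<in> L2" and e: "e > 0"
 shows "(LBINT \<xi>. (norm (fourier_integral f \<xi>))\<^sup>2 * norm (gau (e *\<^sub>R \<xi>))) \<le> (L2_norm f)^2"
  and "integrable lborel (\<lambda>\<xi>. (norm (fourier_integral f \<xi>))\<^sup>2 * norm (gau (e *\<^sub>R \<xi>)))"
proof -
 have [measurable]: "f \<in> bmeas" using f by auto
 have fi: "integrable lborel (\<lambda>x. cnj (f x))" using f by simp
 have B: "norm (fourier_integral f \<xi>) \<le> c0*(LBINT x. norm (f x))" for \<xi> by (rule norm_fourier_integral_le)
 define G where "G \<xi> = cnj (fourier_integral f \<xi>) * gau (e *\<^sub>R \<xi>)" for \<xi>
 have [measurable]: "G \<in> bmeas" unfolding G_def by measurable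
 have G: "integrable lborel G"
 proof (rule Bochner_Integration.integrable_bound)
  show "integrable lborel (\<lambda>\<xi>. (c0*(LBINT x. norm (f x))) * norm (gau (e *\<^sub>R \<xi>)))"
   using gau_scaled_integrable[OF e] by auto
  show "AE \<xi> in lborel. norm (G \<xi>) \<le> norm ((c0*(LBINT x. norm (f x))) * norm (gau (e *\<^sub>R \<xi>)))"
   using B c0_pos by (auto simp: G_def norm_mult abs_mult intro!: mult_right_mono)
 qed measurable
 have sq: "fourier_integral f \<xi> * G \<xi> = of_real ((norm (fourier_integral f \<xi>))^2 * norm (gau (e *\<^sub>R \<xi>)))" for \<xi>
  unfolding G_def of_real_mult complex_norm_square gau_nonneg[symmetric] by (simp add: mult.assoc)
 show int: "integrable lborel (\<lambda>\<xi>. (norm (fourier_integral f \<xi>))\<^sup>2 * norm (gau (e *\<^sub>R \<xi>)))"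
 proof (rule Bochner_Integration.integrable_bound)
  show "integrable lborel (\<lambda>\<xi>. (c0*(LBINT x. norm (f x)))\<^sup>2 * norm (gau (e *\<^sub>R \<xi>)))"
   using gau_scaled_integrable[OF e] by auto
  show "AE \<xi> in lborel. norm ((norm (fourier_integral f \<xi>))^2 * norm (gau (e *\<^sub>R \<xi>))) \<le> norm ((c0*(LBINT x. norm (f x)))^2 * norm (gau (e *\<^sub>R \<xi>)))"
   using B by (auto simp: norm_mult abs_mult intro!: mult_right_mono power_mono)
 qed measurable
 \<comment> \<open>The transform of the Gaussian weight, up to constants. Its row integrals are
   1/(c0 c0) for every \<open>e\<close>, which cancels the two factors \<open>c0\<close> of the
   transforms.\<close>
 define k where "k x y = of_real (1/(c0 * e^3)) * gau ((1/e) *\<^sub>R (x - y))" for x y :: R3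
 have k: "fourier_integral G x = of_real (c0 * c0)*(LBINT y. k x y * cnj (f y))" for x
 proof -
  have G': "G \<xi> = of_real c0*(gau (e *\<^sub>R \<xi>)*(LBINT y. cis (y\<bullet>\<xi>) * cnj (f y)))" for \<xi>
  proof -
   have "cnj (LBINT y. cis (- (y\<bullet>\<xi>)) * f y) = (LBINT y. cis (y\<bullet>\<xi>) * cnj (f y))"
    by (subst Bochner_Integration.integral_cnj[symmetric]) (simp add: cis_cnj)
   thus ?thesis by (simp add: G_def fourier_integral_c0 mult_ac)
  qed
  have kk: "(LBINT \<xi>. (cis (- (x\<bullet>\<xi>)) * gau (e *\<^sub>R \<xi>)) * cis (y\<bullet>\<xi>)) = k x y" for y
  proof -
   have "(LBINT \<xi>. (cis (- (x\<bullet>\<xi>)) * gau (e *\<^sub>R \<xi>)) * cis (y\<bullet>\<xi>)) = (LBINT \<xi>. cis (- (\<xi>\<bullet>(x - y))) * gau (e *\<^sub>R \<xi>))"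
    by (intro Bochner_Integration.integral_cong refl)
     (simp add: mult.assoc mult.commute[of "gau _"], simp add: mult.assoc[symmetric] cis_mult inner_diff_right inner_commute[of x] inner_commute[of y])
   thus ?thesis unfolding k_def using fourier_gau_scaled[OF e, of "x - y"] by simp
  qed
  have "(LBINT \<xi>. cis (- (x\<bullet>\<xi>)) * G \<xi>) = of_real c0*(LBINT \<xi>. (cis (- (x\<bullet>\<xi>)) * gau (e *\<^sub>R \<xi>))*(LBINT y. cis (y\<bullet>\<xi>) * cnj (f y)))"
   unfolding G' integral_mult_right_zero[symmetric] by (simp add: mult_ac)
  also have "(LBINT \<xi>. (cis (- (x\<bullet>\<xi>)) * gau (e *\<^sub>R \<xi>))*(LBINT y. cis (y\<bullet>\<xi>) * cnj (f y)))
   = (LBINT y. (LBINT \<xi>. (cis (- (x\<bullet>\<xi>)) * gau (e *\<^sub>R \<xi>)) * cis (y\<bullet>\<xi>)) * cnj (f y))"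
   by (rule kernel_Fubini(1)[where B=1])
    (use fi e in \<open>auto simp: sigma_finite_lborel intro!: integrable_cis_mult gau_scaled_integrable\<close>)
  finally show ?thesis unfolding kk by (simp add: fourier_integral_c0 inner_commute mult.assoc)
 qed
 have "(LBINT \<xi>. (norm (fourier_integral f \<xi>))\<^sup>2 * norm (gau (e *\<^sub>R \<xi>))) \<le> norm (LBINT \<xi>. fourier_integral f \<xi> * G \<xi>)"
  unfolding sq by (subst integral_complex_of_real) simp
 also have "(LBINT \<xi>. fourier_integral f \<xi> * G \<xi>) = (LBINT x. f x * fourier_integral G x)"
  by (rule fourier_multiplication_formula[OF f(1) G])
 also have "... = of_real (c0 * c0)*(LBINT x. f x*(LBINT y. k x y * cnj (f y)))"
  unfolding k integral_mult_right_zero[symmetric] by (simp add: mult_ac)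
 also have "norm ... \<le> c0 * c0*(1/(c0 * c0)*(L2_norm f)^2)"
 proof -
  have S: "(\<integral>\<^sup>+y. ennreal (norm (k x y)) \<partial>lborel) = ennreal (1/(c0 * c0))" for x
  proof -
   have K: "complex_of_real (norm (k x y)) = of_real (1/(c0 * e^3)) * gau ((1/e) *\<^sub>R (x - y))" for y
    using c0_pos e gau_nonneg[of "(1/e) *\<^sub>R (x - y)"] by (simp add: k_def norm_mult norm_divide norm_power)
   have g: "gau ((1/e) *\<^sub>R (x - (x + e *\<^sub>R w))) = gau w" for w
    using e by (simp add: gau_def)
   have i: "integrable lborel (\<lambda>y. gau ((1/e) *\<^sub>R (x - y)))"
    using lborel_scale_R3(2)[OF e, of "\<lambda>y. gau ((1/e) *\<^sub>R (x - y))" x] gau_integrable unfolding g by simp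
   have "(LBINT y. complex_of_real (norm (k x y))) = of_real (1/(c0 * e^3))*(e^3 *\<^sub>R (LBINT w. gau ((1/e) *\<^sub>R (x - (x + e *\<^sub>R w)))))"
    unfolding K integral_mult_right_zero by (subst lborel_scale_R3(1)[OF e, of _ x]) simp
   also have "... = of_real (1/(c0 * c0))" unfolding g integral_gau using e c0_pos by (simp add: scaleR_conv_of_real)
   finally have "(LBINT y. norm (k x y)) = 1/(c0 * c0)" by (simp only: integral_complex_of_real of_real_eq_iff)
   moreover have "integrable lborel (\<lambda>y. norm (k x y))"
    unfolding k_def using i by (intro integrable_norm integrable_mult_right) auto
   ultimately show ?thesis by (subst nn_integral_eq_integral) auto
  qed
  have sym: "norm (k x y) = norm (k y x)" for x y
   by (simp add: k_def gau_def norm_mult norm_minus_commute[of x y])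
  have "norm (LBINT x. f x*(LBINT y. k x y * cnj (f y))) \<le> 1/(c0 * c0)*(L2_norm f)^2"
  proof (rule schur_bound[OF f(2)])
   show "(\<integral>\<^sup>+x. ennreal (norm (k x y)) \<partial>lborel) \<le> ennreal (1/(c0 * c0))" for y
    unfolding S[of y, symmetric] by (intro nn_integral_mono ennreal_leI) (simp only: sym[of _ y])
  qed (use S in \<open>auto simp: k_def\<close>)
  thus ?thesis using c0_pos by (simp add: norm_mult field_simps)
 qed
 finally show "(LBINT \<xi>. (norm (fourier_integral f \<xi>))\<^sup>2 * norm (gau (e *\<^sub>R \<xi>))) \<le> (L2_norm f)^2"
  using c0_pos by simp
qed

text \<open>The weighted bound is uniform in the width, so Fatou's lemma removes the Gaussian. Only
  a contraction is obtained here; equality follows once the double transform is known to be the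
  reflection.\<close>

lemma L12_fourier_L2:
 assumes f: "integrable lborel f" "f \<in> L2"
 shows "fourier_integral f \<in> L2" "L2_norm (fourier_integral f) \<le> L2_norm f"
proof -
 have [measurable]: "f \<in> bmeas" using f by auto
 define e where "e n = 1/real (Suc n)" for n
 have e: "e n > 0" for n by (simp add: e_def)
 have lim: "(\<lambda>n. ennreal ((norm (fourier_integral f \<xi>))^2 * norm (gau (e n *\<^sub>R \<xi>)))) \<longlonglongrightarrow> ennreal ((norm (fourier_integral f \<xi>))^2)" for \<xi>
 proof -
  have "e \<longlonglongrightarrow> 0" unfolding e_def by (rule LIMSEQ_Suc[OF lim_1_over_n])
  hence "(\<lambda>n. exp (- (e n * norm \<xi>)\<^sup>2/2)) \<longlonglongrightarrow> exp (- (0 * norm \<xi>)\<^sup>2/2)" by (intro tendsto_intros) auto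
  hence "(\<lambda>n. norm (gau (e n *\<^sub>R \<xi>))) \<longlonglongrightarrow> 1" by (simp add: gau_def e_def)
  from tendsto_mult[OF tendsto_const this, of "(norm (fourier_integral f \<xi>))^2"] show ?thesis by (intro tendsto_ennrealI) simp
 qed
 have "(\<integral>\<^sup>+\<xi>. ennreal ((norm (fourier_integral f \<xi>))^2) \<partial>lborel)
  = (\<integral>\<^sup>+\<xi>. liminf (\<lambda>n. ennreal ((norm (fourier_integral f \<xi>))^2 * norm (gau (e n *\<^sub>R \<xi>)))) \<partial>lborel)"
  by (intro nn_integral_cong lim_imp_Liminf[symmetric] lim) auto
 also have "... \<le> liminf (\<lambda>n. \<integral>\<^sup>+\<xi>. ennreal ((norm (fourier_integral f \<xi>))^2 * norm (gau (e n *\<^sub>R \<xi>))) \<partial>lborel)"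
  by (rule nn_integral_liminf) measurable
 also have "... \<le> liminf (\<lambda>n::nat. ennreal ((L2_norm f)^2))"
  using L12_fourier_gauss[OF f e]
  by (intro Liminf_mono always_eventually allI) (subst nn_integral_eq_integral, auto)
 finally have le: "(\<integral>\<^sup>+\<xi>. ennreal ((norm (fourier_integral f \<xi>))^2) \<partial>lborel) \<le> ennreal ((L2_norm f)^2)" by (simp add: Liminf_const)
 show L: "fourier_integral f \<in> L2" unfolding L2_iff_nn using le by (auto simp: less_top[symmetric] top_unique)
 have "ennreal ((L2_norm (fourier_integral f))^2) = (\<integral>\<^sup>+\<xi>. ennreal ((norm (fourier_integral f \<xi>))^2) \<partial>lborel)"
  using L by (subst nn_integral_eq_integral) (auto simp: L2_def L2_norm_def)
 with le have "ennreal ((L2_norm (fourier_integral f))^2) \<le> ennreal ((L2_norm f)^2)" by simp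
 hence "(L2_norm (fourier_integral f))^2 \<le> (L2_norm f)^2" by (subst (asm) ennreal_le_iff) auto
 thus "L2_norm (fourier_integral f) \<le> L2_norm f" by (rule power2_le_imp_le) (simp add: L2_norm_def)
qed

subsection \<open>The Plancherel transform\<close>

definition trunc :: "nat => (R3 => complex) => R3 => complex" where
 "trunc n f x = (if norm x \<le> real n then f x else 0)"

definition L12 :: "(R3 => complex) set" where "L12 = {f \<in> L2. integrable lborel f}"

lemma L12D: "f \<in> L12 ==> f \<in> L2" "f \<in> L12 ==> integrable lborel f" by (auto simp: L12_def)

lemma trunc_L12: assumes "f \<in> L2" shows "trunc n f \<in> L12"
proof -
 have [measurable]: "f \<in> bmeas" using assms by (rule L2_measurable)
 have m[measurable]: "trunc n f \<in> bmeas" unfolding trunc_def by measurable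
 have "trunc n f \<in> L2" by (rule L2_bound[OF assms m, where C=1]) (auto simp: trunc_def)
 moreover have "integrable lborel (trunc n f)"
 proof (rule Bochner_Integration.integrable_bound)
  have "integrable lborel (indicator (cball (0::R3) (real n)) :: R3 => real)"
   using emeasure_lborel_cball_finite[of "0::R3" "real n"] by (subst integrable_indicator_iff) auto
  thus "integrable lborel (\<lambda>x. indicator (cball 0 (real n)) x + (norm (f x))^2)"
   using assms by (auto simp: L2_def)
  have "norm (trunc n f x) \<le> indicator (cball 0 (real n)) x + (norm (f x))^2" for x
  proof -
   have "norm (f x) \<le> 1 + (norm (f x))^2" using sum_squares_bound[of 1 "norm (f x)"] norm_ge_zero[of "f x"]
    unfolding power_one by linarith
   thus ?thesis by (auto simp: trunc_def indicator_def)
  qed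
  thus "AE x in lborel. norm (trunc n f x) \<le> norm (indicator (cball 0 (real n)) x + (norm (f x))^2)"
   by (auto intro!: order_trans[OF _ abs_ge_self])
 qed measurable
 ultimately show ?thesis by (simp add: L12_def)
qed

lemma trunc_tendsto: assumes "f \<in> L2" shows "(\<lambda>n. mk (trunc n f)) \<longlonglongrightarrow> mk f"
proof (rule L2_dct(2)[OF assms])
 show "trunc n f \<in> bmeas" for n using trunc_L12[OF assms] L12D L2_measurable by blast
 show "f \<in> bmeas" using assms by (rule L2_measurable)
 show "AE x in lborel. norm (trunc n f x) \<le> norm (f x)" for n by (auto simp: trunc_def)
 show "AE x in lborel. (\<lambda>n. trunc n f x) \<longlonglongrightarrow> f x"
 proof (rule AE_I2, rule tendsto_eventually)
  fix x :: R3
  obtain N :: nat where "norm x \<le> real N" using real_arch_simple by blast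
  thus "\<forall>\<^sub>F n in sequentially. trunc n f x = f x"
   by (auto simp: trunc_def eventually_sequentially intro!: exI[of _ N])
 qed
qed

lemma L12_add: "f \<in> L12 ==> g \<in> L12 ==> (\<lambda>x. f x + g x) \<in> L12" by (auto simp: L12_def L2_add)
lemma L12_diff: "f \<in> L12 ==> g \<in> L12 ==> (\<lambda>x. f x - g x) \<in> L12" by (auto simp: L12_def L2_diff)

lemma fourier_integral_add: assumes "f \<in> L12" "g \<in> L12"
 shows "fourier_integral (\<lambda>x. f x + g x) \<xi> = fourier_integral f \<xi> + fourier_integral g \<xi>"
 using assms by (simp add: fourier_integral_c0 distrib_left integrable_cis_mult L12D)
lemma fourier_integral_diff: assumes "f \<in> L12" "g \<in> L12"
 shows "fourier_integral (\<lambda>x. f x - g x) \<xi> = fourier_integral f \<xi> - fourier_integral g \<xi>"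
 using assms by (simp add: fourier_integral_c0 right_diff_distrib integrable_cis_mult L12D)
lemma fourier_integral_cmult:
 "fourier_integral (\<lambda>x. c * f x) \<xi> = c * fourier_integral f \<xi>"
 by (simp add: fourier_integral_c0 mult.left_commute[of _ c])
lemma fourier_integral_cong_AE:
 assumes "AE x in lborel. f x = g x" "f \<in> bmeas" "g \<in> bmeas"
 shows "fourier_integral f \<xi> = fourier_integral g \<xi>"
 unfolding fourier_integral_c0 using assms by (intro arg_cong2[where f="(*)"] refl integral_cong_AE) auto

lemma L12_fourier:
 assumes "f \<in> L12" shows "fourier_integral f \<in> L2" "L2_norm (fourier_integral f) \<le> L2_norm f"
 using L12_fourier_L2[of f] assms by (auto simp: L12_def)

lemma trunc_measurable[measurable]:
 assumes [measurable]: "f \<in> bmeas" shows "trunc n f \<in> bmeas"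
 unfolding trunc_def by measurable

lemma L12_fourier_diff_le:
 assumes "f \<in> L12" "g \<in> L12"
 shows "norm (mk (fourier_integral f) - mk (fourier_integral g)) \<le> norm (mk f - mk g)"
proof -
 have "fourier_integral (\<lambda>x. f x - g x) = (\<lambda>\<xi>. fourier_integral f \<xi> - fourier_integral g \<xi>)"
  by (intro ext fourier_integral_diff assms)
 hence "mk (fourier_integral f) - mk (fourier_integral g) = mk (fourier_integral (\<lambda>x. f x - g x))"
  using assms by (simp add: mk_diff L12_fourier)
 also have "norm ... \<le> norm (mk (\<lambda>x. f x - g x))"
  using L12_diff[OF assms] by (simp add: norm_mk L12_fourier L12D)
 finally show ?thesis using assms by (simp add: mk_diff L12D)
qed

text \<open>The Plancherel transform as a limit over truncations to balls, which lie in L^1 and L^2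
  at once. The contraction property makes the sequence Cauchy, and \<open>Ft_mk\<close> identifies
  the limit with the integral on all of \<open>L12\<close>.\<close>

definition Ft :: "l2 => l2" where "Ft v = lim (\<lambda>n. mk (fourier_integral (trunc n (rep v))))"

lemma Ft_tendsto: "(\<lambda>n. mk (fourier_integral (trunc n (rep v)))) \<longlonglongrightarrow> Ft v"
proof -
 have "Cauchy (\<lambda>n. mk (trunc n (rep v)))" using trunc_tendsto[OF rep_L2] by (rule LIMSEQ_imp_Cauchy)
 hence "Cauchy (\<lambda>n. mk (fourier_integral (trunc n (rep v))))"
  unfolding Cauchy_def dist_norm
  using L12_fourier_diff_le[OF trunc_L12[OF rep_L2] trunc_L12[OF rep_L2]] by (meson le_less_trans)
 thus ?thesis unfolding Ft_def by (simp add: Cauchy_convergent_iff convergent_LIMSEQ_iff)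
qed

lemma norm_Ft_le: "norm (Ft v) \<le> norm v"
proof (rule LIMSEQ_le[OF tendsto_norm[OF Ft_tendsto] tendsto_norm[OF trunc_tendsto[OF rep_L2[of v], unfolded mk_rep]]])
 have "norm (mk (fourier_integral (trunc n (rep v)))) \<le> norm (mk (trunc n (rep v)))" for n
  using L12_fourier[OF trunc_L12[OF rep_L2[of v]]] trunc_L12[OF rep_L2[of v], of n]
  by (simp add: norm_mk L12D)
 thus "\<exists>N. \<forall>n\<ge>N. norm (mk (fourier_integral (trunc n (rep v)))) \<le> norm (mk (trunc n (rep v)))" by blast
qed

lemma Ft_mk: assumes f: "f \<in> L12" shows "Ft (mk f) = mk (fourier_integral f)"
proof (rule LIMSEQ_unique[OF Ft_tendsto], rule LIM_zero_cancel, rule Lim_null_comparison)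
 show "\<forall>\<^sub>F n in sequentially. norm (mk (fourier_integral (trunc n (rep (mk f)))) - mk (fourier_integral f)) \<le> norm (mk (trunc n (rep (mk f))) - mk f)"
  by (intro always_eventually allI L12_fourier_diff_le f trunc_L12 rep_L2)
 have "(\<lambda>n. mk (trunc n (rep (mk f))) - mk f) \<longlonglongrightarrow> 0"
  using trunc_tendsto[OF rep_L2[of "mk f"]] by (simp add: LIM_zero)
 thus "(\<lambda>n. norm (mk (trunc n (rep (mk f))) - mk f)) \<longlonglongrightarrow> 0" by (rule tendsto_norm_zero)
qed

lemma Ft_add: "Ft (u + v) = Ft u + Ft v"
proof (rule LIMSEQ_unique[OF Ft_tendsto])
 have "mk (fourier_integral (trunc n (rep (u + v)))) = mk (fourier_integral (trunc n (rep u))) + mk (fourier_integral (trunc n (rep v)))" for n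
 proof -
  have "AE x in lborel. trunc n (rep (u + v)) x = trunc n (rep u) x + trunc n (rep v) x"
   using rep_add[of u v] by eventually_elim (simp add: trunc_def)
  hence "fourier_integral (trunc n (rep (u + v))) = fourier_integral (\<lambda>x. trunc n (rep u) x + trunc n (rep v) x)"
   by (intro ext fourier_integral_cong_AE) measurable
  also have "... = (\<lambda>\<xi>. fourier_integral (trunc n (rep u)) \<xi> + fourier_integral (trunc n (rep v)) \<xi>)"
   by (intro ext fourier_integral_add trunc_L12 rep_L2)
  finally show ?thesis by (simp add: mk_add L12_fourier trunc_L12)
 qed
 thus "(\<lambda>n. mk (fourier_integral (trunc n (rep (u + v))))) \<longlonglongrightarrow> Ft u + Ft v"
  using tendsto_add[OF Ft_tendsto[of u] Ft_tendsto[of v]] by simp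
qed

lemma Ft_cmul: "Ft (cmul c v) = cmul c (Ft v)"
proof (rule LIMSEQ_unique[OF Ft_tendsto])
 have "mk (fourier_integral (trunc n (rep (cmul c v)))) = cmul c (mk (fourier_integral (trunc n (rep v))))" for n
 proof -
  have "AE x in lborel. trunc n (rep (cmul c v)) x = c * trunc n (rep v) x"
   using rep_cmul[of c v] by eventually_elim (simp add: trunc_def)
  hence "fourier_integral (trunc n (rep (cmul c v))) = fourier_integral (\<lambda>x. c * trunc n (rep v) x)"
   by (intro ext fourier_integral_cong_AE) measurable
  thus ?thesis
   by (simp add: cmul_Mul Mul_mk L12_fourier trunc_L12 fourier_integral_cmult[abs_def])
 qed
 thus "(\<lambda>n. mk (fourier_integral (trunc n (rep (cmul c v))))) \<longlonglongrightarrow> cmul c (Ft v)"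
  using bounded_linear.tendsto[OF bounded_linear_cmul Ft_tendsto] by simp
qed

lemma scaleR_cmul: "r *\<^sub>R v = cmul (of_real r) v" by (simp add: scaleR_Mul cmul_Mul)

lemma bounded_linear_Ft: "bounded_linear Ft"
 by (rule bounded_linear_intro[where K=1]) (auto simp: Ft_add scaleR_cmul Ft_cmul norm_Ft_le)

lemma L12_dense_eq:
 assumes "bounded_linear A" "bounded_linear B" "\<And>f. f \<in> L12 ==> A (mk f) = B (mk f)"
 shows "A v = B v"
proof (rule LIMSEQ_unique)
 show "(\<lambda>n. A (mk (trunc n (rep v)))) \<longlonglongrightarrow> A v"
  using bounded_linear.tendsto[OF assms(1) trunc_tendsto[OF rep_L2[of v]]] by simp
 show "(\<lambda>n. A (mk (trunc n (rep v)))) \<longlonglongrightarrow> B v"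
  using bounded_linear.tendsto[OF assms(2) trunc_tendsto[OF rep_L2[of v]]] by (simp add: assms(3) trunc_L12)
qed

text \<open>Bilinear, without conjugation: the pairing that occurs in \<open>is_fourier\<close> and
  in the weak Schroedinger equation. With respect to it \<open>Ft\<close> is symmetric rather than
  unitary.\<close>

definition bp :: "l2 => l2 => complex" where "bp u v = (LBINT x. rep u x * rep v x)"
definition Cnj :: "l2 => l2" where "Cnj v = mk (\<lambda>x. cnj (rep v x))"

lemma rep_Cnj: "AE x in lborel. rep (Cnj v) x = cnj (rep v x)"
 unfolding Cnj_def by (rule rep_mk) (simp add: L2_cnj)

lemma bp_cip: "bp u v = cip (Cnj u) v"
proof -
 have "cip (Cnj u) v = (LBINT x. cnj (cnj (rep u x)) * rep v x)"
  by (intro cip_cong rep_Cnj AE_I2 refl) measurable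
 thus ?thesis by (simp add: bp_def)
qed

lemma norm_Cnj[simp]: "norm (Cnj v) = norm v"
proof -
 have "L2_norm (rep (Cnj v)) = L2_norm (\<lambda>x. cnj (rep v x))" by (intro L2_norm_cong rep_Cnj) measurable
 thus ?thesis by (simp add: norm_l2) (simp add: L2_norm_def)
qed

lemma bp_sym: "bp u v = bp v u" by (simp add: bp_def mult.commute)
lemma bp_norm_le: "norm (bp u v) \<le> norm u * norm v" using cip_norm_le[of "Cnj u" v] by (simp add: bp_cip)

lemma bounded_bilinear_bp: "bounded_bilinear bp"
proof
 show r: "bp a (b + b') = bp a b + bp a b'" for a b b' by (simp add: bp_cip cip_add_right)
 show "bp (a + a') b = bp a b + bp a' b" for a a' b using r by (simp add: bp_sym[of _ b])
 show s: "bp a (r *\<^sub>R b) = r *\<^sub>R bp a b" for r a b by (simp add: bp_cip cip_scaleR_right scaleR_conv_of_real)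
 show "bp (r *\<^sub>R a) b = r *\<^sub>R bp a b" for r a b using s by (simp add: bp_sym[of _ b])
 show "\<exists>K. \<forall>a b. norm (bp a b) \<le> norm a * norm b * K" using bp_norm_le by (intro exI[of _ 1]) simp
qed

lemma bp_mk: assumes "f \<in> L2" "g \<in> L2" shows "bp (mk f) (mk g) = (LBINT x. f x * g x)"
 unfolding bp_def
proof (rule integral_cong_AE)
 show "AE x in lborel. rep (mk f) x * rep (mk g) x = f x * g x"
  using rep_mk[OF assms(1)] rep_mk[OF assms(2)] by eventually_elim simp
qed (use L2_measurable[OF assms(1)] L2_measurable[OF assms(2)] in measurable)

lemma bp_Ft: "bp (Ft u) v = bp u (Ft v)"
proof (rule LIMSEQ_unique)
 note t = trunc_tendsto[OF rep_L2, unfolded mk_rep]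
 note L = trunc_L12[OF rep_L2]
 note T = bounded_bilinear.tendsto[OF bounded_bilinear_bp]
 show "(\<lambda>n. bp (mk (fourier_integral (trunc n (rep u)))) (mk (trunc n (rep v)))) \<longlonglongrightarrow> bp (Ft u) v"
  by (rule T[OF Ft_tendsto t])
 have "bp (mk (fourier_integral (trunc n (rep u)))) (mk (trunc n (rep v))) = bp (mk (trunc n (rep u))) (mk (fourier_integral (trunc n (rep v))))" for n
  by (simp add: bp_mk L12_fourier L L12D fourier_multiplication_formula)
 thus "(\<lambda>n. bp (mk (fourier_integral (trunc n (rep u)))) (mk (trunc n (rep v)))) \<longlonglongrightarrow> bp u (Ft v)"
  using T[OF t Ft_tendsto] by simp
qed

lemma gau_mod_L12: "(\<lambda>x. cis (b\<bullet>x) * gau x) \<in> L12"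
proof -
 have "integrable lborel (\<lambda>x. (norm (gau x))\<^sup>2)"
  by (rule Bochner_Integration.integrable_bound[OF gau_integrable]) (use norm_gau_le in \<open>auto simp: power2_eq_square intro!: AE_I2 mult_left_le_one_le\<close>)
 hence "gau \<in> L2" by (simp add: L2_def)
 hence "(\<lambda>x. cis (b\<bullet>x) * gau x) \<in> L2" by (intro bm_mult_L2 bm_cis) auto
 moreover have "integrable lborel (\<lambda>x. cis (b\<bullet>x) * gau x)" by (intro integrable_cis_mult gau_integrable) measurable
 ultimately show ?thesis by (simp add: L12_def)
qed

lemma gau_shift_L12: "(\<lambda>x. gau (x - b)) \<in> L12"
 using gau_mod_L12[of 0] L2_shift[of gau "- b"] lborel_shift_R3(2)[of gau "- b"] by (auto simp: L12_def)

text \<open>The pairings with modulated Gaussians are the values of the Fourier integral of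
  \<open>f\<close> times \<open>gau\<close>, which is integrable; injectivity on L^1 and positivity
  of \<open>gau\<close> finish. Uniqueness of distributional transforms thus rests on one explicit
  family of Schwartz functions instead of a density argument.\<close>

lemma tempered_gauss_inj:
 assumes i: "integrable lborel (\<lambda>x. f x * gau x)" and 0: "\<And>b. (LBINT x. f x*(cis (b\<bullet>x) * gau x)) = 0"
 shows "AE x in lborel. f x = 0"
proof -
 have "AE x in lborel. f x * gau x = 0"
 proof (rule fourier_L1_inj[OF i])
  fix \<xi>
  have "(LBINT x. f x*(cis ((- \<xi>)\<bullet>x) * gau x)) = (LBINT x. cis (- (x\<bullet>\<xi>))*(f x * gau x))"
   by (simp add: mult_ac inner_commute)
  thus "fourier_integral (\<lambda>x. f x * gau x) \<xi> = 0" using 0[of "- \<xi>"] by (simp add: fourier_integral_c0)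
 qed
 thus ?thesis by eventually_elim (simp add: gau_def)
qed

text \<open>The identity is computed on modulated Gaussians, where both transforms are explicit.
  Symmetry with respect to \<open>bp\<close> moves it from these test vectors onto an arbitrary
  \<open>v\<close>, and the Gaussians separate points.\<close>

lemma Ft_Ft: "Ft (Ft v) = Refl v"
proof -
 define \<gamma> where "\<gamma> b = mk (\<lambda>x. cis (b\<bullet>x) * gau x)" for b
 have gg: "Ft (Ft (\<gamma> b)) = Refl (\<gamma> b)" for b
 proof -
  have "fourier_integral (\<lambda>x. cis (b\<bullet>x) * gau x) = (\<lambda>x. gau (x - b))"
   by (intro ext) (simp add: fourier_integral_modulate fourier_gau)
  moreover have "fourier_integral (\<lambda>x. gau (x - b)) = (\<lambda>x. cis (b \<bullet> - x) * gau (- x))"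
   by (intro ext) (simp only: fourier_integral_translate fourier_gau, simp add: gau_def)
  ultimately show ?thesis
   by (simp add: \<gamma>_def Ft_mk gau_mod_L12 gau_shift_L12 Refl_mk L12D)
 qed
 have bR: "bp u (Refl w) = bp (Refl u) w" for u w
 proof -
  have "AE x in lborel. rep u x * rep (Refl w) x = rep u x * rep w (- x)" using rep_Refl[of w] by eventually_elim simp
  hence "bp u (Refl w) = (LBINT x. rep u x * rep w (- x))" unfolding bp_def by (intro integral_cong_AE) auto
  also have "... = (LBINT x. rep u (- x) * rep w x)"
   using lborel_reflect_R3(1)[of "\<lambda>x. rep u x * rep w (- x)"] by simp
  also have "AE x in lborel. rep u (- x) * rep w x = rep (Refl u) x * rep w x" using rep_Refl[of u] by eventually_elim simp
  hence "(LBINT x. rep u (- x) * rep w x) = bp (Refl u) w" unfolding bp_def by (intro integral_cong_AE) auto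
  finally show ?thesis .
 qed
 have eq: "bp (Ft (Ft v)) (\<gamma> b) = bp (Refl v) (\<gamma> b)" for b by (simp add: bp_Ft gg bR)
 define d where "d = Ft (Ft v) - Refl v"
 have "AE x in lborel. rep d x = 0"
 proof (rule tempered_gauss_inj)
  show "integrable lborel (\<lambda>x. rep d x * gau x)"
   using gau_mod_L12[of 0] by (intro L2_mult_integrable) (auto simp: L12_def)
  fix b
  have "(LBINT x. rep d x*(cis (b\<bullet>x) * gau x)) = bp d (\<gamma> b)"
   unfolding \<gamma>_def using bp_mk[OF rep_L2[of d] L12D(1)[OF gau_mod_L12[of b]]] by simp
  also have "... = 0" unfolding d_def using eq[of b] by (simp add: bounded_bilinear.diff_left[OF bounded_bilinear_bp])
  finally show "(LBINT x. rep d x*(cis (b\<bullet>x) * gau x)) = 0" .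
 qed
 hence "d = 0" unfolding l2_eq_iff using rep_zero by eventually_elim simp
 thus ?thesis by (simp add: d_def)
qed

definition Fi :: "l2 => l2" where "Fi v = Refl (Ft v)"

lemma Ft_Refl: "Ft (Refl v) = Refl (Ft v)" by (simp add: Ft_Ft[symmetric])
lemma Ft_Fi[simp]: "Ft (Fi v) = v" by (simp add: Fi_def Ft_Refl Ft_Ft)
lemma Fi_Ft[simp]: "Fi (Ft v) = v" by (simp add: Fi_def Ft_Ft)

text \<open>Applied twice, the contraction \<open>Ft\<close> gives the isometry \<open>Refl\<close>,
  so no norm can be lost in either application.\<close>

lemma norm_Ft[simp]: "norm (Ft v) = norm v"
 using norm_Ft_le[of v] norm_Ft_le[of "Ft v"] by (simp add: Ft_Ft)
lemma norm_Fi[simp]: "norm (Fi v) = norm v" by (simp add: Fi_def)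

lemma isometry_cip:
 assumes add: "\<And>u v. A (u + v) = A u + A v" and cm: "\<And>c v. A (cmul c v) = cmul c (A v)" and n: "\<And>v. norm (A v) = norm v"
 shows "cip (A u) (A v) = cip u v"
proof -
 have inn: "inner (A u) (A v) = inner u v" for u v
  using n[of "u + v"] n[of u] n[of v] by (simp add: add dot_norm)
 have "Im (cip u v) = inner u (cmul (- \<i>) v)" for u v by (simp add: inner_l2_def cip_cmul_right)
 hence "Im (cip (A u) (A v)) = Im (cip u v)" using inn by (metis cm)
 moreover have "Re (cip (A u) (A v)) = Re (cip u v)" using inn by (simp add: inner_l2_def)
 ultimately show ?thesis by (simp add: complex_eq_iff)
qed

lemma cip_Ft: "cip (Ft u) (Ft v) = cip u v" by (rule isometry_cip) (auto simp: Ft_add Ft_cmul)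
lemma cip_Ft_right: "cip u (Ft v) = cip (Fi u) v" using cip_Ft[of "Fi u" v] by simp
lemma cip_Fi: "cip (Fi u) (Fi v) = cip u v" using cip_Ft[of "Fi u" "Fi v"] by simp

lemma bounded_linear_Fi: "bounded_linear Fi"
 unfolding Fi_def[abs_def] using bounded_linear_compose[OF bounded_linear_Refl bounded_linear_Ft] by simp
lemmas Fi_add = linear_add[OF bounded_linear.linear[OF bounded_linear_Fi]]
lemmas Ft_diff = linear_diff[OF bounded_linear.linear[OF bounded_linear_Ft]]

lemma Ft_modulate: "Ft (Mul (\<lambda>x. cis (b\<bullet>x)) v) = Shift (- b) (Ft v)"
proof (rule L12_dense_eq[where A="\<lambda>v. Ft (Mul (\<lambda>x. cis (b\<bullet>x)) v)" and B="\<lambda>v. Shift (- b) (Ft v)"])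
 have bmc: "bm (\<lambda>x. cis (b\<bullet>x))" by (rule bm_cis) measurable
 show "bounded_linear (\<lambda>v. Ft (Mul (\<lambda>x. cis (b\<bullet>x)) v))"
  by (rule bounded_linear_compose[OF bounded_linear_Ft bounded_linear_Mul[OF bmc]])
 show "bounded_linear (\<lambda>v. Shift (- b) (Ft v))"
  by (rule bounded_linear_compose[OF bounded_linear_Shift bounded_linear_Ft])
 fix f assume f: "f \<in> L12"
 have "(\<lambda>x. cis (b\<bullet>x) * f x) \<in> L12"
  using f bm_mult_L2[OF bmc, of f] by (auto simp: L12_def intro!: integrable_cis_mult)
 thus "Ft (Mul (\<lambda>x. cis (b\<bullet>x)) (mk f)) = Shift (- b) (Ft (mk f))"
  using f bmc by (simp add: Mul_mk L12D Ft_mk Shift_mk L12_fourier fourier_integral_modulate[abs_def])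
qed

section \<open>Gaussians are Schwartz functions\<close>

lemma pderiv1_eq: "(f has_derivative f') (at x) ==> pderiv1 i f x = f' (axis i 1)"
 unfolding pderiv1_def using frechet_derivative_at by metis

lemma pderiv1_mult:
 assumes "f differentiable (at x)" "g differentiable (at x)"
 shows "pderiv1 i (\<lambda>x. f x * g x) x = pderiv1 i f x * g x + f x * pderiv1 i g x"
proof -
 have "(f has_derivative frechet_derivative f (at x)) (at x)" "(g has_derivative frechet_derivative g (at x)) (at x)"
  using assms by (simp_all add: frechet_derivative_works)
 from pderiv1_eq[OF has_derivative_mult[OF this]] show ?thesis by (simp add: pderiv1_def)
qed

lemma pderiv1_add:
 assumes "f differentiable (at x)" "g differentiable (at x)"
 shows "pderiv1 i (\<lambda>x. f x + g x) x = pderiv1 i f x + pderiv1 i g x"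
proof -
 have "(f has_derivative frechet_derivative f (at x)) (at x)" "(g has_derivative frechet_derivative g (at x)) (at x)"
  using assms by (simp_all add: frechet_derivative_works)
 from pderiv1_eq[OF has_derivative_add[OF this]] show ?thesis by (simp add: pderiv1_def)
qed

lemma coord_derivative: "((\<lambda>x::R3. complex_of_real (x $ i)) has_derivative (\<lambda>h. of_real (h $ i))) (at x)"
 by (intro has_derivative_of_real bounded_linear_imp_has_derivative bounded_linear_vec_nth)

lemma japanese_ge1: "1 \<le> japanese y" by (simp add: japanese_def)
lemma japanese_pos: "0 < japanese y" using japanese_ge1[of y] by linarith
lemma japanese_ge_norm: "norm y \<le> japanese y"
 unfolding japanese_def by (rule real_le_rsqrt) simp

definition cgauss :: "R3 => R3 => R3 => complex" where
 "cgauss a b x = exp (of_real (- (x\<bullet>x)/2 + a\<bullet>x) + \<i> * of_real (b\<bullet>x))"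

lemma cgauss_alt: "cgauss a b x = of_real (exp (- (x\<bullet>x)/2 + a\<bullet>x)) * cis (b\<bullet>x)"
 unfolding cgauss_def exp_add[of "of_real _"] cis_conv_exp exp_of_real ..

lemma cgauss_derivative:
 "(cgauss a b has_derivative (\<lambda>h. cgauss a b x*(of_real (- (x\<bullet>h) + a\<bullet>h) + \<i> * of_real (b\<bullet>h)))) (at x)"
proof -
 have "((\<lambda>x. complex_of_real (- (x\<bullet>x)/2 + a\<bullet>x)) has_derivative (\<lambda>h. complex_of_real (- (x\<bullet>h) + a\<bullet>h))) (at x)"
  by (rule has_derivative_of_real) (auto intro!: derivative_eq_intros simp: inner_commute)
 moreover have "((\<lambda>x. complex_of_real (b\<bullet>x)) has_derivative (\<lambda>h. complex_of_real (b\<bullet>h))) (at x)"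
  by (rule has_derivative_of_real) (auto intro!: derivative_eq_intros)
 ultimately have "((\<lambda>x. of_real (- (x\<bullet>x)/2 + a\<bullet>x) + \<i> * of_real (b\<bullet>x)) has_derivative
   (\<lambda>h. of_real (- (x\<bullet>h) + a\<bullet>h) + \<i> * complex_of_real (b\<bullet>h))) (at x)"
  by (intro has_derivative_add has_derivative_mult_right)
 hence "((\<lambda>x. exp (of_real (- (x\<bullet>x)/2 + a\<bullet>x) + \<i> * of_real (b\<bullet>x))) has_derivative
   (\<lambda>h. exp (of_real (- (x\<bullet>x)/2 + a\<bullet>x) + \<i> * of_real (b\<bullet>x))*(of_real (- (x\<bullet>h) + a\<bullet>h) + \<i> * complex_of_real (b\<bullet>h)))) (at x)"
  by (rule has_derivative_compose[OF _ DERIV_exp[unfolded has_field_derivative_def], unfolded o_def])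
 thus ?thesis unfolding cgauss_def[abs_def] by simp
qed

text \<open>One term of the exponential series at (1 + s)/4. With s = |x|^2 this spends a quarter of
  |x|^2 from the Gaussian exponent; the linear term of \<open>cgauss\<close> is absorbed by the
  other quarter.\<close>

lemma one_plus_power_exp_bound:
 assumes "(s::real) \<ge> 0" shows "(1 + s)^n \<le> 4^n * fact n * exp ((1 + s)/4)"
proof -
 define y where "y = (1 + s)/4"
 have y: "y \<ge> 0" "1 + s = 4 * y" using assms by (auto simp: y_def)
 have "(\<Sum>i\<in>{n}. y^i /\<^sub>R fact i) \<le> (\<Sum>i. y^i /\<^sub>R fact i)"
  by (rule sum_le_suminf[OF summable_exp_generic]) (use y in auto)
 hence "y^n/fact n \<le> exp y" unfolding exp_def by (simp add: divide_inverse_commute)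
 hence "y^n \<le> fact n * exp y" by (simp add: pos_divide_le_eq mult.commute)
 hence "4^n * y^n \<le> 4^n*(fact n * exp y)" by (rule mult_left_mono) simp
 thus ?thesis unfolding y_def[symmetric] y(2) by (simp add: power_mult_distrib mult.assoc)
qed

lemma cgauss_decay: "\<exists>C. \<forall>x. japanese x^n * norm (cgauss a b x) \<le> C"
proof -
 have "japanese x^n * norm (cgauss a b x) \<le> 4^n * fact n * exp (1/4 + (norm a)^2)" for x
 proof -
  have "japanese x^n \<le> japanese x^(2 * n)" by (intro power_increasing japanese_ge1) simp
  also have "... = (1 + (norm x)^2)^n" by (simp add: power_mult japanese_def)
  also have "... \<le> 4^n * fact n * exp ((1 + (norm x)^2)/4)" by (rule one_plus_power_exp_bound) simp
  finally have 1: "japanese x^n \<le> 4^n * fact n * exp ((1 + (norm x)^2)/4)" .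
  have "a\<bullet>x \<le> norm a * norm x" by (rule norm_cauchy_schwarz)
  also have "... \<le> (norm x)^2/4 + (norm a)^2"
   using zero_le_power2[of "norm x/2 - norm a"] by (simp add: power2_eq_square algebra_simps)
  finally have "norm (cgauss a b x) \<le> exp (- (norm x)\<^sup>2/4 + (norm a)^2)"
   by (simp add: cgauss_def power2_norm_eq_inner)
  with 1 have "japanese x^n * norm (cgauss a b x) \<le> (4^n * fact n * exp ((1 + (norm x)^2)/4)) * exp (- (norm x)\<^sup>2/4 + (norm a)^2)"
   by (intro mult_mono) auto
  also have "... = 4^n * fact n * exp (1/4 + (norm a)^2)" by (simp add: exp_add[symmetric] field_simps)
  finally show ?thesis .
 qed
 thus ?thesis by blast
qed

text \<open>Polynomials times one Gaussian, a class that survives both \<open>pderiv1\<close> and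
  multiplication by coordinates. The Schwartz property thereby reduces to the decay of
  \<open>cgauss\<close>. The parameter \<open>a\<close> produces translated, \<open>b\<close>
  modulated Gaussians, the two families used as test functions.\<close>

inductive gauss_poly :: "R3 => R3 => (R3 => complex) => bool" for a b where
 base: "gauss_poly a b (cgauss a b)"
| coord: "gauss_poly a b f ==> gauss_poly a b (\<lambda>x. of_real (x $ i) * f x)"
| smult: "gauss_poly a b f ==> gauss_poly a b (\<lambda>x. c * f x)"
| add: "gauss_poly a b f ==> gauss_poly a b g ==> gauss_poly a b (\<lambda>x. f x + g x)"

lemma gauss_poly_diff: "gauss_poly a b f ==> f differentiable (at x)"
proof (induct rule: gauss_poly.induct)
 case base thus ?case using cgauss_derivative differentiable_def by blast
next
 case (coord f i) thus ?case using coord_derivative differentiable_def by (metis differentiable_mult)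
qed (auto intro: derivative_intros)

lemma gauss_poly_pderiv1: "gauss_poly a b f ==> gauss_poly a b (pderiv1 i f)"
proof (induct rule: gauss_poly.induct)
 case base
 have "pderiv1 i (cgauss a b) = (\<lambda>x. (-1)*(of_real (x $ i) * cgauss a b x) + (of_real (a $ i) + \<i> * of_real (b $ i)) * cgauss a b x)"
  by (intro ext, subst pderiv1_eq[OF cgauss_derivative]) (simp add: inner_axis algebra_simps)
 thus ?case by (simp only:) (intro gauss_poly.intros)
next
 case (coord f j)
 have "pderiv1 i (\<lambda>x. of_real (x $ j) * f x) = (\<lambda>x. of_real (axis i (1::real) $ j) * f x + of_real (x $ j) * pderiv1 i f x)"
  using gauss_poly_diff[OF coord(1)] coord_derivative[of j]
  by (intro ext, subst pderiv1_mult) (auto simp: differentiable_def pderiv1_eq[OF coord_derivative])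
 thus ?case by (simp only:) (intro gauss_poly.intros coord)
next
 case (smult f c)
 have "pderiv1 i (\<lambda>x. c * f x) = (\<lambda>x. c * pderiv1 i f x)"
  using gauss_poly_diff[OF smult(1)]
  by (intro ext, subst pderiv1_mult) (auto simp: pderiv1_eq[OF has_derivative_const])
 thus ?case by (simp only:) (intro gauss_poly.intros smult)
next
 case (add f g)
 have "pderiv1 i (\<lambda>x. f x + g x) = (\<lambda>x. pderiv1 i f x + pderiv1 i g x)"
  by (intro ext pderiv1_add gauss_poly_diff[OF add(1)] gauss_poly_diff[OF add(3)])
 thus ?case by (simp only:) (intro gauss_poly.intros add)
qed

lemma gauss_poly_decay: "gauss_poly a b f ==> \<exists>C. \<forall>x. japanese x^n * norm (f x) \<le> C"
proof (induct arbitrary: n rule: gauss_poly.induct)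
 case base thus ?case by (rule cgauss_decay)
next
 case (coord f i)
 obtain C where C: "\<And>x. japanese x^Suc n * norm (f x) \<le> C" using coord(2) by blast
 have "japanese x^n * norm (of_real (x $ i) * f x) \<le> C" for x
 proof (rule order_trans[OF _ C[of x]])
  have "japanese x^n*(\<bar>x $ i\<bar> * norm (f x)) \<le> japanese x^n*(japanese x * norm (f x))"
   using japanese_pos[of x] order_trans[OF component_le_norm_cart japanese_ge_norm[of x]] by (intro mult_left_mono mult_right_mono) auto
  thus "japanese x^n * norm (of_real (x $ i) * f x) \<le> japanese x^Suc n * norm (f x)" by (simp add: norm_mult mult_ac)
 qed
 thus ?case by blast
next
 case (smult f c)
 obtain C where C: "\<And>x. japanese x^n * norm (f x) \<le> C" using smult(2) by blast
 show ?case using mult_left_mono[OF C norm_ge_zero[of c]] by (intro exI[of _ "norm c * C"]) (simp add: norm_mult mult_ac)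
next
 case (add f g)
 obtain C D where "\<And>x. japanese x^n * norm (f x) \<le> C" "\<And>x. japanese x^n * norm (g x) \<le> D" using add(2,4) by meson
 hence "japanese x^n*(norm (f x) + norm (g x)) \<le> C + D" for x by (simp add: distrib_left add_mono)
 hence "japanese x^n * norm (f x + g x) \<le> C + D" for x
  using order_trans[OF mult_left_mono[OF norm_triangle_ineq[of "f x" "g x"]]] japanese_pos[of x] by (meson less_imp_le zero_le_power)
 thus ?case by blast
qed

lemma schwartz_gauss_poly: assumes "gauss_poly a b f" shows "schwartz f"
proof -
 have "gauss_poly a b ((pderiv1 i ^^ n) f)" if "gauss_poly a b f" for i n f
  using that by (induct n) (auto intro: gauss_poly_pderiv1)
 hence gp: "gauss_poly a b (pderivs \<alpha> f)" for \<alpha> unfolding pderivs_def using assms by blast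
 show ?thesis unfolding schwartz_def smooth_def differentiable_on_def
  by (simp add: gauss_poly_diff[OF gp] gauss_poly_decay[OF gp])
qed

lemma schwartz_gau_mod: "schwartz (\<lambda>x. cis (b\<bullet>x) * gau x)"
proof -
 have "cgauss 0 b = (\<lambda>x. cis (b\<bullet>x) * gau x)"
  unfolding cgauss_alt gau_def power2_norm_eq_inner by (simp add: fun_eq_iff mult.commute)
 thus ?thesis using schwartz_gauss_poly[OF gauss_poly.base, of 0 b] by simp
qed

lemma schwartz_gau_shift: "schwartz (\<lambda>x. gau (x - b))"
proof -
 have "(\<lambda>x. of_real (exp (- (b\<bullet>b)/2)) * cgauss b 0 x) = (\<lambda>x. gau (x - b))"
 proof
  fix x :: R3
  have "- (norm (x - b))\<^sup>2/2 = - (b\<bullet>b)/2 + (- (x\<bullet>x)/2 + b\<bullet>x)"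
   by (simp add: power2_norm_eq_inner inner_diff_left inner_diff_right inner_commute field_simps)
  thus "of_real (exp (- (b\<bullet>b)/2)) * cgauss b 0 x = gau (x - b)"
   unfolding gau_def cgauss_alt by (simp only: exp_add of_real_mult) simp
 qed
 thus ?thesis using schwartz_gauss_poly[OF gauss_poly.smult[OF gauss_poly.base], of "of_real (exp (- (b\<bullet>b)/2))" b 0] by simp
qed

section \<open>The distributional Fourier transform\<close>

lemma smooth_continuous: assumes "smooth f" shows "continuous_on UNIV f"
proof -
 have "pderivs 0 f differentiable_on UNIV" using assms by (simp add: smooth_def)
 thus ?thesis by (simp add: pderivs_def differentiable_imp_continuous_on)
qed

text \<open>Six powers of the weight are (1 + |x|^2)^3, which dominates the product of 1 + x_b^2
  over the three coordinates; its reciprocal is integrable as a product of one-dimensional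
  integrals. Boundedness upgrades L^1 to L^2.\<close>

lemma schwartz_L12: assumes "schwartz \<phi>" shows "\<phi> \<in> L12"
proof -
 have cont: "continuous_on UNIV \<phi>" using assms smooth_continuous by (simp add: schwartz_def)
 have m[measurable]: "\<phi> \<in> bmeas" using cont by (rule borel_measurable_continuous_onI)
 obtain C where C: "\<And>x. japanese x^6 * norm (pderivs 0 \<phi> x) \<le> C" using assms unfolding schwartz_def by blast
 hence C: "japanese x^6 * norm (\<phi> x) \<le> C" for x by (simp add: pderivs_def)
 have le: "norm (\<phi> x) \<le> C*(\<Prod>b\<in>Basis. inverse (1 + (x\<bullet>b)^2))" for x
 proof -
  have "(\<Prod>b\<in>(Basis::R3 set). 1 + (x\<bullet>b)^2) \<le> (\<Prod>b\<in>(Basis::R3 set). 1 + (norm x)^2)"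
   by (intro prod_mono) (auto intro!: power2_le_iff_abs_le[THEN iffD2] Basis_le_norm)
  also have "... = (1 + (norm x)^2)^3" by simp
  also have "... = japanese x^6"
   using power_mult[of "japanese x" 2 3] by (simp add: japanese_def)
  finally have 1: "(\<Prod>b\<in>(Basis::R3 set). 1 + (x\<bullet>b)^2) \<le> japanese x^6" .
  have 2: "0 < (\<Prod>b\<in>(Basis::R3 set). 1 + (x\<bullet>b)^2)" by (intro prod_pos) (auto simp: add_pos_nonneg)
  have "(\<Prod>b\<in>(Basis::R3 set). 1 + (x\<bullet>b)^2) * norm (\<phi> x) \<le> C"
   using mult_right_mono[OF 1 norm_ge_zero[of "\<phi> x"]] C[of x] by linarith
  moreover have "(\<Prod>b\<in>(Basis::R3 set). inverse (1 + (x\<bullet>b)^2)) = inverse (\<Prod>b\<in>(Basis::R3 set). 1 + (x\<bullet>b)^2)"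
   using prod_inversef[of "\<lambda>b. 1 + (x\<bullet>b)^2" "Basis::R3 set"] by (simp add: o_def)
  ultimately show ?thesis using 2 by (simp add: field_simps)
 qed
 have "integrable lborel (\<lambda>t::real. inverse (1 + t\<^sup>2))"
  using integrable_inverse_1_plus_square by (simp add: set_integrable_def)
 hence "integrable lborel (\<lambda>t::real. complex_of_real (inverse (1 + t\<^sup>2)))" by (rule integrable_of_real)
 hence "integrable lborel (\<lambda>x::R3. \<Prod>b\<in>Basis. complex_of_real (inverse (1 + (x\<bullet>b)^2)))"
  by (intro R3_product_integral(1))
 hence "integrable lborel (\<lambda>x::R3. of_real C*(\<Prod>b\<in>Basis. complex_of_real (inverse (1 + (x\<bullet>b)^2))))" by (rule integrable_mult_right)
 hence i: "integrable lborel \<phi>"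
 proof (rule Bochner_Integration.integrable_bound)
  have "norm (\<phi> x) \<le> norm (of_real C*(\<Prod>b\<in>Basis. complex_of_real (inverse (1 + (x\<bullet>b)^2))))" for x
   using order_trans[OF le[of x] abs_ge_self] unfolding of_real_prod[symmetric] of_real_mult[symmetric] norm_of_real .
  thus "AE x in lborel. norm (\<phi> x) \<le> norm (of_real C*(\<Prod>b\<in>Basis. complex_of_real (inverse (1 + (x\<bullet>b)^2))))" by simp
 qed measurable
 have C': "norm (\<phi> x) \<le> C" for x
  using C[of x] mult_right_mono[OF one_le_power[OF japanese_ge1[of x], of 6] norm_ge_zero[of "\<phi> x"]] by linarith
 have "integrable lborel (\<lambda>x. C * norm (\<phi> x))" using i by auto
 hence "integrable lborel (\<lambda>x. (norm (\<phi> x))\<^sup>2)"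
  by (rule Bochner_Integration.integrable_bound)
   (use C' in \<open>auto simp: power2_eq_square intro!: AE_I2 order_trans[OF _ abs_ge_self] mult_right_mono\<close>)
 with i show ?thesis by (simp add: L12_def L2_def)
qed

lemma tempered_L2: "f \<in> L2 ==> tempered_function f"
 unfolding tempered_function_def using schwartz_L12 L2_mult_integrable by (auto simp: L12_def L2_def)

lemma is_fourier_L2:
 assumes "f \<in> L2" "g \<in> L2" "Ft (mk f) = mk g" shows "is_fourier f g"
 unfolding is_fourier_def
proof (intro conjI allI impI tempered_L2 assms)
 fix \<phi> assume "schwartz \<phi>"
 hence \<phi>: "\<phi> \<in> L12" by (rule schwartz_L12)
 have "(LBINT \<xi>. g \<xi>*\<phi> \<xi>) = bp (mk g) (mk \<phi>)" using assms \<phi> by (simp add: bp_mk L12D)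
 also have "... = bp (mk f) (mk (fourier_integral \<phi>))" unfolding assms(3)[symmetric] bp_Ft Ft_mk[OF \<phi>] ..
 also have "... = (LBINT x. f x * fourier_integral \<phi> x)" using assms \<phi> by (simp add: bp_mk L12_fourier)
 finally show "(LBINT \<xi>. g \<xi>*\<phi> \<xi>) = (LBINT x. f x * fourier_integral \<phi> x)" .
qed

lemma tempered_integrable: "tempered_function f ==> schwartz \<phi> ==> integrable lborel (\<lambda>x. f x*\<phi> x)"
 by (simp add: tempered_function_def)

lemma is_fourier_unique:
 assumes "is_fourier f g" "is_fourier f g'" shows "AE x in lborel. g x = g' x"
proof -
 note i = tempered_integrable[OF _ schwartz_gau_mod]
 have t: "tempered_function g" "tempered_function g'" using assms by (auto simp: is_fourier_def)
 have "AE x in lborel. g x - g' x = 0"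
 proof (rule tempered_gauss_inj)
  show "integrable lborel (\<lambda>x. (g x - g' x) * gau x)" using i[of _ 0] t by (simp add: left_diff_distrib)
  show "(LBINT x. (g x - g' x)*(cis (b\<bullet>x) * gau x)) = 0" for b
   using assms schwartz_gau_mod[of b] i[OF t(1), of b] i[OF t(2), of b]
   by (simp add: left_diff_distrib is_fourier_def)
 qed
 thus ?thesis by simp
qed

lemma is_fourierD:
 "is_fourier f g ==> schwartz \<phi> ==> (LBINT x. f x * fourier_integral \<phi> x) = (LBINT \<xi>. g \<xi>*\<phi> \<xi>)"
 by (simp add: is_fourier_def)

lemma fourier_gau_shift: "fourier_integral (\<lambda>x. gau (x - b)) = (\<lambda>x. cis ((- b)\<bullet>x) * gau x)"
 by (intro ext) (simp add: fourier_integral_translate fourier_gau)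
lemma fourier_gau_mod: "fourier_integral (\<lambda>x. cis (b\<bullet>x) * gau x) = (\<lambda>x. gau (x - b))"
 by (intro ext) (simp add: fourier_integral_modulate fourier_gau)

text \<open>The test functions must have known transforms: translated Gaussians are used, because
  they are carried to the modulated Gaussians that separate.\<close>

lemma is_fourier_inj:
 assumes "is_fourier f g" "is_fourier f' g" shows "AE x in lborel. f x = f' x"
proof -
 note i = tempered_integrable[OF _ schwartz_gau_mod]
 have t: "tempered_function f" "tempered_function f'" using assms by (auto simp: is_fourier_def)
 have "AE x in lborel. f x - f' x = 0"
 proof (rule tempered_gauss_inj)
  show "integrable lborel (\<lambda>x. (f x - f' x) * gau x)" using i[of _ 0] t by (simp add: left_diff_distrib)
  fix b
  have "(LBINT x. f x * fourier_integral (\<lambda>x. gau (x - (- b))) x) = (LBINT x. f' x * fourier_integral (\<lambda>x. gau (x - (- b))) x)"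
   using is_fourierD[OF assms(1) schwartz_gau_shift[of "- b"]] is_fourierD[OF assms(2) schwartz_gau_shift[of "- b"]]
   by (simp only:)
  thus "(LBINT x. (f x - f' x)*(cis (b\<bullet>x) * gau x)) = 0"
   unfolding fourier_gau_shift using i[OF t(1), of b] i[OF t(2), of b] by (simp add: left_diff_distrib)
 qed
 thus ?thesis by simp
qed

text \<open>The Plancherel transform is a witness for the choice in \<open>fourier\<close>, and by
  uniqueness any other choice differs from it only on a null set. From here on the operators of the
  statement can be computed with \<open>Ft\<close>.\<close>

lemma fourier_L2: assumes "f \<in> L2" shows "fourier f \<in> L2" "mk (fourier f) = Ft (mk f)"
proof -
 have ex: "is_fourier f (rep (Ft (mk f)))" by (rule is_fourier_L2) (use assms in auto)
 hence F: "is_fourier f (fourier f)" unfolding fourier_def by (rule someI[of "is_fourier f"])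
 have ae: "AE x in lborel. rep (Ft (mk f)) x = fourier f x" by (rule is_fourier_unique[OF ex F])
 have m: "fourier f \<in> bmeas" using F by (simp add: is_fourier_def tempered_function_def)
 show "fourier f \<in> L2" by (rule L2_cong_AE[OF rep_L2 m ae])
 show "mk (fourier f) = Ft (mk f)" using mk_eqI[OF rep_L2 m ae] by simp
qed

lemma inv_fourier_L2: assumes "g \<in> L2" shows "inv_fourier g \<in> L2" "mk (inv_fourier g) = Fi (mk g)"
proof -
 have ex: "is_fourier (rep (Fi (mk g))) g" by (rule is_fourier_L2) (use assms in auto)
 hence F: "is_fourier (inv_fourier g) g" unfolding inv_fourier_def by (rule someI[of "\<lambda>f. is_fourier f g"])
 have ae: "AE x in lborel. rep (Fi (mk g)) x = inv_fourier g x" by (rule is_fourier_inj[OF ex F])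
 have m: "inv_fourier g \<in> bmeas" using F by (simp add: is_fourier_def tempered_function_def)
 show "inv_fourier g \<in> L2" by (rule L2_cong_AE[OF rep_L2 m ae])
 show "mk (inv_fourier g) = Fi (mk g)" using mk_eqI[OF rep_L2 m ae] by simp
qed

lemma fourier_multiplier_L2:
 assumes "bm m" "f \<in> L2"
 shows "fourier_multiplier m f \<in> L2" "mk (fourier_multiplier m f) = Fi (Mul m (Ft (mk f)))"
 using assms fourier_L2[OF assms(2)] bm_mult_L2[OF assms(1) fourier_L2(1)[OF assms(2)]]
 by (auto simp: fourier_multiplier_def inv_fourier_L2 Mul_mk[symmetric])

text \<open>Fourier inversion when the distributional transform is integrable: both sides have equal
  pairings with modulated Gaussians. The argument is -x because the forward integral is reused as
  the inverse one.\<close>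

lemma is_fourier_L1:
 assumes F: "is_fourier f g" and g: "integrable lborel g"
 shows "AE x in lborel. f x = fourier_integral g (- x)"
proof -
 note i = tempered_integrable[OF _ schwartz_gau_mod]
 have t: "tempered_function f" using F by (auto simp: is_fourier_def)
 have [measurable]: "g \<in> bmeas" using g by auto
 have mG[measurable]: "(\<lambda>x. fourier_integral g (- x)) \<in> bmeas" by measurable
 have i2: "integrable lborel (\<lambda>x. fourier_integral g (- x)*(cis (b\<bullet>x) * gau x))" for b
 proof (rule Bochner_Integration.integrable_bound)
  show "integrable lborel (\<lambda>x. (c0*(LBINT x. norm (g x))) * norm (gau x))" using gau_integrable by auto
  show "AE x in lborel. norm (fourier_integral g (- x)*(cis (b\<bullet>x) * gau x)) \<le> norm ((c0*(LBINT x. norm (g x))) * norm (gau x))"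
   using norm_fourier_integral_le[of g] by (auto simp: norm_mult intro!: AE_I2 order_trans[OF _ abs_ge_self] mult_right_mono)
 qed measurable
 have "AE x in lborel. f x - fourier_integral g (- x) = 0"
 proof (rule tempered_gauss_inj)
  show "integrable lborel (\<lambda>x. (f x - fourier_integral g (- x)) * gau x)" using i[OF t, of 0] i2[of 0] by (simp add: left_diff_distrib)
  fix b
  have "(LBINT x. f x*(cis (b\<bullet>x) * gau x)) = (LBINT x. f x * fourier_integral (\<lambda>x. gau (x - (- b))) x)"
   unfolding fourier_gau_shift by simp
  also have "... = (LBINT x. g x * gau (x - (- b)))"
   by (rule is_fourierD[OF F schwartz_gau_shift])
  also have "... = (LBINT x. g x * fourier_integral (\<lambda>x. cis ((- b)\<bullet>x) * gau x) x)" unfolding fourier_gau_mod ..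
  also have "... = (LBINT x. fourier_integral g x*(cis ((- b)\<bullet>x) * gau x))"
   by (rule fourier_multiplication_formula[symmetric, OF g L12D(2)[OF gau_mod_L12]])
  also have "... = (LBINT x. fourier_integral g (- x)*(cis (b\<bullet>x) * gau x))"
   by (subst lborel_reflect_R3(1)[symmetric]) (simp add: gau_def)
  finally have "(LBINT x. f x*(cis (b\<bullet>x) * gau x)) = (LBINT x. fourier_integral g (- x)*(cis (b\<bullet>x) * gau x))" .
  thus "(LBINT x. (f x - fourier_integral g (- x))*(cis (b\<bullet>x) * gau x)) = 0"
   using i[OF t, of b] i2[of b] by (simp add: left_diff_distrib)
 qed
 thus ?thesis by simp
qed

section \<open>Test functions\<close>

lemma has_vector_derivative_iff_quotient:
 "(f has_vector_derivative d) (at s within S) \<longleftrightarrow> ((\<lambda>t. (f t - f s) /\<^sub>R (t - s)) \<longlongrightarrow> d) (at s within S)"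
proof -
 have eq: "norm (f t - f s - (t - s) *\<^sub>R d)/norm (t - s) = norm ((f t - f s) /\<^sub>R (t - s) - d)" if "t \<noteq> s" for t
 proof -
  have "(f t - f s) /\<^sub>R (t - s) - d = (f t - f s - (t - s) *\<^sub>R d) /\<^sub>R (t - s)" using that by (simp add: scaleR_diff_right)
  thus ?thesis by (simp add: divide_inverse_commute)
 qed
 have "(f has_vector_derivative d) (at s within S) \<longleftrightarrow> ((\<lambda>t. norm (f t - f s - (t - s) *\<^sub>R d)/norm (t - s)) \<longlongrightarrow> 0) (at s within S)"
  unfolding has_vector_derivative_def has_derivative_iff_norm by (simp add: bounded_linear_scaleR_left)
 also have "... \<longleftrightarrow> ((\<lambda>t. norm ((f t - f s) /\<^sub>R (t - s) - d)) \<longlongrightarrow> 0) (at s within S)"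
  by (rule tendsto_cong) (use eq in \<open>auto simp: eventually_at_filter\<close>)
 finally show ?thesis by (simp only: tendsto_norm_zero_iff LIM_zero_iff)
qed

section \<open>Smooth functions that vanish on a half line, and the bumps built from them\<close>

definition bf :: "real poly => real => real" where
 "bf P s = (if s > 0 then poly P (1/s) * exp (- (1/s)) else 0)"

lemma poly_over_exp_tendsto_0: "((\<lambda>u. poly P u * exp (- u)) \<longlongrightarrow> (0::real)) at_top"
proof -
 have "((\<lambda>u. u^k*(poly P u * exp (- u))) \<longlongrightarrow> (0::real)) at_top" for k
 proof (induct P arbitrary: k)
  case (pCons a P)
  have "((\<lambda>u. a*(u^k/exp u) + u^Suc k*(poly P u * exp (- u))) \<longlongrightarrow> a*0 + 0) at_top"
   by (intro tendsto_intros tendsto_power_div_exp_0 pCons)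
  thus ?case by (simp add: exp_minus field_simps)
 qed simp
 from this[of 0] show ?thesis by simp
qed

lemma bf_tendsto_0: "((\<lambda>s. bf P s) \<longlongrightarrow> 0) (at_right 0)"
proof -
 have "filterlim (\<lambda>s::real. 1/s) at_top (at_right 0)"
  using filterlim_inverse_at_top_right by (simp add: inverse_eq_divide)
 note l = filterlim_compose[OF poly_over_exp_tendsto_0 this, of P]
 show ?thesis
 proof (rule tendsto_cong[THEN iffD1, OF _ l])
  show "\<forall>\<^sub>F s in at_right 0. poly P (1/s) * exp (- (1/s)) = bf P s"
   using eventually_at_right_less[of 0] by eventually_elim (simp add: bf_def)
 qed
qed

text \<open>In r = 1/s the derivative d/ds is -r^2 d/dr, and it sends P(r) e^(-r) to r^2 (P - P')(r)
  e^(-r).\<close>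

definition bfD :: "real poly => real poly" where "bfD P = [:0, 0, 1:]*(P - pderiv P)"

lemma bf_deriv: "(bf P has_real_derivative bf (bfD P) s) (at s)"
proof -
 consider "s > 0" | "s < 0" | "s = 0" by linarith
 thus ?thesis
 proof cases
  case 1
  have "((\<lambda>s. poly P (1/s) * exp (- (1/s))) has_real_derivative bf (bfD P) s) (at s)"
   using 1 by (auto intro!: derivative_eq_intros DERIV_chain2[OF poly_DERIV] simp: bf_def bfD_def power2_eq_square field_simps)
  thus ?thesis
   by (rule has_field_derivative_transform_within_open[where S="{0<..}"]) (use 1 in \<open>auto simp: bf_def\<close>)
 next
  case 2
  have "((\<lambda>s. 0) has_real_derivative bf (bfD P) s) (at s)" using 2 by (auto simp: bf_def)
  thus ?thesis
   by (rule has_field_derivative_transform_within_open[where S="{..<0}"]) (use 2 in \<open>auto simp: bf_def\<close>)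
 next
  case 3
  \<comment> \<open>To the right of the corner the difference quotient is again of the form
    \<open>bf\<close>, with polynomial r P(r), so its limit is covered by
    \<open>bf_tendsto_0\<close>.\<close>
  have "((\<lambda>h. bf P h/h) \<longlongrightarrow> 0) (at_right 0)"
  proof (rule tendsto_cong[THEN iffD1, OF _ bf_tendsto_0[of "[:0, 1:] * P"]])
   show "\<forall>\<^sub>F x in at_right 0. bf ([:0, 1:] * P) x = bf P x/x"
    using eventually_at_right_less[of 0] by eventually_elim (simp add: bf_def)
  qed
  moreover have "((\<lambda>h. bf P h/h) \<longlongrightarrow> 0) (at_left 0)"
  proof (rule tendsto_eventually)
   show "\<forall>\<^sub>F x in at_left 0. bf P x/x = 0"
    by (auto simp: eventually_at_filter bf_def)
  qed
  ultimately have "((\<lambda>h. bf P h/h) \<longlongrightarrow> 0) (at 0)" by (simp add: filterlim_split_at)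
  thus ?thesis unfolding has_field_derivative_iff using 3 by (simp add: bf_def)
 qed
qed

text \<open>An algebra of explicit functions closed under partial derivatives. Smoothness and the
  commutation of partial derivatives are proved on it by structural induction.\<close>

inductive bumpf :: "(R3 => complex) => bool" where
 const: "bumpf (\<lambda>x. c)"
| base: "bumpf (\<lambda>x. of_real (bf P (c * x $ i + d)))"
| add: "bumpf f ==> bumpf g ==> bumpf (\<lambda>x. f x + g x)"
| mult: "bumpf f ==> bumpf g ==> bumpf (\<lambda>x. f x * g x)"

lemma base_derivative:
 "((\<lambda>x::R3. complex_of_real (bf P (c * x $ i + d))) has_derivative (\<lambda>h. of_real (bf (bfD P) (c * x $ i + d)*(c * h $ i)))) (at x)"
proof (rule has_derivative_of_real)
 have "((\<lambda>x::R3. c * x $ i + d) has_derivative (\<lambda>h. c * h $ i)) (at x)"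
  by (auto intro!: derivative_eq_intros bounded_linear_imp_has_derivative bounded_linear_vec_nth)
 from has_derivative_compose[OF this bf_deriv[unfolded has_field_derivative_def]]
 show "((\<lambda>x::R3. bf P (c * x $ i + d)) has_derivative (\<lambda>h. bf (bfD P) (c * x $ i + d)*(c * h $ i))) (at x)"
  by simp
qed

lemma bumpf_diff: "bumpf f ==> f differentiable (at x)"
proof (induct rule: bumpf.induct)
 case (base P c i d) thus ?case using base_derivative differentiable_def by blast
qed (auto intro: derivative_intros)

lemma pderiv1_const: "pderiv1 i (\<lambda>x. c) = (\<lambda>x. 0)"
 by (intro ext, subst pderiv1_eq[OF has_derivative_const]) simp

lemma pderiv1_base: "pderiv1 i (\<lambda>x. of_real (bf P (c * x $ j + d))) = (\<lambda>x. of_real (if i = j then c else 0) * of_real (bf (bfD P) (c * x $ j + d)))"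
 by (intro ext, subst pderiv1_eq[OF base_derivative]) (simp add: axis_def)

lemma bumpf_pderiv1_add: "bumpf f ==> bumpf g ==> pderiv1 i (\<lambda>x. f x + g x) = (\<lambda>x. pderiv1 i f x + pderiv1 i g x)"
 by (intro ext pderiv1_add bumpf_diff)
lemma bumpf_pderiv1_mult: "bumpf f ==> bumpf g ==> pderiv1 i (\<lambda>x. f x * g x) = (\<lambda>x. pderiv1 i f x * g x + f x * pderiv1 i g x)"
 by (intro ext pderiv1_mult bumpf_diff)

lemma bumpf_pderiv1: "bumpf f ==> bumpf (pderiv1 i f)"
proof (induct rule: bumpf.induct)
 case (const c) thus ?case by (simp add: pderiv1_const bumpf.const)
next
 case (base P c j d) thus ?case unfolding pderiv1_base by (intro bumpf.intros)
next
 case (add f g) thus ?case by (simp add: bumpf_pderiv1_add bumpf.add)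
next
 case (mult f g) thus ?case by (simp add: bumpf_pderiv1_mult bumpf.add bumpf.mult)
qed

lemma bumpf_commute: "bumpf f ==> pderiv1 i (pderiv1 j f) = pderiv1 j (pderiv1 i f)"
proof (induct rule: bumpf.induct)
 case (const c) thus ?case by (simp add: pderiv1_const)
next
 case (base P c k d)
 thus ?case unfolding pderiv1_base
  by (simp add: bumpf_pderiv1_mult[OF bumpf.const bumpf.base] pderiv1_const pderiv1_base mult_ac)
next
 case (add f g) thus ?case by (simp add: bumpf_pderiv1_add bumpf_pderiv1)
next
 case (mult f g) thus ?case
  by (simp add: bumpf_pderiv1_add bumpf_pderiv1_mult bumpf_pderiv1 bumpf.mult algebra_simps)
qed

lemma bumpf_pow: "bumpf f ==> bumpf ((pderiv1 i ^^ n) f)"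
 by (induct n) (auto intro: bumpf_pderiv1)

lemma bumpf_pow_commute: "bumpf f ==> (pderiv1 i ^^ n) (pderiv1 j f) = pderiv1 j ((pderiv1 i ^^ n) f)"
 by (induct n) (auto simp: bumpf_pow bumpf_commute[of _ i j])

lemma bumpf_pderivs: "bumpf f ==> bumpf (pderivs \<alpha> f)"
 unfolding pderivs_def by (intro bumpf_pow)

lemma bumpf_smooth: "bumpf f ==> smooth f"
 unfolding smooth_def differentiable_on_def using bumpf_diff[OF bumpf_pderivs] by auto

text \<open>\<open>pderivs\<close> composes the partial derivatives in a fixed order, so an
  additional derivative applied first has to be commuted to its place; symmetry of mixed derivatives
  enters here.\<close>

lemma bumpf_pderivs_Suc:
 assumes "bumpf f" shows "pderivs \<alpha> (pderiv1 k f) = pderivs (\<alpha> + axis k 1) f"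
proof -
 have "k = 1 \<or> k = 2 \<or> k = 3" using UNIV_3 by (metis UNIV_I empty_iff insert_iff)
 thus ?thesis unfolding pderivs_def
  using assms by (auto simp: axis_def bumpf_pow_commute bumpf_pow)
qed

text \<open>Each coordinate factor is positive exactly for |x_i| < 1, so the bump is nonnegative and
  lives on the cube of half side 1.\<close>

definition bump :: "R3 => complex" where
 "bump x = (\<Prod>i\<in>UNIV. of_real (bf 1 (1 * x $ i + 1)) * of_real (bf 1 ((-1) * x $ i + 1)))"

text \<open>The scale \<open>l\<close> is an inverse width: large \<open>l\<close> concentrates the
  bump at \<open>b\<close>.\<close>

definition bumpl :: "real => R3 => R3 => complex" where "bumpl l b x = bump (l *\<^sub>R (x - b))"

lemma bumpf_bumpl: "bumpf (bumpl l b)"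
proof -
 define F where "F i x = complex_of_real (bf 1 (l * x $ i + (1 - l * b $ i))) * complex_of_real (bf 1 ((- l) * x $ i + (1 + l * b $ i)))"
  for i :: 3 and x :: R3
 have a: "1*(l *\<^sub>R (x - b)) $ i + 1 = l * x $ i + (1 - l * b $ i)"
  "(-1)*(l *\<^sub>R (x - b)) $ i + 1 = (- l) * x $ i + (1 + l * b $ i)" for i x by (simp_all add: algebra_simps)
 have "bumpl l b x = F 1 x*(F 2 x * F 3 x)" for x
  unfolding bumpl_def bump_def F_def[symmetric] a UNIV_3 by (simp add: mult.assoc)
 hence "bumpl l b = (\<lambda>x. F 1 x*(F 2 x * F 3 x))" by (rule ext)
 moreover have "bumpf (F i)" for i unfolding F_def[abs_def] by (intro bumpf.intros)
 ultimately show ?thesis by (simp only:) (intro bumpf.mult, auto)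
qed

lemma bump_support: "bump x \<noteq> 0 ==> norm x \<le> 3"
proof -
 assume "bump x \<noteq> 0"
 hence nz: "bf 1 (1 * x $ i + 1) \<noteq> 0 \<and> bf 1 ((-1) * x $ i + 1) \<noteq> 0" for i by (simp add: bump_def)
 have "\<bar>x $ i\<bar> \<le> 1" for i using nz[of i] unfolding bf_def by (simp split: if_splits)
 hence "(\<Sum>i\<in>UNIV. \<bar>x $ i\<bar>) \<le> (\<Sum>i\<in>(UNIV::3 set). 1)" by (intro sum_mono)
 thus ?thesis using norm_le_l1_cart[of x] by simp
qed

lemma bump_pos: "bump x = of_real (norm (bump x))" "bump 0 \<noteq> 0"
proof -
 define r where "r = (\<Prod>i\<in>UNIV. bf 1 (1 * x $ i + 1) * bf 1 ((-1) * x $ i + 1))"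
 have "bump x = of_real r" by (simp add: bump_def r_def)
 moreover have "r \<ge> 0" unfolding r_def by (intro prod_nonneg) (simp add: bf_def)
 ultimately show "bump x = of_real (norm (bump x))" by simp
 show "bump 0 \<noteq> 0" by (simp add: bump_def bf_def)
qed

lemma bumpl_support: assumes "l > 0" shows "bounded {x. bumpl l b x \<noteq> 0}"
proof (rule bounded_subset[OF bounded_cball[of b "3/l"]], safe)
 fix x assume "bumpl l b x \<noteq> 0"
 hence "norm (l *\<^sub>R (x - b)) \<le> 3" unfolding bumpl_def by (rule bump_support)
 hence "l * norm (x - b) \<le> 3" unfolding norm_scaleR abs_of_pos[OF assms] .
 hence "norm (b - x) \<le> 3/l" using assms by (simp only: norm_minus_commute[of b] pos_le_divide_eq mult.commute)
 thus "x \<in> cball b (3/l)" by (simp add: dist_norm)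
qed

lemma test_function_bumpl: "l > 0 ==> test_function (bumpl l b)"
 by (simp add: test_function_def bumpf_smooth[OF bumpf_bumpl] bumpl_support)

lemma bumpf_continuous: "bumpf f ==> continuous_on UNIV f"
 using bumpf_smooth smooth_continuous by blast

subsection \<open>Integration by parts\<close>

definition C1c :: "3 => (R3 => complex) => bool" where
 "C1c k f \<longleftrightarrow> (\<forall>x. f differentiable (at x)) \<and> continuous_on UNIV (pderiv1 k f) \<and> bounded {x. f x \<noteq> 0}"

lemma pderiv1_support: "{x. pderiv1 k f x \<noteq> 0} \<subseteq> closure {x. f x \<noteq> 0}"
proof safe
 fix x assume nz: "pderiv1 k f x \<noteq> 0"
 show "x \<in> closure {x. f x \<noteq> 0}"
 proof (rule ccontr)
  assume "x \<notin> closure {x. f x \<noteq> 0}"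
  hence x: "x \<in> - closure {x. f x \<noteq> 0}" by simp
  have "((\<lambda>x. 0::complex) has_derivative (\<lambda>h. 0)) (at x)" by simp
  hence "(f has_derivative (\<lambda>h. 0)) (at x)"
  proof (rule has_derivative_transform_within_open[where s="- closure {x. f x \<noteq> 0}"])
   show "0 = f y" if "y \<in> - closure {x. f x \<noteq> 0}" for y
    using that closure_subset[of "{x. f x \<noteq> 0}"] by (cases "f y = 0") auto
  qed (use x in auto)
  from pderiv1_eq[OF this] nz show False by simp
 qed
qed

lemma pderiv1_support_bounded: "bounded {x. f x \<noteq> 0} ==> bounded {x. pderiv1 k f x \<noteq> 0}"
 by (rule bounded_subset[OF bounded_closure pderiv1_support])

lemma cont_bsupp_bounded:
 fixes f :: "R3 => complex"
 assumes "continuous_on UNIV f" "bounded {x. f x \<noteq> 0}"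
 obtains B where "B \<ge> 0" "\<forall>x. norm (f x) \<le> B"
proof -
 have "compact (closure {x. f x \<noteq> 0})" using assms(2) by (simp add: compact_closure)
 hence "compact (f ` closure {x. f x \<noteq> 0})" using assms(1) compact_continuous_image continuous_on_subset by blast
 then obtain B where B: "\<And>y. y \<in> f ` closure {x. f x \<noteq> 0} ==> norm y \<le> B"
  using compact_imp_bounded bounded_iff by metis
 have "norm (f x) \<le> max B 0" for x
 proof (cases "f x = 0")
  case False
  hence "x \<in> closure {x. f x \<noteq> 0}" using closure_subset[of "{x. f x \<noteq> 0}"] by auto
  thus ?thesis using B by (simp add: max.coboundedI1)
 qed simp
 thus thesis using that[of "max B 0"] by simp
qed

lemma cont_bsupp_integrable:
 fixes f :: "R3 => complex"
 assumes c: "continuous_on UNIV f" and b: "bounded {x. f x \<noteq> 0}"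
 shows "integrable lborel f"
proof -
 have [measurable]: "f \<in> bmeas" using c by (rule borel_measurable_continuous_onI)
 obtain B where B: "\<forall>x. norm (f x) \<le> B" using cont_bsupp_bounded[OF assms] by blast
 obtain R where R: "\<And>x. f x \<noteq> 0 ==> norm x \<le> R" using b unfolding bounded_iff by auto
 have "integrable lborel (indicator (cball (0::R3) R) :: R3 => real)"
  using emeasure_lborel_cball_finite[of "0::R3" R] by (subst integrable_indicator_iff) auto
 hence "integrable lborel (\<lambda>x::R3. B * indicator (cball 0 R) x)" by (rule integrable_mult_right)
 thus ?thesis
 proof (rule Bochner_Integration.integrable_bound)
  have "norm (f x) \<le> norm (B * indicator (cball 0 R) x)" for x
   using R[of x] B[rule_format, of x] by (cases "f x = 0") (auto simp: indicator_def)
  thus "AE x in lborel. norm (f x) \<le> norm (B * indicator (cball 0 R) x)" by simp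
 qed measurable
qed

text \<open>Differentiation under the integral for translates of a compactly supported function
  against a merely continuous weight. A constant weight yields integration by parts, a general one
  yields constancy of functions with vanishing weak gradient.\<close>

lemma translate_integral_derivative:
 assumes f: "C1c k f" and w: "continuous_on UNIV (w :: R3 => complex)"
 shows "((\<lambda>s. LBINT x. w x * f (x + s *\<^sub>R axis k 1)) has_vector_derivative (LBINT x. w x * pderiv1 k f (x + s *\<^sub>R axis k 1))) (at s)"
proof -
 let ?e = "axis k (1::real) :: R3"
 have diff: "f differentiable (at x)" for x using f by (simp add: C1c_def)
 have fc: "continuous_on UNIV f" using diff by (simp add: differentiable_imp_continuous_within continuous_at_imp_continuous_on)
 have gc: "continuous_on UNIV (pderiv1 k f)" and fb: "bounded {x. f x \<noteq> 0}" using f by (auto simp: C1c_def)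
 have [measurable]: "f \<in> bmeas" "w \<in> bmeas" "pderiv1 k f \<in> bmeas"
  using fc w gc by (auto intro: borel_measurable_continuous_onI)
 have line: "((\<lambda>s. f (x + s *\<^sub>R ?e)) has_vector_derivative pderiv1 k f (x + s *\<^sub>R ?e)) (at s)" for x s
 proof -
  have 1: "((\<lambda>s. x + s *\<^sub>R ?e) has_derivative (\<lambda>h. h *\<^sub>R ?e)) (at s)" by (auto intro!: derivative_eq_intros)
  have 2: "(f has_derivative frechet_derivative f (at (x + s *\<^sub>R ?e))) (at (x + s *\<^sub>R ?e))"
   using diff by (simp add: frechet_derivative_works)
  have "frechet_derivative f (at (x + s *\<^sub>R ?e)) (h *\<^sub>R ?e) = h *\<^sub>R pderiv1 k f (x + s *\<^sub>R ?e)" for h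
   unfolding pderiv1_def using 2 by (simp add: linear_scale[OF has_derivative_linear])
  thus ?thesis using has_derivative_compose[OF 1 2] by (simp add: has_vector_derivative_def)
 qed
 have "bounded ({x. f x \<noteq> 0} \<union> {x. pderiv1 k f x \<noteq> 0})" using fb pderiv1_support_bounded by simp
 then obtain R where R: "\<And>x. f x \<noteq> 0 ==> norm x \<le> R" "\<And>x. pderiv1 k f x \<noteq> 0 ==> norm x \<le> R" unfolding bounded_iff by auto
 \<comment> \<open>While the parameter stays within distance 1 of \<open>s\<close>, the translated
   supports remain in this fixed box, so the Leibniz rule on a compact box applies.\<close>
 obtain c where c: "cball (0::R3) (R + \<bar>s\<bar> + 1) \<subseteq> cbox (- c) c" using bounded_subset_cbox_symmetric bounded_cball by blast
 let ?U = "{s - 1..s + 1}"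
 have key: "((\<lambda>x. w x * g (x + t *\<^sub>R ?e)) has_integral (LBINT x. w x * g (x + t *\<^sub>R ?e))) (cbox (- c) c)"
  if g: "continuous_on UNIV g" "\<And>x. g x \<noteq> 0 ==> norm x \<le> R" and t: "t \<in> ?U" for g t
 proof -
  have z: "x \<in> cbox (- c) c" if "w x * g (x + t *\<^sub>R ?e) \<noteq> 0" for x
  proof -
   have "norm x \<le> norm (x + t *\<^sub>R ?e) + \<bar>t\<bar>" using norm_triangle_ineq4[of "x + t *\<^sub>R ?e" "t *\<^sub>R ?e"] by simp
   thus ?thesis using c g(2)[of "x + t *\<^sub>R ?e"] that t by (auto intro!: subsetD[OF c])
  qed
  have "continuous_on UNIV (\<lambda>x. w x * g (x + t *\<^sub>R ?e))" by (intro continuous_intros w continuous_on_compose2[OF g(1)]) auto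
  moreover have "bounded {x. w x * g (x + t *\<^sub>R ?e) \<noteq> 0}" by (rule bounded_subset[OF bounded_cbox[of "- c" c]]) (use z in auto)
  ultimately have "((\<lambda>x. w x * g (x + t *\<^sub>R ?e)) has_integral (LBINT x. w x * g (x + t *\<^sub>R ?e))) UNIV"
   by (intro has_integral_integral_lborel cont_bsupp_integrable)
  moreover have "(\<lambda>x. if x \<in> cbox (- c) c then w x * g (x + t *\<^sub>R ?e) else 0) = (\<lambda>x. w x * g (x + t *\<^sub>R ?e))"
  proof
   fix x
   have "x \<notin> cbox (- c) c ==> w x * g (x + t *\<^sub>R ?e) = 0" using z by blast
   thus "(if x \<in> cbox (- c) c then w x * g (x + t *\<^sub>R ?e) else 0) = w x * g (x + t *\<^sub>R ?e)" by (cases "x \<in> cbox (- c) c") auto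
  qed
  ultimately have "((\<lambda>x. if x \<in> cbox (- c) c then w x * g (x + t *\<^sub>R ?e) else 0) has_integral (LBINT x. w x * g (x + t *\<^sub>R ?e))) UNIV" by (simp only:)
  thus ?thesis unfolding has_integral_restrict_UNIV .
 qed
 have "((\<lambda>t. integral (cbox (- c) c) (\<lambda>x. w x * f (x + t *\<^sub>R ?e))) has_vector_derivative
   integral (cbox (- c) c) (\<lambda>x. w x * pderiv1 k f (x + s *\<^sub>R ?e))) (at s within ?U)"
 proof (rule leibniz_rule_vector_derivative[where f="\<lambda>t x. w x * f (x + t *\<^sub>R ?e)" and fx="\<lambda>t x. w x * pderiv1 k f (x + t *\<^sub>R ?e)"])
  show "((\<lambda>t. w x * f (x + t *\<^sub>R ?e)) has_vector_derivative w x * pderiv1 k f (x + t *\<^sub>R ?e)) (at t within ?U)" for x t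
   by (rule has_vector_derivative_mult_right[OF has_vector_derivative_at_within[OF line]])
  show "continuous_on (?U \<times> cbox (- c) c) (\<lambda>(t, x). w x * pderiv1 k f (x + t *\<^sub>R ?e))"
   unfolding case_prod_beta
  proof (rule continuous_on_mult)
   show "continuous_on (?U \<times> cbox (- c) c) (\<lambda>p. w (snd p))"
    by (rule continuous_on_compose2[OF w]) (auto intro: continuous_intros)
   show "continuous_on (?U \<times> cbox (- c) c) (\<lambda>p. pderiv1 k f (snd p + fst p *\<^sub>R ?e))"
    by (rule continuous_on_compose2[OF gc]) (auto intro!: continuous_intros)
  qed
  show "(\<lambda>x. w x * f (x + t *\<^sub>R ?e)) integrable_on cbox (- c) c" if "t \<in> ?U" for t
   by (rule has_integral_integrable[OF key[OF fc R(1) that]])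
 qed auto
 hence "((\<lambda>t. LBINT x. w x * f (x + t *\<^sub>R ?e)) has_vector_derivative (LBINT x. w x * pderiv1 k f (x + s *\<^sub>R ?e))) (at s within ?U)"
  by (rule has_vector_derivative_transform[rotated 2, THEN has_vector_derivative_eq_rhs])
   (simp_all add: integral_unique[OF key[OF fc R(1)]] integral_unique[OF key[OF gc R(2)]])
 thus ?thesis using at_within_interior[of s ?U] by simp
qed

lemma C1c_continuous: "C1c k f ==> continuous_on UNIV f"
 by (simp add: C1c_def differentiable_imp_continuous_within continuous_at_imp_continuous_on)

lemma C1c_integrable: "C1c k f ==> integrable lborel f" "C1c k f ==> integrable lborel (pderiv1 k f)"
 using C1c_continuous pderiv1_support_bounded by (auto intro!: cont_bsupp_integrable simp: C1c_def)

text \<open>The integral of a translate does not depend on the translation, so its derivative in the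
  shift, which is the integral of the partial derivative, is zero.\<close>

lemma integral_pderiv1_0: assumes "C1c k f" shows "(LBINT x. pderiv1 k f x) = 0"
proof -
 have c: "(LBINT x. 1 * f (x + s *\<^sub>R axis k 1)) = (LBINT x. f x)" for s
  using lborel_shift_R3(1)[of f "s *\<^sub>R axis k 1"] by simp
 have "((\<lambda>s. LBINT x. 1 * f (x + s *\<^sub>R axis k 1)) has_vector_derivative (LBINT x. 1 * pderiv1 k f (x + 0 *\<^sub>R axis k 1))) (at 0)"
  by (rule translate_integral_derivative[OF assms]) auto
 hence "((\<lambda>s::real. LBINT x. f x) has_vector_derivative (LBINT x. pderiv1 k f x)) (at 0)"
  unfolding c by simp
 thus ?thesis using vector_derivative_unique_at[OF _ has_vector_derivative_const] by blast
qed

section \<open>Transforms of compactly supported functions\<close>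

lemma cis_derivative:
 "((\<lambda>x. cis (\<eta>\<bullet>x)) has_derivative (\<lambda>h. \<i> * of_real (\<eta>\<bullet>h) * cis (\<eta>\<bullet>x))) (at (x::R3))"
proof -
 have "((\<lambda>x. complex_of_real (\<eta>\<bullet>x)) has_derivative (\<lambda>h. complex_of_real (\<eta>\<bullet>h))) (at x)"
  by (rule has_derivative_of_real) (auto intro!: derivative_eq_intros)
 hence "((\<lambda>x. \<i> * complex_of_real (\<eta>\<bullet>x)) has_derivative (\<lambda>h. \<i> * complex_of_real (\<eta>\<bullet>h))) (at x)"
  by (rule has_derivative_mult_right)
 from has_derivative_compose[OF this DERIV_exp[unfolded has_field_derivative_def]]
 show ?thesis by (simp add: cis_conv_exp mult_ac)
qed

lemma cis_pderiv1: "pderiv1 k (\<lambda>x. cis (\<eta>\<bullet>x)) x = \<i> * of_real (\<eta> $ k) * cis (\<eta>\<bullet>x)"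
 using pderiv1_eq[OF cis_derivative] by (simp add: inner_axis)

lemma cis_differentiable: "(\<lambda>x. cis (\<eta>\<bullet>x)) differentiable (at (x::R3))"
 using cis_derivative differentiable_def by blast

text \<open>The inverse transform without its constant \<open>c0\<close>. The positive sign matches
  the plane waves in which the potential will be expanded.\<close>

definition chk :: "(R3 => complex) => R3 => complex" where
 "chk f \<eta> = (LBINT x. cis (\<eta>\<bullet>x) * f x)"

lemma chk_fourier: "fourier_integral f (- \<eta>) = of_real c0 * chk f \<eta>"
 by (simp add: fourier_integral_c0 chk_def inner_commute)

lemma chk_measurable[measurable]:
 assumes [measurable]: "f \<in> bmeas" shows "chk f \<in> bmeas"
 unfolding chk_def by measurable

lemma chk_pderiv1:
 assumes f: "C1c k f" shows "chk (pderiv1 k f) \<eta> = - \<i> * of_real (\<eta> $ k) * chk f \<eta>"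
proof -
 have d: "f differentiable (at x)" for x using f by (simp add: C1c_def)
 have p: "pderiv1 k (\<lambda>x. cis (\<eta>\<bullet>x) * f x) = (\<lambda>x. \<i> * of_real (\<eta> $ k)*(cis (\<eta>\<bullet>x) * f x) + cis (\<eta>\<bullet>x) * pderiv1 k f x)"
  by (intro ext) (simp add: pderiv1_mult[OF cis_differentiable d] cis_pderiv1)
 have fc: "continuous_on UNIV f" and pc: "continuous_on UNIV (pderiv1 k f)"
  using C1c_continuous[OF f] f by (auto simp: C1c_def)
 have cc: "continuous_on UNIV (\<lambda>x::R3. cis (\<eta>\<bullet>x))" by (intro continuous_on_cis continuous_intros)
 have "C1c k (\<lambda>x. cis (\<eta>\<bullet>x) * f x)"
  unfolding C1c_def p
 proof (intro conjI allI)
  show "(\<lambda>x. cis (\<eta>\<bullet>x) * f x) differentiable at x" for x using cis_differentiable d by (rule differentiable_mult)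
  show "continuous_on UNIV (\<lambda>x. \<i> * of_real (\<eta> $ k)*(cis (\<eta>\<bullet>x) * f x) + cis (\<eta>\<bullet>x) * pderiv1 k f x)"
   by (intro continuous_intros cc fc pc)
  show "bounded {x. cis (\<eta>\<bullet>x) * f x \<noteq> 0}" using f by (simp add: C1c_def)
 qed
 from integral_pderiv1_0[OF this] have "(LBINT x. \<i> * of_real (\<eta> $ k)*(cis (\<eta>\<bullet>x) * f x) + cis (\<eta>\<bullet>x) * pderiv1 k f x) = 0"
  unfolding p .
 moreover have "integrable lborel (\<lambda>x. \<i> * of_real (\<eta> $ k)*(cis (\<eta>\<bullet>x) * f x))" "integrable lborel (\<lambda>x. cis (\<eta>\<bullet>x) * pderiv1 k f x)"
  using C1c_integrable[OF f] by (auto intro!: integrable_mult_right integrable_cis_mult)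
 ultimately have "\<i> * of_real (\<eta> $ k) * chk f \<eta> + chk (pderiv1 k f) \<eta> = 0" by (simp add: chk_def)
 from minus_unique[OF this] show ?thesis by simp
qed

lemma C1c_bumpl: "l > 0 ==> C1c k (bumpl l b)"
 unfolding C1c_def using bumpf_bumpl bumpf_diff bumpf_continuous bumpf_pderiv1 bumpl_support by blast

lemma bump_eq_bumpl: "bump = bumpl 1 0" by (simp add: bumpl_def fun_eq_iff)

lemma bump_measurable[measurable]: "bump \<in> bmeas"
 unfolding bump_eq_bumpl by (intro borel_measurable_continuous_onI bumpf_continuous bumpf_bumpl)

lemma bumpl_measurable[measurable]: "bumpl l b \<in> bmeas"
 by (intro borel_measurable_continuous_onI bumpf_continuous bumpf_bumpl)

lemma bump_integrable: "integrable lborel bump"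
 unfolding bump_eq_bumpl using C1c_integrable(1)[OF C1c_bumpl[of 1 0]] by simp

definition bumpI :: real where "bumpI = (LBINT x. norm (bump x))"

lemma integral_bump: "(LBINT x. bump x) = of_real bumpI"
 unfolding bumpI_def by (subst integral_complex_of_real[symmetric]) (simp only: bump_pos(1)[symmetric])

lemma bumpI_pos: "bumpI > 0"
proof -
 have "bumpI \<ge> 0" unfolding bumpI_def by simp
 moreover have "bumpI \<noteq> 0"
 proof
  assume "bumpI = 0"
  have cont: "continuous_on UNIV (\<lambda>x. norm (bump x))"
   unfolding bump_eq_bumpl by (intro continuous_intros bumpf_continuous bumpf_bumpl)
  have "AE x in lborel. norm (bump x) = 0"
   using \<open>bumpI = 0\<close> bump_integrable unfolding bumpI_def by (subst (asm) integral_nonneg_eq_0_iff_AE) auto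
  hence "{x. norm (bump x) \<noteq> 0} \<in> null_sets lborel"
   using AE_iff_null[of lborel "\<lambda>x. norm (bump x) = 0"] by simp
  hence "negligible {x. norm (bump x) \<noteq> 0}" by (simp only: negligible_iff_null_sets null_sets_completionI)
  moreover have "open {x. norm (bump x) \<noteq> 0}" using cont by (intro open_Collect_neq) auto
  ultimately have "{x. norm (bump x) \<noteq> 0} = {}" using open_not_negligible by blast
  thus False using bump_pos(2) by auto
 qed
 ultimately show ?thesis by linarith
qed

lemma bumpl_scaled_integral:
 assumes l: "l > 0"
 shows "(LBINT x. w x * bumpl l b x) = of_real (1/l^3)*(LBINT y. w (b + (1/l) *\<^sub>R y) * bump y)"
proof -
 have "(LBINT x. w x * bumpl l b x) = (1/l)^3 *\<^sub>R (LBINT y. w (b + (1/l) *\<^sub>R y) * bumpl l b (b + (1/l) *\<^sub>R y))"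
  by (rule lborel_scale_R3(1)) (use l in simp)
 moreover have "bumpl l b (b + (1/l) *\<^sub>R y) = bump y" for y using l by (simp add: bumpl_def)
 ultimately show ?thesis by (simp add: scaleR_conv_of_real power_one_over)
qed

lemma chk_bumpl: assumes l: "l > 0" shows "chk (bumpl l b) \<eta> = of_real (1/l^3)*(cis (\<eta>\<bullet>b) * chk bump ((1/l) *\<^sub>R \<eta>))"
proof -
 have "(LBINT y. cis (\<eta>\<bullet>(b + (1/l) *\<^sub>R y)) * bump y) = (LBINT y. cis (\<eta>\<bullet>b)*(cis (((1/l) *\<^sub>R \<eta>)\<bullet>y) * bump y))"
  by (simp add: inner_add_right cis_mult[symmetric] mult_ac)
 thus ?thesis unfolding chk_def using bumpl_scaled_integral[OF l, of "\<lambda>x. cis (\<eta>\<bullet>x)" b] by simp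
qed

lemma bump_approximate_identity:
 assumes w: "continuous_on UNIV (w :: R3 => complex)"
 shows "(\<lambda>n. LBINT y. w (b + (1/real (Suc n)) *\<^sub>R y) * bump y) \<longlonglongrightarrow> w b * of_real bumpI"
proof -
 have [measurable]: "w \<in> bmeas" using w by (rule borel_measurable_continuous_onI)
 have "compact (w ` cball b 3)" using w continuous_on_subset by (intro compact_continuous_image) auto
 then obtain W where W: "\<And>x. x \<in> cball b 3 ==> norm (w x) \<le> W" by (meson bounded_iff compact_imp_bounded imageI)
 have "(\<lambda>n. LBINT y. w (b + (1/real (Suc n)) *\<^sub>R y) * bump y) \<longlonglongrightarrow> (LBINT y. w b * bump y)"
 proof (rule integral_dominated_convergence)
  show "integrable lborel (\<lambda>y. W * norm (bump y))" using bump_integrable by auto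
  show "AE y in lborel. (\<lambda>n. w (b + (1/real (Suc n)) *\<^sub>R y) * bump y) \<longlonglongrightarrow> w b * bump y"
  proof (rule AE_I2, rule tendsto_mult[OF _ tendsto_const])
   fix y
   have "(\<lambda>n. b + (1/real (Suc n)) *\<^sub>R y) \<longlonglongrightarrow> b + 0 *\<^sub>R y" by (intro tendsto_intros LIMSEQ_Suc lim_1_over_n)
   thus "(\<lambda>n. w (b + (1/real (Suc n)) *\<^sub>R y)) \<longlonglongrightarrow> w b" using continuous_on_tendsto_compose[OF w] by simp
  qed
  show "AE y in lborel. norm (w (b + (1/real (Suc n)) *\<^sub>R y) * bump y) \<le> W * norm (bump y)" for n
  proof (rule AE_I2)
   fix y
   show "norm (w (b + (1/real (Suc n)) *\<^sub>R y) * bump y) \<le> W * norm (bump y)"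
   proof (cases "bump y = 0")
    case False
    hence "norm y \<le> 3" by (rule bump_support)
    moreover have "1/real (Suc n) \<le> 1" by simp
    ultimately have "(1/real (Suc n)) * norm y \<le> 1*3" by (intro mult_mono) auto
    hence "b + (1/real (Suc n)) *\<^sub>R y \<in> cball b 3" by (simp add: dist_norm)
    thus ?thesis unfolding norm_mult by (intro mult_right_mono W) auto
   qed simp
  qed
 qed measurable
 thus ?thesis by (simp add: integral_bump)
qed

text \<open>Turns an essential bound into a bound at every point: a weak derivative of order 0 has
  the same pairings with bumps as \<open>f\<close>, and bumps shrinking to \<open>b\<close> recover
  the value of the continuous \<open>f\<close> there.\<close>

lemma weak_deriv_0_bound:
 assumes f: "continuous_on UNIV f" and wd: "is_weak_deriv 0 f g" and C: "Linf_norm g \<le> ennreal C" "0 \<le> C"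
 shows "norm (f b) \<le> C"
proof -
 have [measurable]: "g \<in> bmeas" using wd by (simp add: is_weak_deriv_def locally_integrable_def)
 have gC: "AE x in lborel. norm (g x) \<le> C"
 proof -
  have "AE x in lborel. ennreal (norm (g x)) \<le> Linf_norm g" unfolding Linf_norm_def by (rule esssup_AE)
  thus ?thesis
  proof eventually_elim
   case (elim x)
   hence "ennreal (norm (g x)) \<le> ennreal C" using C(1) by (rule order_trans)
   thus ?case using C(2) by simp
  qed
 qed
 have le: "norm (LBINT y. f (b + (1/real (Suc n)) *\<^sub>R y) * bump y) \<le> C * bumpI" for n
 proof -
  define l where "l = real (Suc n)"
  have l: "l > 0" by (simp add: l_def)
  have e: "(LBINT x. f x * bumpl l b x) = (LBINT x. g x * bumpl l b x)"
   using wd test_function_bumpl[OF l, of b] unfolding is_weak_deriv_def pderivs_def by (auto simp: mi_order_def)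
  have i: "integrable lborel (bumpl l b)" by (rule C1c_integrable(1)[OF C1c_bumpl[OF l]])
  have "norm (LBINT x. g x * bumpl l b x) \<le> (LBINT x. C * norm (bumpl l b x))"
  proof (rule order_trans[OF integral_norm_bound], rule integral_mono_AE)
   show ib: "integrable lborel (\<lambda>x. C * norm (bumpl l b x))" using i by auto
   have le: "AE x in lborel. norm (g x * bumpl l b x) \<le> C * norm (bumpl l b x)"
    using gC by eventually_elim (simp add: norm_mult mult_right_mono)
   thus "AE x in lborel. norm (g x * bumpl l b x) \<le> C * norm (bumpl l b x)" .
   show "integrable lborel (\<lambda>x. norm (g x * bumpl l b x))"
    by (rule Bochner_Integration.integrable_bound[OF ib]) (use le C(2) in \<open>auto simp: abs_mult elim!: eventually_mono\<close>)
  qed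
  also have "complex_of_real (LBINT x. C * norm (bumpl l b x)) = (LBINT x. of_real C * bumpl l b x)"
   by (subst integral_complex_of_real[symmetric]) (simp add: bumpl_def bump_pos(1)[symmetric])
  hence "(LBINT x. C * norm (bumpl l b x)) = Re (LBINT x. of_real C * bumpl l b x)" by (metis Re_complex_of_real)
  also have "(LBINT x. of_real C * bumpl l b x) = of_real (1/l^3)*(of_real C * of_real bumpI)"
   using bumpl_scaled_integral[OF l, of "\<lambda>x. of_real C" b] by (simp add: integral_bump)
  finally have "norm (LBINT x. g x * bumpl l b x) \<le> 1/l^3*(C * bumpI)" by simp
  thus ?thesis unfolding e[symmetric] bumpl_scaled_integral[OF l] l_def[symmetric] using l
   by (simp add: norm_mult norm_divide norm_power divide_le_cancel)
 qed
 have "norm (f b * of_real bumpI) \<le> C * bumpI"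
  by (rule LIMSEQ_le_const2[OF tendsto_norm[OF bump_approximate_identity[OF f]]]) (use le in blast)
 thus ?thesis using bumpI_pos by (simp add: norm_mult)
qed

text \<open>Moving the bump to \<open>b\<close> multiplies its transform by a plane wave, so the
  hypothesis says that \<open>q\<close> times the transform of the centred bump has vanishing
  Fourier integral. Up to the factor l^(-3), that transform tends to a nonzero constant at each
  \<eta> as the bump shrinks; hence at every point some scale leaves only q = 0.\<close>

lemma chk_bump_separating:
 assumes [measurable]: "q \<in> bmeas" and i: "\<And>l. l > 0 ==> integrable lborel (\<lambda>\<eta>. q \<eta> * chk (bumpl l 0) \<eta>)"
  and 0: "\<And>l b. l > 0 ==> (LBINT \<eta>. q \<eta> * chk (bumpl l b) \<eta>) = 0"
 shows "AE \<eta> in lborel. q \<eta> = 0"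
proof -
 have "AE \<eta> in lborel. q \<eta> * chk (bumpl l 0) \<eta> = 0" if l: "l > 0" for l
 proof (rule fourier_L1_inj[OF i[OF l]])
  fix b
  have e: "q \<eta> * chk (bumpl l (- b)) \<eta> = cis (- (\<eta>\<bullet>b))*(q \<eta> * chk (bumpl l 0) \<eta>)" for \<eta>
   using l by (simp add: chk_bumpl)
  show "fourier_integral (\<lambda>\<eta>. q \<eta> * chk (bumpl l 0) \<eta>) b = 0"
   unfolding fourier_integral_c0 e[symmetric] 0[OF l] by simp
 qed
 hence "AE \<eta> in lborel. \<forall>n. q \<eta> * chk (bumpl (real (Suc n)) 0) \<eta> = 0" unfolding AE_all_countable by simp
 thus ?thesis
 proof eventually_elim
  case (elim \<eta>)
  have "(\<lambda>n. LBINT y. cis (\<eta>\<bullet>(0 + (1/real (Suc n)) *\<^sub>R y)) * bump y) \<longlonglongrightarrow> cis (\<eta>\<bullet>0) * of_real bumpI"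
   by (rule bump_approximate_identity[of "\<lambda>x. cis (\<eta>\<bullet>x)"]) (intro continuous_on_cis continuous_intros)
  hence "(\<lambda>n. chk bump ((1/real (Suc n)) *\<^sub>R \<eta>)) \<longlonglongrightarrow> of_real bumpI" by (simp add: chk_def)
  hence "\<forall>\<^sub>F n in sequentially. chk bump ((1/real (Suc n)) *\<^sub>R \<eta>) \<noteq> 0"
   using bumpI_pos by (intro tendsto_imp_eventually_ne) auto
  then obtain n where "chk bump ((1/real (Suc n)) *\<^sub>R \<eta>) \<noteq> 0" using eventually_happens'[OF sequentially_bot] by blast
  moreover have "complex_of_real (1/real (Suc n)^3) \<noteq> 0" by (simp del: of_nat_Suc)
  moreover have "real (Suc n) > 0" by simp
  ultimately have "chk (bumpl (real (Suc n)) 0) \<eta> \<noteq> 0" by (simp only: chk_bumpl mult_eq_0_iff cis_neq_zero) simp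
  thus ?case using elim[rule_format, of n] unfolding mult_eq_0_iff by blast
 qed
qed

text \<open>The inversion formula is inserted for \<open>F\<close>, followed by Fubini. This extends
  the duality of \<open>is_fourier\<close> from Schwartz functions to every integrable
  \<open>\<psi>\<close>, in particular to bumps.\<close>

lemma is_fourier_pairing:
 assumes F: "is_fourier F G" and G: "integrable lborel G" and \<psi>: "integrable lborel \<psi>"
 shows "(LBINT x. F x*\<psi> x) = of_real c0*(LBINT \<eta>. G \<eta> * chk \<psi> \<eta>)"
  and "integrable lborel (\<lambda>\<eta>. G \<eta> * chk \<psi> \<eta>)"
proof -
 have [measurable]: "F \<in> bmeas" "\<psi> \<in> bmeas" "G \<in> bmeas"
  using F \<psi> G by (auto simp: is_fourier_def tempered_function_def)
 note K = kernel_Fubini[OF sigma_finite_lborel sigma_finite_lborel G \<psi>, of "\<lambda>\<eta> x. cis (\<eta>\<bullet>x)" 1]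
 have Fx: "AE x in lborel. F x*\<psi> x = of_real c0*((LBINT \<eta>. G \<eta> * cis (\<eta>\<bullet>x))*\<psi> x)"
  using is_fourier_L1[OF F G] by eventually_elim (simp add: fourier_integral_c0 inner_commute mult.commute[of "cis _"])
 have "(LBINT x. F x*\<psi> x) = (LBINT x. of_real c0*((LBINT \<eta>. G \<eta> * cis (\<eta>\<bullet>x))*\<psi> x))"
  by (rule integral_cong_AE[OF _ _ Fx]) measurable
 also have "... = of_real c0*(LBINT \<eta>. G \<eta> * chk \<psi> \<eta>)"
  unfolding integral_mult_right_zero chk_def by (subst K(1)) auto
 finally show "(LBINT x. F x*\<psi> x) = of_real c0*(LBINT \<eta>. G \<eta> * chk \<psi> \<eta>)" .
 show "integrable lborel (\<lambda>\<eta>. G \<eta> * chk \<psi> \<eta>)" unfolding chk_def using K(3) by simp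
qed

text \<open>Testing the first weak derivative with the k-th derivative of a bump gives minus the
  pairing of the next one with the bump. On the Fourier side this is multiplication by i \<eta>_k,
  and the transforms of bumps separate.\<close>

lemma weak_fourier_relation:
 assumes wa: "is_weak_deriv \<alpha> f Fa" and wb: "is_weak_deriv (\<alpha> + axis k 1) f Fb"
  and fa: "is_fourier Fa Ga" and fb: "is_fourier Fb Gb" and ga: "integrable lborel Ga" and gb: "integrable lborel Gb"
 shows "AE \<eta> in lborel. Gb \<eta> = \<i> * of_real (\<eta> $ k) * Ga \<eta>"
proof -
 have [measurable]: "Ga \<in> bmeas" "Gb \<in> bmeas" using ga gb by auto
 note pair = is_fourier_pairing(1) and pairi = is_fourier_pairing(2)
 have tf: "test_function (pderiv1 k (bumpl l b))" if "l > 0" for l b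
  unfolding test_function_def using that
  by (intro conjI bumpf_smooth bumpf_pderiv1 bumpf_bumpl pderiv1_support_bounded bumpl_support)
 have od: "mi_order (\<alpha> + axis k 1) = Suc (mi_order \<alpha>)"
  unfolding mi_order_def vector_add_component sum.distrib axis_def by simp
 have "AE \<eta> in lborel. Gb \<eta> - \<i> * of_real (\<eta> $ k) * Ga \<eta> = 0"
 proof (rule chk_bump_separating)
  have e: "(Gb \<eta> - \<i> * of_real (\<eta> $ k) * Ga \<eta>) * chk (bumpl l b) \<eta> = Gb \<eta> * chk (bumpl l b) \<eta> + Ga \<eta> * chk (pderiv1 k (bumpl l b)) \<eta>"
   if "l > 0" for l b \<eta>
   by (simp add: chk_pderiv1[OF C1c_bumpl[OF that]] algebra_simps)
  fix l :: real and b assume l: "l > 0"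
  note I = C1c_integrable[OF C1c_bumpl[OF l, of k]]
  show "integrable lborel (\<lambda>\<eta>. (Gb \<eta> - \<i> * of_real (\<eta> $ k) * Ga \<eta>) * chk (bumpl l 0) \<eta>)"
   unfolding e[OF l] by (intro Bochner_Integration.integrable_add pairi[OF fb gb] pairi[OF fa ga] I)
  have "(LBINT x. Fa x * pderiv1 k (bumpl l b) x) = - (LBINT x. Fb x * bumpl l b x)"
  proof -
   have "(LBINT x. f x * pderivs \<alpha> (pderiv1 k (bumpl l b)) x) = (-1)^mi_order \<alpha>*(LBINT x. Fa x * pderiv1 k (bumpl l b) x)"
    using wa tf[OF l, of b] by (simp add: is_weak_deriv_def)
   moreover have "(LBINT x. f x * pderivs (\<alpha> + axis k 1) (bumpl l b) x) = (-1)^mi_order (\<alpha> + axis k 1)*(LBINT x. Fb x * bumpl l b x)"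
    using wb test_function_bumpl[OF l, of b] by (simp add: is_weak_deriv_def)
   ultimately have "(-1)^mi_order \<alpha>*(LBINT x. Fa x * pderiv1 k (bumpl l b) x) = (-1)^mi_order \<alpha>*(- (LBINT x. Fb x * bumpl l b x))"
    unfolding bumpf_pderivs_Suc[OF bumpf_bumpl] od by simp
   thus ?thesis by (simp only: mult_cancel_left) simp
  qed
  hence "of_real c0*(LBINT \<eta>. Ga \<eta> * chk (pderiv1 k (bumpl l b)) \<eta>) = of_real c0*(- (LBINT \<eta>. Gb \<eta> * chk (bumpl l b) \<eta>))"
   unfolding pair[OF fa ga I(2)] pair[OF fb gb I(1)] by simp
  hence "complex_of_real c0 = 0 \<or> (LBINT \<eta>. Ga \<eta> * chk (pderiv1 k (bumpl l b)) \<eta>) = - (LBINT \<eta>. Gb \<eta> * chk (bumpl l b) \<eta>)"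
   unfolding mult_cancel_left .
  hence "(LBINT \<eta>. Ga \<eta> * chk (pderiv1 k (bumpl l b)) \<eta>) = - (LBINT \<eta>. Gb \<eta> * chk (bumpl l b) \<eta>)"
   using c0_pos by simp
  thus "(LBINT \<eta>. (Gb \<eta> - \<i> * of_real (\<eta> $ k) * Ga \<eta>) * chk (bumpl l b) \<eta>) = 0"
   unfolding e[OF l] using pairi[OF fb gb I(1)] pairi[OF fa ga I(2)] by simp
 qed measurable
 thus ?thesis by simp
qed

section \<open>Potentials with integrable Fourier transform of the derivatives\<close>

lemma norm_cis_diff_le: "norm (cis a - cis b) \<le> \<bar>a - b\<bar>"
proof -
 have "norm (cis a - cis b) \<le> 1 * norm (a - b)"
 proof (rule differentiable_bound[of UNIV cis "\<lambda>t h. h *\<^sub>R (\<i> * cis t)"])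
  fix t :: real
  have "((\<lambda>t. \<i> * complex_of_real t) has_derivative (\<lambda>h. \<i> * complex_of_real h)) (at t)"
   by (intro has_derivative_mult_right has_derivative_of_real has_derivative_ident)
  from has_derivative_compose[OF this DERIV_exp[unfolded has_field_derivative_def]]
  show "(cis has_derivative (\<lambda>h. h *\<^sub>R (\<i> * cis t))) (at t within UNIV)"
   by (simp add: cis_conv_exp[abs_def] scaleR_conv_of_real mult_ac)
  show "onorm (\<lambda>h. h *\<^sub>R (\<i> * cis t)) \<le> 1" by (rule onorm_le) (simp add: norm_mult)
 qed auto
 thus ?thesis by simp
qed

lemma norm_cis_diff_le2: "norm (cis a - cis b) \<le> 2"
 using norm_triangle_ineq4[of "cis a" "cis b"] by simp

text \<open>Moving the bump along a coordinate axis differentiates to a pairing of \<open>w\<close>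
  with a derivative of the bump, which is zero; three such moves connect \<open>b\<close> with
  0.\<close>

lemma translated_bump_integral_const:
 assumes w: "continuous_on UNIV (w :: R3 => complex)" and l: "l > 0"
  and 0: "\<And>b k. (LBINT x. w x * pderiv1 k (bumpl l b) x) = 0"
 shows "(LBINT x. w x * bumpl l b x) = (LBINT x. w x * bumpl l 0 x)"
proof -
 define H where "H b = (LBINT x. w x * bumpl l b x)" for b
 have step: "H (b - r *\<^sub>R axis k 1) = H b" for b r k
 proof -
  let ?e = "axis k (1::real) :: R3"
  have tr: "bumpl l (b - s *\<^sub>R ?e) = (\<lambda>x. bumpl l b (x + s *\<^sub>R ?e))" for s
   by (simp add: bumpl_def fun_eq_iff algebra_simps)
  have pd: "pderiv1 k (bumpl l b) (x + s *\<^sub>R ?e) = pderiv1 k (bumpl l (b - s *\<^sub>R ?e)) x" for x s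
  proof -
   have "(bumpl l b has_derivative frechet_derivative (bumpl l b) (at (x + s *\<^sub>R ?e))) (at (x + s *\<^sub>R ?e))"
    using bumpf_diff[OF bumpf_bumpl] frechet_derivative_works by blast
   moreover have "((\<lambda>x. x + s *\<^sub>R ?e) has_derivative (\<lambda>h. h)) (at x)" by (auto intro!: derivative_eq_intros)
   ultimately
   have "(bumpl l (b - s *\<^sub>R ?e) has_derivative frechet_derivative (bumpl l b) (at (x + s *\<^sub>R ?e))) (at x)"
    unfolding tr by (rule has_derivative_compose[rotated])
   from pderiv1_eq[OF this] show ?thesis by (simp add: pderiv1_def)
  qed
  have "((\<lambda>s. H (b - s *\<^sub>R ?e)) has_vector_derivative 0) (at s)" for s
   using translate_integral_derivative[OF C1c_bumpl[OF l] w, of b k s, unfolded pd 0] unfolding H_def tr .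
  hence "\<exists>c. \<forall>s\<in>UNIV. H (b - s *\<^sub>R ?e) = c"
   by (intro has_derivative_zero_constant) (auto simp: has_vector_derivative_def)
  then obtain c where "\<And>s. H (b - s *\<^sub>R ?e) = c" by blast
  from this[of r] this[of 0] show ?thesis by simp
 qed
 have "b = 0 - (- (b $ 1)) *\<^sub>R axis 1 1 - (- (b $ 2)) *\<^sub>R axis 2 1 - (- (b $ 3)) *\<^sub>R axis 3 1"
  by (simp add: vec_eq_iff forall_3 axis_def)
 hence "H b = H 0" using step by metis
 thus ?thesis by (simp add: H_def)
qed

lemma norm_le_sum_components: "norm (x::R3) \<le> (\<Sum>k\<in>UNIV. \<bar>x $ k\<bar>)"
 by (rule norm_le_l1_cart)

text \<open>\<open>\<nu>\<close> plays the part of \<open>c0\<close> times the transform of V. Only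
  differences of V are represented: near \<eta> = 0 nothing better than integrability of |\<eta>|
  |\<nu>| is available, and the difference of the plane waves supplies the missing factor
  |\<eta>|.\<close>

definition nu_rep :: "(R3 => complex) => (R3 => real) => (nat => real) => bool" where
 "nu_rep \<nu> V n \<longleftrightarrow> \<nu> \<in> bmeas \<and>
   (\<forall>k\<in>{1..3}. integrable lborel (\<lambda>\<eta>. norm \<eta>^k * norm (\<nu> \<eta>)) \<and> (LBINT \<eta>. norm \<eta>^k * norm (\<nu> \<eta>)) \<le> n k) \<and>
   (\<forall>x y. of_real (V x) - of_real (V y) = (LBINT \<eta>. \<nu> \<eta>*(cis (\<eta>\<bullet>x) - cis (\<eta>\<bullet>y))))"

lemma nn_bound_integrable:
 fixes f :: "R3 => real"
 assumes "f \<in> bmeas" "\<And>x. 0 \<le> f x" "(\<integral>\<^sup>+x. ennreal (f x) \<partial>lborel) \<le> ennreal C" "0 \<le> C"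
 shows "integrable lborel f" "(LBINT x. f x) \<le> C"
proof -
 show i: "integrable lborel f" using assms by (intro integrableI_nonneg) (auto simp: less_top[symmetric] top_unique)
 have "ennreal (LBINT x. f x) \<le> ennreal C" using nn_integral_eq_integral[OF i] assms by simp
 thus "(LBINT x. f x) \<le> C" using assms(4) by simp
qed

text \<open>The norm |\<eta>| is at most the sum of the three |\<eta>_k|, so each power of |\<eta>|
  is exchanged for one more derivative at the cost of a factor 3.\<close>

lemma nn_moment_Suc:
 fixes f :: "R3 => real" and F :: "3 => R3 => real"
 assumes F: "\<And>k. AE \<eta> in lborel. \<bar>\<eta> $ k\<bar> * f \<eta> = F k \<eta>" and f: "\<And>\<eta>. 0 \<le> f \<eta>" and [measurable]: "\<And>k. F k \<in> bmeas"
  and le: "\<And>k. (\<integral>\<^sup>+\<eta>. ennreal (norm \<eta>^p * F k \<eta>) \<partial>lborel) \<le> ennreal C" and C: "0 \<le> C"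
 shows "(\<integral>\<^sup>+\<eta>. ennreal (norm \<eta>^Suc p * f \<eta>) \<partial>lborel) \<le> ennreal (3 * C)"
proof -
 have "AE \<eta> in lborel. \<forall>k. \<bar>\<eta> $ k\<bar> * f \<eta> = F k \<eta>" using F by (simp add: AE_all_countable)
 hence "AE \<eta> in lborel. ennreal (norm \<eta>^Suc p * f \<eta>) \<le> (\<Sum>k\<in>UNIV. ennreal (norm \<eta>^p * F k \<eta>))"
 proof eventually_elim
  case (elim \<eta>)
  have "norm \<eta> * f \<eta> \<le> (\<Sum>k\<in>UNIV. \<bar>\<eta> $ k\<bar>) * f \<eta>" by (intro mult_right_mono norm_le_sum_components f)
  hence "norm \<eta>^p*(norm \<eta> * f \<eta>) \<le> norm \<eta>^p*(\<Sum>k\<in>UNIV. F k \<eta>)"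
   unfolding sum_distrib_right elim[rule_format] by (rule mult_left_mono) simp
  moreover have "0 \<le> norm \<eta>^p * F k \<eta>" for k unfolding elim[rule_format, symmetric] using f by simp
  ultimately show ?case by (simp add: sum_distrib_left mult_ac ennreal_leI)
 qed
 hence "(\<integral>\<^sup>+\<eta>. ennreal (norm \<eta>^Suc p * f \<eta>) \<partial>lborel) \<le> (\<Sum>k\<in>UNIV. (\<integral>\<^sup>+\<eta>. ennreal (norm \<eta>^p * F k \<eta>) \<partial>lborel))"
  by (subst nn_integral_sum[symmetric]) (auto intro: nn_integral_mono_AE)
 also have "... \<le> (\<Sum>k\<in>(UNIV :: 3 set). ennreal C)" by (intro sum_mono le)
 finally show ?thesis using C by (simp add: ennreal_mult)
qed

text \<open>Fubini for the conditionally defined kernel: only \<open>|\<eta>| |\<nu> \<eta>|\<close> is integrable, and the missing power of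
 \<open>|\<eta>|\<close> is taken from the difference of the exponentials.\<close>

lemma nu_Fubini:
 fixes x :: R3 and p :: "R3 => R3" and q :: "R3 => complex"
 assumes nu1: "integrable lborel (\<lambda>\<eta>. norm \<eta> * norm (\<nu> \<eta>))" and [measurable]: "\<nu> \<in> bmeas" "p \<in> bmeas"
  and q: "integrable lborel (\<lambda>y. of_real (norm y) * q y)" and p: "\<And>y. norm (x - p y) \<le> m * norm y" and m: "m \<ge> 0"
 shows "(LBINT \<eta>. \<nu> \<eta>*(LBINT y. (cis (\<eta>\<bullet>x) - cis (\<eta>\<bullet>p y)) * q y))
   = (LBINT y. (LBINT \<eta>. \<nu> \<eta>*(cis (\<eta>\<bullet>x) - cis (\<eta>\<bullet>p y))) * q y)"
proof -
 define K where "K \<eta> y = (cis (\<eta>\<bullet>x) - cis (\<eta>\<bullet>p y))/of_real (norm \<eta> * norm y)" for \<eta> y :: R3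
 have le: "norm (cis (\<eta>\<bullet>x) - cis (\<eta>\<bullet>p y)) \<le> m*(norm \<eta> * norm y)" for \<eta> y
 proof -
  have "norm (cis (\<eta>\<bullet>x) - cis (\<eta>\<bullet>p y)) \<le> norm \<eta> * norm (x - p y)"
   using norm_cis_diff_le[of "\<eta>\<bullet>x" "\<eta>\<bullet>p y"] Cauchy_Schwarz_ineq2[of \<eta> "x - p y"] by (simp add: inner_diff_right)
  also have "... \<le> norm \<eta>*(m * norm y)" by (intro mult_left_mono p) simp
  finally show ?thesis by (simp add: mult_ac)
 qed
 have KB: "norm (K \<eta> y) \<le> m" for \<eta> y
 proof (cases "\<eta> = 0 \<or> y = 0")
  case False
  thus ?thesis using le[of \<eta> y] unfolding K_def norm_divide norm_of_real by (simp add: abs_mult divide_le_eq)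
 qed (use m in \<open>auto simp: K_def\<close>)
 have n\<nu>: "integrable lborel (\<lambda>\<eta>. of_real (norm \<eta>)*\<nu> \<eta>)"
  by (rule Bochner_Integration.integrable_bound[OF nu1]) (auto simp: norm_mult)
 have "p y = x" if "y = 0" for y using p[of y] that by simp
 hence nK: "of_real (norm \<eta>)*(\<nu> \<eta>*(K \<eta> y*(of_real (norm y) * q y))) = \<nu> \<eta>*((cis (\<eta>\<bullet>x) - cis (\<eta>\<bullet>p y)) * q y)" for \<eta> y
  by (cases "\<eta> = 0 \<or> y = 0") (auto simp: K_def)
 have "(LBINT \<eta>. (of_real (norm \<eta>)*\<nu> \<eta>)*(LBINT y. K \<eta> y*(of_real (norm y) * q y)))
   = (LBINT y. (LBINT \<eta>. (of_real (norm \<eta>)*\<nu> \<eta>) * K \<eta> y)*(of_real (norm y) * q y))"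
  by (rule kernel_Fubini(1)[OF sigma_finite_lborel sigma_finite_lborel n\<nu> q _ KB]) (simp add: K_def split_beta')
 thus ?thesis
  unfolding integral_mult_right_zero[symmetric] integral_mult_left_zero[symmetric] mult.assoc nK .
qed

text \<open>The transforms of the first derivatives determine \<nu> away from 0. The function
  defined by \<nu> has the same weak gradient as V, so the two differ by a constant, which is why
  the conclusion speaks of differences.\<close>

theorem nu_representation:
 fixes V :: "R3 => real"
 assumes cont: "continuous_on UNIV V"
  and wd: "\<And>\<alpha>. mi_order \<alpha> \<in> {1..3} ==> is_weak_deriv \<alpha> (\<lambda>x. of_real (V x)) (F \<alpha>)"
  and ft: "\<And>\<alpha>. mi_order \<alpha> \<in> {1..3} ==> is_fourier (F \<alpha>) (G \<alpha>)"
  and nn: "\<And>\<alpha>. mi_order \<alpha> \<in> {1..3} ==> (\<integral>\<^sup>+\<eta>. ennreal (norm (G \<alpha> \<eta>)) \<partial>lborel) \<le> ennreal (n (mi_order \<alpha>))"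
  and n0: "\<And>k. 0 \<le> n k"
 obtains \<nu> where "nu_rep \<nu> V (\<lambda>k. 27 * c0 * n k)"
proof -
 have Gm[measurable]: "G \<alpha> \<in> bmeas" if "mi_order \<alpha> \<in> {1..3}" for \<alpha>
  using ft[OF that] by (simp add: is_fourier_def tempered_function_def)
 have Gi: "integrable lborel (G \<alpha>)" if "mi_order \<alpha> \<in> {1..3}" for \<alpha>
  unfolding integrable_iff_bounded using Gm[OF that] nn[OF that] by (auto simp: less_top[symmetric] top_unique)
 have od: "mi_order (axis j 1) = 1" "mi_order (axis j 1 + axis k 1) = 2" "mi_order (axis j 1 + axis k 1 + axis m 1) = 3" for j k m :: 3
  unfolding mi_order_def vector_add_component sum.distrib axis_def by simp_all
 define g where "g j = G (axis j 1)" for j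
 have gi: "integrable lborel (g j)" for j unfolding g_def by (rule Gi) (simp add: od del: One_nat_def)
 have [measurable]: "g j \<in> bmeas" for j using gi[of j] by auto
 have od': "mi_order (\<alpha> + axis k 1) = mi_order \<alpha> + 1" for \<alpha> and k :: 3
  unfolding mi_order_def vector_add_component sum.distrib axis_def by simp
 have R: "AE \<eta> in lborel. G (\<alpha> + axis k 1) \<eta> = \<i> * of_real (\<eta> $ k) * G \<alpha> \<eta>" if "mi_order \<alpha> \<in> {1..2}" for \<alpha> k
  by (rule weak_fourier_relation[OF wd wd ft ft Gi Gi]) (use that in \<open>auto simp: od' simp del: One_nat_def\<close>)
 \<comment> \<open>The least-squares solution of the three equations i \<eta>_k \<nu> =
   \<open>c0\<close> g_k. Its value at \<eta> = 0 concerns a null set only.\<close>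
 define \<nu> where "\<nu> \<eta> = of_real c0*(\<Sum>j\<in>UNIV. - \<i> * of_real (\<eta> $ j) * g j \<eta>)/of_real ((norm \<eta>)^2)" for \<eta>
 have \<nu>m[measurable]: "\<nu> \<in> bmeas" unfolding \<nu>_def by measurable
 \<comment> \<open>Both sides are the transform of the same second derivative, reached in the two
   orders. This compatibility makes the overdetermined system for \<open>\<nu>\<close>
   solvable.\<close>
 have "AE \<eta> in lborel. \<forall>j k. \<i> * of_real (\<eta> $ k) * g j \<eta> = \<i> * of_real (\<eta> $ j) * g k \<eta>"
 proof -
  have o1: "mi_order (axis j 1) \<in> {1..2}" for j :: 3 unfolding od by simp
  have "AE \<eta> in lborel. \<i> * of_real (\<eta> $ k) * g j \<eta> = \<i> * of_real (\<eta> $ j) * g k \<eta>" for j k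
   using R[OF o1, of j k] R[OF o1, of k j] unfolding add.commute[of "axis k 1"] g_def by eventually_elim simp
  thus ?thesis by (simp add: AE_all_countable)
 qed
 moreover have "AE \<eta>::R3 in lborel. \<eta> \<noteq> 0" by (rule AE_lborel_singleton)
 ultimately have R1: "AE \<eta> in lborel. \<forall>k. \<i> * of_real (\<eta> $ k)*\<nu> \<eta> = of_real c0 * g k \<eta>"
 proof eventually_elim
  case (elim \<eta>)
  show ?case
  proof
   fix k
   have sym: "of_real (\<eta> $ k) * g j \<eta> = of_real (\<eta> $ j) * g k \<eta>" for j using elim(1)[rule_format, of k j] by simp
   have nsq: "complex_of_real ((norm \<eta>)^2) = (\<Sum>j\<in>UNIV. of_real (\<eta> $ j) * of_real (\<eta> $ j))"
    by (simp only: power2_norm_eq_inner inner_vec_def of_real_sum inner_real_def of_real_mult)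
   have "\<i> * of_real (\<eta> $ k)*(\<Sum>j\<in>UNIV. - \<i> * of_real (\<eta> $ j) * g j \<eta>) = (\<Sum>j\<in>UNIV. of_real (\<eta> $ j)*(of_real (\<eta> $ k) * g j \<eta>))"
    unfolding sum_distrib_left by (intro sum.cong refl) (simp add: algebra_simps)
   also have "... = of_real ((norm \<eta>)^2) * g k \<eta>"
    unfolding sym nsq sum_distrib_right by (simp add: mult.assoc)
   finally have *: "\<i> * of_real (\<eta> $ k)*(\<Sum>j\<in>UNIV. - \<i> * of_real (\<eta> $ j) * g j \<eta>) = of_real ((norm \<eta>)^2) * g k \<eta>" .
   have "\<i> * of_real (\<eta> $ k)*\<nu> \<eta> = of_real c0*(\<i> * of_real (\<eta> $ k)*(\<Sum>j\<in>UNIV. - \<i> * of_real (\<eta> $ j) * g j \<eta>))/of_real ((norm \<eta>)^2)"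
    by (simp add: \<nu>_def)
   also have "... = of_real c0 * g k \<eta>" unfolding * using elim(2) by simp
   finally show "\<i> * of_real (\<eta> $ k)*\<nu> \<eta> = of_real c0 * g k \<eta>" .
  qed
 qed
 have N1: "AE \<eta> in lborel. \<bar>\<eta> $ j\<bar> * norm (\<nu> \<eta>) = c0 * norm (g j \<eta>)" for j
  using R1
 proof eventually_elim
  case (elim \<eta>)
  from arg_cong[OF elim[rule_format, of j], of norm] show ?case using c0_pos by (simp add: norm_mult)
 qed
 \<comment> \<open>A power |\<eta>|^p is paid by p further derivatives, so the order plus p may not
   exceed 3, and the constant is 3^p.\<close>
 have mom: "(\<integral>\<^sup>+\<eta>. ennreal (norm \<eta>^p * norm (G \<alpha> \<eta>)) \<partial>lborel) \<le> ennreal (3^p * n (mi_order \<alpha> + p))"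
  if "1 \<le> mi_order \<alpha>" "mi_order \<alpha> + p \<le> 3" for p \<alpha>
  using that
 proof (induct p arbitrary: \<alpha>)
  case 0 thus ?case using nn[of \<alpha>] by simp
 next
  case (Suc p)
  have "(\<integral>\<^sup>+\<eta>. ennreal (norm \<eta>^Suc p * norm (G \<alpha> \<eta>)) \<partial>lborel) \<le> ennreal (3*(3^p * n (mi_order \<alpha> + 1 + p)))"
  proof (rule nn_moment_Suc[where F="\<lambda>k \<eta>. norm (G (\<alpha> + axis k 1) \<eta>)"])
   show "AE \<eta> in lborel. \<bar>\<eta> $ k\<bar> * norm (G \<alpha> \<eta>) = norm (G (\<alpha> + axis k 1) \<eta>)" for k
    using R[of \<alpha> k] Suc.prems by (auto simp: norm_mult elim: eventually_mono)
   show "(\<integral>\<^sup>+\<eta>. ennreal (norm \<eta>^p * norm (G (\<alpha> + axis k 1) \<eta>)) \<partial>lborel) \<le> ennreal (3^p * n (mi_order \<alpha> + 1 + p))" for k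
    using Suc.hyps[of "\<alpha> + axis k 1"] Suc.prems by (simp add: od' del: One_nat_def)
   show "(\<lambda>\<eta>. norm (G (\<alpha> + axis k 1) \<eta>)) \<in> bmeas" for k
    using Gm[of "\<alpha> + axis k 1"] Suc.prems by (auto simp: od' simp del: One_nat_def)
  qed (use n0 in auto)
  thus ?case by (simp add: mult.assoc)
 qed
 \<comment> \<open>At most two factors 3 come from the moments of the first-order transforms, and
   passing from these to \<nu> costs a third one, whence 27.\<close>
 have nui: "integrable lborel (\<lambda>\<eta>. norm \<eta>^k * norm (\<nu> \<eta>)) \<and> (LBINT \<eta>. norm \<eta>^k * norm (\<nu> \<eta>)) \<le> 27 * c0 * n k" if k: "k \<in> {1..3}" for k
 proof -
  obtain p where p: "k = Suc p" "p \<le> 2" using k by (cases k) auto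
  have "(\<integral>\<^sup>+\<eta>. ennreal (norm \<eta>^Suc p * norm (\<nu> \<eta>)) \<partial>lborel) \<le> ennreal (3*(c0*(9 * n k)))"
  proof (rule nn_moment_Suc[OF N1])
   fix j
   have "(\<integral>\<^sup>+\<eta>. ennreal (norm \<eta>^p*(c0 * norm (g j \<eta>))) \<partial>lborel) = (\<integral>\<^sup>+\<eta>. ennreal c0 * ennreal (norm \<eta>^p * norm (g j \<eta>)) \<partial>lborel)"
    using c0_pos by (simp add: ennreal_mult[symmetric] mult_ac)
   also have "... = ennreal c0*(\<integral>\<^sup>+\<eta>. ennreal (norm \<eta>^p * norm (g j \<eta>)) \<partial>lborel)" by (rule nn_integral_cmult) measurable
   also have "... \<le> ennreal c0 * ennreal (3^p * n k)"
    using mom[of "axis j 1" p] p unfolding od by (intro mult_left_mono) (simp_all add: g_def)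
   also have "... = ennreal (c0*(3^p * n k))" using c0_pos n0 by (simp add: ennreal_mult)
   also have "... \<le> ennreal (c0*(9 * n k))"
    using power_increasing[OF p(2), of "3::real"] c0_pos n0 by (intro ennreal_leI mult_left_mono mult_right_mono) auto
   finally show "(\<integral>\<^sup>+\<eta>. ennreal (norm \<eta>^p*(c0 * norm (g j \<eta>))) \<partial>lborel) \<le> ennreal (c0*(9 * n k))" .
  qed (use c0_pos n0 in auto)
  from nn_bound_integrable[OF _ _ this] show ?thesis using c0_pos n0 by (auto simp: p(1) mult_ac)
 qed
 have nu1: "integrable lborel (\<lambda>\<eta>. norm \<eta> * norm (\<nu> \<eta>))" using nui[of 1] by simp
 have nule: "norm (\<nu> \<eta>*(cis (\<eta>\<bullet>x) - cis (\<eta>\<bullet>y))) \<le> norm (x - y)*(norm \<eta> * norm (\<nu> \<eta>))" for \<eta> x y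
 proof -
  have "norm (cis (\<eta>\<bullet>x) - cis (\<eta>\<bullet>y)) \<le> \<bar>\<eta>\<bullet>x - \<eta>\<bullet>y\<bar>" by (rule norm_cis_diff_le)
  also have "... \<le> norm \<eta> * norm (x - y)" unfolding inner_diff_right[symmetric] by (rule Cauchy_Schwarz_ineq2)
  finally have "norm (\<nu> \<eta>) * norm (cis (\<eta>\<bullet>x) - cis (\<eta>\<bullet>y)) \<le> norm (\<nu> \<eta>)*(norm \<eta> * norm (x - y))" by (rule mult_left_mono) simp
  thus ?thesis by (simp add: norm_mult mult_ac)
 qed
 have int: "integrable lborel (\<lambda>\<eta>. \<nu> \<eta>*(cis (\<eta>\<bullet>x) - cis (\<eta>\<bullet>y)))" for x y
 proof (rule Bochner_Integration.integrable_bound)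
  show "integrable lborel (\<lambda>\<eta>. norm (x - y)*(norm \<eta> * norm (\<nu> \<eta>)))" using nu1 by (rule integrable_mult_right)
  show "AE \<eta> in lborel. norm (\<nu> \<eta>*(cis (\<eta>\<bullet>x) - cis (\<eta>\<bullet>y))) \<le> norm (norm (x - y)*(norm \<eta> * norm (\<nu> \<eta>)))"
   using nule by simp
 qed measurable
 define f0 where "f0 x = (LBINT \<eta>. \<nu> \<eta>*(cis (\<eta>\<bullet>x) - cis (\<eta>\<bullet>0)))" for x
 have f0d: "f0 x - f0 y = (LBINT \<eta>. \<nu> \<eta>*(cis (\<eta>\<bullet>x) - cis (\<eta>\<bullet>y)))" for x y
  unfolding f0_def by (subst Bochner_Integration.integral_diff[symmetric, OF int int]) (simp add: algebra_simps)
 have f0c: "continuous_on UNIV f0"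
 proof (rule lipschitz_on_continuous_on, rule lipschitz_onI)
  fix x y
  have le: "norm (\<nu> \<eta>*(cis (\<eta>\<bullet>x) - cis (\<eta>\<bullet>y))) \<le> norm (x - y)*(norm \<eta> * norm (\<nu> \<eta>))" for \<eta> by (rule nule)
  have "norm (f0 x - f0 y) \<le> (LBINT \<eta>. norm (x - y)*(norm \<eta> * norm (\<nu> \<eta>)))"
   unfolding f0d by (rule order_trans[OF integral_norm_bound], rule integral_mono) (use le nu1 int in auto)
  thus "dist (f0 x) (f0 y) \<le> (LBINT \<eta>. norm \<eta> * norm (\<nu> \<eta>)) * dist x y" by (simp add: dist_norm mult.commute)
 qed simp
 \<comment> \<open>It remains to see that \<open>w\<close> is constant. It is continuous with
   vanishing weak gradient, so its averages over bumps do not depend on the centre.\<close>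
 define w where "w x = of_real (V x) - f0 x" for x
 have wc: "continuous_on UNIV w" unfolding w_def using cont f0c by (intro continuous_intros)
 have w0: "(LBINT x. w x * pderiv1 k (bumpl l b) x) = 0" if l: "l > 0" for l b k
 proof -
  define \<psi> where "\<psi> = pderiv1 k (bumpl l b)"
  have \<psi>c: "continuous_on UNIV \<psi>" and \<psi>s: "bounded {x. \<psi> x \<noteq> 0}"
   using C1c_bumpl[OF l, of k b] pderiv1_support_bounded unfolding C1c_def \<psi>_def by auto
  have [measurable]: "\<psi> \<in> bmeas" using \<psi>c by (rule borel_measurable_continuous_onI)
  have \<psi>i: "integrable lborel \<psi>" using \<psi>c \<psi>s by (rule cont_bsupp_integrable)
  have x\<psi>i: "integrable lborel (\<lambda>x. of_real (norm x)*\<psi> x)"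
   by (rule cont_bsupp_integrable) (auto intro!: continuous_intros \<psi>c bounded_subset[OF \<psi>s])
  have L: "(LBINT x. (cis (\<eta>\<bullet>0) - cis (\<eta>\<bullet>x))*\<psi> x) = \<i> * of_real (\<eta> $ k) * chk (bumpl l b) \<eta>" for \<eta>
  proof -
   have "(LBINT x. (cis (\<eta>\<bullet>0) - cis (\<eta>\<bullet>x))*\<psi> x) = (LBINT x. \<psi> x) - chk \<psi> \<eta>"
    unfolding chk_def left_diff_distrib using \<psi>i by (subst Bochner_Integration.integral_diff) (auto intro!: integrable_cis_mult)
   also have "(LBINT x. \<psi> x) = 0" unfolding \<psi>_def by (rule integral_pderiv1_0[OF C1c_bumpl[OF l]])
   also have "chk \<psi> \<eta> = - \<i> * of_real (\<eta> $ k) * chk (bumpl l b) \<eta>" unfolding \<psi>_def by (rule chk_pderiv1[OF C1c_bumpl[OF l]])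
   finally show ?thesis by simp
  qed
  have "(LBINT x. (f0 0 - f0 x)*\<psi> x) = (LBINT \<eta>. \<nu> \<eta>*(\<i> * of_real (\<eta> $ k) * chk (bumpl l b) \<eta>))"
   unfolding f0d L[symmetric] by (rule nu_Fubini[OF nu1 \<nu>m _ x\<psi>i, where m=1, symmetric]) auto
  hence "(LBINT x. f0 x*\<psi> x) = (LBINT \<eta>. \<nu> \<eta>*(- \<i> * of_real (\<eta> $ k) * chk (bumpl l b) \<eta>))"
   by (simp add: f0_def[of 0]) (metis minus_minus)
  also have "... = (LBINT \<eta>. - (of_real c0*(g k \<eta> * chk (bumpl l b) \<eta>)))"
  proof (rule integral_cong_AE)
   show "AE \<eta> in lborel. \<nu> \<eta>*(- \<i> * of_real (\<eta> $ k) * chk (bumpl l b) \<eta>) = - (of_real c0*(g k \<eta> * chk (bumpl l b) \<eta>))"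
    using R1
   proof eventually_elim
    case (elim \<eta>)
    have "\<nu> \<eta>*(- \<i> * of_real (\<eta> $ k) * chk (bumpl l b) \<eta>) = - ((\<i> * of_real (\<eta> $ k)*\<nu> \<eta>) * chk (bumpl l b) \<eta>)" by (simp add: mult_ac)
    thus ?case unfolding elim[rule_format] by (simp add: mult_ac)
   qed
  qed measurable
  also have "... = - (of_real c0*(LBINT \<eta>. g k \<eta> * chk (bumpl l b) \<eta>))" by simp
  finally have A: "(LBINT x. f0 x*\<psi> x) = - (of_real c0*(LBINT \<eta>. g k \<eta> * chk (bumpl l b) \<eta>))" .
  have wk: "is_weak_deriv (axis k 1) (\<lambda>x. of_real (V x)) (F (axis k 1))" by (rule wd) (simp add: od del: One_nat_def)
  have fk: "is_fourier (F (axis k 1)) (g k)" unfolding g_def by (rule ft) (simp add: od del: One_nat_def)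
  have "pderivs (axis k 1) (bumpl l b) = \<psi>"
   unfolding \<psi>_def using bumpf_pderivs_Suc[OF bumpf_bumpl, of 0 k l b] by (simp add: pderivs_def)
  moreover have "(LBINT x. of_real (V x) * pderivs (axis k 1) (bumpl l b) x) = (- 1)^1*(LBINT x. F (axis k 1) x * bumpl l b x)"
   using wk test_function_bumpl[OF l, of b] unfolding is_weak_deriv_def od by blast
  ultimately have "(LBINT x. of_real (V x)*\<psi> x) = - (LBINT x. F (axis k 1) x * bumpl l b x)" by simp
  also have "... = - (of_real c0*(LBINT \<eta>. g k \<eta> * chk (bumpl l b) \<eta>))"
   unfolding is_fourier_pairing(1)[OF fk gi C1c_integrable(1)[OF C1c_bumpl[OF l]]] ..
  finally have B: "(LBINT x. of_real (V x)*\<psi> x) = (LBINT x. f0 x*\<psi> x)" unfolding A .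
  have i1: "integrable lborel (\<lambda>x. u x*\<psi> x)" if "continuous_on UNIV u" for u
   by (rule cont_bsupp_integrable) (auto intro!: continuous_intros \<psi>c that bounded_subset[OF \<psi>s])
  have "integrable lborel (\<lambda>x. of_real (V x)*\<psi> x)" "integrable lborel (\<lambda>x. f0 x*\<psi> x)"
   by (intro i1 f0c continuous_intros cont)+
  thus ?thesis unfolding w_def left_diff_distrib \<psi>_def[symmetric] using B by simp
 qed
 have ww0: "w x = w 0" for x
 proof -
  have "(\<lambda>n. LBINT y. w (x + (1/real (Suc n)) *\<^sub>R y) * bump y) = (\<lambda>n. LBINT y. w (0 + (1/real (Suc n)) *\<^sub>R y) * bump y)"
  proof
   fix n
   have l: "real (Suc n) > 0" by simp
   have "(LBINT x'. w x' * bumpl (real (Suc n)) x x') = (LBINT x'. w x' * bumpl (real (Suc n)) 0 x')"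
    by (rule translated_bump_integral_const[OF wc l w0[OF l]])
   thus "(LBINT y. w (x + (1/real (Suc n)) *\<^sub>R y) * bump y) = (LBINT y. w (0 + (1/real (Suc n)) *\<^sub>R y) * bump y)"
    unfolding bumpl_scaled_integral[OF l] mult_cancel_left by (simp del: of_nat_Suc)
  qed
  hence "w x * of_real bumpI = w 0 * of_real bumpI"
   using bump_approximate_identity[OF wc, of x] LIMSEQ_unique[OF _ bump_approximate_identity[OF wc, of 0]] by simp
  thus ?thesis using bumpI_pos by simp
 qed
 have ww: "w x = w y" for x y unfolding ww0[of x] ww0[of y] ..
 have "of_real (V x) - of_real (V y) = f0 x - f0 y" for x y using ww[of x y] unfolding w_def by (simp add: algebra_simps)
 hence "nu_rep \<nu> V (\<lambda>k. 27 * c0 * n k)" unfolding nu_rep_def f0d using \<nu>m nui by auto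
 thus thesis by (rule that)
qed

section \<open>Integrals of the potential against densities of total mass zero\<close>

lemma norm_gau_integrable: "integrable lborel (\<lambda>y. of_real (norm y) * gau y)"
proof (rule Bochner_Integration.integrable_bound)
 show "integrable lborel (\<lambda>y. gau ((1/sqrt 2) *\<^sub>R y))" by (rule gau_scaled_integrable) simp
 show "AE y in lborel. norm (of_real (norm y) * gau y) \<le> norm (gau ((1/sqrt 2) *\<^sub>R y))"
 proof (rule AE_I2)
  fix y :: R3
  have "0 \<le> (norm y/2 - 1)^2" by simp
  hence "norm y \<le> 1 + (norm y)^2/4" by (simp add: power2_eq_square algebra_simps)
  also have "... \<le> exp ((norm y)^2/4)" by (rule exp_ge_add_one_self)
  finally have "norm y * exp (- (norm y)\<^sup>2/2) \<le> exp ((norm y)^2/4) * exp (- (norm y)\<^sup>2/2)" by (rule mult_right_mono) simp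
  also have "... = exp (- ((1/sqrt 2) * norm y)\<^sup>2/2)" by (simp add: exp_add[symmetric] power_mult_distrib power_divide)
  finally show "norm (of_real (norm y) * gau y) \<le> norm (gau ((1/sqrt 2) *\<^sub>R y))" by (simp add: gau_def norm_mult)
 qed
qed measurable

lemma one_minus_gau_le: "norm (1 - gau x) \<le> norm x"
proof -
 define s where "s = norm x"
 have s: "s \<ge> 0" by (simp add: s_def)
 have "1 - exp (- s\<^sup>2/2) \<le> s"
 proof (cases "s \<le> 2")
  case True
  have "1 - s\<^sup>2/2 \<le> exp (- s\<^sup>2/2)" using exp_ge_add_one_self[of "- s\<^sup>2/2"] by simp
  moreover have "s\<^sup>2/2 \<le> s" using True s by (simp add: power2_eq_square mult_left_mono[of s 2 s, simplified])
  ultimately show ?thesis by linarith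
 next
  case False
  have "0 < exp (- s\<^sup>2/2)" by simp
  thus ?thesis using False by linarith
 qed
 moreover have "exp (- s\<^sup>2/2) \<le> 1" by simp
 moreover have "1 - gau x = of_real (1 - exp (- s\<^sup>2/2))" by (simp add: gau_def s_def)
 ultimately show ?thesis unfolding s_def by (simp only: norm_of_real)
qed

lemma norm_one_minus_gau_le1: "norm (1 - gau x) \<le> 1"
proof -
 have "1 - gau x = of_real (1 - exp (- (norm x)\<^sup>2/2))" by (simp add: gau_def)
 thus ?thesis by (simp only: norm_of_real) simp
qed

text \<open>The factor 1 - gau(m \<eta>) is at most m |\<eta>| and so removes the singularity at 0.
  In the space variable it subtracts from V its Gaussian average at scale m, which explains the
  bound 2 B uniformly in m.\<close>

lemma nu_rep_mollified:
 assumes nu: "nu_rep \<nu> V n" and cont: "continuous_on UNIV V" and B: "\<And>x. \<bar>V x\<bar> \<le> B" and m: "m > 0"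
 shows "norm (LBINT \<eta>. \<nu> \<eta>*(1 - gau (m *\<^sub>R \<eta>)) * cis (\<eta>\<bullet>x)) \<le> 2 * B"
  and "integrable lborel (\<lambda>\<eta>. \<nu> \<eta>*(1 - gau (m *\<^sub>R \<eta>)))"
proof -
 have [measurable]: "\<nu> \<in> bmeas" using nu by (simp add: nu_rep_def)
 have [measurable]: "V \<in> bmeas" using cont by (rule borel_measurable_continuous_onI)
 have nu1: "integrable lborel (\<lambda>\<eta>. norm \<eta> * norm (\<nu> \<eta>))" using nu unfolding nu_rep_def by (auto dest: bspec[of _ _ 1])
 have rep: "of_real (V x) - of_real (V y) = (LBINT \<eta>. \<nu> \<eta>*(cis (\<eta>\<bullet>x) - cis (\<eta>\<bullet>y)))" for x y
  using nu by (simp add: nu_rep_def)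
 show "integrable lborel (\<lambda>\<eta>. \<nu> \<eta>*(1 - gau (m *\<^sub>R \<eta>)))"
 proof (rule Bochner_Integration.integrable_bound)
  show "integrable lborel (\<lambda>\<eta>. m*(norm \<eta> * norm (\<nu> \<eta>)))" using nu1 by (rule integrable_mult_right)
  have "norm (\<nu> \<eta>*(1 - gau (m *\<^sub>R \<eta>))) \<le> m*(norm \<eta> * norm (\<nu> \<eta>))" for \<eta>
   using mult_left_mono[OF one_minus_gau_le[of "m *\<^sub>R \<eta>"] norm_ge_zero[of "\<nu> \<eta>"]] m by (simp add: norm_mult mult_ac)
  thus "AE \<eta> in lborel. norm (\<nu> \<eta>*(1 - gau (m *\<^sub>R \<eta>))) \<le> norm (m*(norm \<eta> * norm (\<nu> \<eta>)))"
   using m by (auto intro!: AE_I2 order_trans[OF _ abs_ge_self])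
 qed measurable
 have L: "(LBINT y. (cis (\<eta>\<bullet>x) - cis (\<eta>\<bullet>(x - m *\<^sub>R y))) * gau y) = of_real (1/c0)*((1 - gau (m *\<^sub>R \<eta>)) * cis (\<eta>\<bullet>x))" for \<eta>
 proof -
  have "cis (\<eta>\<bullet>(x - m *\<^sub>R y)) = cis (\<eta>\<bullet>x) * cis (- (y\<bullet>(m *\<^sub>R \<eta>)))" for y
   by (simp add: cis_mult inner_diff_right inner_commute)
  hence "(LBINT y. (cis (\<eta>\<bullet>x) - cis (\<eta>\<bullet>(x - m *\<^sub>R y))) * gau y) = (LBINT y. cis (\<eta>\<bullet>x)*(gau y - cis (- (y\<bullet>(m *\<^sub>R \<eta>))) * gau y))"
   by (simp add: algebra_simps)
  also have "... = cis (\<eta>\<bullet>x)*((LBINT y. gau y) - (LBINT y. cis (- (y\<bullet>(m *\<^sub>R \<eta>))) * gau y))"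
   unfolding integral_mult_right_zero
   by (subst Bochner_Integration.integral_diff) (auto intro!: integrable_cis_mult gau_integrable)
  also have "(LBINT y. cis (- (y\<bullet>(m *\<^sub>R \<eta>))) * gau y) = of_real (1/c0) * gau (m *\<^sub>R \<eta>)"
   using fourier_gau[of "m *\<^sub>R \<eta>"] c0_pos by (simp add: fourier_integral_c0 field_simps)
  finally show ?thesis unfolding integral_gau by (simp add: algebra_simps)
 qed
 have "(LBINT \<eta>. \<nu> \<eta>*(LBINT y. (cis (\<eta>\<bullet>x) - cis (\<eta>\<bullet>(x - m *\<^sub>R y))) * gau y))
   = (LBINT y. (LBINT \<eta>. \<nu> \<eta>*(cis (\<eta>\<bullet>x) - cis (\<eta>\<bullet>(x - m *\<^sub>R y)))) * gau y)"
  by (rule nu_Fubini[OF nu1 _ _ norm_gau_integrable, where m=m]) (use m in auto)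
 hence Fub: "(LBINT \<eta>. of_real (1/c0)*(\<nu> \<eta>*(1 - gau (m *\<^sub>R \<eta>)) * cis (\<eta>\<bullet>x))) = (LBINT y. of_real (V x - V (x - m *\<^sub>R y)) * gau y)"
  unfolding L rep[symmetric] of_real_diff by (simp add: mult_ac)
 have "of_real (1/c0)*(LBINT \<eta>. \<nu> \<eta>*(1 - gau (m *\<^sub>R \<eta>)) * cis (\<eta>\<bullet>x)) = (LBINT y. of_real (V x - V (x - m *\<^sub>R y)) * gau y)"
  using Fub unfolding integral_mult_right_zero .
 moreover have "norm (LBINT y. of_real (V x - V (x - m *\<^sub>R y)) * gau y) \<le> (LBINT y. (2 * B) * norm (gau y))"
 proof (rule order_trans[OF integral_norm_bound], rule integral_mono)
  show i: "integrable lborel (\<lambda>y. (2 * B) * norm (gau y))" using gau_integrable by auto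
  show le: "norm (of_real (V x - V (x - m *\<^sub>R y)) * gau y) \<le> (2 * B) * norm (gau y)" for y
   unfolding norm_mult norm_of_real using B[of x] B[of "x - m *\<^sub>R y"] by (intro mult_right_mono) auto
  show "integrable lborel (\<lambda>y. norm (of_real (V x - V (x - m *\<^sub>R y)) * gau y))"
   by (rule Bochner_Integration.integrable_bound[OF i]) (use le in \<open>auto intro!: AE_I2 order_trans[OF _ abs_ge_self]\<close>)
 qed
 moreover have "(LBINT y. norm (gau y)) = 1/c0"
 proof -
  have "complex_of_real (LBINT y. norm (gau y)) = of_real (1/c0)"
   unfolding integral_gau[symmetric] by (subst integral_complex_of_real[symmetric]) (simp only: gau_nonneg[symmetric])
  thus ?thesis by (simp only: of_real_eq_iff)
 qed
 ultimately have "norm (of_real (1/c0)*(LBINT \<eta>. \<nu> \<eta>*(1 - gau (m *\<^sub>R \<eta>)) * cis (\<eta>\<bullet>x))) \<le> 2 * B*(1/c0)" by simp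
 thus "norm (LBINT \<eta>. \<nu> \<eta>*(1 - gau (m *\<^sub>R \<eta>)) * cis (\<eta>\<bullet>x)) \<le> 2 * B"
  using c0_pos by (simp add: norm_mult norm_divide divide_le_cancel)
qed

text \<open>Formally the left side is the integral of \<nu> against the function estimated by
  \<open>g\<close>, but \<nu> alone need not be integrable. Damping \<nu> near 0 gives integrable
  densities whose transforms stay bounded and converge to V after subtraction of constants; the
  constants drop out because the total mass is zero.\<close>

theorem nu_functional_bound:
 fixes V :: "R3 => real" and w :: "'i => R3 => complex" and \<phi> :: "'i => R3 => R3"
 assumes nu: "nu_rep \<nu> V n" and cont: "continuous_on UNIV V" and B: "\<And>x. \<bar>V x\<bar> \<le> B"
  and I: "finite I" and w: "\<And>i. i \<in> I ==> integrable lborel (w i)" and \<phi>[measurable]: "\<And>i. \<phi> i \<in> bmeas"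
  and tot: "(\<Sum>i\<in>I. LBINT x. w i x) = 0"
  and k: "\<And>\<eta>. norm (\<Sum>i\<in>I. LBINT x. cis (\<eta>\<bullet>\<phi> i x) * w i x) \<le> g \<eta>"
  and g: "integrable lborel (\<lambda>\<eta>. norm (\<nu> \<eta>) * g \<eta>)" "(LBINT \<eta>. norm (\<nu> \<eta>) * g \<eta>) \<le> C"
 shows "norm (\<Sum>i\<in>I. LBINT x. of_real (V (\<phi> i x)) * w i x) \<le> C"
proof -
 have [measurable]: "\<nu> \<in> bmeas" using nu by (simp add: nu_rep_def)
 have Vm[measurable]: "V \<in> bmeas" using cont by (rule borel_measurable_continuous_onI)
 have B0: "0 \<le> B" using B[of 0] by linarith
 have nu1: "integrable lborel (\<lambda>\<eta>. norm \<eta> * norm (\<nu> \<eta>))" using nu unfolding nu_rep_def by (auto dest: bspec[of _ _ 1])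
 have rep: "of_real (V x) - of_real (V y) = (LBINT \<eta>. \<nu> \<eta>*(cis (\<eta>\<bullet>x) - cis (\<eta>\<bullet>y)))" for x y
  using nu by (simp add: nu_rep_def)
 \<comment> \<open>As m grows, the cut-off tends to 1 away from the origin. It never exceeds 1, so
   the bound by \<open>g\<close> survives the damping.\<close>
 define M where "M m \<eta> = \<nu> \<eta>*(1 - gau (real (Suc m) *\<^sub>R \<eta>))" for m \<eta>
 have Mm[measurable]: "M m \<in> bmeas" for m unfolding M_def by measurable
 have Ml: "norm (M m \<eta>) \<le> norm (\<nu> \<eta>)" for m \<eta>
  unfolding M_def norm_mult by (rule mult_left_le) (use norm_one_minus_gau_le1 in auto)
 define S where "S m x = (LBINT \<eta>. M m \<eta> * cis (\<eta>\<bullet>x))" for m x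
 note S1 = nu_rep_mollified[OF nu cont B, of "real (Suc m)" for m]
 have Sb: "norm (S m x) \<le> 2 * B" for m x unfolding S_def M_def by (rule S1(1)) simp
 have Si: "integrable lborel (\<lambda>\<eta>. M m \<eta>)" for m unfolding M_def by (rule S1(2)) simp
 have Sm[measurable]: "S m \<in> bmeas" for m unfolding S_def by measurable
 have Slim: "(\<lambda>m. S m x - S m 0) \<longlonglongrightarrow> of_real (V x) - of_real (V 0)" for x
 proof -
  have e: "S m x - S m 0 = (LBINT \<eta>. M m \<eta>*(cis (\<eta>\<bullet>x) - cis (\<eta>\<bullet>0)))" for m
  proof -
   have i: "integrable lborel (\<lambda>\<eta>. M m \<eta> * cis (\<eta>\<bullet>y))" for y
    using integrable_cis_mult[OF _ Si[of m], of "\<lambda>\<eta>. \<eta>\<bullet>y"] by (simp add: mult.commute)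
   show ?thesis unfolding S_def right_diff_distrib[of _ "cis _"] by (rule Bochner_Integration.integral_diff[symmetric]) (rule i)+
  qed
  show ?thesis unfolding e rep
  proof (rule integral_dominated_convergence)
   show "integrable lborel (\<lambda>\<eta>. norm x*(norm \<eta> * norm (\<nu> \<eta>)))" using nu1 by (rule integrable_mult_right)
   show "AE \<eta> in lborel. (\<lambda>m. M m \<eta>*(cis (\<eta>\<bullet>x) - cis (\<eta>\<bullet>0))) \<longlonglongrightarrow> \<nu> \<eta>*(cis (\<eta>\<bullet>x) - cis (\<eta>\<bullet>0))"
    using AE_lborel_singleton[of "0::R3"]
   proof eventually_elim
    case (elim \<eta>)
    have "filterlim (\<lambda>m. (real (Suc m) * norm \<eta>)\<^sup>2/2) at_top sequentially"
    proof -
     have "filterlim (\<lambda>m. real (Suc m)) at_top sequentially"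
      by (rule filterlim_compose[OF filterlim_real_sequentially filterlim_Suc])
     hence "filterlim (\<lambda>m. norm \<eta> * real (Suc m)) at_top sequentially"
      using elim by (intro filterlim_tendsto_pos_mult_at_top[OF tendsto_const]) auto
     from filterlim_pow_at_top[OF _ this, of 2] have "filterlim (\<lambda>m. (1/2)*(norm \<eta> * real (Suc m))^2) at_top sequentially"
      by (intro filterlim_tendsto_pos_mult_at_top[OF tendsto_const]) auto
     thus ?thesis by (simp add: mult.commute)
    qed
    hence "filterlim (\<lambda>m. - ((real (Suc m) * norm \<eta>)^2/2)) at_bot sequentially"
     by (simp add: filterlim_uminus_at_bot)
    from filterlim_compose[OF exp_at_bot this] have "(\<lambda>m. exp (- ((real (Suc m) * norm \<eta>)^2/2))) \<longlonglongrightarrow> 0" .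
    hence "(\<lambda>m. complex_of_real (exp (- ((real (Suc m) * norm \<eta>)^2/2)))) \<longlonglongrightarrow> of_real 0" by (rule tendsto_of_real)
    hence "(\<lambda>m. gau (real (Suc m) *\<^sub>R \<eta>)) \<longlonglongrightarrow> 0" by (simp add: gau_def)
    hence "(\<lambda>m. M m \<eta>*(cis (\<eta>\<bullet>x) - cis (\<eta>\<bullet>0))) \<longlonglongrightarrow> \<nu> \<eta>*(1 - 0)*(cis (\<eta>\<bullet>x) - cis (\<eta>\<bullet>0))"
     unfolding M_def by (intro tendsto_intros)
    thus ?case by simp
   qed
   fix m
   have "norm (M m \<eta>*(cis (\<eta>\<bullet>x) - cis (\<eta>\<bullet>0))) \<le> norm x*(norm \<eta> * norm (\<nu> \<eta>))" for \<eta>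
   proof -
    have "norm (cis (\<eta>\<bullet>x) - cis (\<eta>\<bullet>0)) \<le> norm \<eta> * norm x"
     using norm_cis_diff_le[of "\<eta>\<bullet>x" "\<eta>\<bullet>0"] Cauchy_Schwarz_ineq2[of \<eta> x] by simp
    from mult_mono[OF Ml this] show ?thesis by (simp add: norm_mult mult_ac)
   qed
   thus "AE \<eta> in lborel. norm (M m \<eta>*(cis (\<eta>\<bullet>x) - cis (\<eta>\<bullet>0))) \<le> norm x*(norm \<eta> * norm (\<nu> \<eta>))" by simp
  qed measurable
 qed
 have Swi: "integrable lborel (\<lambda>x. S m (\<phi> i x) * w i x)" if "i \<in> I" for i m
 proof (rule Bochner_Integration.integrable_bound)
  have [measurable]: "w i \<in> bmeas" using w[OF that] by auto
  show "(\<lambda>x. S m (\<phi> i x) * w i x) \<in> borel_measurable lborel" by measurable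
  show "integrable lborel (\<lambda>x. (2 * B) * norm (w i x))" using w[OF that] by auto
  show "AE x in lborel. norm (S m (\<phi> i x) * w i x) \<le> norm ((2 * B) * norm (w i x))"
   using B0 Sb by (auto simp: norm_mult abs_mult intro!: AE_I2 mult_right_mono)
 qed
 have Vwi: "integrable lborel (\<lambda>x. of_real (V (\<phi> i x)) * w i x)" if "i \<in> I" for i
 proof (rule Bochner_Integration.integrable_bound)
  have [measurable]: "w i \<in> bmeas" using w[OF that] by auto
  show "(\<lambda>x. of_real (V (\<phi> i x)) * w i x) \<in> borel_measurable lborel" by measurable
  show "integrable lborel (\<lambda>x. B * norm (w i x))" using w[OF that] by auto
  show "AE x in lborel. norm (of_real (V (\<phi> i x)) * w i x) \<le> norm (B * norm (w i x))"
   using B0 B by (auto simp: norm_mult abs_mult intro!: AE_I2 mult_right_mono)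
 qed
 have bound: "norm (\<Sum>i\<in>I. LBINT x. S m (\<phi> i x) * w i x) \<le> C" for m
 proof -
  have "(LBINT x. S m (\<phi> i x) * w i x) = (LBINT \<eta>. M m \<eta>*(LBINT x. cis (\<eta>\<bullet>\<phi> i x) * w i x))" if "i \<in> I" for i
   unfolding S_def
   by (rule kernel_Fubini(1)[OF sigma_finite_lborel sigma_finite_lborel Si w[OF that], of _ 1, symmetric]) auto
  moreover have ii: "integrable lborel (\<lambda>\<eta>. M m \<eta>*(LBINT x. cis (\<eta>\<bullet>\<phi> i x) * w i x))" if "i \<in> I" for i
   by (rule kernel_Fubini(3)[OF sigma_finite_lborel sigma_finite_lborel Si w[OF that], of _ 1]) auto
  ultimately have "(\<Sum>i\<in>I. LBINT x. S m (\<phi> i x) * w i x) = (LBINT \<eta>. M m \<eta>*(\<Sum>i\<in>I. LBINT x. cis (\<eta>\<bullet>\<phi> i x) * w i x))"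
   by (simp add: sum_distrib_left Bochner_Integration.integral_sum)
  also have "norm ... \<le> (LBINT \<eta>. norm (\<nu> \<eta>) * g \<eta>)"
  proof (rule order_trans[OF integral_norm_bound], rule integral_mono)
   show "norm (M m \<eta>*(\<Sum>i\<in>I. LBINT x. cis (\<eta>\<bullet>\<phi> i x) * w i x)) \<le> norm (\<nu> \<eta>) * g \<eta>" for \<eta>
    unfolding norm_mult by (intro mult_mono Ml k) auto
   show "integrable lborel (\<lambda>\<eta>. norm (M m \<eta>*(\<Sum>i\<in>I. LBINT x. cis (\<eta>\<bullet>\<phi> i x) * w i x)))"
    unfolding sum_distrib_left using ii by (intro integrable_norm Bochner_Integration.integrable_sum)
  qed (rule g)
  finally show ?thesis using g(2) by linarith
 qed
 have "(\<lambda>m. \<Sum>i\<in>I. LBINT x. (S m (\<phi> i x) - S m 0) * w i x) \<longlonglongrightarrow> (\<Sum>i\<in>I. LBINT x. (of_real (V (\<phi> i x)) - of_real (V 0)) * w i x)"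
 proof (rule tendsto_sum)
  fix i assume i: "i \<in> I"
  have [measurable]: "w i \<in> bmeas" using w[OF i] by auto
  show "(\<lambda>m. LBINT x. (S m (\<phi> i x) - S m 0) * w i x) \<longlonglongrightarrow> (LBINT x. (of_real (V (\<phi> i x)) - of_real (V 0)) * w i x)"
  proof (rule integral_dominated_convergence)
   show "integrable lborel (\<lambda>x. (4 * B) * norm (w i x))" using w[OF i] by auto
   show "AE x in lborel. (\<lambda>m. (S m (\<phi> i x) - S m 0) * w i x) \<longlonglongrightarrow> (of_real (V (\<phi> i x)) - of_real (V 0)) * w i x"
    by (intro AE_I2 tendsto_mult Slim tendsto_const)
   fix m
   have "norm (S m y - S m 0) \<le> 4 * B" for y using norm_triangle_ineq4[of "S m y" "S m 0"] Sb[of m y] Sb[of m 0] by linarith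
   thus "AE x in lborel. norm ((S m (\<phi> i x) - S m 0) * w i x) \<le> (4 * B) * norm (w i x)"
    by (auto simp: norm_mult intro!: AE_I2 mult_right_mono)
  qed measurable
 qed
 \<comment> \<open>Only differences of \<open>S m\<close> are known to converge; vanishing total
   mass allows the value at 0 to be subtracted without changing the sum.\<close>
 moreover have "(\<Sum>i\<in>I. LBINT x. (S m (\<phi> i x) - S m 0) * w i x) = (\<Sum>i\<in>I. LBINT x. S m (\<phi> i x) * w i x)" for m
 proof -
  have "(\<Sum>i\<in>I. LBINT x. (S m (\<phi> i x) - S m 0) * w i x) = (\<Sum>i\<in>I. (LBINT x. S m (\<phi> i x) * w i x) - S m 0*(LBINT x. w i x))"
   using Swi w by (intro sum.cong refl) (simp add: left_diff_distrib)
  thus ?thesis by (simp add: sum_subtractf sum_distrib_left[symmetric] tot)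
 qed
 moreover have "(\<Sum>i\<in>I. LBINT x. (of_real (V (\<phi> i x)) - of_real (V 0)) * w i x) = (\<Sum>i\<in>I. LBINT x. of_real (V (\<phi> i x)) * w i x)"
 proof -
  have "(\<Sum>i\<in>I. LBINT x. (of_real (V (\<phi> i x)) - of_real (V 0)) * w i x) = (\<Sum>i\<in>I. (LBINT x. of_real (V (\<phi> i x)) * w i x) - of_real (V 0)*(LBINT x. w i x))"
   using Vwi w by (intro sum.cong refl) (simp add: left_diff_distrib)
  thus ?thesis by (simp add: sum_subtractf sum_distrib_left[symmetric] tot)
 qed
 ultimately have "(\<lambda>m. \<Sum>i\<in>I. LBINT x. S m (\<phi> i x) * w i x) \<longlonglongrightarrow> (\<Sum>i\<in>I. LBINT x. of_real (V (\<phi> i x)) * w i x)" by simp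
 from LIMSEQ_le_const2[OF tendsto_norm[OF this]] show ?thesis using bound by blast
qed

section \<open>The generator at a fixed time\<close>

lemma norm_cis_minus_1_le: "norm (cis a - 1) \<le> \<bar>a\<bar>"
 using norm_cis_diff_le[of a 0] by simp

lemma norm_cis_minus_1_le2: "norm (cis a - 1) \<le> 2"
 using norm_cis_diff_le2[of a 0] by simp

text \<open>One instant of time: \<tau> stands for t h and \<Omega>(\<xi>) for \<Psi>(t, h \<xi>).
  \<open>L1\<close>, \<open>L2\<close>, \<open>L3\<close> bound differences of \<Omega> of orders 1,
  2 and 3, one increment of which is always \<eta>: the generator contains only \<Omega>(\<xi>) -
  \<Omega>(\<xi> - \<eta>), and translations act on that.\<close>

locale slice =
 fixes h \<tau> :: real and V \<Omega> :: "R3 => real" and \<nu> :: "R3 => complex" and n :: "nat => real" and Bd L1 L2 L3 :: real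
 assumes h: "h > 0" and \<tau>: "\<tau> \<ge> 0" and nu: "nu_rep \<nu> V n" and contV: "continuous_on UNIV V" and Bd: "\<And>x. \<bar>V x\<bar> \<le> Bd"
  and \<Omega>m[measurable]: "\<Omega> \<in> bmeas"
  and L1: "\<And>\<xi> \<eta>. \<bar>\<Omega> \<xi> - \<Omega> (\<xi> - \<eta>)\<bar> \<le> L1 * norm \<eta>"
  and L2: "\<And>\<xi> a \<eta>. \<bar>\<Omega> (\<xi> + a) - \<Omega> (\<xi> + a - \<eta>) - (\<Omega> \<xi> - \<Omega> (\<xi> - \<eta>))\<bar> \<le> L2*(norm a * norm \<eta>)"
  and L3: "\<And>\<xi> a b \<eta>. \<bar>(\<Omega> (\<xi> + (a + b)) - \<Omega> (\<xi> + (a + b) - \<eta>)) - (\<Omega> (\<xi> + a) - \<Omega> (\<xi> + a - \<eta>)) - (\<Omega> (\<xi> + b) - \<Omega> (\<xi> + b - \<eta>)) + (\<Omega> \<xi> - \<Omega> (\<xi> - \<eta>))\<bar> \<le> L3*(norm a * norm b * norm \<eta>)"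
  and Lpos: "L1 \<ge> 0" "L2 \<ge> 0" "L3 \<ge> 0"
begin

section \<open>The conjugated potential and the integrand of the generator\<close>

lemma Vm[measurable]: "V \<in> bmeas" using contV by (rule borel_measurable_continuous_onI)

definition \<theta> :: "R3 => real" where "\<theta> \<xi> = \<Omega> \<xi> + \<tau>*(norm \<xi>)^2/2"

lemma \<theta>m[measurable]: "\<theta> \<in> bmeas" unfolding \<theta>_def by measurable

text \<open>The point \<open>c\<close> records by how much the symbols have been translated; the
  generator itself is \<open>Hc 0\<close>. \<open>pp\<close> undoes the translated phase and returns
  to the space variable, where V acts by multiplication.\<close>

definition pp :: "R3 => l2 => l2" where "pp c v = Fi (Mul (\<lambda>\<xi>. cis (- \<theta> (\<xi> + c))) v)"
definition mV :: "R3 => R3 => complex" where "mV c \<xi> = of_real (V (\<tau> *\<^sub>R (\<xi> + c)))"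
definition cV :: "R3 => complex" where "cV x = of_real (V x)"
definition Bc :: "R3 => l2 => l2" where
 "Bc c v = Mul (\<lambda>\<xi>. cis (\<theta> (\<xi> + c))) (Ft (Mul cV (pp c v)))"
definition Hc :: "R3 => l2 => l2" where
 "Hc c v = cmul (- \<i>/of_real h) (Bc c v - Mul (mV c) v)"

text \<open>Under the conjugation a plane wave e^(i\<eta>x) becomes translation by \<eta> times the
  unimodular factors \<open>ep\<close> and \<open>dd\<close>. The factor \<open>ep\<close> is the
  plane wave of V(\<tau>(\<xi> + c)), and \<open>dd\<close> collects what tends to 1 with \<eta>.
  Formally \<open>Hc c\<close> is -i/h times the integral of \<nu>(\<eta>)
  \<open>Kc c \<eta>\<close>.\<close>

definition ep :: "R3 => R3 => R3 => complex" where "ep c \<eta> \<xi> = cis (\<tau>*(\<eta>\<bullet>(\<xi> + c)))"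
definition dd :: "R3 => R3 => R3 => complex" where
 "dd c \<eta> \<xi> = cis (\<Omega> (\<xi> + c) - \<Omega> (\<xi> + c - \<eta>) - \<tau>*(norm \<eta>)^2/2)"
definition Rc :: "R3 => R3 => l2 => l2" where "Rc c \<eta> z = Mul (dd c \<eta>) (Shift (- \<eta>) z)"
definition Kc :: "R3 => R3 => l2 => l2" where "Kc c \<eta> z = Mul (ep c \<eta>) (Rc c \<eta> z - z)"

lemma bm_cV[simp]: "bm cV" unfolding cV_def[abs_def] by (rule bmI[where C=Bd]) (use Bd in auto)
lemma bm_mV[simp]: "bm (mV c)" unfolding mV_def[abs_def] by (rule bmI[where C=Bd]) (use Bd in auto)
lemma bm_ct[simp]: "bm (\<lambda>\<xi>. cis (\<theta> (\<xi> + c)))" "bm (\<lambda>\<xi>. cis (- \<theta> (\<xi> + c)))" by (rule bm_cis, measurable)+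
lemma bm_ep[simp]: "bm (ep c \<eta>)" unfolding ep_def[abs_def] by (rule bm_cis) measurable
lemma bm_dd[simp]: "bm (dd c \<eta>)" unfolding dd_def[abs_def] by (rule bm_cis) measurable

lemma cip_pp: "cip (pp c u) (pp c v) = cip u v"
 unfolding pp_def cip_Fi by (simp add: cip_Mul Mul_Mul cis_cnj cis_mult)

lemma cip_Bc: "cip y (Bc c z) = cip (pp c y) (Mul cV (pp c z))"
proof -
 have "cip y (Bc c z) = cip (Mul (\<lambda>\<xi>. cis (- \<theta> (\<xi> + c))) y) (Ft (Mul cV (pp c z)))"
  unfolding Bc_def by (simp add: cip_Mul cis_cnj)
 thus ?thesis by (simp add: cip_Ft_right pp_def)
qed

lemma cip_Hc: "cip y (Hc c z) = (- \<i>/of_real h) *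
  ((LBINT x. of_real (V x)*(cnj (rep (pp c y) x) * rep (pp c z) x))
  - (LBINT \<xi>. of_real (V (\<tau> *\<^sub>R (\<xi> + c)))*(cnj (rep y \<xi>) * rep z \<xi>)))"
 unfolding Hc_def cip_cmul_right cip_diff_right cip_Bc cip_Mul_right[OF bm_cV] cip_Mul_right[OF bm_mV] cV_def mV_def
 by (simp add: mult_ac)

text \<open>A plane wave acts in the Fourier variable as translation by \<eta>. Expanding |\<xi> + c
  - \<eta>|^2 splits the change of the kinetic phase into a part linear in \<xi>, which is
  \<open>ep\<close>, and a constant that joins the change of \<Omega> in \<open>dd\<close>.\<close>

lemma cip_pp_mod: "cip (pp c y) (Mul (\<lambda>x. cis (\<eta>\<bullet>x)) (pp c z)) = cip y (Mul (ep c \<eta>) (Rc c \<eta> z))"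
proof -
 have e: "cis (\<theta> (\<xi> + c)) * cis (- \<theta> (\<xi> + - \<eta> + c)) = ep c \<eta> \<xi> * dd c \<eta> \<xi>" for \<xi>
 proof -
  have n: "(norm (\<xi> + c - \<eta>))^2 = (norm (\<xi> + c))^2 - 2*(\<eta>\<bullet>(\<xi> + c)) + (norm \<eta>)^2"
   by (simp add: power2_norm_eq_inner inner_diff_left inner_diff_right inner_commute)
  have "\<xi> + - \<eta> + c = \<xi> + c - \<eta>" by simp
  hence "\<theta> (\<xi> + c) + - \<theta> (\<xi> + - \<eta> + c) = \<tau>*(\<eta>\<bullet>(\<xi> + c)) + (\<Omega> (\<xi> + c) - \<Omega> (\<xi> + c - \<eta>) - \<tau>*(norm \<eta>)^2/2)"
   unfolding \<theta>_def by (simp only: n) (simp add: field_simps)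
  thus ?thesis by (simp only: ep_def dd_def cis_mult)
 qed
 have s: "bm (\<lambda>\<xi>. cis (- \<theta> (\<xi> + - \<eta> + c)))" by (rule bm_cis) measurable
 have "cip (pp c y) (Mul (\<lambda>x. cis (\<eta>\<bullet>x)) (pp c z)) = cip (Mul (\<lambda>\<xi>. cis (- \<theta> (\<xi> + c))) y) (Ft (Mul (\<lambda>x. cis (\<eta>\<bullet>x)) (pp c z)))"
  unfolding pp_def cip_Ft_right ..
 also have "... = cip y (Mul (\<lambda>\<xi>. cis (\<theta> (\<xi> + c))) (Ft (Mul (\<lambda>x. cis (\<eta>\<bullet>x)) (pp c z))))"
  by (simp add: cip_Mul cis_cnj)
 also have "Ft (Mul (\<lambda>x. cis (\<eta>\<bullet>x)) (pp c z)) = Mul (\<lambda>\<xi>. cis (- \<theta> (\<xi> + - \<eta> + c))) (Shift (- \<eta>) z)"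
  unfolding Ft_modulate pp_def by (simp add: Shift_Mul)
 also have "Mul (\<lambda>\<xi>. cis (\<theta> (\<xi> + c))) ... = Mul (ep c \<eta>) (Rc c \<eta> z)"
  unfolding Rc_def using s by (simp add: Mul_Mul e del: add_uminus_conv_diff)
 finally show ?thesis .
qed

text \<open>By duality and \<open>nu_functional_bound\<close> an estimate for generators is reduced
  to a pointwise one in \<eta> for \<open>Kc\<close>. The total mass vanishes because both terms of
  each generator have the same integral: the phases and the Fourier transform are unitary.\<close>

lemma Hc_combination_bound:
 fixes I :: "'i set" and \<sigma> :: "'i => real" and c :: "'i => R3"
 assumes I: "finite I" and K: "\<And>\<eta>. norm (\<Sum>i\<in>I. \<sigma> i *\<^sub>R Kc (c i) \<eta> z) \<le> g \<eta>"
  and g: "integrable lborel (\<lambda>\<eta>. norm (\<nu> \<eta>) * g \<eta>)" "(LBINT \<eta>. norm (\<nu> \<eta>) * g \<eta>) \<le> C"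
 shows "norm (\<Sum>i\<in>I. \<sigma> i *\<^sub>R Hc (c i) z) \<le> C/h"
proof (rule norm_le_by_cip)
 have C0: "0 \<le> C"
 proof -
  have "0 \<le> (LBINT \<eta>. norm (\<nu> \<eta>) * g \<eta>)"
   using order_trans[OF norm_ge_zero K] by (intro integral_nonneg_AE AE_I2) auto
  thus ?thesis using g(2) by linarith
 qed
 show "0 \<le> C/h" using C0 h by simp
 fix y
 \<comment> \<open>The flag distinguishes the two terms of a generator: \<open>True\<close> is the
   conjugated potential, where V is evaluated at x, and \<open>False\<close> the subtracted
   multiplication, where it is evaluated at \<tau>(x + c).\<close>
 define w where "w = (\<lambda>(i, b) x. if b then of_real (\<sigma> i)*(cnj (rep (pp (c i) y) x) * rep (pp (c i) z) x) else - of_real (\<sigma> i)*(cnj (rep y x) * rep z x))"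
 define \<phi> where "\<phi> = (\<lambda>(i, b) x. if b then x else \<tau> *\<^sub>R (x + c i))"
 have wi: "integrable lborel (w j)" for j
  by (cases j, cases "snd j") (simp_all add: w_def cip_integrable)
 have \<phi>m: "\<phi> j \<in> bmeas" for j
  by (cases j, cases "snd j") (simp_all add: \<phi>_def)
 have sum2: "(\<Sum>j\<in>I \<times> UNIV. F j) = (\<Sum>i\<in>I. F (i, True) + F (i, False))" for F :: "'i \<times> bool => complex"
 proof -
  have "(\<Sum>i\<in>I. \<Sum>b\<in>UNIV. F (i, b)) = (\<Sum>(i, b)\<in>I \<times> UNIV. F (i, b))" by (rule sum.cartesian_product)
  thus ?thesis by (simp add: UNIV_bool add.commute)
 qed
 have tot: "(\<Sum>j\<in>I \<times> UNIV. LBINT x. w j x) = 0"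
  unfolding sum2 w_def by (simp add: cip_def[symmetric] cip_pp)
 have kk: "(\<Sum>j\<in>I \<times> UNIV. LBINT x. cis (\<eta>\<bullet>\<phi> j x) * w j x) = cip y (\<Sum>i\<in>I. \<sigma> i *\<^sub>R Kc (c i) \<eta> z)" for \<eta>
 proof -
  have bmc: "bm (\<lambda>x. cis (\<eta>\<bullet>x))" by (rule bm_cis) measurable
  have a: "(LBINT x. cis (\<eta>\<bullet>\<phi> (i, True) x) * w (i, True) x) = of_real (\<sigma> i) * cip (pp (c i) y) (Mul (\<lambda>x. cis (\<eta>\<bullet>x)) (pp (c i) z))" for i
   unfolding cip_Mul_right[OF bmc] integral_mult_right_zero[symmetric] by (simp add: \<phi>_def w_def mult_ac)
  have b: "(LBINT x. cis (\<eta>\<bullet>\<phi> (i, False) x) * w (i, False) x) = - (of_real (\<sigma> i) * cip y (Mul (ep (c i) \<eta>) z))" for i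
  proof -
   have "(LBINT x. cis (\<eta>\<bullet>\<phi> (i, False) x) * w (i, False) x) = (LBINT x. (- of_real (\<sigma> i))*(cnj (rep y x)*(ep (c i) \<eta> x * rep z x)))"
    by (simp add: \<phi>_def w_def ep_def mult_ac inner_scaleR_right)
   thus ?thesis unfolding integral_mult_right_zero cip_Mul_right[OF bm_ep] by simp
  qed
  have "(\<Sum>j\<in>I \<times> UNIV. LBINT x. cis (\<eta>\<bullet>\<phi> j x) * w j x) = (\<Sum>i\<in>I. of_real (\<sigma> i)*(cip y (Mul (ep (c i) \<eta>) (Rc (c i) \<eta> z)) - cip y (Mul (ep (c i) \<eta>) z)))"
   unfolding sum2 a b cip_pp_mod by (simp add: right_diff_distrib)
  also have "... = (\<Sum>i\<in>I. cip y (\<sigma> i *\<^sub>R Kc (c i) \<eta> z))"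
   by (simp add: Kc_def cip_scaleR_right Mul_diff cip_diff_right)
  also have "... = cip y (\<Sum>i\<in>I. \<sigma> i *\<^sub>R Kc (c i) \<eta> z)"
   by (rule linear_sum[OF bounded_linear.linear[OF bounded_linear_cip_right], symmetric])
  finally show ?thesis .
 qed
 have "norm (\<Sum>j\<in>I \<times> UNIV. LBINT x. of_real (V (\<phi> j x)) * w j x) \<le> norm y * C"
 proof (rule nu_functional_bound[OF nu contV Bd _ wi \<phi>m tot])
  show "finite (I \<times> (UNIV :: bool set))" using I by simp
  show "norm (\<Sum>j\<in>I \<times> UNIV. LBINT x. cis (\<eta>\<bullet>\<phi> j x) * w j x) \<le> norm y * g \<eta>" for \<eta>
   unfolding kk using cip_norm_le[of y "\<Sum>i\<in>I. \<sigma> i *\<^sub>R Kc (c i) \<eta> z"] mult_left_mono[OF K norm_ge_zero[of y]] by (rule order_trans)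
  have e: "norm (\<nu> \<eta>)*(norm y * g \<eta>) = norm y*(norm (\<nu> \<eta>) * g \<eta>)" for \<eta> by simp
  show "integrable lborel (\<lambda>\<eta>. norm (\<nu> \<eta>)*(norm y * g \<eta>))" unfolding e using g(1) by (rule integrable_mult_right)
  show "(LBINT \<eta>. norm (\<nu> \<eta>)*(norm y * g \<eta>)) \<le> norm y * C"
   unfolding e integral_mult_right_zero using g(2) by (rule mult_left_mono) simp
 qed
 moreover have "cip y (\<Sum>i\<in>I. \<sigma> i *\<^sub>R Hc (c i) z) = (- \<i>/of_real h)*(\<Sum>j\<in>I \<times> UNIV. LBINT x. of_real (V (\<phi> j x)) * w j x)"
 proof -
  have "cip y (\<Sum>i\<in>I. \<sigma> i *\<^sub>R Hc (c i) z) = (\<Sum>i\<in>I. of_real (\<sigma> i) * cip y (Hc (c i) z))"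
   unfolding linear_sum[OF bounded_linear.linear[OF bounded_linear_cip_right]] by (simp add: cip_scaleR_right)
  also have "... = (\<Sum>i\<in>I. (- \<i>/of_real h)*((LBINT x. of_real (V (\<phi> (i, True) x)) * w (i, True) x) + (LBINT x. of_real (V (\<phi> (i, False) x)) * w (i, False) x)))"
  proof (intro sum.cong refl)
   fix i
   have a: "(LBINT x. of_real (V (\<phi> (i, True) x)) * w (i, True) x) = of_real (\<sigma> i)*(LBINT x. of_real (V x)*(cnj (rep (pp (c i) y) x) * rep (pp (c i) z) x))"
    unfolding integral_mult_right_zero[symmetric] by (simp add: \<phi>_def w_def mult_ac)
   have b: "(LBINT x. of_real (V (\<phi> (i, False) x)) * w (i, False) x) = (- of_real (\<sigma> i))*(LBINT x. of_real (V (\<tau> *\<^sub>R (x + c i)))*(cnj (rep y x) * rep z x))"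
    unfolding integral_mult_right_zero[symmetric] by (simp add: \<phi>_def w_def mult_ac)
   show "of_real (\<sigma> i) * cip y (Hc (c i) z) = (- \<i>/of_real h)*((LBINT x. of_real (V (\<phi> (i, True) x)) * w (i, True) x) + (LBINT x. of_real (V (\<phi> (i, False) x)) * w (i, False) x))"
    unfolding a b cip_Hc by (simp add: algebra_simps)
  qed
  also have "... = (- \<i>/of_real h)*(\<Sum>j\<in>I \<times> UNIV. LBINT x. of_real (V (\<phi> j x)) * w j x)"
   unfolding sum2 sum_distrib_left ..
  finally show ?thesis .
 qed
 ultimately have "norm (cip y (\<Sum>i\<in>I. \<sigma> i *\<^sub>R Hc (c i) z)) \<le> (1/h)*(norm y * C)"
  using h by (simp add: norm_mult norm_divide divide_right_mono)
 thus "norm (cip y (\<Sum>i\<in>I. \<sigma> i *\<^sub>R Hc (c i) z)) \<le> C/h * norm y" by (simp add: mult.commute)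
qed

subsection \<open>Elementary properties\<close>

lemma bounded_linear_pp: "bounded_linear (pp c)"
 unfolding pp_def[abs_def] by (rule bounded_linear_compose[OF bounded_linear_Fi bounded_linear_Mul]) simp

lemma bounded_linear_Hc: "bounded_linear (Hc c)"
proof -
 have "bounded_linear (\<lambda>v. Bc c v - Mul (mV c) v)"
  unfolding Bc_def[abs_def]
  by (intro bounded_linear_sub bounded_linear_Mul bm_mV
    bounded_linear_compose[OF bounded_linear_Mul[OF bm_ct(1)] bounded_linear_compose[OF bounded_linear_Ft bounded_linear_compose[OF bounded_linear_Mul[OF bm_cV] bounded_linear_pp]]])
 thus ?thesis unfolding Hc_def[abs_def] by (rule bounded_linear_compose[OF bounded_linear_cmul])
qed

lemma Hc_diff: "Hc c (u - v) = Hc c u - Hc c v"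
 by (rule linear_diff[OF bounded_linear.linear[OF bounded_linear_Hc]])

lemma Hc_skew: "inner v (Hc c v) = 0"
proof -
 have r: "Im (cip u (Mul m u)) = 0" if "bm m" "\<And>x. cnj (m x) = m x" for u m
 proof -
  have "cnj (cip u (Mul m u)) = cip u (Mul m u)" using that by (simp add: cip_cnj cip_Mul)
  thus ?thesis by (metis complex_In_mult_cnj_zero Im_complex_of_real Reals_cnj_iff complex_is_Real_iff)
 qed
 have "Im (cip v (Bc c v)) = 0" unfolding cip_Bc by (rule r) (auto simp: cV_def)
 moreover have "Im (cip v (Mul (mV c) v)) = 0" by (rule r) (auto simp: mV_def)
 ultimately show ?thesis using h by (simp add: inner_l2_def Hc_def cip_cmul_right cip_diff_right Re_divide)
qed

text \<open>Translation in the Fourier variable is modulation in the space variable and commutes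
  with multiplication by V; only the phases and the symbol of the subtracted term move.\<close>

lemma Shift_Hc: "Shift a (Hc c v) = Hc (c + a) (Shift a v)"
proof (rule l2_eq_by_cip)
 fix y
 have ps: "pp (c + a) (Shift a u) = Mul (\<lambda>x. cis ((- a)\<bullet>x)) (pp c u)" for u
 proof -
  have "Mul (\<lambda>\<xi>. cis (- \<theta> (\<xi> + (c + a)))) (Shift a u) = Shift a (Mul (\<lambda>\<xi>. cis (- \<theta> (\<xi> + c))) u)"
   by (simp add: Shift_Mul add_ac)
  also have "... = Ft (Mul (\<lambda>x. cis ((- a)\<bullet>x)) (pp c u))"
   unfolding Ft_modulate pp_def by simp
  finally show ?thesis unfolding pp_def[of "c + a"] by simp
 qed
 have bma: "bm (\<lambda>x. cis ((- a)\<bullet>x))" by (rule bm_cis) measurable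
 have B: "cip (Shift a u) (Bc (c + a) (Shift a v)) = cip u (Bc c v)" for u
 proof -
  define q where "q x = cis ((- a)\<bullet>x)" for x
  have bq: "bm q" using bma by (simp add: q_def[abs_def])
  have "cip (Mul q (pp c u)) (Mul cV (Mul q (pp c v))) = cip (pp c u) (Mul (\<lambda>x. cnj (q x)) (Mul (\<lambda>x. cV x * q x) (pp c v)))"
   by (simp add: cip_Mul bq Mul_Mul)
  also have "... = cip (pp c u) (Mul (\<lambda>x. cnj (q x)*(cV x * q x)) (pp c v))"
   by (subst Mul_Mul) (simp_all add: bq bm_cnj bm_mult)
  also have "(\<lambda>x. cnj (q x)*(cV x * q x)) = cV"
   by (simp add: fun_eq_iff q_def cis_cnj mult.left_commute[of _ "cV _"] cis_mult)
  finally show ?thesis unfolding cip_Bc ps q_def[abs_def] .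
 qed
 have M: "Shift a (Mul (mV c) v) = Mul (mV (c + a)) (Shift a v)"
  unfolding Shift_Mul[OF bm_mV] by (simp add: mV_def[abs_def] add_ac)
 have "cip (Shift a (Shift (- a) y)) (Bc (c + a) (Shift a v)) = cip (Shift (- a) y) (Bc c v)" by (rule B)
 hence "cip y (Bc (c + a) (Shift a v)) = cip y (Shift a (Bc c v))" by (simp add: cip_Shift_right)
 thus "cip y (Shift a (Hc c v)) = cip y (Hc (c + a) (Shift a v))"
  unfolding Hc_def Shift_cmul Shift_diff M by (simp add: cip_cmul_right cip_diff_right)
qed

subsection \<open>Commutators with translations\<close>

lemma Rc_Shift: "Rc c \<eta> (Shift c v) = Shift c (Rc 0 \<eta> v)"
proof -
 have "dd c \<eta> = (\<lambda>x. dd 0 \<eta> (x + c))" by (simp add: dd_def fun_eq_iff)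
 thus ?thesis unfolding Rc_def Shift_Mul[OF bm_dd] by (simp add: add.commute)
qed

lemma norm_Rc_Shift: "norm (Rc c \<eta> (Shift c v) - Shift c v) = norm (Rc 0 \<eta> v - v)"
 unfolding Rc_Shift Shift_diff[symmetric] norm_Shift ..

lemma ep_diff: "norm (ep a \<eta> \<xi> - ep 0 \<eta> \<xi>) \<le> \<tau>*(norm \<eta> * norm a)"
proof -
 have "norm (ep a \<eta> \<xi> - ep 0 \<eta> \<xi>) \<le> \<bar>\<tau>*(\<eta>\<bullet>(\<xi> + a)) - \<tau>*(\<eta>\<bullet>(\<xi> + 0))\<bar>" unfolding ep_def by (rule norm_cis_diff_le)
 also have "... = \<tau>*\<bar>\<eta>\<bullet>a\<bar>" using \<tau> by (simp add: inner_add_right right_diff_distrib[symmetric] abs_mult)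
 also have "... \<le> \<tau>*(norm \<eta> * norm a)" using \<tau> by (intro mult_left_mono Cauchy_Schwarz_ineq2)
 finally show ?thesis .
qed

lemma dd_diff: "norm (dd (c + a) \<eta> \<xi> - dd c \<eta> \<xi>) \<le> L2*(norm a * norm \<eta>)"
proof -
 have "norm (dd (c + a) \<eta> \<xi> - dd c \<eta> \<xi>) \<le> \<bar>(\<Omega> (\<xi> + (c + a)) - \<Omega> (\<xi> + (c + a) - \<eta>) - \<tau>*(norm \<eta>)^2/2) - (\<Omega> (\<xi> + c) - \<Omega> (\<xi> + c - \<eta>) - \<tau>*(norm \<eta>)^2/2)\<bar>"
  unfolding dd_def by (rule norm_cis_diff_le)
 also have "... \<le> L2*(norm a * norm \<eta>)" using L2[of "\<xi> + c" a \<eta>] by (simp add: add.assoc)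
 finally show ?thesis .
qed

lemma Rc_diff: "norm (Rc (c + a) \<eta> z - Rc c \<eta> z) \<le> L2*(norm a * norm \<eta>) * norm z"
 unfolding Rc_def
 by (subst Mul_diff_fun, simp, simp, rule order_trans[OF norm_Mul_le[where C="L2*(norm a * norm \<eta>)"]]) (auto intro: bm_diff dd_diff)

text \<open>Product rule. A difference of \<open>ep\<close> costs \<tau> |\<eta>| |a| and keeps the
  small factor, \<open>Rc\<close> minus the identity; a difference of \<open>dd\<close> costs
  \<open>L2\<close>. The vector is translated by the same a, so that the small factor can be
  evaluated at v itself.\<close>

lemma Kc_first:
 "norm (Kc a \<eta> (Shift a v) - Kc 0 \<eta> (Shift a v)) \<le> norm a*(\<tau>*(norm \<eta> * norm (Rc 0 \<eta> v - v)) + L2 * norm \<eta> * norm v)"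
proof -
 let ?z = "Shift a v"
 have "Kc a \<eta> ?z - Kc 0 \<eta> ?z = Mul (\<lambda>\<xi>. ep a \<eta> \<xi> - ep 0 \<eta> \<xi>) (Rc a \<eta> ?z - ?z) + Mul (ep 0 \<eta>) (Rc a \<eta> ?z - Rc 0 \<eta> ?z)"
  unfolding Kc_def by (simp add: Mul_diff_fun[symmetric] Mul_diff)
 also have "norm ... \<le> \<tau>*(norm \<eta> * norm a) * norm (Rc 0 \<eta> v - v) + L2*(norm a * norm \<eta>) * norm v"
 proof (rule norm_triangle_mono)
  show "norm (Mul (\<lambda>\<xi>. ep a \<eta> \<xi> - ep 0 \<eta> \<xi>) (Rc a \<eta> ?z - ?z)) \<le> \<tau>*(norm \<eta> * norm a) * norm (Rc 0 \<eta> v - v)"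
   using norm_Mul_le[of "\<lambda>\<xi>. ep a \<eta> \<xi> - ep 0 \<eta> \<xi>" "\<tau>*(norm \<eta> * norm a)" "Rc a \<eta> ?z - ?z"]
   by (simp add: bm_diff ep_diff norm_Rc_Shift)
  have "norm (Mul (ep 0 \<eta>) (Rc a \<eta> ?z - Rc 0 \<eta> ?z)) = norm (Rc a \<eta> ?z - Rc 0 \<eta> ?z)"
   by (rule norm_Mul_unit) (auto simp: ep_def)
  thus "norm (Mul (ep 0 \<eta>) (Rc a \<eta> ?z - Rc 0 \<eta> ?z)) \<le> L2*(norm a * norm \<eta>) * norm v"
   using Rc_diff[of 0 a \<eta> ?z] by simp
 qed
 finally show ?thesis by (simp add: algebra_simps)
qed

lemma dd_second:
 "norm (dd (a + b) \<eta> \<xi> - dd a \<eta> \<xi> - dd b \<eta> \<xi> + dd 0 \<eta> \<xi>) \<le> norm a * norm b*(L3 * norm \<eta> + L2\<^sup>2*(norm \<eta>)^2)"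
proof -
 define w where "w c = \<Omega> (\<xi> + c) - \<Omega> (\<xi> + c - \<eta>)" for c
 define s where "s = \<tau>*(norm \<eta>)^2/2"
 have dw: "dd c \<eta> \<xi> = cis (w c - s)" for c by (simp add: dd_def w_def s_def)
 have a: "\<bar>w a - w 0\<bar> \<le> L2*(norm a * norm \<eta>)" for a using L2[of \<xi> a \<eta>] by (simp add: w_def)
 \<comment> \<open>Relative to the phase at c = 0, the second difference of exponentials is the
   defect of additivity of the phase plus a product of two first differences; the former is paid by
   \<open>L3\<close>, the latter by the square of \<open>L2\<close>.\<close>
 have "dd (a + b) \<eta> \<xi> - dd a \<eta> \<xi> - dd b \<eta> \<xi> + dd 0 \<eta> \<xi>
   = cis (w 0 - s)*((cis (w (a + b) - w 0) - cis ((w a - w 0) + (w b - w 0))) + (cis (w a - w 0) - 1)*(cis (w b - w 0) - 1))"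
  unfolding dw by (simp add: algebra_simps cis_mult)
 also have "norm ... \<le> \<bar>(w (a + b) - w 0) - ((w a - w 0) + (w b - w 0))\<bar> + \<bar>w a - w 0\<bar>*\<bar>w b - w 0\<bar>"
  unfolding norm_mult norm_cis mult_1
  by (rule order_trans[OF norm_triangle_ineq], unfold norm_mult)
   (intro add_mono norm_cis_diff_le mult_mono norm_cis_minus_1_le, auto)
 also have "(w (a + b) - w 0) - ((w a - w 0) + (w b - w 0)) = w (a + b) - w a - w b + w 0" by simp
 also have "\<bar>w (a + b) - w a - w b + w 0\<bar> \<le> L3*(norm a * norm b * norm \<eta>)" using L3[of \<xi> a b \<eta>] by (simp add: w_def)
 also have "\<bar>w a - w 0\<bar>*\<bar>w b - w 0\<bar> \<le> (L2*(norm a * norm \<eta>))*(L2*(norm b * norm \<eta>))"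
  using Lpos by (intro mult_mono a) auto
 finally show ?thesis by (simp add: power2_eq_square algebra_simps)
qed

text \<open>Second-order product rule: both differences fall on \<open>ep\<close>, one on each
  factor, or both on \<open>dd\<close>. The dangerous first case has \<tau>^2 |\<eta>|^2 but keeps
  the full small factor; the others are paid by \<open>L2\<close> and \<open>L3\<close>.\<close>

lemma Kc_second:
 "norm (Kc (a + b) \<eta> (Shift (a + b) v) - Kc a \<eta> (Shift (a + b) v) - Kc b \<eta> (Shift (a + b) v) + Kc 0 \<eta> (Shift (a + b) v))
  \<le> norm a * norm b*(\<tau>\<^sup>2*((norm \<eta>)^2 * norm (Rc 0 \<eta> v - v)) + (2*\<tau> * L2*(norm \<eta>)^2 + L3 * norm \<eta> + L2\<^sup>2*(norm \<eta>)^2) * norm v)"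
proof -
 let ?z = "Shift (a + b) v"
 define P where "P c \<xi> = ep c \<eta> \<xi> - ep 0 \<eta> \<xi>" for c \<xi>
 define u where "u = Rc (a + b) \<eta> ?z - ?z"
 \<comment> \<open>The second difference of \<open>ep\<close> factorises, since its phase is
   additive in the translation.\<close>
 define E where "E \<xi> = P a \<xi>*(cis (\<tau>*(\<eta>\<bullet>b)) - 1)" for \<xi>
 have bP[simp]: "bm (P c)" for c unfolding P_def[abs_def] by (intro bm_diff bm_ep)
 have bE[simp]: "bm E" unfolding E_def[abs_def] by (intro bm_mult bP bm_const)
 have epab: "ep (a + b) \<eta> \<xi> = ep 0 \<eta> \<xi> + P a \<xi> + P b \<xi> + E \<xi>" for \<xi>
 proof -
  have "ep (a + b) \<eta> \<xi> = ep 0 \<eta> \<xi>*(cis (\<tau>*(\<eta>\<bullet>a)) * cis (\<tau>*(\<eta>\<bullet>b)))" "ep a \<eta> \<xi> = ep 0 \<eta> \<xi> * cis (\<tau>*(\<eta>\<bullet>a))" "ep b \<eta> \<xi> = ep 0 \<eta> \<xi> * cis (\<tau>*(\<eta>\<bullet>b))"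
   by (simp_all add: ep_def cis_mult inner_add_right algebra_simps)
  thus ?thesis by (simp add: P_def E_def algebra_simps)
 qed
 have e1: "Mul (ep (a + b) \<eta>) u = Mul (ep 0 \<eta>) u + Mul (P a) u + Mul (P b) u + Mul E u"
 proof -
  have "ep (a + b) \<eta> = (\<lambda>\<xi>. ep 0 \<eta> \<xi> + P a \<xi> + P b \<xi> + E \<xi>)" using epab by (rule ext)
  thus ?thesis by (simp add: Mul_add_fun bm_add)
 qed
 have e2: "Mul (ep c \<eta>) x = Mul (ep 0 \<eta>) x + Mul (P c) x" for c x
  by (simp add: Mul_add_fun P_def)
 have "Kc (a + b) \<eta> ?z - Kc a \<eta> ?z - Kc b \<eta> ?z + Kc 0 \<eta> ?z =
   Mul E u + Mul (P a) (Rc (a + b) \<eta> ?z - Rc a \<eta> ?z) + Mul (P b) (Rc (a + b) \<eta> ?z - Rc b \<eta> ?z)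
   + Mul (ep 0 \<eta>) (Mul (\<lambda>\<xi>. dd (a + b) \<eta> \<xi> - dd a \<eta> \<xi> - dd b \<eta> \<xi> + dd 0 \<eta> \<xi>) (Shift (- \<eta>) ?z))"
 proof -
  have X: "Mul (\<lambda>\<xi>. dd (a + b) \<eta> \<xi> - dd a \<eta> \<xi> - dd b \<eta> \<xi> + dd 0 \<eta> \<xi>) (Shift (- \<eta>) ?z) = Rc (a + b) \<eta> ?z - Rc a \<eta> ?z - Rc b \<eta> ?z + Rc 0 \<eta> ?z"
   unfolding Rc_def by (simp add: Mul_add_fun Mul_diff_fun bm_diff)
  show ?thesis
   unfolding X unfolding Kc_def[of "a + b"] u_def[symmetric] e1 unfolding Kc_def e2[of a] e2[of b] u_def
   by (simp add: Mul_diff Mul_add algebra_simps)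
 qed
 also have "norm ... \<le> (\<tau>\<^sup>2*(norm a * norm b*(norm \<eta>)^2)) * norm (Rc 0 \<eta> v - v)
   + (\<tau>*(norm \<eta> * norm a))*(L2*(norm b * norm \<eta>) * norm v) + (\<tau>*(norm \<eta> * norm b))*(L2*(norm a * norm \<eta>) * norm v)
   + (norm a * norm b*(L3 * norm \<eta> + L2\<^sup>2*(norm \<eta>)^2)) * norm v"
 proof (intro norm_triangle_mono)
  have nP: "norm (P c \<xi>) \<le> \<tau>*(norm \<eta> * norm c)" for c \<xi> unfolding P_def by (rule ep_diff)
  have "norm (E \<xi>) \<le> (\<tau>*(norm \<eta> * norm a))*(\<tau>*(norm \<eta> * norm b))" for \<xi>
  proof -
   have "norm (cis (\<tau>*(\<eta>\<bullet>b)) - 1) \<le> \<tau>*(norm \<eta> * norm b)"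
    using norm_cis_minus_1_le[of "\<tau>*(\<eta>\<bullet>b)"] mult_left_mono[OF Cauchy_Schwarz_ineq2[of \<eta> b] \<tau>] \<tau> by (simp add: abs_mult)
   thus ?thesis unfolding E_def norm_mult using \<tau> by (intro mult_mono nP) auto
  qed
  from norm_Mul_le[OF bE this, of u]
  show "norm (Mul E u) \<le> (\<tau>\<^sup>2*(norm a * norm b*(norm \<eta>)^2)) * norm (Rc 0 \<eta> v - v)"
   unfolding u_def norm_Rc_Shift by (simp add: power2_eq_square mult_ac)
  show "norm (Mul (P a) (Rc (a + b) \<eta> ?z - Rc a \<eta> ?z)) \<le> (\<tau>*(norm \<eta> * norm a))*(L2*(norm b * norm \<eta>) * norm v)"
   by (rule order_trans[OF norm_Mul_le[OF bP nP]], rule mult_left_mono) (use Rc_diff[of a b \<eta> ?z] \<tau> in auto)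
  show "norm (Mul (P b) (Rc (a + b) \<eta> ?z - Rc b \<eta> ?z)) \<le> (\<tau>*(norm \<eta> * norm b))*(L2*(norm a * norm \<eta>) * norm v)"
   by (rule order_trans[OF norm_Mul_le[OF bP nP]], rule mult_left_mono) (use Rc_diff[of b a \<eta> ?z] \<tau> in \<open>auto simp: add.commute\<close>)
  have "norm (Mul (ep 0 \<eta>) x) = norm x" for x by (rule norm_Mul_unit) (auto simp: ep_def)
  thus "norm (Mul (ep 0 \<eta>) (Mul (\<lambda>\<xi>. dd (a + b) \<eta> \<xi> - dd a \<eta> \<xi> - dd b \<eta> \<xi> + dd 0 \<eta> \<xi>) (Shift (- \<eta>) ?z)))
    \<le> (norm a * norm b*(L3 * norm \<eta> + L2\<^sup>2*(norm \<eta>)^2)) * norm v"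
   using norm_Mul_le[of "\<lambda>\<xi>. dd (a + b) \<eta> \<xi> - dd a \<eta> \<xi> - dd b \<eta> \<xi> + dd 0 \<eta> \<xi>" _ "Shift (- \<eta>) ?z", OF _ dd_second]
   by (simp add: bm_add bm_diff)
 qed
 finally show ?thesis by (simp add: power2_eq_square algebra_simps)
qed

lemma nu_moment: "k \<in> {1..3} ==> integrable lborel (\<lambda>\<eta>. norm (\<nu> \<eta>) * norm \<eta>^k)"
 "k \<in> {1..3} ==> (LBINT \<eta>. norm (\<nu> \<eta>) * norm \<eta>^k) \<le> n k"
 using nu by (auto simp: nu_rep_def mult.commute)

text \<open>The exponent \<open>p = 0\<close> gives bounds that depend on \<open>h\<close> and on the time but need no regularity of \<open>v\<close>;
 \<open>p = 1\<close> gives the uniform ones.\<close>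

theorem commutator_bounds:
 assumes p: "p \<in> {0, 1}" and r: "\<And>\<eta>. norm (Rc 0 \<eta> v - v) \<le> \<rho> * norm \<eta>^p" and \<rho>: "\<rho> \<ge> 0"
 shows "norm (Hc a (Shift a v) - Hc 0 (Shift a v)) \<le> norm a*((\<tau>*\<rho> * n (Suc p) + L2 * norm v * n 1)/h)"
  and "norm (Hc (a + b) (Shift (a + b) v) - Hc a (Shift (a + b) v) - Hc b (Shift (a + b) v) + Hc 0 (Shift (a + b) v))
   \<le> norm a * norm b*((\<tau>\<^sup>2*\<rho> * n (p + 2) + (2*\<tau> * L2 + L2\<^sup>2) * norm v * n 2 + L3 * norm v * n 1)/h)"
proof -
 have pS: "Suc p \<in> {1..3}" "p + 2 \<in> {1..3}" using p by auto
 note m1 = nu_moment[of 1, simplified] and m2 = nu_moment[of 2, simplified]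
 note mS = nu_moment[OF pS(1)] and mS2 = nu_moment[OF pS(2)]
 have "norm (\<Sum>i\<in>UNIV. (if i then 1 else -1) *\<^sub>R Hc (if i then a else 0) (Shift a v)) \<le> (norm a*(\<tau>*\<rho> * n (Suc p) + L2 * norm v * n 1))/h"
 proof (rule Hc_combination_bound)
  define g where "g \<eta> = norm a*(\<tau>*\<rho> * norm \<eta>^Suc p + L2 * norm v * norm \<eta>)" for \<eta> :: R3
  have "norm a*(\<tau>*(norm \<eta> * norm (Rc 0 \<eta> v - v)) + L2 * norm \<eta> * norm v) \<le> g \<eta>" for \<eta>
  proof -
   have "\<tau>*(norm \<eta> * norm (Rc 0 \<eta> v - v)) \<le> \<tau>*(norm \<eta>*(\<rho> * norm \<eta>^p))" using \<tau> by (intro mult_left_mono r) auto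
   thus ?thesis unfolding g_def by (intro mult_left_mono) (auto simp: mult_ac)
  qed
  from order_trans[OF Kc_first this]
  show "norm (\<Sum>i\<in>UNIV. (if i then 1 else -1) *\<^sub>R Kc (if i then a else 0) \<eta> (Shift a v)) \<le> g \<eta>" for \<eta>
   by (simp add: UNIV_bool)
  have e: "norm (\<nu> \<eta>) * g \<eta> = (norm a*\<tau>*\<rho>)*(norm (\<nu> \<eta>) * norm \<eta>^Suc p) + (norm a * L2 * norm v)*(norm (\<nu> \<eta>) * norm \<eta>)" for \<eta>
   by (simp add: g_def algebra_simps)
  show "integrable lborel (\<lambda>\<eta>. norm (\<nu> \<eta>) * g \<eta>)" unfolding e using m1 mS by (intro Bochner_Integration.integrable_add integrable_mult_right)
  have "(LBINT \<eta>. norm (\<nu> \<eta>) * g \<eta>) = (norm a*\<tau>*\<rho>)*(LBINT \<eta>. norm (\<nu> \<eta>) * norm \<eta>^Suc p) + (norm a * L2 * norm v)*(LBINT \<eta>. norm (\<nu> \<eta>) * norm \<eta>)"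
   unfolding e using m1(1) mS(1) by (subst Bochner_Integration.integral_add) (auto simp del: power_Suc)
  also have "... \<le> (norm a*\<tau>*\<rho>) * n (Suc p) + (norm a * L2 * norm v) * n 1"
   using \<tau> \<rho> Lpos m1 mS by (intro add_mono mult_left_mono) (auto simp del: power_Suc)
  finally show "(LBINT \<eta>. norm (\<nu> \<eta>) * g \<eta>) \<le> norm a*(\<tau>*\<rho> * n (Suc p) + L2 * norm v * n 1)" by (simp add: algebra_simps)
 qed simp
 thus "norm (Hc a (Shift a v) - Hc 0 (Shift a v)) \<le> norm a*((\<tau>*\<rho> * n (Suc p) + L2 * norm v * n 1)/h)"
  by (simp add: UNIV_bool)
 let ?z = "Shift (a + b) v"
 \<comment> \<open>The four corners of a second difference, indexed by two flags; the sign is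
   positive when both increments are present or both are absent.\<close>
 let ?s = "\<lambda>(i, j). (if i = j then 1 else -1) :: real" and ?c = "\<lambda>(i, j). (if i then a else 0) + (if j then b else 0)"
 have four: "(\<Sum>i\<in>UNIV. ?s i *\<^sub>R F (?c i)) = F (a + b) - F a - F b + F 0" for F :: "R3 => l2"
  unfolding UNIV_Times_UNIV[symmetric] sum.cartesian_product'[symmetric] by (simp add: UNIV_bool)
 have "norm (\<Sum>i\<in>UNIV. ?s i *\<^sub>R Hc (?c i) ?z) \<le> (norm a * norm b*(\<tau>\<^sup>2*\<rho> * n (p + 2) + (2*\<tau> * L2 + L2\<^sup>2) * norm v * n 2 + L3 * norm v * n 1))/h"
 proof (rule Hc_combination_bound)
  define g where "g \<eta> = norm a * norm b*(\<tau>\<^sup>2*\<rho> * norm \<eta>^(p + 2) + (2*\<tau> * L2 + L2\<^sup>2) * norm v * (norm \<eta>)^2 + L3 * norm v * norm \<eta>)" for \<eta> :: R3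
  have "norm a * norm b*(\<tau>\<^sup>2*((norm \<eta>)^2 * norm (Rc 0 \<eta> v - v)) + (2*\<tau> * L2*(norm \<eta>)^2 + L3 * norm \<eta> + L2\<^sup>2*(norm \<eta>)^2) * norm v) \<le> g \<eta>" for \<eta>
  proof -
   have "\<tau>\<^sup>2*((norm \<eta>)^2 * norm (Rc 0 \<eta> v - v)) \<le> \<tau>\<^sup>2*((norm \<eta>)^2*(\<rho> * norm \<eta>^p))" by (intro mult_left_mono r) auto
   also have "... = \<tau>\<^sup>2*\<rho> * norm \<eta>^(p + 2)" by (simp add: power_add power2_eq_square mult_ac)
   finally show ?thesis unfolding g_def by (intro mult_left_mono) (auto simp: algebra_simps)
  qed
  from order_trans[OF Kc_second this]
  show "norm (\<Sum>i\<in>UNIV. ?s i *\<^sub>R Kc (?c i) \<eta> ?z) \<le> g \<eta>" for \<eta> unfolding four[of "\<lambda>c. Kc c \<eta> ?z"] .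
  have e: "norm (\<nu> \<eta>) * g \<eta> = (norm a * norm b*\<tau>\<^sup>2*\<rho>)*(norm (\<nu> \<eta>) * norm \<eta>^(p + 2)) + ((norm a * norm b*(2*\<tau> * L2 + L2\<^sup>2) * norm v)*(norm (\<nu> \<eta>)*(norm \<eta>)^2) + (norm a * norm b * L3 * norm v)*(norm (\<nu> \<eta>) * norm \<eta>))" for \<eta>
   by (simp add: g_def algebra_simps)
  show "integrable lborel (\<lambda>\<eta>. norm (\<nu> \<eta>) * g \<eta>)" unfolding e using m1 m2 mS2 by (intro Bochner_Integration.integrable_add integrable_mult_right)
  have "(LBINT \<eta>. norm (\<nu> \<eta>) * g \<eta>) = (norm a * norm b*\<tau>\<^sup>2*\<rho>)*(LBINT \<eta>. norm (\<nu> \<eta>) * norm \<eta>^(p + 2)) + ((norm a * norm b*(2*\<tau> * L2 + L2\<^sup>2) * norm v)*(LBINT \<eta>. norm (\<nu> \<eta>)*(norm \<eta>)^2) + (norm a * norm b * L3 * norm v)*(LBINT \<eta>. norm (\<nu> \<eta>) * norm \<eta>))"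
  proof -
   have "(LBINT \<eta>. A * f \<eta> + (B * g \<eta> + C * k \<eta>)) = A*(LBINT \<eta>. f \<eta>) + (B*(LBINT \<eta>. g \<eta>) + C*(LBINT \<eta>. k \<eta>))"
    if "integrable lborel f" "integrable lborel g" "integrable lborel k" for A B C :: real and f g k :: "R3 => real"
    using that by simp
   from this[OF mS2(1) m2(1) m1(1)] show ?thesis unfolding e .
  qed
  also have "... \<le> (norm a * norm b*\<tau>\<^sup>2*\<rho>) * n (p + 2) + ((norm a * norm b*(2*\<tau> * L2 + L2\<^sup>2) * norm v) * n 2 + (norm a * norm b * L3 * norm v) * n 1)"
   using \<tau> \<rho> Lpos m1(2) m2(2) mS2(2) by (intro add_mono mult_left_mono) auto
  finally show "(LBINT \<eta>. norm (\<nu> \<eta>) * g \<eta>) \<le> norm a * norm b*(\<tau>\<^sup>2*\<rho> * n (p + 2) + (2*\<tau> * L2 + L2\<^sup>2) * norm v * n 2 + L3 * norm v * n 1)"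
   by (simp add: algebra_simps)
 qed simp
 thus "norm (Hc (a + b) ?z - Hc a ?z - Hc b ?z + Hc 0 ?z)
   \<le> norm a * norm b*((\<tau>\<^sup>2*\<rho> * n (p + 2) + (2*\<tau> * L2 + L2\<^sup>2) * norm v * n 2 + L3 * norm v * n 1)/h)"
  unfolding four[of "\<lambda>c. Hc c ?z"] by simp
qed

lemma Rc_crude: "norm (Rc 0 \<eta> v - v) \<le> (2 * norm v) * norm \<eta>^0"
proof -
 have "norm (Rc 0 \<eta> v) = norm v" unfolding Rc_def by (subst norm_Mul_unit) (auto simp: dd_def)
 thus ?thesis using norm_triangle_ineq4[of "Rc 0 \<eta> v" v] by simp
qed

text \<open>With s = sqrt(\<tau>) |\<eta>| the kinetic factor satisfies |e^(-i s^2/2) - 1| \<le>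
  min(2, s^2/2) \<le> s. Using only the square root of the phase costs one power of |\<eta>|, so
  that in second differences the third moment suffices; the full phase would call for a
  fourth.\<close>

lemma Rc_refined:
 assumes N: "\<And>a. norm (Shift a v - v) \<le> N * norm a"
 shows "norm (Rc 0 \<eta> v - v) \<le> (N + (L1 + sqrt \<tau>) * norm v) * norm \<eta>^1"
proof -
 have d: "norm (dd 0 \<eta> \<xi> - 1) \<le> (L1 + sqrt \<tau>) * norm \<eta>" for \<xi>
 proof -
  define s where "s = sqrt \<tau> * norm \<eta>"
  have s: "s \<ge> 0" "s\<^sup>2 = \<tau>*(norm \<eta>)^2" using \<tau> by (auto simp: s_def power_mult_distrib)
  have c1: "norm (cis (- (\<tau>*(norm \<eta>)^2/2)) - 1) \<le> s"
  proof (cases "s \<le> 2")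
   case True
   have "norm (cis (- (\<tau>*(norm \<eta>)^2/2)) - 1) \<le> s\<^sup>2/2"
    using norm_cis_minus_1_le[of "- (\<tau>*(norm \<eta>)^2/2)"] \<tau> by (simp add: s)
   also have "... \<le> s" using True s(1) mult_left_mono[of s 2 s] by (simp add: power2_eq_square)
   finally show ?thesis .
  next
   case False
   thus ?thesis using norm_cis_minus_1_le2[of "- (\<tau>*(norm \<eta>)^2/2)"] by linarith
  qed
  have c2: "norm (cis (\<Omega> \<xi> - \<Omega> (\<xi> - \<eta>)) - 1) \<le> L1 * norm \<eta>"
   using norm_cis_minus_1_le L1 order_trans by blast
  have c3: "dd 0 \<eta> \<xi> - 1 = (cis (\<Omega> \<xi> - \<Omega> (\<xi> - \<eta>)) - 1) * cis (- (\<tau>*(norm \<eta>)^2/2)) + (cis (- (\<tau>*(norm \<eta>)^2/2)) - 1)"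
   by (simp add: dd_def algebra_simps cis_mult)
  have c4: "norm ((cis (\<Omega> \<xi> - \<Omega> (\<xi> - \<eta>)) - 1) * cis (- (\<tau>*(norm \<eta>)^2/2)) + (cis (- (\<tau>*(norm \<eta>)^2/2)) - 1))
   \<le> norm (cis (\<Omega> \<xi> - \<Omega> (\<xi> - \<eta>)) - 1) + norm (cis (- (\<tau>*(norm \<eta>)^2/2)) - 1)"
   by (rule order_trans[OF norm_triangle_ineq]) (simp add: norm_mult)
  have "norm (dd 0 \<eta> \<xi> - 1) \<le> L1 * norm \<eta> + s" unfolding c3 using c4 c1 c2 by linarith
  thus ?thesis by (simp add: s_def algebra_simps)
 qed
 have "Rc 0 \<eta> v - v = Mul (\<lambda>\<xi>. dd 0 \<eta> \<xi> - 1) (Shift (- \<eta>) v) + (Shift (- \<eta>) v - v)"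
  unfolding Rc_def by (simp add: Mul_diff_fun[symmetric])
 also have "norm ... \<le> (L1 + sqrt \<tau>) * norm \<eta> * norm v + N * norm \<eta>"
 proof (rule norm_triangle_mono)
  show "norm (Mul (\<lambda>\<xi>. dd 0 \<eta> \<xi> - 1) (Shift (- \<eta>) v)) \<le> (L1 + sqrt \<tau>) * norm \<eta> * norm v"
   using norm_Mul_le[of "\<lambda>\<xi>. dd 0 \<eta> \<xi> - 1" _ "Shift (- \<eta>) v", OF _ d] by (simp add: bm_diff)
  show "norm (Shift (- \<eta>) v - v) \<le> N * norm \<eta>" using N[of "- \<eta>"] by simp
 qed
 finally show ?thesis by (simp add: algebra_simps)
qed

end

section \<open>The evolution equation\<close>

lemma Mul_tendsto_at:
 assumes m: "\<And>t. t \<in> S ==> m t \<in> bmeas" "\<And>t x. t \<in> S ==> norm (m t x) \<le> C"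
  and lim: "\<And>x. ((\<lambda>t. m t x) \<longlongrightarrow> m t0 x) (at t0 within S)" and t0: "t0 \<in> S"
 shows "((\<lambda>t. Mul (m t) v) \<longlongrightarrow> Mul (m t0) v) (at (t0::real) within S)"
 unfolding tendsto_at_iff_sequentially comp_def
proof (intro allI impI)
 fix X assume X: "\<forall>i. X i \<in> S - {t0}" "X \<longlonglongrightarrow> t0"
 show "(\<lambda>n. Mul (m (X n)) v) \<longlonglongrightarrow> Mul (m t0) v"
 proof (rule Mul_tendsto)
  show "(\<lambda>n. m (X n) x) \<longlonglongrightarrow> m t0 x" for x
   using lim[of x] X unfolding tendsto_at_iff_sequentially comp_def by blast
 qed (use m X t0 in auto)
qed

text \<open>The operators below are continuous in time only strongly; uniform boundedness permits
  passing to the limit in operator and argument together.\<close>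

lemma strong_tendsto:
 fixes A :: "real => 'a::real_normed_vector => 'b::real_normed_vector"
 assumes u: "(u \<longlongrightarrow> u0) (at t0 within S)" and A: "((\<lambda>t. A t u0) \<longlongrightarrow> a) (at t0 within S)"
  and b: "\<And>t. t \<in> S ==> bounded_linear (A t)" "\<And>t x. t \<in> S ==> norm (A t x) \<le> C * norm x"
 shows "((\<lambda>t. A t (u t)) \<longlongrightarrow> a) (at t0 within S)"
proof -
 have "((\<lambda>t. A t (u t) - A t u0) \<longlongrightarrow> 0) (at t0 within S)"
 proof (rule Lim_null_comparison)
  show "\<forall>\<^sub>F t in at t0 within S. norm (A t (u t) - A t u0) \<le> C * norm (u t - u0)"
   unfolding eventually_at_filter
  proof (intro always_eventually allI impI)
   fix t assume t: "t \<in> S"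
   have "A t (u t) - A t u0 = A t (u t - u0)" using linear_diff[OF bounded_linear.linear[OF b(1)[OF t]]] by simp
   thus "norm (A t (u t) - A t u0) \<le> C * norm (u t - u0)" using b(2)[OF t] by simp
  qed
  have "((\<lambda>t. C * norm (u t - u0)) \<longlongrightarrow> C*0) (at t0 within S)"
   using u by (intro tendsto_mult tendsto_const tendsto_norm_zero) (simp add: LIM_zero)
  thus "((\<lambda>t. C * norm (u t - u0)) \<longlongrightarrow> 0) (at t0 within S)" by simp
 qed
 from tendsto_add[OF this A] show ?thesis by simp
qed

lemma has_vector_derivative_mono_norm:
 fixes f :: "real => 'a::real_normed_vector"
 assumes "\<And>t. t \<in> {0..T} ==> (f has_vector_derivative f' t) (at t within {0..T})" "\<And>t. t \<in> {0..T} ==> norm (f' t) \<le> B"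
  and "s \<in> {0..T}" "t \<in> {0..T}"
 shows "norm (f t - f s) \<le> B*\<bar>t - s\<bar>"
proof -
 have "norm (f t - f s) \<le> B * norm (t - s)"
 proof (rule differentiable_bound[of "{0..T}" f "\<lambda>t h. h *\<^sub>R f' t"])
  show "onorm (\<lambda>h. h *\<^sub>R f' x) \<le> B" if "x \<in> {0..T}" for x
   using assms(2)[OF that] by (intro onorm_le) (simp add: mult.commute[of B] mult_left_mono)
 qed (use assms in \<open>auto simp: has_vector_derivative_def\<close>)
 thus ?thesis by simp
qed

lemma zero_derivative_const:
 fixes f :: "real => 'a::real_normed_vector"
 assumes "\<And>t. t \<in> {0..T} ==> (f has_vector_derivative 0) (at t within {0..T})" "t \<in> {0..T}"
 shows "f t = f 0"
 using has_vector_derivative_mono_norm[of T f "\<lambda>_. 0" 0 0 t] assms by auto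

text \<open>The resolvent symbol. The kinetic phase brings in |\<xi>|^2, which becomes bounded after
  multiplication by \<open>Lam\<close>; since \<open>Lam\<close> never vanishes, it can be cancelled
  at the end.\<close>

definition Lam :: "R3 => complex" where "Lam \<xi> = of_real (1/(1 + (norm \<xi>)^2))"

lemma one_plus_sq_pos: "0 < 1 + (norm (\<xi>::'a::real_normed_vector))^2" by (simp add: add_pos_nonneg)

lemma norm_Lam: "norm (Lam \<xi>) = 1/(1 + (norm \<xi>)^2)"
 unfolding Lam_def norm_of_real using one_plus_sq_pos[of \<xi>] by (simp only: abs_divide abs_one abs_of_pos)
lemma Lam_pos: "Lam \<xi> \<noteq> 0" using norm_Lam[of \<xi>] one_plus_sq_pos[of \<xi>] by (metis divide_pos_pos less_irrefl norm_zero zero_less_one)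
lemma bm_Lam[simp]: "bm Lam"
proof (rule bmI)
 show "norm (Lam \<xi>) \<le> 1" for \<xi> unfolding norm_Lam by (simp add: divide_le_eq one_plus_sq_pos)
qed (simp add: Lam_def[abs_def])
lemma norm_sq_Lam_le: "(norm \<xi>)^2 * norm (Lam \<xi>) \<le> 1"
 unfolding norm_Lam using one_plus_sq_pos[of \<xi>] by (simp add: divide_le_eq)
lemma bm_sq_Lam[simp]: "bm (\<lambda>\<xi>. of_real (c*(norm \<xi>)^2) * Lam \<xi>)"
proof (rule bmI)
 show "norm (of_real (c*(norm \<xi>)^2) * Lam \<xi>) \<le> \<bar>c\<bar>" for \<xi> :: R3
  using mult_left_mono[OF norm_sq_Lam_le[of \<xi>] abs_ge_zero[of c]]
  by (simp add: norm_mult abs_mult mult.assoc norm_power)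
qed (simp add: Lam_def[abs_def])

lemma Mul_Lam_inj: assumes "Mul Lam u = 0" shows "u = 0"
proof -
 have "AE x in lborel. Lam x * rep u x = 0"
  using rep_Mul[OF bm_Lam, of u] rep_zero unfolding assms by eventually_elim simp
 thus ?thesis unfolding l2_eq_iff using rep_zero by eventually_elim (simp add: Lam_pos)
qed

subsection \<open>Transforms of test functions\<close>

lemma bp_Refl: "bp u (Refl w) = bp (Refl u) w"
proof -
 have "AE x in lborel. rep u x * rep (Refl w) x = rep u x * rep w (- x)" using rep_Refl[of w] by eventually_elim simp
 hence "bp u (Refl w) = (LBINT x. rep u x * rep w (- x))" unfolding bp_def by (intro integral_cong_AE) auto
 also have "... = (LBINT x. rep u (- x) * rep w x)"
  using lborel_reflect_R3(1)[of "\<lambda>x. rep u x * rep w (- x)"] by simp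
 also have "AE x in lborel. rep u (- x) * rep w x = rep (Refl u) x * rep w x" using rep_Refl[of u] by eventually_elim simp
 hence "(LBINT x. rep u (- x) * rep w x) = bp (Refl u) w" unfolding bp_def by (intro integral_cong_AE) auto
 finally show ?thesis .
qed

lemma bp_Fi: "bp (Fi u) v = bp u (Fi v)"
 unfolding Fi_def bp_Refl[symmetric] bp_Ft Ft_Refl ..

lemma bp_Mul: assumes "bm m" shows "bp (Mul m u) v = bp u (Mul m v)"
proof -
 have "bp (Mul m u) v = (LBINT x. (m x * rep u x) * rep v x)"
  unfolding bp_def by (rule integral_cong_AE) (use rep_Mul[OF assms, of u] bm_measurable[OF assms] in \<open>auto elim!: eventually_mono\<close>)
 also have "... = (LBINT x. rep u x * rep (Mul m v) x)"
  by (rule integral_cong_AE) (use rep_Mul[OF assms, of v] bm_measurable[OF assms] in \<open>auto elim!: eventually_mono\<close>)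
 finally show ?thesis by (simp add: bp_def)
qed

lemma bp_cmul: "bp (cmul c u) v = c * bp u v" "bp u (cmul c v) = c * bp u v"
 unfolding bp_cip by (simp_all add: cip_cmul_right bp_cip[symmetric] bp_sym[of _ v]) (simp add: bp_cip cip_cmul_right)

lemma test_function_C1c:
 assumes "test_function \<psi>" shows "C1c k \<psi>" "C1c k (pderiv1 k \<psi>)" "continuous_on UNIV (pderiv1 k (pderiv1 k \<psi>))"
proof -
 have s: "smooth \<psi>" and b: "bounded {x. \<psi> x \<noteq> 0}" using assms by (auto simp: test_function_def)
 have k3: "k = 1 \<or> k = 2 \<or> k = 3" using UNIV_3 by (metis UNIV_I empty_iff insert_iff)
 have p: "pderivs (axis k j) \<psi> = (pderiv1 k ^^ j) \<psi>" for j
  unfolding pderivs_def using k3 by (auto simp: axis_def)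
 have d: "(pderiv1 k ^^ j) \<psi> differentiable_on UNIV" for j using s unfolding smooth_def p[symmetric] by blast
 have c: "continuous_on UNIV ((pderiv1 k ^^ j) \<psi>)" for j using d by (rule differentiable_imp_continuous_on)
 have d': "(pderiv1 k ^^ j) \<psi> differentiable at x" for j x using d[of j] by (simp add: differentiable_on_def)
 show "C1c k \<psi>" unfolding C1c_def using d'[of 0] c[of 1] b by simp
 show "C1c k (pderiv1 k \<psi>)" unfolding C1c_def using d'[of 1] c[of 2] b pderiv1_support_bounded by (simp add: numeral_2_eq_2)
 show "continuous_on UNIV (pderiv1 k (pderiv1 k \<psi>))" using c[of 2] by (simp add: numeral_2_eq_2)
qed

lemma cont_bsupp_L12: assumes "continuous_on UNIV f" "bounded {x. f x \<noteq> 0}" shows "f \<in> L12"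
proof -
 have "continuous_on UNIV (\<lambda>x. f x * f x)" using assms(1) by (intro continuous_intros)
 moreover have "bounded {x. f x * f x \<noteq> 0}" using assms(2) by simp
 ultimately have "integrable lborel (\<lambda>x. norm (f x * f x))" by (intro integrable_norm cont_bsupp_integrable)
 moreover have "f \<in> bmeas" using assms(1) by (rule borel_measurable_continuous_onI)
 ultimately show ?thesis using cont_bsupp_integrable[OF assms] by (simp add: L12_def L2_def norm_mult power2_eq_square)
qed

lemma test_function_L12: assumes "test_function \<psi>" shows "\<psi> \<in> L12" "laplacian \<psi> \<in> L12"
proof -
 have b: "bounded {x. \<psi> x \<noteq> 0}" using assms by (simp add: test_function_def)
 show "\<psi> \<in> L12" using C1c_continuous[OF test_function_C1c(1)[OF assms]] b by (rule cont_bsupp_L12)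
 have "pderiv1 k (pderiv1 k \<psi>) \<in> L12" for k
  using test_function_C1c(3)[OF assms] by (rule cont_bsupp_L12) (intro pderiv1_support_bounded b)
 hence "(\<lambda>x. pderiv1 1 (pderiv1 1 \<psi>) x + (pderiv1 2 (pderiv1 2 \<psi>) x + pderiv1 3 (pderiv1 3 \<psi>) x)) \<in> L12"
  by (intro L12_add)
 thus "laplacian \<psi> \<in> L12" by (simp add: laplacian_def[abs_def] sum_3 add.assoc)
qed

lemma Fi_mk: assumes "f \<in> L12" shows "Fi (mk f) = mk (\<lambda>\<xi>. of_real c0 * chk f \<xi>)" "(\<lambda>\<xi>. of_real c0 * chk f \<xi>) \<in> L2"
proof -
 have "(\<lambda>\<xi>. fourier_integral f (- \<xi>)) = (\<lambda>\<xi>. of_real c0 * chk f \<xi>)" by (simp add: chk_fourier)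
 thus "Fi (mk f) = mk (\<lambda>\<xi>. of_real c0 * chk f \<xi>)" "(\<lambda>\<xi>. of_real c0 * chk f \<xi>) \<in> L2"
  using L2_reflect[OF L12_fourier(1)[OF assms]] by (simp_all add: Fi_def Ft_mk[OF assms] Refl_mk L12_fourier assms)
qed

lemma chk_laplacian: assumes "test_function \<psi>" shows "chk (laplacian \<psi>) \<xi> = - of_real ((norm \<xi>)^2) * chk \<psi> \<xi>"
proof -
 have i: "integrable lborel (pderiv1 k (pderiv1 k \<psi>))" for k
  using C1c_integrable(2)[OF test_function_C1c(2)[OF assms]] .
 have "chk (laplacian \<psi>) \<xi> = (\<Sum>k\<in>UNIV. chk (pderiv1 k (pderiv1 k \<psi>)) \<xi>)"
  unfolding chk_def laplacian_def sum_distrib_left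
  using i by (subst Bochner_Integration.integral_sum) (auto intro!: integrable_cis_mult)
 also have "... = (\<Sum>k\<in>UNIV. - (of_real (\<xi> $ k*\<xi> $ k)) * chk \<psi> \<xi>)"
  by (intro sum.cong refl) (simp add: chk_pderiv1[OF test_function_C1c(2)[OF assms]] chk_pderiv1[OF test_function_C1c(1)[OF assms]] algebra_simps)
 also have "... = - of_real (\<Sum>k\<in>UNIV. \<xi> $ k*\<xi> $ k) * chk \<psi> \<xi>"
  unfolding sum_distrib_right[symmetric] sum_negf of_real_sum ..
 also have "(\<Sum>k\<in>UNIV. \<xi> $ k*\<xi> $ k) = (norm \<xi>)^2" by (simp only: power2_norm_eq_inner inner_vec_def inner_real_def)
 finally show ?thesis .
qed

text \<open>The domain of the kinetic operator in Fourier variables. Outside it the value of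
  \<open>sqm\<close> carries no information.\<close>

definition dom2 :: "l2 => bool" where "dom2 \<zeta> \<longleftrightarrow> (\<lambda>\<xi>. of_real ((norm \<xi>)^2) * rep \<zeta> \<xi>) \<in> L2"
definition sqm :: "l2 => l2" where "sqm \<zeta> = mk (\<lambda>\<xi>. of_real ((norm \<xi>)^2) * rep \<zeta> \<xi>)"

lemma dom2_test: assumes "test_function \<psi>"
 shows "dom2 (Fi (mk \<psi>))" "sqm (Fi (mk \<psi>)) = - Fi (mk (laplacian \<psi>))"
proof -
 note \<psi> = test_function_L12[OF assms]
 have "AE \<xi> in lborel. rep (Fi (mk \<psi>)) \<xi> = of_real c0 * chk \<psi> \<xi>"
  unfolding Fi_mk(1)[OF \<psi>(1)] by (rule rep_mk[OF Fi_mk(2)[OF \<psi>(1)]])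
 hence ae: "AE \<xi> in lborel. - (of_real c0 * chk (laplacian \<psi>) \<xi>) = of_real ((norm \<xi>)^2) * rep (Fi (mk \<psi>)) \<xi>"
  by eventually_elim (simp add: chk_laplacian[OF assms])
 have L: "(\<lambda>\<xi>. - (of_real c0 * chk (laplacian \<psi>) \<xi>)) \<in> L2" by (intro L2_uminus Fi_mk(2) \<psi>)
 have m: "(\<lambda>\<xi>. of_real ((norm \<xi>)^2) * rep (Fi (mk \<psi>)) \<xi>) \<in> bmeas" by measurable
 show "dom2 (Fi (mk \<psi>))" unfolding dom2_def by (rule L2_cong_AE[OF L m ae])
 have "sqm (Fi (mk \<psi>)) = mk (\<lambda>\<xi>. - (of_real c0 * chk (laplacian \<psi>) \<xi>))"
  unfolding sqm_def by (rule mk_eqI[OF L m ae, symmetric])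
 also have "... = mk (\<lambda>\<xi>. 0) - mk (\<lambda>\<xi>. of_real c0 * chk (laplacian \<psi>) \<xi>)"
  by (subst mk_diff) (auto intro: Fi_mk(2) \<psi>)
 also have "... = - Fi (mk (laplacian \<psi>))" by (simp add: Fi_mk(1)[OF \<psi>(2)] zero_l2_def[symmetric])
 finally show "sqm (Fi (mk \<psi>)) = - Fi (mk (laplacian \<psi>))" .
qed

lemma Lam_identity: "of_real (1 + (norm \<xi>)^2) * Lam \<xi> = 1"
 unfolding Lam_def of_real_mult[symmetric] using one_plus_sq_pos[of \<xi>] by simp

lemma dom2_Lam: "dom2 (Mul Lam u)" "sqm (Mul Lam u) = Mul (\<lambda>\<xi>. of_real (1*(norm \<xi>)^2) * Lam \<xi>) u"
proof -
 have ae: "AE \<xi> in lborel. of_real (1*(norm \<xi>)^2) * Lam \<xi> * rep u \<xi> = of_real ((norm \<xi>)^2) * rep (Mul Lam u) \<xi>"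
  using rep_Mul[OF bm_Lam, of u] by eventually_elim simp
 have L: "(\<lambda>\<xi>. of_real (1*(norm \<xi>)^2) * Lam \<xi> * rep u \<xi>) \<in> L2" by (rule bm_mult_L2[OF bm_sq_Lam]) simp
 have m: "(\<lambda>\<xi>. of_real ((norm \<xi>)^2) * rep (Mul Lam u) \<xi>) \<in> bmeas" by measurable
 show "dom2 (Mul Lam u)" unfolding dom2_def by (rule L2_cong_AE[OF L m ae])
 show "sqm (Mul Lam u) = Mul (\<lambda>\<xi>. of_real (1*(norm \<xi>)^2) * Lam \<xi>) u"
  unfolding sqm_def Mul_def[of "\<lambda>\<xi>. of_real (1*(norm \<xi>)^2) * Lam \<xi>"] by (rule mk_eqI[OF L m ae, symmetric])
qed

text \<open>Every vector of the domain is a resolvent: \<zeta> is \<open>Lam\<close> applied to (1 +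
  |\<xi>|^2) \<zeta>. The weak equation, which is tested on the domain, can thus be read as an
  equation for \<open>Lam\<close> times the solution.\<close>

lemma dom2_unLam: assumes "dom2 \<zeta>" shows "Mul Lam (\<zeta> + sqm \<zeta>) = \<zeta>" "sqm \<zeta> = Mul (\<lambda>\<xi>. of_real (1*(norm \<xi>)^2) * Lam \<xi>) (\<zeta> + sqm \<zeta>)"
proof -
 have "AE \<xi> in lborel. rep (sqm \<zeta>) \<xi> = of_real ((norm \<xi>)^2) * rep \<zeta> \<xi>"
  using assms unfolding sqm_def dom2_def by (rule rep_mk)
 hence "AE \<xi> in lborel. rep (Mul Lam (\<zeta> + sqm \<zeta>)) \<xi> = rep \<zeta> \<xi>"
  using rep_Mul[OF bm_Lam, of "\<zeta> + sqm \<zeta>"] rep_add[of \<zeta> "sqm \<zeta>"]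
 proof eventually_elim
  case (elim \<xi>)
  have "rep (Mul Lam (\<zeta> + sqm \<zeta>)) \<xi> = (of_real (1 + (norm \<xi>)^2) * Lam \<xi>) * rep \<zeta> \<xi>" unfolding elim by (simp add: algebra_simps)
  thus ?case by (simp only: Lam_identity mult_1)
 qed
 thus 1: "Mul Lam (\<zeta> + sqm \<zeta>) = \<zeta>" unfolding l2_eq_iff .
 show "sqm \<zeta> = Mul (\<lambda>\<xi>. of_real (1*(norm \<xi>)^2) * Lam \<xi>) (\<zeta> + sqm \<zeta>)"
  using dom2_Lam(2)[of "\<zeta> + sqm \<zeta>"] unfolding 1 .
qed

text \<open>Picard iteration for a bounded, strongly continuous \<open>H\<close>. The unknown is
  rescaled by exp(-lm t), so that the integral operator contracts on all of [0,T] at once.\<close>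

lemma linear_ode_exists:
 fixes H :: "real => 'a::banach => 'a"
 assumes T: "T \<ge> 0" and bl: "\<And>t. t \<in> {0..T} ==> bounded_linear (H t)"
  and M: "\<And>t x. t \<in> {0..T} ==> norm (H t x) \<le> M * norm x" and M0: "M \<ge> 0"
  and c: "\<And>x. continuous_on {0..T} (\<lambda>t. H t x)"
 obtains v where "v 0 = x0" "\<forall>t\<in>{0..T}. (v has_vector_derivative H t (v t)) (at t within {0..T})"
proof -
 \<comment> \<open>The contraction factor is M/lm, and 2 M + 1 keeps it below 1/2, even for M =
   0.\<close>
 define lm where "lm = 2 * M + 1"
 have lp: "lm > 0" using M0 by (simp add: lm_def)
 \<comment> \<open>The Banach space consists of bounded continuous functions on the whole line, so
   time is clamped to [0,T].\<close>
 define cl where "cl t = max 0 (min T t)" for t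
 have cl: "cl t \<in> {0..T}" for t using T by (auto simp: cl_def)
 have cl_id: "cl t = t" if "t \<in> {0..T}" for t using that by (auto simp: cl_def)
 have ccl: "continuous_on UNIV cl" unfolding cl_def[abs_def] by (intro continuous_intros)
 define I where "I w s = exp (lm * s) *\<^sub>R H s (w s)" for w :: "real => 'a" and s
 have Ic: "continuous_on {0..T} (I w)" if "continuous_on {0..T} w" for w
  unfolding I_def[abs_def]
 proof (intro continuous_intros)
  show "continuous_on {0..T} (\<lambda>s. H s (w s))" unfolding continuous_on_def
  proof
   fix t assume t: "t \<in> {0..T}"
   show "((\<lambda>s. H s (w s)) \<longlongrightarrow> H t (w t)) (at t within {0..T})"
   proof (rule strong_tendsto[where C=M, OF _ _ bl M])
    show "(w \<longlongrightarrow> w t) (at t within {0..T})" using that t unfolding continuous_on_def by blast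
    show "((\<lambda>s. H s (w t)) \<longlongrightarrow> H t (w t)) (at t within {0..T})" using c[of "w t"] t unfolding continuous_on_def by blast
   qed
  qed
 qed
 have Ii: "I w integrable_on {0..t}" if "continuous_on {0..T} w" "t \<in> {0..T}" for w t
  using continuous_on_subset[OF Ic[OF that(1)], of "{0..t}"] that(2) by (intro integrable_continuous_real) auto
 define P where "P w t = exp (- lm * cl t) *\<^sub>R (x0 + integral {0..cl t} (I w))" for w t
 have Pc: "continuous_on UNIV (P w)" if "continuous_on {0..T} w" for w
 proof -
  have "continuous_on {0..T} (\<lambda>t. exp (- lm * t) *\<^sub>R (x0 + integral {0..t} (I w)))"
   using Ii[OF that, of T] T by (intro continuous_intros indefinite_integral_continuous_1) auto
  moreover have "range cl \<subseteq> {0..T}" using cl by blast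
  ultimately show ?thesis unfolding P_def[abs_def] using continuous_on_compose2[OF _ ccl] by blast
 qed
 have Pb: "P w \<in> bcontfun" if "continuous_on {0..T} w" for w
 proof -
  have "P w ` UNIV \<subseteq> P w ` {0..T}"
  proof
   fix y assume "y \<in> P w ` UNIV"
   then obtain t where "y = P w t" by auto
   moreover have "P w t = P w (cl t)" unfolding P_def using cl_id[OF cl] by simp
   ultimately show "y \<in> P w ` {0..T}" using cl by blast
  qed
  moreover have "bounded (P w ` {0..T})"
   by (intro compact_imp_bounded compact_continuous_image continuous_on_subset[OF Pc[OF that]]) auto
  ultimately have "bounded (range (P w))" using bounded_subset by blast
  thus ?thesis using Pc[OF that] by (simp add: bcontfun_def)
 qed
 have wc: "continuous_on {0..T} (apply_bcontfun w)" for w :: "real \<Rightarrow>\<^sub>C 'a"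
  by (rule continuous_on_apply_bcontfun)
 define F where "F w = Bcontfun (P (apply_bcontfun w))" for w :: "real \<Rightarrow>\<^sub>C 'a"
 have Fa: "apply_bcontfun (F w) = P (apply_bcontfun w)" for w
  unfolding F_def by (rule Bcontfun_inverse[OF Pb[OF wc]])
 have "\<forall>x y. dist (F x) (F y) \<le> (1/2) * dist x y"
 proof (intro allI dist_bound)
  fix x y :: "real \<Rightarrow>\<^sub>C 'a" and t
  define r where "r = cl t"
  have r: "r \<in> {0..T}" using cl by (simp add: r_def)
  define d where "d = dist x y"
  have n: "norm (I x s - I y s) \<le> M * d * exp (lm * s)" if "s \<in> {0..r}" for s
  proof -
   have s: "s \<in> {0..T}" using that r by auto
   have "I x s - I y s = exp (lm * s) *\<^sub>R H s (x s - y s)"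
    using linear_diff[OF bounded_linear.linear[OF bl[OF s]]] by (simp add: I_def scaleR_diff_right)
   also have "norm ... \<le> exp (lm * s)*(M * d)"
    using order_trans[OF M[OF s] mult_left_mono[OF dist_bounded[of x s y, unfolded dist_norm] M0]] by (simp add: d_def dist_norm)
   finally show ?thesis by (simp add: mult_ac)
  qed
  have ei: "((\<lambda>s. exp (lm * s)) has_integral (exp (lm * r)/lm - exp (lm*0)/lm)) {0..r}"
   using r lp by (intro fundamental_theorem_of_calculus)
    (auto intro!: derivative_eq_intros simp: has_real_derivative_iff_has_vector_derivative[symmetric])
  have "norm (integral {0..r} (I x) - integral {0..r} (I y)) \<le> integral {0..r} (\<lambda>s. M * d * exp (lm * s))"
   unfolding integral_diff[OF Ii[OF wc r] Ii[OF wc r], symmetric]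
   by (intro integral_norm_bound_integral n integrable_diff Ii wc r has_integral_integrable[OF has_integral_mult_right[OF ei]])
  also have "... = M * d*(exp (lm * r)/lm - 1/lm)" using integral_unique[OF ei] by simp
  also have "... \<le> M * d*(exp (lm * r)/lm)" using lp M0 by (intro mult_left_mono mult_nonneg_nonneg) (auto simp: d_def)
  finally have 1: "norm (integral {0..r} (I x) - integral {0..r} (I y)) \<le> M * d*(exp (lm * r)/lm)" .
  have "dist (F x t) (F y t) = exp (- lm * r) * norm (integral {0..r} (I x) - integral {0..r} (I y))"
   unfolding Fa P_def dist_norm r_def[symmetric] scaleR_diff_right[symmetric] by simp
  also have "... \<le> exp (- lm * r)*(M * d*(exp (lm * r)/lm))" using 1 by (intro mult_left_mono) auto
  also have "... = M/lm * d" by (simp add: exp_minus field_simps)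
  also have "... \<le> (1/2) * d" using lp by (intro mult_right_mono) (auto simp: d_def lm_def divide_le_eq)
  finally show "dist (F x t) (F y t) \<le> (1/2) * dist x y" by (simp add: d_def)
 qed
 hence "\<exists>!w. F w = w" by (intro banach_fix_type[of "1/2"]) auto
 then obtain w where w: "F w = w" by auto
 define v where "v t = x0 + integral {0..t} (I (apply_bcontfun w))" for t
 have wv: "H t (v t) = I (apply_bcontfun w) t" if t: "t \<in> {0..T}" for t
 proof -
  have "apply_bcontfun w t = P (apply_bcontfun w) t" using Fa[of w] w by simp
  hence "v t = exp (lm * t) *\<^sub>R apply_bcontfun w t" unfolding P_def cl_id[OF t] v_def by (simp add: exp_minus)
  thus ?thesis using linear_scale[OF bounded_linear.linear[OF bl[OF t]]] by (simp add: I_def)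
 qed
 show thesis
 proof
  show "v 0 = x0" by (simp add: v_def)
  show "\<forall>t\<in>{0..T}. (v has_vector_derivative H t (v t)) (at t within {0..T})"
  proof
   fix t assume t: "t \<in> {0..T}"
   have "((\<lambda>t. x0 + integral {0..t} (I (apply_bcontfun w))) has_vector_derivative 0 + I (apply_bcontfun w) t) (at t within {0..T})"
    by (intro has_vector_derivative_add has_vector_derivative_const integral_has_vector_derivative Ic wc t)
   thus "(v has_vector_derivative H t (v t)) (at t within {0..T})" unfolding wv[OF t] unfolding v_def[abs_def] by simp
  qed
 qed
qed

section \<open>Phases in time, the generator, and its bounds for fixed h\<close>

locale evo =
 fixes h T :: real and V :: "real => R3 => real" and Bd :: real
 assumes h: "h > 0" and T: "T > 0" and jc: "continuous_on ({0..T} \<times> UNIV) (\<lambda>p. V (fst p) (snd p))"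
  and Bd: "\<And>t x. t \<in> {0..T} ==> \<bar>V t x\<bar> \<le> Bd"
begin

definition \<Omega> :: "real => R3 => real" where "\<Omega> t \<xi> = phase h V t (h *\<^sub>R \<xi>)"
definition \<Theta> :: "real => R3 => real" where "\<Theta> t \<xi> = \<Omega> t \<xi> + (t * h)*(norm \<xi>)^2/2"
text \<open>The time derivative of \<Theta>. Its first term is the one that the generator subtracts;
  its second is unbounded in \<xi>, which is why \<open>W\<close> is differentiated only on
  \<open>dom2\<close>.\<close>

definition \<Theta>' :: "real => R3 => real" where "\<Theta>' t \<xi> = V t ((t * h) *\<^sub>R \<xi>)/h + h*(norm \<xi>)^2/2"
definition W :: "real => real => l2 => l2" where "W \<sigma> t = Mul (\<lambda>\<xi>. cis (\<sigma>*\<Theta> t \<xi>))"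
definition mV :: "real => R3 => complex" where "mV t \<xi> = of_real (V t ((t * h) *\<^sub>R \<xi>))"
definition cV :: "real => R3 => complex" where "cV t x = of_real (V t x)"
text \<open>The free part has disappeared into the phases, so for fixed h the operator is bounded by
  2 Bd/h, and every initial value has a norm-differentiable solution. The factor 1/h is what the
  uniform estimates have to overcome.\<close>

definition H :: "real => l2 => l2" where
 "H t v = cmul (- \<i>/of_real h) (W 1 t (Ft (Mul (cV t) (Fi (W (-1) t v)))) - Mul (mV t) v)"

lemma Bd0: "Bd \<ge> 0" using Bd[of 0 0] T by auto

lemma V_comp: assumes "continuous_on S f" "continuous_on S g" "\<And>s. s \<in> S ==> f s \<in> {0..T}"
 shows "continuous_on S (\<lambda>s. V (f s) (g s))"
proof -
 have "(\<lambda>s. (f s, g s)) ` S \<subseteq> {0..T} \<times> UNIV" using assms(3) by auto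
 from continuous_on_compose2[OF jc continuous_on_Pair[OF assms(1,2)] this] show ?thesis by simp
qed

lemma V_meas: assumes "t \<in> {0..T}" "continuous_on UNIV g" shows "(\<lambda>x. V t (g x)) \<in> bmeas"
 using assms by (intro borel_measurable_continuous_onI V_comp) auto

lemma \<Omega>_cont: assumes "t \<in> {0..T}" shows "continuous_on UNIV (\<Omega> t)"
proof -
 have "continuous_on (UNIV \<times> cbox 0 t) (\<lambda>(\<xi>::R3, s). V s (s *\<^sub>R (h *\<^sub>R \<xi>)))"
  unfolding case_prod_beta using assms by (intro V_comp continuous_intros) auto
 hence "continuous_on UNIV (\<lambda>\<xi>::R3. integral (cbox 0 t) (\<lambda>s. V s (s *\<^sub>R (h *\<^sub>R \<xi>))))" by (rule integral_continuous_on_param)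
 thus ?thesis unfolding \<Omega>_def[abs_def] phase_def by (intro continuous_intros) simp
qed

lemma \<Theta>_meas: assumes "t \<in> {0..T}" shows "\<Theta> t \<in> bmeas"
 unfolding \<Theta>_def[abs_def] using \<Omega>_cont[OF assms] by (intro borel_measurable_continuous_onI continuous_intros) auto

lemma bm_W: assumes "t \<in> {0..T}" shows "bm (\<lambda>\<xi>. cis (\<sigma>*\<Theta> t \<xi>))"
 using \<Theta>_meas[OF assms] by (intro bm_cis) measurable
lemma bm_mV: assumes "t \<in> {0..T}" shows "bm (mV t)"
proof (rule bmI)
 show "mV t \<in> bmeas" unfolding mV_def[abs_def]
  using V_meas[OF assms, of "\<lambda>\<xi>. (t * h) *\<^sub>R \<xi>"] by (simp add: continuous_on_scaleR)
 show "norm (mV t \<xi>) \<le> Bd" for \<xi> using Bd[OF assms] by (simp add: mV_def)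
qed
lemma bm_cV: assumes "t \<in> {0..T}" shows "bm (cV t)"
proof (rule bmI)
 show "cV t \<in> bmeas" unfolding cV_def[abs_def] using V_meas[OF assms, of "\<lambda>x. x"] by simp
 show "norm (cV t \<xi>) \<le> Bd" for \<xi> using Bd[OF assms] by (simp add: cV_def)
qed

lemma norm_cV: "t \<in> {0..T} ==> norm (cV t x) \<le> Bd" by (simp add: cV_def Bd)

lemma norm_W: "t \<in> {0..T} ==> norm (W \<sigma> t v) = norm v" unfolding W_def by (rule norm_Mul_unit[OF bm_W]) auto
lemma bl_W: "t \<in> {0..T} ==> bounded_linear (W \<sigma> t)" unfolding W_def by (rule bounded_linear_Mul[OF bm_W])
lemma W_W: assumes "t \<in> {0..T}" shows "W \<sigma> t (W \<rho> t v) = W (\<sigma> + \<rho>) t v"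
 unfolding W_def by (simp add: Mul_Mul bm_W[OF assms] cis_mult distrib_right)
lemma W_0: "W 0 t v = v" by (simp add: W_def)
lemma W_inv: "t \<in> {0..T} ==> W 1 t (W (-1) t v) = v" "t \<in> {0..T} ==> W (-1) t (W 1 t v) = v"
 by (simp_all add: W_W W_0)
lemma W_time0: "W \<sigma> 0 v = v" by (simp add: W_def \<Theta>_def \<Omega>_def phase_def)
lemma W_Mul: assumes "t \<in> {0..T}" "bm m" shows "W \<sigma> t (Mul m v) = Mul m (W \<sigma> t v)"
 unfolding W_def using bm_W[OF assms(1)] assms(2) by (simp add: Mul_Mul mult.commute)
lemma bp_W: assumes "t \<in> {0..T}" shows "bp (W \<sigma> t u) v = bp u (W \<sigma> t v)"
 unfolding W_def by (rule bp_Mul[OF bm_W[OF assms]])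

lemma bl_H: assumes "t \<in> {0..T}" shows "bounded_linear (H t)"
 unfolding H_def[abs_def]
 by (intro bounded_linear_compose[OF bounded_linear_cmul] bounded_linear_sub bounded_linear_compose[OF bl_W[OF assms]]
   bounded_linear_compose[OF bounded_linear_Ft] bounded_linear_compose[OF bounded_linear_Mul[OF bm_cV[OF assms]]]
   bounded_linear_compose[OF bounded_linear_Fi] bl_W[OF assms] bounded_linear_Mul[OF bm_mV[OF assms]])

lemma norm_H: assumes t: "t \<in> {0..T}" shows "norm (H t v) \<le> (2 * Bd/h) * norm v"
proof -
 have "norm (Mul (cV t) (Fi (W (-1) t v))) \<le> Bd * norm (Fi (W (-1) t v))"
  by (rule norm_Mul_le[OF bm_cV[OF t]]) (simp add: cV_def Bd[OF t])
 moreover have "norm (Mul (mV t) v) \<le> Bd * norm v"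
  by (rule norm_Mul_le[OF bm_mV[OF t]]) (simp add: mV_def Bd[OF t])
 ultimately have "norm (W 1 t (Ft (Mul (cV t) (Fi (W (-1) t v)))) - Mul (mV t) v) \<le> 2 * Bd * norm v"
  using norm_triangle_ineq4[of "W 1 t (Ft (Mul (cV t) (Fi (W (-1) t v))))" "Mul (mV t) v"] by (simp add: norm_W[OF t])
 hence "1/h * norm (W 1 t (Ft (Mul (cV t) (Fi (W (-1) t v)))) - Mul (mV t) v) \<le> 1/h*(2 * Bd * norm v)"
  using h by (intro mult_left_mono) auto
 thus ?thesis unfolding H_def norm_cmul using h by (simp add: norm_divide)
qed

lemma \<Theta>_deriv: assumes t: "t \<in> {0..T}" shows "((\<lambda>s. \<Theta> s \<xi>) has_vector_derivative \<Theta>' t \<xi>) (at t within {0..T})"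
proof -
 have c: "continuous_on {0..T} (\<lambda>s. V s (s *\<^sub>R (h *\<^sub>R \<xi>)))" by (intro V_comp continuous_intros) auto
 have "((\<lambda>s. 1/h * integral {0..s} (\<lambda>\<tau>. V \<tau> (\<tau> *\<^sub>R (h *\<^sub>R \<xi>))) + s*(h*(norm \<xi>)^2/2)) has_vector_derivative
   1/h * V t (t *\<^sub>R (h *\<^sub>R \<xi>)) + 1*(h*(norm \<xi>)^2/2)) (at t within {0..T})"
  by (intro has_vector_derivative_add has_vector_derivative_mult_left has_vector_derivative_mult_right
    integral_has_vector_derivative c t has_vector_derivative_id[unfolded id_def])
 thus ?thesis unfolding \<Theta>_def \<Omega>_def phase_def \<Theta>'_def by (simp add: mult.assoc)
qed

lemma \<Theta>'_bound: assumes "t \<in> {0..T}" shows "\<bar>\<Theta>' t \<xi>\<bar> \<le> Bd/h + h*(norm \<xi>)^2/2"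
proof -
 have "\<bar>V t ((t * h) *\<^sub>R \<xi>)/h\<bar> \<le> Bd/h" using Bd[OF assms] h by (simp add: abs_divide divide_right_mono)
 moreover have "\<bar>h*(norm \<xi>)^2/2\<bar> = h*(norm \<xi>)^2/2" using h by simp
 ultimately show ?thesis unfolding \<Theta>'_def by linarith
qed

lemma \<Theta>_lip: assumes "s \<in> {0..T}" "t \<in> {0..T}" shows "\<bar>\<Theta> t \<xi> - \<Theta> s \<xi>\<bar> \<le> (Bd/h + h*(norm \<xi>)^2/2)*\<bar>t - s\<bar>"
 using has_vector_derivative_mono_norm[OF \<Theta>_deriv, where B="Bd/h + h*(norm \<xi>)^2/2"] \<Theta>'_bound assms by simp

lemma \<Theta>_cont: "continuous_on {0..T} (\<lambda>s. \<Theta> s \<xi>)"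
 using has_vector_derivative_continuous[OF \<Theta>_deriv] by (auto simp: continuous_on_eq_continuous_within)

lemma W_tendsto: assumes t: "t \<in> {0..T}" shows "((\<lambda>s. W \<sigma> s v) \<longlongrightarrow> W \<sigma> t v) (at t within {0..T})"
 unfolding W_def
proof (rule Mul_tendsto_at[where C=1])
 show "((\<lambda>s. cis (\<sigma>*\<Theta> s x)) \<longlongrightarrow> cis (\<sigma>*\<Theta> t x)) (at t within {0..T})" for x
  using \<Theta>_cont[of x] t by (intro tendsto_intros) (auto simp: continuous_on_def)
qed (use t bm_W bm_measurable in auto)

lemma cV_tendsto: assumes t: "t \<in> {0..T}" shows "((\<lambda>s. Mul (cV s) v) \<longlongrightarrow> Mul (cV t) v) (at t within {0..T})"
proof (rule Mul_tendsto_at[where C=Bd])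
 have "continuous_on {0..T} (\<lambda>s. cV s x)" for x unfolding cV_def by (intro continuous_intros V_comp) auto
 thus "((\<lambda>s. cV s x) \<longlongrightarrow> cV t x) (at t within {0..T})" for x using t by (auto simp: continuous_on_def)
 show "norm (cV s x) \<le> Bd" if "s \<in> {0..T}" for s x using Bd[OF that] by (simp add: cV_def)
qed (use t bm_cV bm_measurable in auto)

lemma mV_tendsto: assumes t: "t \<in> {0..T}" shows "((\<lambda>s. Mul (mV s) v) \<longlongrightarrow> Mul (mV t) v) (at t within {0..T})"
proof (rule Mul_tendsto_at[where C=Bd])
 have "continuous_on {0..T} (\<lambda>s. mV s x)" for x unfolding mV_def by (intro continuous_intros V_comp) auto
 thus "((\<lambda>s. mV s x) \<longlongrightarrow> mV t x) (at t within {0..T})" for x using t by (auto simp: continuous_on_def)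
 show "norm (mV s x) \<le> Bd" if "s \<in> {0..T}" for s x using Bd[OF that] by (simp add: mV_def)
qed (use t bm_mV bm_measurable in auto)

lemma W_strong: assumes t: "t \<in> {0..T}" and u: "(u \<longlongrightarrow> u0) (at t within {0..T})" shows "((\<lambda>s. W \<sigma> s (u s)) \<longlongrightarrow> W \<sigma> t u0) (at t within {0..T})"
 by (rule strong_tendsto[where C=1, OF u W_tendsto[OF t]]) (auto simp: bl_W norm_W)
lemma cV_strong: assumes t: "t \<in> {0..T}" and u: "(u \<longlongrightarrow> u0) (at t within {0..T})" shows "((\<lambda>s. Mul (cV s) (u s)) \<longlongrightarrow> Mul (cV t) u0) (at t within {0..T})"
 by (rule strong_tendsto[where C=Bd, OF u cV_tendsto[OF t] bounded_linear_Mul[OF bm_cV] norm_Mul_le[OF bm_cV norm_cV]])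
lemma H_tendsto: assumes t: "t \<in> {0..T}" shows "((\<lambda>s. H s v) \<longlongrightarrow> H t v) (at t within {0..T})"
 unfolding H_def
 by (intro bounded_linear.tendsto[OF bounded_linear_cmul] tendsto_diff W_strong[OF t] bounded_linear.tendsto[OF bounded_linear_Ft]
   cV_strong[OF t] bounded_linear.tendsto[OF bounded_linear_Fi] W_tendsto[OF t] mV_tendsto[OF t])

lemma H_strong: assumes t: "t \<in> {0..T}" and u: "(u \<longlongrightarrow> u0) (at t within {0..T})" shows "((\<lambda>s. H s (u s)) \<longlongrightarrow> H t u0) (at t within {0..T})"
 by (rule strong_tendsto[where C="2 * Bd/h", OF u H_tendsto[OF t] bl_H norm_H])

definition strong :: "(real => l2) => bool" where
 "strong v \<longleftrightarrow> (\<forall>t\<in>{0..T}. (v has_vector_derivative H t (v t)) (at t within {0..T}))"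

lemma strong_exists: obtains v where "v 0 = x0" "strong v"
proof -
 obtain v where "v 0 = x0" "\<forall>t\<in>{0..T}. (v has_vector_derivative H t (v t)) (at t within {0..T})"
  by (rule linear_ode_exists[of T H "2 * Bd/h" x0])
   (use T bl_H norm_H h Bd0 H_tendsto in \<open>auto simp: continuous_on_def\<close>)
 thus thesis by (intro that) (auto simp: strong_def)
qed

text \<open>The difference quotients of the phase are dominated by Bd/h + h |\<xi>|^2/2 up to the
  factor |\<sigma>|, so membership in \<open>dom2\<close> provides the L^2 majorant for dominated
  convergence.\<close>

lemma W_deriv:
 assumes z: "dom2 z" and t: "t \<in> {0..T}"
 shows "((\<lambda>s. W \<sigma> s z) has_vector_derivative cmul (\<i> * of_real \<sigma>) (W \<sigma> t (cmul (1/of_real h) (Mul (mV t) z) + cmul (of_real h/2) (sqm z)))) (at t within {0..T})"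
 unfolding has_vector_derivative_iff_quotient tendsto_at_iff_sequentially comp_def
proof (intro allI impI)
 fix X assume X: "\<forall>i. X i \<in> {0..T} - {t}" "X \<longlonglongrightarrow> t"
 hence Xi: "X i \<in> {0..T}" "X i - t \<noteq> 0" for i by auto
 define q where "q n \<xi> = of_real (inverse (X n - t))*(cis (\<sigma>*\<Theta> (X n) \<xi>) - cis (\<sigma>*\<Theta> t \<xi>))" for n \<xi>
 have bq: "bm (q n)" for n unfolding q_def[abs_def] by (intro bm_mult bm_const bm_diff bm_W Xi t)
 have q: "(W \<sigma> (X n) z - W \<sigma> t z) /\<^sub>R (X n - t) = mk (\<lambda>\<xi>. q n \<xi> * rep z \<xi>)" for n
  unfolding Mul_def[of "q n", symmetric] W_def scaleR_Mul
   Mul_diff_fun[OF bm_W[OF Xi(1)] bm_W[OF t]]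
   Mul_Mul[OF bm_const bm_diff[OF bm_W[OF Xi(1)] bm_W[OF t]]]
  by (simp add: q_def[abs_def])
 define g where "g \<xi> = \<i> * of_real (\<sigma>*\<Theta>' t \<xi>) * cis (\<sigma>*\<Theta> t \<xi>) * rep z \<xi>" for \<xi>
 have mg: "g \<in> bmeas"
  unfolding g_def \<Theta>'_def using V_meas[OF t, of "\<lambda>\<xi>. (t * h) *\<^sub>R \<xi>"] bm_measurable[OF bm_W[OF t, of \<sigma>]]
  by (intro borel_measurable_times rep_measurable borel_measurable_const borel_measurable_of_real borel_measurable_add
    borel_measurable_divide) (auto simp: continuous_on_scaleR)
 have w: "(\<lambda>\<xi>. of_real (\<bar>\<sigma>\<bar> * Bd/h) * rep z \<xi> + of_real (\<bar>\<sigma>\<bar> * h/2)*(of_real ((norm \<xi>)^2) * rep z \<xi>)) \<in> L2"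
  using z unfolding dom2_def by (intro L2_add L2_cmult) auto
 have le: "norm (q n \<xi>) \<le> \<bar>\<sigma>\<bar>*(Bd/h + h*(norm \<xi>)^2/2)" for n \<xi>
 proof -
  have "norm (cis (\<sigma>*\<Theta> (X n) \<xi>) - cis (\<sigma>*\<Theta> t \<xi>)) \<le> \<bar>\<sigma>*(\<Theta> (X n) \<xi> - \<Theta> t \<xi>)\<bar>"
   using norm_cis_diff_le[of "\<sigma>*\<Theta> (X n) \<xi>" "\<sigma>*\<Theta> t \<xi>"] by (simp add: right_diff_distrib)
  also have "... \<le> \<bar>\<sigma>\<bar>*((Bd/h + h*(norm \<xi>)^2/2)*\<bar>X n - t\<bar>)"
   unfolding abs_mult by (intro mult_left_mono \<Theta>_lip Xi t) simp
  finally show ?thesis unfolding q_def norm_mult norm_of_real using Xi(2)[of n] by (simp add: field_simps)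
 qed
 have lim: "(\<lambda>n. q n \<xi>) \<longlonglongrightarrow> \<i> * of_real (\<sigma>*\<Theta>' t \<xi>) * cis (\<sigma>*\<Theta> t \<xi>)" for \<xi>
 proof -
  have "((\<lambda>s. cis (\<sigma>*\<Theta> s \<xi>)) has_vector_derivative (\<sigma>*\<Theta>' t \<xi>) *\<^sub>R (\<i> * cis (\<sigma>*\<Theta> t \<xi>))) (at t within {0..T})"
  proof -
   have d: "((\<lambda>s. \<sigma>*\<Theta> s \<xi>) has_vector_derivative \<sigma>*\<Theta>' t \<xi>) (at t within {0..T})"
    by (intro has_vector_derivative_mult_right \<Theta>_deriv t)
   have "(cis has_vector_derivative \<i> * cis (\<sigma>*\<Theta> t \<xi>)) (at (\<sigma>*\<Theta> t \<xi>) within (\<lambda>s. \<sigma>*\<Theta> s \<xi>) ` {0..T})"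
    unfolding has_vector_derivative_def by (auto intro!: derivative_eq_intros simp: scaleR_conv_of_real fun_eq_iff)
   from vector_diff_chain_within[OF d this] show ?thesis by (simp add: comp_def)
  qed
  hence "((\<lambda>s. (cis (\<sigma>*\<Theta> s \<xi>) - cis (\<sigma>*\<Theta> t \<xi>)) /\<^sub>R (s - t)) \<longlongrightarrow> (\<sigma>*\<Theta>' t \<xi>) *\<^sub>R (\<i> * cis (\<sigma>*\<Theta> t \<xi>))) (at t within {0..T})"
   unfolding has_vector_derivative_iff_quotient .
  hence "(\<lambda>n. (cis (\<sigma>*\<Theta> (X n) \<xi>) - cis (\<sigma>*\<Theta> t \<xi>)) /\<^sub>R (X n - t)) \<longlonglongrightarrow> (\<sigma>*\<Theta>' t \<xi>) *\<^sub>R (\<i> * cis (\<sigma>*\<Theta> t \<xi>))"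
   using X unfolding tendsto_at_iff_sequentially comp_def by blast
  thus ?thesis by (simp add: q_def scaleR_conv_of_real mult_ac)
 qed
 have gL: "g \<in> L2" and conv: "(\<lambda>n. mk (\<lambda>\<xi>. q n \<xi> * rep z \<xi>)) \<longlonglongrightarrow> mk g"
 proof -
  have m: "(\<lambda>\<xi>. q n \<xi> * rep z \<xi>) \<in> bmeas" for n
   by (intro borel_measurable_times rep_measurable bm_measurable bq)
  have l: "AE \<xi> in lborel. norm (q n \<xi> * rep z \<xi>) \<le> norm (of_real (\<bar>\<sigma>\<bar> * Bd/h) * rep z \<xi> + of_real (\<bar>\<sigma>\<bar> * h/2)*(of_real ((norm \<xi>)^2) * rep z \<xi>))" for n
  proof (intro AE_I2)
   fix \<xi>
   have e: "of_real (\<bar>\<sigma>\<bar> * Bd/h) * rep z \<xi> + of_real (\<bar>\<sigma>\<bar> * h/2)*(of_real ((norm \<xi>)^2) * rep z \<xi>) = of_real (\<bar>\<sigma>\<bar>*(Bd/h + h*(norm \<xi>)^2/2)) * rep z \<xi>"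
    by (simp add: field_simps)
   have p: "0 \<le> \<bar>\<sigma>\<bar>*(Bd/h + h*(norm \<xi>)^2/2)" using Bd0 h by (intro mult_nonneg_nonneg add_nonneg_nonneg) auto
   show "norm (q n \<xi> * rep z \<xi>) \<le> norm (of_real (\<bar>\<sigma>\<bar> * Bd/h) * rep z \<xi> + of_real (\<bar>\<sigma>\<bar> * h/2)*(of_real ((norm \<xi>)^2) * rep z \<xi>))"
    unfolding e norm_mult norm_of_real abs_of_nonneg[OF p] by (intro mult_right_mono le) simp
  qed
  have li: "AE \<xi> in lborel. (\<lambda>n. q n \<xi> * rep z \<xi>) \<longlonglongrightarrow> g \<xi>"
   unfolding g_def by (intro AE_I2 tendsto_mult_right lim)
  show "g \<in> L2" "(\<lambda>n. mk (\<lambda>\<xi>. q n \<xi> * rep z \<xi>)) \<longlonglongrightarrow> mk g"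
   using L2_dct[OF w m mg l li] .
 qed
 have "mk g = cmul (\<i> * of_real \<sigma>) (W \<sigma> t (cmul (1/of_real h) (Mul (mV t) z) + cmul (of_real h/2) (sqm z)))"
  unfolding l2_eq_iff W_def
  using rep_mk[OF gL] rep_cmul[of "\<i> * of_real \<sigma>" "Mul (\<lambda>\<xi>. cis (\<sigma>*\<Theta> t \<xi>)) (cmul (1/of_real h) (Mul (mV t) z) + cmul (of_real h/2) (sqm z))"]
   rep_Mul[OF bm_W[OF t, of \<sigma>], of "cmul (1/of_real h) (Mul (mV t) z) + cmul (of_real h/2) (sqm z)"]
   rep_add[of "cmul (1/of_real h) (Mul (mV t) z)" "cmul (of_real h/2) (sqm z)"] rep_cmul[of "1/of_real h" "Mul (mV t) z"]
   rep_cmul[of "of_real h/2" "sqm z"] rep_Mul[OF bm_mV[OF t], of z] rep_mk[OF z[unfolded dom2_def]]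
  unfolding sqm_def[symmetric]
  by eventually_elim (simp add: g_def \<Theta>'_def mV_def algebra_simps)
 thus "(\<lambda>n. (W \<sigma> (X n) z - W \<sigma> t z) /\<^sub>R (X n - t)) \<longlonglongrightarrow> cmul (\<i> * of_real \<sigma>) (W \<sigma> t (cmul (1/of_real h) (Mul (mV t) z) + cmul (of_real h/2) (sqm z)))"
  using conv unfolding q by simp
qed

end

text \<open>The transforms of bumps already separate; the positive factor 1 + |\<xi>|^2 is moved
  from the test side onto \<open>Y\<close> and divided out pointwise.\<close>

lemma test_orthogonal_0:
 assumes 0: "\<And>\<psi>. test_function \<psi> ==> bp Y (Fi (mk \<psi>) + sqm (Fi (mk \<psi>))) = 0"
 shows "Y = 0"
proof -
 define F where "F \<psi> \<xi> = of_real c0*(of_real (1 + (norm \<xi>)^2) * chk \<psi> \<xi>)" for \<psi> \<xi>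
 have F: "F \<psi> \<in> L2 \<and> mk (F \<psi>) = Fi (mk \<psi>) + sqm (Fi (mk \<psi>))" if "test_function \<psi>" for \<psi>
 proof -
  note L = test_function_L12[OF that]
  have e: "F \<psi> \<xi> = of_real c0 * chk \<psi> \<xi> - of_real c0 * chk (laplacian \<psi>) \<xi>" for \<xi>
   unfolding F_def chk_laplacian[OF that] by (simp add: algebra_simps)
  show ?thesis unfolding dom2_test(2)[OF that] e[abs_def]
   using Fi_mk[OF L(1)] Fi_mk[OF L(2)] by (simp add: mk_diff L2_diff)
 qed
 have "AE \<xi> in lborel. of_real (1 + (norm \<xi>)^2) * rep Y \<xi> = 0"
 proof (rule chk_bump_separating)
  have q: "of_real (1 + (norm \<eta>)^2) * rep Y \<eta> * chk \<psi> \<eta> = (1/of_real c0)*(rep Y \<eta> * F \<psi> \<eta>)" for \<psi> \<eta>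
   using c0_pos by (simp add: F_def)
  show "integrable lborel (\<lambda>\<eta>. of_real (1 + (norm \<eta>)^2) * rep Y \<eta> * chk (bumpl l 0) \<eta>)" if "l > 0" for l
   unfolding q using F[OF test_function_bumpl[OF that]] by (intro integrable_mult_right L2_mult_integrable) auto
  show "(LBINT \<eta>. of_real (1 + (norm \<eta>)^2) * rep Y \<eta> * chk (bumpl l b) \<eta>) = 0" if "l > 0" for l b
   unfolding q integral_mult_right_zero using F[OF test_function_bumpl[OF that, of b]] 0[OF test_function_bumpl[OF that, of b]]
   by (subst bp_mk[OF rep_L2, symmetric]) auto
 qed measurable
 hence "AE \<xi> in lborel. rep Y \<xi> = rep 0 \<xi>"
  using rep_zero
 proof eventually_elim
  case (elim \<xi>)
  have "complex_of_real (1 + (norm \<xi>)^2) \<noteq> 0" using one_plus_sq_pos[of \<xi>] unfolding of_real_eq_0_iff by linarith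
  thus ?case using elim by simp
 qed
 thus ?thesis unfolding l2_eq_iff .
qed

lemma bp_plancherel: "bp u v = bp (Ft u) (Fi v)"
 using bp_Fi[of "Ft u" v] by simp

text \<open>A norm derivative is recovered from derivatives under jointly injective bounded
  operators: \<open>v\<close> is compared with the integral of the continuous \<open>w\<close>, and
  each operator sees a constant difference. It is used with the test pairings and with
  \<open>Lam\<close>.\<close>

lemma has_vector_derivative_cancel:
 fixes v w :: "real => 'a::banach"
 assumes w: "continuous_on {0..T} w" and t: "t \<in> {0..T}"
  and A: "\<And>i. i \<in> I ==> bounded_linear (A i :: 'a => 'b::real_normed_vector)" and inj: "\<And>x. (\<And>i. i \<in> I ==> A i x = 0) ==> x = 0"
  and d: "\<And>i t. i \<in> I ==> t \<in> {0..T} ==> ((\<lambda>s. A i (v s)) has_vector_derivative A i (w t)) (at t within {0..T})"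
 shows "(v has_vector_derivative w t) (at t within {0..T})"
proof -
 define J where "J t = integral {0..t} w" for t
 have J: "(J has_vector_derivative w t) (at t within {0..T})" if "t \<in> {0..T}" for t
  unfolding J_def[abs_def] by (rule integral_has_vector_derivative[OF w that])
 have "v t - J t - (v 0 - J 0) = 0" if t: "t \<in> {0..T}" for t
 proof (rule inj)
  fix i assume i: "i \<in> I"
  note lin = linear_diff[OF bounded_linear.linear[OF A[OF i]]]
  have "((\<lambda>s. A i (v s) - A i (J s)) has_vector_derivative A i (w s) - A i (w s)) (at s within {0..T})" if "s \<in> {0..T}" for s
   by (intro has_vector_derivative_diff d i that bounded_linear.has_vector_derivative[OF A[OF i] J])
  hence "A i (v t) - A i (J t) = A i (v 0) - A i (J 0)"
   using t by (intro zero_derivative_const[of T "\<lambda>s. A i (v s) - A i (J s)" t]) auto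
  thus "A i (v t - J t - (v 0 - J 0)) = 0" by (simp add: lin)
 qed
 hence e: "v s = J s + (v 0 - J 0)" if "s \<in> {0..T}" for s using that by (simp add: algebra_simps)
 have "((\<lambda>s. J s + (v 0 - J 0)) has_vector_derivative w t + 0) (at t within {0..T})"
  by (intro has_vector_derivative_add J t has_vector_derivative_const)
 thus ?thesis using has_vector_derivative_transform[OF t e] by simp
qed

context evo
begin

section \<open>The distributional equation and the flow in Fourier variables\<close>

lemma weak_pairing:
 assumes "u \<in> L2" "test_function \<psi>" "t \<in> {0..T}"
 shows "(LBINT x. u x*\<psi> x) = bp (Ft (mk u)) (Fi (mk \<psi>))"
  and "(LBINT x. u x*(- of_real (h\<^sup>2/2) * laplacian \<psi> x + of_real (V t x)*\<psi> x)) =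
   of_real (h\<^sup>2/2) * bp (Ft (mk u)) (sqm (Fi (mk \<psi>))) + bp (Ft (Mul (cV t) (mk u))) (Fi (mk \<psi>))"
proof -
 note L = test_function_L12[OF assms(2), THEN L12D(1)]
 show "(LBINT x. u x*\<psi> x) = bp (Ft (mk u)) (Fi (mk \<psi>))"
  using assms L by (simp add: bp_mk bp_plancherel[symmetric])
 have cL: "(\<lambda>x. cV t x * u x) \<in> L2" by (rule bm_mult_L2[OF bm_cV[OF assms(3)] assms(1)])
 have "(LBINT x. u x*(- of_real (h\<^sup>2/2) * laplacian \<psi> x + of_real (V t x)*\<psi> x)) =
  (LBINT x. - of_real (h\<^sup>2/2)*(u x * laplacian \<psi> x) + (cV t x * u x)*\<psi> x)"
  by (rule Bochner_Integration.integral_cong) (simp_all add: cV_def algebra_simps)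
 also have "... = - of_real (h\<^sup>2/2)*(LBINT x. u x * laplacian \<psi> x) + (LBINT x. (cV t x * u x)*\<psi> x)"
  using L2_mult_integrable[OF assms(1) L(2)] L2_mult_integrable[OF cL L(1)]
  by (subst Bochner_Integration.integral_add) (auto intro!: integrable_mult_right)
 also have "(LBINT x. u x * laplacian \<psi> x) = - bp (Ft (mk u)) (sqm (Fi (mk \<psi>)))"
  unfolding dom2_test(2)[OF assms(2)] bp_mk[OF assms(1) L(2), symmetric] bp_plancherel[of "mk u"]
  by (simp add: bp_cip cip_uminus_right)
 also have "(LBINT x. (cV t x * u x)*\<psi> x) = bp (Ft (Mul (cV t) (mk u))) (Fi (mk \<psi>))"
  unfolding bp_mk[OF cL L(1), symmetric] bp_plancherel[symmetric] Mul_mk[OF bm_cV[OF assms(3)] assms(1)] ..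
 finally show "(LBINT x. u x*(- of_real (h\<^sup>2/2) * laplacian \<psi> x + of_real (V t x)*\<psi> x)) =
   of_real (h\<^sup>2/2) * bp (Ft (mk u)) (sqm (Fi (mk \<psi>))) + bp (Ft (Mul (cV t) (mk u))) (Fi (mk \<psi>))" by simp
qed

lemma strong_continuous: "strong v ==> continuous_on {0..T} v"
 unfolding strong_def continuous_on_eq_continuous_within using has_vector_derivative_continuous by blast

text \<open>The inverse phase is moved onto the transform of the test function, which lies in
  \<open>dom2\<close>, and is differentiated there. The potential part of the phase derivative
  cancels the subtracted term of \<open>H\<close>, leaving the kinetic term and V.\<close>

lemma strong_solution:
 assumes v: "strong v" and \<phi>: "\<phi> \<in> L2" "v 0 = Ft (mk \<phi>)"
 shows "schrodinger_solution h T V \<phi> (\<lambda>t. rep (Fi (W (-1) t (v t))))"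
 unfolding schrodinger_solution_def
proof (intro conjI ballI allI impI)
 define u where "u t = Fi (W (-1) t (v t))" for t
 fix t assume t: "t \<in> {0..T}"
 show "rep (Fi (W (-1) t (v t))) \<in> L2" by simp
 have "(v \<longlongrightarrow> v t) (at t within {0..T})" using strong_continuous[OF v] t by (simp add: continuous_on_def)
 hence "(u \<longlongrightarrow> u t) (at t within {0..T})" unfolding u_def[abs_def]
  by (intro bounded_linear.tendsto[OF bounded_linear_Fi] W_strong t)
 hence "((\<lambda>\<tau>. norm (u \<tau> - u t)) \<longlongrightarrow> 0) (at t within {0..T})" by (intro tendsto_norm_zero) (simp add: LIM_zero)
 moreover have "norm (u \<tau> - u t) = L2_norm (\<lambda>x. rep (u \<tau>) x - rep (u t) x)" for \<tau>
  unfolding norm_l2 by (intro L2_norm_cong rep_diff) measurable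
 ultimately show "((\<lambda>\<tau>. L2_norm (\<lambda>x. rep (Fi (W (-1) \<tau> (v \<tau>))) x - rep (Fi (W (-1) t (v t))) x)) \<longlongrightarrow> 0) (at t within {0..T})"
  by (simp add: u_def)
next
 show "AE x in lborel. rep (Fi (W (-1) 0 (v 0))) x = \<phi> x"
  using rep_mk[OF \<phi>(1)] by (simp add: W_time0 \<phi>(2))
next
 fix \<psi> t assume \<psi>: "test_function \<psi>" and t: "t \<in> {0..T}"
 define \<zeta> where "\<zeta> = Fi (mk \<psi>)"
 have z: "dom2 \<zeta>" unfolding \<zeta>_def by (rule dom2_test(1)[OF \<psi>])
 have d: "((\<lambda>s. bp (v s) (W (-1) s \<zeta>)) has_vector_derivative
   bp (v t) (cmul (\<i> * of_real (-1)) (W (-1) t (cmul (1/of_real h) (Mul (mV t) \<zeta>) + cmul (of_real h/2) (sqm \<zeta>)))) + bp (H t (v t)) (W (-1) t \<zeta>))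
   (at t within {0..T})"
  using v[unfolded strong_def] t by (intro bounded_bilinear.has_vector_derivative[OF bounded_bilinear_bp] W_deriv[OF z]) auto
 have bl: "bounded_linear (\<lambda>x::complex. \<i> * of_real h * x)" by (intro bounded_linear_intros)
 have h2: "bp (H t (v t)) (W (-1) t \<zeta>) = (- \<i>/of_real h)*(bp (Ft (Mul (cV t) (Fi (W (-1) t (v t))))) \<zeta> - bp (v t) (W (-1) t (Mul (mV t) \<zeta>)))"
  unfolding H_def bp_cmul bounded_bilinear.diff_left[OF bounded_bilinear_bp] bp_W[OF t] W_inv[OF t] bp_Mul[OF bm_mV[OF t]]
   W_Mul[OF t bm_mV[OF t]] ..
 have i1: "bp (v t) (cmul (\<i> * of_real (-1)) (W (-1) t (cmul (1/of_real h) (Mul (mV t) \<zeta>) + cmul (of_real h/2) (sqm \<zeta>))))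
  = - \<i>*((1/of_real h) * bp (v t) (W (-1) t (Mul (mV t) \<zeta>)) + (of_real h/2) * bp (v t) (W (-1) t (sqm \<zeta>)))"
  unfolding bp_cmul bp_W[OF t, symmetric] bounded_bilinear.add_right[OF bounded_bilinear_bp] by simp
 show "((\<lambda>\<tau>. \<i> * of_real h*(LBINT x. rep (Fi (W (-1) \<tau> (v \<tau>))) x*\<psi> x)) has_vector_derivative
   (LBINT x. rep (Fi (W (-1) t (v t))) x*(- of_real (h\<^sup>2/2) * laplacian \<psi> x + of_real (V t x)*\<psi> x))) (at t within {0..T})"
 proof (rule has_vector_derivative_transform[OF t])
  show "\<i> * of_real h*(LBINT x. rep (Fi (W (-1) \<tau> (v \<tau>))) x*\<psi> x) = \<i> * of_real h * bp (v \<tau>) (W (-1) \<tau> \<zeta>)" if "\<tau> \<in> {0..T}" for \<tau>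
   unfolding weak_pairing(1)[OF rep_L2 \<psi> t] \<zeta>_def by (simp add: bp_W[OF that])
  have "(LBINT x. rep (Fi (W (-1) t (v t))) x*(- of_real (h\<^sup>2/2) * laplacian \<psi> x + of_real (V t x)*\<psi> x)) =
   \<i> * of_real h*(bp (v t) (cmul (\<i> * of_real (-1)) (W (-1) t (cmul (1/of_real h) (Mul (mV t) \<zeta>) + cmul (of_real h/2) (sqm \<zeta>)))) + bp (H t (v t)) (W (-1) t \<zeta>))"
   unfolding weak_pairing(2)[OF rep_L2 \<psi> t] h2 i1 \<zeta>_def[symmetric] mk_rep Ft_Fi bp_W[OF t]
   using h by (simp add: field_simps power2_eq_square)
  thus "((\<lambda>\<tau>. \<i> * of_real h * bp (v \<tau>) (W (-1) \<tau> \<zeta>)) has_vector_derivative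
   (LBINT x. rep (Fi (W (-1) t (v t))) x*(- of_real (h\<^sup>2/2) * laplacian \<psi> x + of_real (V t x)*\<psi> x))) (at t within {0..T})"
   using bounded_linear.has_vector_derivative[OF bl d] by simp
 qed
qed

text \<open>Any distributional solution, not only the constructed one, has to be shown to solve the
  equation in norm. \<open>Lam\<close> makes the kinetic term bounded; after the product rule with
  the phase the kinetic parts cancel, and \<open>Lam\<close> is removed by injectivity.\<close>

lemma solution_strong:
 assumes u: "schrodinger_solution h T V \<phi> u"
 shows "strong (\<lambda>t. W 1 t (Ft (mk (u t))))"
proof -
 define U where "U t = Ft (mk (u t))" for t
 define S where "S = Mul (\<lambda>\<xi>. of_real (1*(norm \<xi>)^2) * Lam \<xi>)"
 \<comment> \<open>The right side of the equation for the transform of \<open>u\<close>, multiplied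
   by \<open>Lam\<close>: now a continuous curve in L^2.\<close>
 define E where "E t = cmul (- \<i>/of_real h) (cmul (of_real (h\<^sup>2/2)) (S (U t)) + Mul Lam (Ft (Mul (cV t) (mk (u t)))))" for t
 have uL: "u t \<in> L2" if "t \<in> {0..T}" for t using u that unfolding schrodinger_solution_def by blast
 have muc: "((\<lambda>t. mk (u t)) \<longlongrightarrow> mk (u t)) (at t within {0..T})" if t: "t \<in> {0..T}" for t
 proof (rule LIM_zero_cancel, rule tendsto_norm_zero_cancel)
  have "((\<lambda>\<tau>. L2_norm (\<lambda>x. u \<tau> x - u t x)) \<longlongrightarrow> 0) (at t within {0..T})"
   using u t unfolding schrodinger_solution_def by blast
  thus "((\<lambda>\<tau>. norm (mk (u \<tau>) - mk (u t))) \<longlongrightarrow> 0) (at t within {0..T})"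
  proof (rule Lim_transform_within[OF _ zero_less_one])
   fix \<tau> assume "\<tau> \<in> {0..T}"
   thus "L2_norm (\<lambda>x. u \<tau> x - u t x) = norm (mk (u \<tau>) - mk (u t))"
    using uL t by (simp add: mk_diff norm_mk L2_diff)
  qed
 qed
 have Uc: "(U \<longlongrightarrow> U t) (at t within {0..T})" if "t \<in> {0..T}" for t
  unfolding U_def[abs_def] by (intro bounded_linear.tendsto[OF bounded_linear_Ft] muc that)
 have Sb: "bounded_linear S" unfolding S_def by (intro bounded_linear_Mul bm_sq_Lam)
 have Ec: "continuous_on {0..T} E" unfolding continuous_on_def E_def
  by (intro ballI bounded_linear.tendsto[OF bounded_linear_cmul] tendsto_add bounded_linear.tendsto[OF Sb] Uc
    bounded_linear.tendsto[OF bounded_linear_Mul[OF bm_Lam]] bounded_linear.tendsto[OF bounded_linear_Ft] cV_strong muc)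
 have f: "((\<lambda>t. Mul Lam (U t)) has_vector_derivative E t) (at t within {0..T})" if t: "t \<in> {0..T}" for t
 proof (rule has_vector_derivative_cancel[OF Ec t, of "{\<psi>. test_function \<psi>}" "\<lambda>\<psi> Y. bp Y (Fi (mk \<psi>) + sqm (Fi (mk \<psi>)))"])
  show "bounded_linear (\<lambda>Y. bp Y (Fi (mk \<psi>) + sqm (Fi (mk \<psi>))))" for \<psi>
   by (rule bounded_bilinear.bounded_linear_left[OF bounded_bilinear_bp])
  show "x = 0" if "\<And>\<psi>. \<psi> \<in> {\<psi>. test_function \<psi>} ==> bp x (Fi (mk \<psi>) + sqm (Fi (mk \<psi>))) = 0" for x
   using that by (intro test_orthogonal_0) auto
  fix \<psi> t assume "\<psi> \<in> {\<psi>. test_function \<psi>}" and t: "t \<in> {0..T}"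
  hence \<psi>: "test_function \<psi>" by simp
  define \<zeta> where "\<zeta> = Fi (mk \<psi>)"
  have z: "Mul Lam (\<zeta> + sqm \<zeta>) = \<zeta>" "S (\<zeta> + sqm \<zeta>) = sqm \<zeta>"
   using dom2_unLam[OF dom2_test(1)[OF \<psi>]] unfolding \<zeta>_def S_def by simp_all
  have bl: "bounded_linear (\<lambda>x::complex. (- \<i>/of_real h) * x)" by (intro bounded_linear_intros)
  have "((\<lambda>\<tau>. \<i> * of_real h*(LBINT x. u \<tau> x*\<psi> x)) has_vector_derivative
      (LBINT x. u t x*(- of_real (h\<^sup>2/2) * laplacian \<psi> x + of_real (V t x)*\<psi> x))) (at t within {0..T})"
   using u t \<psi> unfolding schrodinger_solution_def by blast
  from bounded_linear.has_vector_derivative[OF bl this]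
  show "((\<lambda>s. bp (Mul Lam (U s)) (Fi (mk \<psi>) + sqm (Fi (mk \<psi>)))) has_vector_derivative bp (E t) (Fi (mk \<psi>) + sqm (Fi (mk \<psi>)))) (at t within {0..T})"
  proof (rule has_vector_derivative_transform[OF t, rotated, THEN has_vector_derivative_eq_rhs])
   show "bp (Mul Lam (U \<tau>)) (Fi (mk \<psi>) + sqm (Fi (mk \<psi>))) = - \<i>/of_real h*(\<i> * of_real h*(LBINT x. u \<tau> x*\<psi> x))" if "\<tau> \<in> {0..T}" for \<tau>
    unfolding bp_Mul[OF bm_Lam] \<zeta>_def[symmetric] z weak_pairing(1)[OF uL[OF that] \<psi> t] U_def using h by (simp add: \<zeta>_def)
   show "- \<i>/of_real h*(LBINT x. u t x*(- of_real (h\<^sup>2/2) * laplacian \<psi> x + of_real (V t x)*\<psi> x)) = bp (E t) (Fi (mk \<psi>) + sqm (Fi (mk \<psi>)))"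
    unfolding weak_pairing(2)[OF uL[OF t] \<psi> t] E_def bp_cmul bounded_bilinear.add_left[OF bounded_bilinear_bp] S_def bp_Mul[OF bm_sq_Lam] bp_Mul[OF bm_Lam]
    unfolding S_def[symmetric] \<zeta>_def[symmetric] z U_def ..
  qed
 qed
 define v where "v t = W 1 t (U t)" for t
 have G: "((\<lambda>s. Mul Lam (v s)) has_vector_derivative Mul Lam (H t (v t))) (at t within {0..T})" if t: "t \<in> {0..T}" for t
 proof -
  define f where "f s = Mul Lam (U s)" for s
  \<comment> \<open>Product rule for a phase that is only strongly differentiable: the moving phase
    acts on the quotient of \<open>f\<close>, and the phase itself is differentiated on the fixed
    vector \<open>f t\<close>, which lies in \<open>dom2\<close>.\<close>
  have q: "(W 1 s (f s) - W 1 t (f t)) /\<^sub>R (s - t) = W 1 s ((f s - f t) /\<^sub>R (s - t)) + (W 1 s (f t) - W 1 t (f t)) /\<^sub>R (s - t)" if "s \<in> {0..T}" for s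
   unfolding linear_scale[OF bounded_linear.linear[OF bl_W[OF that]]] linear_diff[OF bounded_linear.linear[OF bl_W[OF that]]]
   by (simp add: scaleR_diff_right)
  have "((\<lambda>s. W 1 s ((f s - f t) /\<^sub>R (s - t)) + (W 1 s (f t) - W 1 t (f t)) /\<^sub>R (s - t)) \<longlongrightarrow>
    W 1 t (E t) + cmul (\<i> * of_real 1) (W 1 t (cmul (1/of_real h) (Mul (mV t) (f t)) + cmul (of_real h/2) (sqm (f t))))) (at t within {0..T})"
   using f[OF t] W_deriv[OF dom2_Lam(1) t, of "1" "U t"] unfolding has_vector_derivative_iff_quotient f_def[symmetric]
   by (intro tendsto_add W_strong[OF t])
  hence "((\<lambda>s. W 1 s (f s)) has_vector_derivative
    W 1 t (E t) + cmul (\<i> * of_real 1) (W 1 t (cmul (1/of_real h) (Mul (mV t) (f t)) + cmul (of_real h/2) (sqm (f t))))) (at t within {0..T})"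
   unfolding has_vector_derivative_iff_quotient by (rule Lim_transform_within[OF _ zero_less_one]) (simp add: q)
  moreover have "W 1 t (E t) + cmul (\<i> * of_real 1) (W 1 t (cmul (1/of_real h) (Mul (mV t) (f t)) + cmul (of_real h/2) (sqm (f t)))) = Mul Lam (H t (v t))"
  proof -
   have sq: "sqm (f t) = S (U t)" unfolding f_def S_def by (rule dom2_Lam(2))
   have r: "Fi (W (-1) t (v t)) = mk (u t)" by (simp add: v_def W_inv[OF t] U_def)
   have m: "Mul Lam (Mul (mV t) (v t)) = W 1 t (Mul (mV t) (f t))"
    unfolding v_def f_def W_Mul[OF t bm_mV[OF t]] W_Mul[OF t bm_Lam] by (simp add: Mul_Mul bm_mV[OF t] mult.commute)
   show ?thesis
   proof (rule l2_eq_by_cip)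
    fix y
    have cW: "W 1 t (a + b) = W 1 t a + W 1 t b" "W 1 t (cmul c a) = cmul c (W 1 t a)" for a b c
     unfolding W_def by (rule Mul_add[OF bm_W[OF t]] Mul_cmul[OF bm_W[OF t]])+
    show "cip y (W 1 t (E t) + cmul (\<i> * of_real 1) (W 1 t (cmul (1/of_real h) (Mul (mV t) (f t)) + cmul (of_real h/2) (sqm (f t))))) = cip y (Mul Lam (H t (v t)))"
     unfolding H_def E_def sq r Mul_cmul[OF bm_Lam] Mul_diff[OF bm_Lam] m W_Mul[OF t bm_Lam, symmetric] cW cip_simps
     using h by (simp add: field_simps power2_eq_square)
   qed
  qed
  ultimately have "((\<lambda>s. W 1 s (f s)) has_vector_derivative Mul Lam (H t (v t))) (at t within {0..T})" by simp
  thus ?thesis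
   by (rule has_vector_derivative_transform[OF t, rotated]) (simp add: v_def f_def W_Mul)
 qed
 have vc: "(v \<longlongrightarrow> v t) (at t within {0..T})" if "t \<in> {0..T}" for t
  unfolding v_def[abs_def] by (intro W_strong Uc that)
 have "(v has_vector_derivative H t (v t)) (at t within {0..T})" if t: "t \<in> {0..T}" for t
 proof (rule has_vector_derivative_cancel[OF _ t, of "\<lambda>t. H t (v t)" "UNIV :: unit set" "\<lambda>_. Mul Lam"])
  show "continuous_on {0..T} (\<lambda>t. H t (v t))" unfolding continuous_on_def by (intro ballI H_strong vc)
 qed (use G Mul_Lam_inj bounded_linear_Mul[OF bm_Lam] in auto)
 thus ?thesis by (simp add: strong_def v_def[abs_def] U_def)
qed

text \<open>The choice in \<open>propagator\<close> is legitimate because a solution exists, and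
  whichever solution is chosen, adding the phase turns it into a norm solution with the prescribed
  initial value.\<close>

lemma propagator_strong:
 assumes \<phi>: "\<phi> \<in> L2"
 obtains v where "strong v" "v 0 = Ft (mk \<phi>)"
  "\<forall>t\<in>{0..T}. propagator h T V t \<phi> \<in> L2 \<and> mk (propagator h T V t \<phi>) = Fi (W (-1) t (v t))"
proof -
 obtain v0 where v0: "v0 0 = Ft (mk \<phi>)" "strong v0" by (rule strong_exists)
 define u where "u = (SOME u. schrodinger_solution h T V \<phi> u)"
 have u: "schrodinger_solution h T V \<phi> u" unfolding u_def
  by (rule someI[of "schrodinger_solution h T V \<phi>", OF strong_solution[OF v0(2) \<phi> v0(1)]])
 have p: "propagator h T V t \<phi> = u t" for t by (simp add: propagator_def u_def)
 have uL: "u t \<in> L2" if "t \<in> {0..T}" for t using u that unfolding schrodinger_solution_def by blast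
 have "AE x in lborel. u 0 x = \<phi> x" using u unfolding schrodinger_solution_def by blast
 hence 0: "mk (u 0) = mk \<phi>" using uL[of 0] T \<phi> by (subst mk_eq_iff) auto
 show thesis
  by (rule that[OF solution_strong[OF u]]) (use uL in \<open>auto simp: p W_inv 0 W_time0\<close>)
qed

lemma bm_\<Omega>: assumes "t \<in> {0..T}" shows "bm (\<lambda>\<xi>. cis (\<Omega> t \<xi>))"
 using \<Omega>_cont[OF assms] by (intro bm_cis borel_measurable_continuous_onI)

text \<open>The free propagator run backwards has symbol e^(i t h |\<xi>|^2/2), and together with
  e^(i\<Omega>) this is exactly the phase that separates the propagator from v. The unweighted
  operator of the statement is therefore the flow of \<open>H\<close>, conjugated by the Fourier
  transform.\<close>

lemma wave_operator_strong:
 assumes \<phi>: "\<phi> \<in> L2"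
 obtains v where "strong v" "v 0 = Ft (mk \<phi>)"
  "\<forall>t\<in>{0..T}. semiclassical_multiplier h (\<lambda>\<xi>. cis (phase h V t \<xi>)) (wave_operator h T V t \<phi>) \<in> L2 \<and>
   mk (semiclassical_multiplier h (\<lambda>\<xi>. cis (phase h V t \<xi>)) (wave_operator h T V t \<phi>)) = Fi (v t)"
proof -
 obtain v where v: "strong v" "v 0 = Ft (mk \<phi>)"
  "\<forall>t\<in>{0..T}. propagator h T V t \<phi> \<in> L2 \<and> mk (propagator h T V t \<phi>) = Fi (W (-1) t (v t))"
  using propagator_strong[OF \<phi>] .
 show thesis
 proof (rule that[OF v(1,2)], intro ballI)
  fix t assume t: "t \<in> {0..T}"
  define m where "m \<xi> = cis (- (- t * h*(norm \<xi>)^2/2))" for \<xi> :: R3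
  have bm: "bm m" unfolding m_def by (rule bm_cis) measurable
  have w: "wave_operator h T V t \<phi> = fourier_multiplier m (propagator h T V t \<phi>)"
   by (simp add: wave_operator_def free_propagator_def m_def[abs_def])
  note F1 = fourier_multiplier_L2[OF bm, of "propagator h T V t \<phi>"] fourier_multiplier_L2[OF bm_\<Omega>[OF t], of "wave_operator h T V t \<phi>"]
  have "(\<lambda>\<xi>. cis (\<Omega> t \<xi>) * m \<xi>) = (\<lambda>\<xi>. cis (1*\<Theta> t \<xi>))" by (simp add: m_def cis_mult \<Theta>_def)
  hence "Mul (\<lambda>\<xi>. cis (\<Omega> t \<xi>)) (Mul m (W (-1) t (v t))) = v t"
   using W_inv(1)[OF t, of "v t"] by (simp add: Mul_Mul bm_\<Omega>[OF t] bm W_def[of 1])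
  thus "semiclassical_multiplier h (\<lambda>\<xi>. cis (phase h V t \<xi>)) (wave_operator h T V t \<phi>) \<in> L2 \<and>
   mk (semiclassical_multiplier h (\<lambda>\<xi>. cis (phase h V t \<xi>)) (wave_operator h T V t \<phi>)) = Fi (v t)"
   unfolding semiclassical_multiplier_def \<Omega>_def[symmetric] using F1 v(3) t by (simp add: w)
 qed
qed

end

section \<open>Energy estimates\<close>

text \<open>The square root is regularised to \<open>sqrt (e\<^sup>2 + |w|\<^sup>2)\<close>, which is differentiable also where \<open>w\<close> vanishes.\<close>

lemma energy_le:
 fixes w w' :: "real => 'a::real_inner"
 assumes d: "\<And>t. t \<in> {0..T} ==> (w has_vector_derivative w' t) (at t within {0..T})"
  and G: "\<And>t. t \<in> {0..T} ==> (G has_real_derivative g t) (at t within {0..T})"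
  and le: "\<And>t. t \<in> {0..T} ==> inner (w t) (w' t) \<le> norm (w t) * g t" and g0: "\<And>t. t \<in> {0..T} ==> 0 \<le> g t"
  and t: "t \<in> {0..T}"
 shows "norm (w t) \<le> norm (w 0) + (G t - G 0)"
proof (rule field_le_epsilon)
 fix e :: real assume e: "e > 0"
 define y where "y s = sqrt (e\<^sup>2 + inner (w s) (w s))" for s
 have pos: "0 < e\<^sup>2 + inner (w s) (w s)" for s using e by (intro add_pos_nonneg) auto
 have wy: "norm (w s) \<le> y s" for s unfolding y_def norm_eq_sqrt_inner by (rule real_sqrt_le_mono) simp
 have y0: "0 < y s" for s unfolding y_def using pos by simp
 have dy: "(y has_real_derivative inner (w s) (w' s)/y s) (at s within {0..T})" if s: "s \<in> {0..T}" for s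
 proof -
  have "((\<lambda>s. inner (w s) (w s)) has_vector_derivative inner (w s) (w' s) + inner (w' s) (w s)) (at s within {0..T})"
   by (rule bounded_bilinear.has_vector_derivative[OF bounded_bilinear_inner d[OF s] d[OF s]])
  hence "((\<lambda>s. inner (w s) (w s)) has_real_derivative 2 * inner (w s) (w' s)) (at s within {0..T})"
   by (simp add: has_real_derivative_iff_has_vector_derivative inner_commute)
  hence "((\<lambda>s. e\<^sup>2 + inner (w s) (w s)) has_real_derivative 0 + 2 * inner (w s) (w' s)) (at s within {0..T})"
   by (intro DERIV_add DERIV_const)
  from DERIV_chain2[OF DERIV_real_sqrt[OF pos] this] show ?thesis
   unfolding y_def[abs_def] by (simp add: field_simps)
 qed
 have "y t - G t \<le> y 0 - G 0"
 proof (rule DERIV_nonpos_imp_decreasing_open[of 0 t "\<lambda>s. y s - G s"])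
  show "0 \<le> t" using t by simp
  fix s assume s: "0 < s" "s < t"
  hence sT: "s \<in> {0..T}" "s \<in> {0<..<T}" using t by auto
  have "((\<lambda>s. y s - G s) has_real_derivative inner (w s) (w' s)/y s - g s) (at s within {0..T})"
   by (intro DERIV_diff dy G sT)
  moreover have "at s within {0..T} = at s" using sT(2) by (intro at_within_interior) simp
  moreover have "inner (w s) (w' s)/y s - g s \<le> 0"
   using order_trans[OF le[OF sT(1)] mult_right_mono[OF wy g0[OF sT(1)]]] y0[of s] by (simp add: divide_le_eq mult.commute)
  ultimately show "\<exists>z. ((\<lambda>s. y s - G s) has_real_derivative z) (at s) \<and> z \<le> 0" by auto
 next
  have "continuous_on {0..T} (\<lambda>s. y s - G s)"
   unfolding continuous_on_eq_continuous_within by (intro ballI DERIV_continuous[OF DERIV_diff[OF dy G]])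
  thus "continuous_on {0..t} (\<lambda>s. y s - G s)" by (rule continuous_on_subset) (use t in auto)
 qed
 moreover have "y 0 \<le> e + norm (w 0)"
  unfolding y_def using sqrt_add_le_add_sqrt[of "e\<^sup>2" "inner (w 0) (w 0)"] e by (simp add: norm_eq_sqrt_inner)
 ultimately show "norm (w t) \<le> norm (w 0) + (G t - G 0) + e" using wy[of t] by linarith
qed

text \<open>Gronwall for a supremum over \<open>i\<close> that need not be measurable in \<open>t\<close>: each application of the
 hypothesis halves the excess of the bound, so a crude bound is enough to start.\<close>

lemma gronwall_family:
 fixes w w' :: "'i => real => 'a::real_inner"
 assumes d: "\<And>i t. t \<in> {0..T} ==> (w i has_vector_derivative w' i t) (at t within {0..T})"
  and B: "\<And>t. t \<in> {0..T} ==> (B has_real_derivative \<beta> t) (at t within {0..T})" "B 0 = 0" "\<And>t. t \<in> {0..T} ==> B t \<in> {0..b}"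
  and \<beta>: "\<And>t. t \<in> {0..T} ==> 0 \<le> \<beta> t" and q: "\<And>i. 0 \<le> q i" and c: "c \<ge> 0" "m0 \<ge> 0" "k \<ge> 0"
  and step: "\<And>\<kappa> i t. t \<in> {0..T} ==> 0 \<le> \<kappa> ==> (\<And>j. norm (w j t) \<le> \<kappa> * q j) ==>
   inner (w i t) (w' i t) \<le> norm (w i t)*(q i*(\<beta> t*(k*\<kappa> + c)))"
  and init: "\<And>i. norm (w i 0) \<le> q i * m0" and crude: "\<And>i t. t \<in> {0..T} ==> norm (w i t) \<le> Kr * q i" and Kr: "Kr \<ge> 0"
  and t: "t \<in> {0..T}"
 shows "norm (w i t) \<le> (2*(m0 + c * b) * exp (2 * k * b)) * q i"
proof -
 have b0: "b \<ge> 0" using B(3)[OF t] by auto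
 define A where "A = m0 + c * b"
 have A0: "0 \<le> A" using c b0 by (simp add: A_def)
 define P where "P \<kappa> \<longleftrightarrow> (\<forall>i. \<forall>t\<in>{0..T}. norm (w i t) \<le> \<kappa> * exp (2 * k * B t) * q i)" for \<kappa>
 \<comment> \<open>Integrating k \<kappa> \<beta> exp(2 k B) produces \<kappa>/2 times the
   exponential: the doubled exponent is what halves \<kappa>.\<close>
 have st: "P (A + \<kappa>/2)" if \<kappa>: "\<kappa> \<ge> 0" "P \<kappa>" for \<kappa>
  unfolding P_def
 proof (intro allI ballI)
  fix i t assume t: "t \<in> {0..T}"
  define G where "G t = q i*(\<kappa>/2 * exp (2 * k * B t) + c * B t)" for t
  define g where "g t = q i*(\<beta> t*(k*(\<kappa> * exp (2 * k * B t)) + c))" for t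
  have "norm (w i t) \<le> norm (w i 0) + (G t - G 0)"
  proof (rule energy_le[OF d _ _ _ t])
   show "(G has_real_derivative g s) (at s within {0..T})" if "s \<in> {0..T}" for s
    unfolding G_def[abs_def] g_def by (auto intro!: derivative_eq_intros B(1) that simp: algebra_simps)
   show "inner (w i s) (w' i s) \<le> norm (w i s) * g s" if "s \<in> {0..T}" for s
    unfolding g_def using \<kappa> that by (intro step) (auto simp: P_def)
   show "0 \<le> g s" if "s \<in> {0..T}" for s unfolding g_def using q \<beta>[OF that] c \<kappa> by (intro mult_nonneg_nonneg add_nonneg_nonneg) auto
  qed
  also have "... \<le> q i * m0 + q i*(\<kappa>/2 * exp (2 * k * B t) + c * b)"
  proof -
   have "G t \<le> q i*(\<kappa>/2 * exp (2 * k * B t) + c * b)"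
    unfolding G_def using q c B(3)[OF t] by (intro mult_left_mono add_left_mono) auto
   moreover have "0 \<le> G 0" unfolding G_def using q[of i] c \<kappa> B(2) by simp
   ultimately show ?thesis using init[of i] by linarith
  qed
  also have "... = q i*(A + \<kappa>/2 * exp (2 * k * B t))" by (simp add: A_def algebra_simps)
  also have "... \<le> q i*(A * exp (2 * k * B t) + \<kappa>/2 * exp (2 * k * B t))"
  proof -
   have "1 \<le> exp (2 * k * B t)" using c B(3)[OF t] by simp
   hence "A*1 \<le> A * exp (2 * k * B t)" using A0 by (intro mult_left_mono)
   thus ?thesis using q[of i] by (intro mult_left_mono) auto
  qed
  finally show "norm (w i t) \<le> (A + \<kappa>/2) * exp (2 * k * B t) * q i" by (simp add: algebra_simps)
 qed
 \<comment> \<open>2 A is the fixed point of \<kappa> -> A + \<kappa>/2; the excess over it starts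
   at \<open>Kr\<close> and is halved in each round.\<close>
 have it: "P (2 * A + Kr/2^j)" for j
 proof (induct j)
  case 0
  show ?case unfolding P_def
  proof (intro allI ballI)
   fix i t assume t: "t \<in> {0..T}"
   have "1 \<le> exp (2 * k * B t)" using c B(3)[OF t] by simp
   hence "Kr*1 \<le> (2 * A + Kr/2^0) * exp (2 * k * B t)" using A0 Kr by (intro mult_mono) auto
   thus "norm (w i t) \<le> (2 * A + Kr/2^0) * exp (2 * k * B t) * q i"
    using order_trans[OF crude[OF t] mult_right_mono[OF _ q]] by simp
  qed
 next
  case (Suc j)
  have "0 \<le> 2 * A + Kr/2^j" using A0 Kr by simp
  from st[OF this Suc] show ?case by (simp add: field_simps)
 qed
 have "(\<lambda>j. (2 * A + Kr*(1/2)^j) * exp (2 * k * B t) * q i) \<longlonglongrightarrow> (2 * A + Kr*0) * exp (2 * k * B t) * q i"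
  by (intro tendsto_intros LIMSEQ_power_zero) simp
 hence "norm (w i t) \<le> (2 * A + Kr*0) * exp (2 * k * B t) * q i"
  by (rule LIMSEQ_le_const) (use it t in \<open>auto simp: P_def power_divide\<close>)
 also have "... \<le> 2 * A * exp (2 * k * b) * q i"
 proof -
  have "exp (2 * k * B t) \<le> exp (2 * k * b)" using c B(3)[OF t] by (simp add: mult_left_mono)
  hence "2 * A * exp (2 * k * B t) \<le> 2 * A * exp (2 * k * b)" using A0 by (intro mult_left_mono) auto
  thus ?thesis using q by (simp add: mult_right_mono)
 qed
 finally show ?thesis by (simp add: A_def)
qed

section \<open>Differences of the flow in the Fourier variable\<close>

definition D :: "R3 => l2 => l2" where "D a v = Shift a v - v"

lemma bounded_linear_D: "bounded_linear (D a)"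
 unfolding D_def[abs_def] by (intro bounded_linear_sub bounded_linear_Shift bounded_linear_ident)
lemma D_D: "D a (D b v) = Shift (a + b) v - Shift a v - Shift b v + v"
 by (simp add: D_def Shift_diff)
lemma Shift_D: "Shift b (D a v) = Shift (a + b) v - Shift b v" by (simp add: D_def Shift_diff add.commute)

text \<open>\<open>R1\<close> and \<open>R2\<close> are the coefficients of the commutator bounds
  with exponent p = 0, \<open>A1\<close> and \<open>A2\<close> those with p = 1, all for \<tau> = t
  h. \<open>R\<close> only starts the iteration and does not enter the final constants; these are
  governed by \<beta> through the bound b on its antiderivative.\<close>

locale evo_est = evo +
 fixes \<nu> :: "real => R3 => complex" and n :: "real => nat => real" and M1 M2 M3 :: "real => real" and \<beta> B :: "real => real" and R b :: real
 assumes sl: "\<And>t. t \<in> {0..T} ==> slice h (t * h) (V t) (\<Omega> t) (\<nu> t) (n t) Bd (M1 t) (M2 t) (M3 t)"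
  and R1: "\<And>t. t \<in> {0..T} ==> n t 1*(2 * t + M2 t/h) \<le> R"
  and R2: "\<And>t. t \<in> {0..T} ==> n t 2*(2 * t\<^sup>2 * h + 2 * t * M2 t + (M2 t)^2/h) + M3 t/h * n t 1 \<le> R"
  and A1: "\<And>t. t \<in> {0..T} ==> t * n t 2*(1 + M1 t + sqrt (t * h)) + M2 t/h * n t 1 \<le> \<beta> t"
  and A2: "\<And>t. t \<in> {0..T} ==> t\<^sup>2 * h * n t 3*(1 + M1 t + sqrt (t * h)) + n t 2*(2 * t * M2 t + (M2 t)^2/h) + M3 t/h * n t 1 \<le> \<beta> t"
  and B: "\<And>t. t \<in> {0..T} ==> (B has_real_derivative \<beta> t) (at t within {0..T})" "B 0 = 0" "\<And>t. t \<in> {0..T} ==> B t \<in> {0..b}"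
begin

definition G :: "R3 => real => l2 => l2" where "G c t = slice.Hc h (t * h) (V t) (\<Omega> t) c"

lemma G_0: assumes t: "t \<in> {0..T}" shows "G 0 t = H t"
proof
 fix v
 interpret S: slice h "t * h" "V t" "\<Omega> t" "\<nu> t" "n t" Bd "M1 t" "M2 t" "M3 t" by (rule sl[OF t])
 have \<theta>: "S.\<theta> = \<Theta> t" by (rule ext) (simp add: S.\<theta>_def \<Theta>_def)
 show "G 0 t v = H t v"
  unfolding G_def S.Hc_def S.Bc_def S.pp_def H_def W_def \<theta> by (simp add: S.mV_def[abs_def] mV_def[abs_def] S.cV_def[abs_def] cV_def[abs_def])
qed

lemma G_skew: assumes t: "t \<in> {0..T}" shows "inner v (G c t v) = 0"
 using slice.Hc_skew[OF sl[OF t]] by (simp add: G_def)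
lemma Shift_G: assumes t: "t \<in> {0..T}" shows "Shift a (G c t v) = G (c + a) t (Shift a v)"
 using slice.Shift_Hc[OF sl[OF t]] by (simp add: G_def)
lemma G_diff: assumes t: "t \<in> {0..T}" shows "G c t (u - v) = G c t u - G c t v"
 using slice.Hc_diff[OF sl[OF t]] by (simp add: G_def)

lemma G_add: assumes t: "t \<in> {0..T}" shows "G c t (u + v) = G c t u + G c t v"
 unfolding G_def by (rule linear_add[OF bounded_linear.linear[OF slice.bounded_linear_Hc[OF sl[OF t]]]])

lemma n_pos: assumes t: "t \<in> {0..T}" and k: "k \<in> {1..3}" shows "0 \<le> n t k"
proof -
 have "0 \<le> (LBINT \<eta>. norm \<eta>^k * norm (\<nu> t \<eta>))" by (intro integral_nonneg_AE AE_I2) simp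
 moreover have "(LBINT \<eta>. norm \<eta>^k * norm (\<nu> t \<eta>)) \<le> n t k"
  using slice.nu[OF sl[OF t], unfolded nu_rep_def] k by blast
 ultimately show ?thesis by linarith
qed

lemma L_pos: assumes t: "t \<in> {0..T}" shows "0 \<le> M1 t" "0 \<le> M2 t" "0 \<le> M3 t" using slice.Lpos[OF sl[OF t]] by auto

text \<open>Translating \<open>H t\<close> by a yields \<open>G a t\<close>, so these are the
  commutators of the generator with one and with two translations, written on translated vectors as
  in the bounds at a fixed time.\<close>

definition dG1 :: "R3 => real => l2 => l2" where "dG1 a t v = G a t (Shift a v) - G 0 t (Shift a v)"
definition dG2 :: "R3 => R3 => real => l2 => l2" where
 "dG2 a a' t v = G (a + a') t (Shift (a + a') v) - G a t (Shift (a + a') v) - G a' t (Shift (a + a') v) + G 0 t (Shift (a + a') v)"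

lemma crude1: assumes t: "t \<in> {0..T}" shows "norm (dG1 a t v) \<le> norm a*(R * norm v)"
proof -
 have "norm (dG1 a t v) \<le> norm a*((t * h*(2 * norm v) * n t (Suc 0) + M2 t * norm v * n t 1)/h)"
  unfolding dG1_def G_def by (rule slice.commutator_bounds(1)[OF sl[OF t] _ slice.Rc_crude[OF sl[OF t]]]) auto
 also have "(t * h*(2 * norm v) * n t (Suc 0) + M2 t * norm v * n t 1)/h = n t 1*(2 * t + M2 t/h) * norm v"
  using h by (simp add: field_simps)
 also have "norm a * ... \<le> norm a*(R * norm v)" by (intro mult_left_mono mult_right_mono R1 t) auto
 finally show ?thesis .
qed

lemma crude2: assumes t: "t \<in> {0..T}" shows "norm (dG2 a a' t v) \<le> norm a * norm a'*(R * norm v)"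
proof -
 have "norm (dG2 a a' t v) \<le> norm a * norm a'*(((t * h)^2*(2 * norm v) * n t (0 + 2) + (2*(t * h) * M2 t + (M2 t)^2) * norm v * n t 2 + M3 t * norm v * n t 1)/h)"
  unfolding dG2_def G_def by (rule slice.commutator_bounds(2)[OF sl[OF t] _ slice.Rc_crude[OF sl[OF t]]]) auto
 also have "((t * h)^2*(2 * norm v) * n t (0 + 2) + (2*(t * h) * M2 t + (M2 t)^2) * norm v * n t 2 + M3 t * norm v * n t 1)/h
   = (n t 2*(2 * t\<^sup>2 * h + 2 * t * M2 t + (M2 t)^2/h) + M3 t/h * n t 1) * norm v"
  unfolding add_0_left using h by (simp add: field_simps power2_eq_square)
 also have "norm a * norm a' * ... \<le> norm a * norm a'*(R * norm v)" by (intro mult_left_mono mult_right_mono R2 t) auto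
 finally show ?thesis .
qed

text \<open>Both remainders are linear in N + |v|, where N bounds the first differences: even the
  second commutator costs no more than first differences of v.\<close>

lemma refined:
 assumes t: "t \<in> {0..T}" and N: "\<And>a. norm (D a v) \<le> N * norm a" "N \<ge> 0"
 shows "norm (dG1 a t v) \<le> norm a*(\<beta> t*(N + norm v))"
  and "norm (dG2 a a' t v) \<le> norm a * norm a'*(\<beta> t*(N + norm v))"
proof -
 define \<rho> where "\<rho> = N + (M1 t + sqrt (t * h)) * norm v"
 define s where "s = 1 + M1 t + sqrt (t * h)"
 have th: "0 \<le> t" "0 \<le> t * h" using t h by auto
 have s1: "1 \<le> s" using L_pos[OF t] th by (simp add: s_def)
 have \<rho>0: "0 \<le> \<rho>" using N L_pos[OF t] th by (simp add: \<rho>_def)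
 have \<rho>: "\<rho> \<le> s*(N + norm v)"
 proof -
  have "N*1 \<le> N * s" by (rule mult_left_mono[OF s1 N(2)])
  moreover have "s * norm v = norm v + (M1 t + sqrt (t * h)) * norm v" by (simp add: s_def algebra_simps)
  moreover have "s*(N + norm v) = N * s + s * norm v" by (simp add: algebra_simps)
  ultimately show ?thesis unfolding \<rho>_def using norm_ge_zero[of v] by linarith
 qed
 have k23: "Suc 1 = 2" "1 + 2 = (3::nat)" by simp_all
 have vN: "norm v \<le> N + norm v" using N by simp
 note r = slice.Rc_refined[OF sl[OF t] N(1)[unfolded D_def], folded \<rho>_def]
 have "norm (dG1 a t v) \<le> norm a*((t * h*\<rho> * n t (Suc 1) + M2 t * norm v * n t 1)/h)"
  unfolding dG1_def G_def by (rule slice.commutator_bounds(1)[OF sl[OF t] _ r \<rho>0]) auto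
 also have "(t * h*\<rho> * n t (Suc 1) + M2 t * norm v * n t 1)/h = t * n t 2*\<rho> + M2 t/h * n t 1 * norm v"
  unfolding k23 using h by (simp add: field_simps)
 also have "... \<le> t * n t 2*(s*(N + norm v)) + M2 t/h * n t 1*(N + norm v)"
  using n_pos[OF t] L_pos[OF t] h th by (intro add_mono mult_left_mono \<rho> vN) auto
 also have "... = (t * n t 2 * s + M2 t/h * n t 1)*(N + norm v)" by (simp add: algebra_simps)
 also have "... \<le> \<beta> t*(N + norm v)" using A1[OF t] N by (intro mult_right_mono) (auto simp: s_def)
 finally show "norm (dG1 a t v) \<le> norm a*(\<beta> t*(N + norm v))" by (simp add: mult_left_mono)
 have "norm (dG2 a a' t v) \<le> norm a * norm a'*(((t * h)^2*\<rho> * n t (1 + 2) + (2*(t * h) * M2 t + (M2 t)^2) * norm v * n t 2 + M3 t * norm v * n t 1)/h)"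
  unfolding dG2_def G_def by (rule slice.commutator_bounds(2)[OF sl[OF t] _ r \<rho>0]) auto
 also have "((t * h)^2*\<rho> * n t (1 + 2) + (2*(t * h) * M2 t + (M2 t)^2) * norm v * n t 2 + M3 t * norm v * n t 1)/h
   = t\<^sup>2 * h * n t 3*\<rho> + (n t 2*(2 * t * M2 t + (M2 t)^2/h)) * norm v + M3 t/h * n t 1 * norm v"
  unfolding k23 using h by (simp add: field_simps power2_eq_square)
 also have "... \<le> t\<^sup>2 * h * n t 3*(s*(N + norm v)) + (n t 2*(2 * t * M2 t + (M2 t)^2/h))*(N + norm v) + M3 t/h * n t 1*(N + norm v)"
  using n_pos[OF t] L_pos[OF t] h th by (intro add_mono mult_left_mono \<rho> vN) auto
 also have "... = (t\<^sup>2 * h * n t 3 * s + n t 2*(2 * t * M2 t + (M2 t)^2/h) + M3 t/h * n t 1)*(N + norm v)" by (simp add: algebra_simps)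
 also have "... \<le> \<beta> t*(N + norm v)" using A2[OF t] N by (intro mult_right_mono) (auto simp: s_def)
 finally show "norm (dG2 a a' t v) \<le> norm a * norm a'*(\<beta> t*(N + norm v))" by (simp add: mult_left_mono)
qed

lemma D_H: assumes t: "t \<in> {0..T}" shows "D a (H t v) = G 0 t (D a v) + dG1 a t v"
 unfolding G_0[OF t, symmetric] by (simp add: D_def dG1_def G_diff[OF t] Shift_G[OF t])

text \<open>Discrete Leibniz rule. The term with \<open>G 0 t\<close> is skew and disappears from
  the energy identity; the two mixed terms lead back to second differences of v, the last one only
  to first differences.\<close>

lemma D_D_H: assumes t: "t \<in> {0..T}"
 shows "D a (D a' (H t v)) = G 0 t (D a (D a' v)) + dG1 a t (D a' v) + dG1 a' t (D a v) + dG2 a a' t v"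
 unfolding G_0[OF t, symmetric] dG1_def dG2_def Shift_D D_D
 by (simp add: Shift_G[OF t] G_diff[OF t] G_add[OF t] add.commute[of a' a])

lemma \<beta>_pos: assumes t: "t \<in> {0..T}" shows "0 \<le> \<beta> t"
proof (rule order_trans[OF _ A1[OF t]])
 show "0 \<le> t * n t 2*(1 + M1 t + sqrt (t * h)) + M2 t/h * n t 1"
  using n_pos[OF t] L_pos[OF t] t h by (intro add_nonneg_nonneg mult_nonneg_nonneg divide_nonneg_nonneg) auto
qed

lemma R_pos: "0 \<le> R"
proof (rule order_trans[OF _ R1[of 0]])
 show "0 \<le> n 0 1*(2*0 + M2 0/h)" using n_pos[of 0 1] L_pos[of 0] T h by (intro mult_nonneg_nonneg) auto
qed (use T in auto)

context
 fixes v assumes v: "strong v"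
begin

lemma vd: "t \<in> {0..T} ==> (v has_vector_derivative H t (v t)) (at t within {0..T})"
 using v by (simp add: strong_def)

lemma norm_v: assumes t: "t \<in> {0..T}" shows "norm (v t) = norm (v 0)"
proof -
 have "((\<lambda>t. inner (v t) (v t)) has_vector_derivative 0) (at t within {0..T})" if t: "t \<in> {0..T}" for t
  using bounded_bilinear.has_vector_derivative[OF bounded_bilinear_inner vd[OF t] vd[OF t]] G_skew[OF t, of "v t" 0]
  by (simp add: G_0[OF t] inner_commute)
 from zero_derivative_const[OF this t] show ?thesis by (simp add: norm_eq_sqrt_inner)
qed

lemma Dd: "t \<in> {0..T} ==> ((\<lambda>t. D a (v t)) has_vector_derivative D a (H t (v t))) (at t within {0..T})"
 by (intro bounded_linear.has_vector_derivative[OF bounded_linear_D] vd)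
lemma DDd: "t \<in> {0..T} ==> ((\<lambda>t. D a (D a' (v t))) has_vector_derivative D a (D a' (H t (v t)))) (at t within {0..T})"
 by (intro bounded_linear.has_vector_derivative[OF bounded_linear_D] Dd)

lemma inner_D: assumes t: "t \<in> {0..T}" and C: "norm (dG1 a t (v t)) \<le> C"
 shows "inner (D a (v t)) (D a (H t (v t))) \<le> norm (D a (v t)) * C"
proof -
 have "inner (D a (v t)) (D a (H t (v t))) = inner (D a (v t)) (dG1 a t (v t))"
  by (simp add: D_H[OF t] inner_add_right G_skew[OF t])
 also have "... \<le> norm (D a (v t)) * norm (dG1 a t (v t))" by (rule norm_cauchy_schwarz)
 also have "... \<le> norm (D a (v t)) * C" by (intro mult_left_mono C) simp
 finally show ?thesis .
qed

lemma inner_DD: assumes t: "t \<in> {0..T}" and C: "norm (dG1 a t (D a' (v t))) \<le> C1" "norm (dG1 a' t (D a (v t))) \<le> C2" "norm (dG2 a a' t (v t)) \<le> C3"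
 shows "inner (D a (D a' (v t))) (D a (D a' (H t (v t)))) \<le> norm (D a (D a' (v t)))*(C1 + C2 + C3)"
proof -
 have "inner (D a (D a' (v t))) (D a (D a' (H t (v t)))) = inner (D a (D a' (v t))) (dG1 a t (D a' (v t)) + dG1 a' t (D a (v t)) + dG2 a a' t (v t))"
  by (simp add: D_D_H[OF t] inner_add_right G_skew[OF t])
 also have "... \<le> norm (D a (D a' (v t))) * norm (dG1 a t (D a' (v t)) + dG1 a' t (D a (v t)) + dG2 a a' t (v t))" by (rule norm_cauchy_schwarz)
 also have "... \<le> norm (D a (D a' (v t)))*(C1 + C2 + C3)" by (intro mult_left_mono norm_triangle_mono C) simp
 finally show ?thesis .
qed

text \<open>The commutator with one translation is controlled by first differences themselves, so
  Gronwall's lemma closes. The crude bound, integrated over [0,T], supplies the finite starting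
  constant \<open>Kr\<close>, which leaves no trace in the conclusion.\<close>

lemma D_bound:
 assumes init: "\<And>a. norm (D a (v 0)) \<le> norm a * m0" and m0: "0 \<le> m0" and m: "norm (v 0) \<le> m0" and t: "t \<in> {0..T}"
 shows "norm (D a (v t)) \<le> (2*(m0 + m0 * b) * exp (2*1 * b)) * norm a"
proof (rule gronwall_family[where w="\<lambda>a t. D a (v t)" and q=norm and Kr="m0 + R * m0 * T", OF Dd B \<beta>_pos norm_ge_zero m0 m0 zero_le_one _ init _ _ t])
 show "0 \<le> m0 + R * m0 * T" using m0 R_pos T by simp
next
 fix \<kappa> a t assume t: "t \<in> {0..T}" and "0 \<le> \<kappa>" "\<And>a. norm (D a (v t)) \<le> \<kappa> * norm a"
 hence "norm (dG1 a t (v t)) \<le> norm a*(\<beta> t*(\<kappa> + norm (v t)))" by (intro refined) auto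
 also have "... \<le> norm a*(\<beta> t*(1*\<kappa> + m0))" using m norm_v[OF t] \<beta>_pos[OF t] by (intro mult_left_mono) auto
 finally show "inner (D a (v t)) (D a (H t (v t))) \<le> norm (D a (v t))*(norm a*(\<beta> t*(1*\<kappa> + m0)))" by (rule inner_D[OF t])
next
 fix a t assume t: "t \<in> {0..T}"
 have "norm (D a (v t)) \<le> norm (D a (v 0)) + (norm a*(R * m0) * t - norm a*(R * m0)*0)"
 proof (rule energy_le[OF Dd _ inner_D _ t])
  show "((*) (norm a*(R * m0)) has_real_derivative norm a*(R * m0)) (at s within {0..T})" for s
   by (auto intro!: derivative_eq_intros)
  show "norm (dG1 a s (v s)) \<le> norm a*(R * m0)" if s: "s \<in> {0..T}" for s
   using crude1[OF s, of a "v s"] m R_pos norm_v[OF s] by (smt (verit) mult_left_mono norm_ge_zero)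
 qed (use R_pos m0 in auto)
 also have "... \<le> norm a * m0 + norm a*(R * m0) * T" using init[of a] t R_pos m0 by (simp add: add_mono mult_left_mono)
 finally show "norm (D a (v t)) \<le> (m0 + R * m0 * T) * norm a" by (simp add: algebra_simps)
qed

text \<open>The family is indexed by pairs of increments. Both mixed commutators contain second
  differences, whence k = 2. Each also contains a first difference, and \<open>dG2\<close> a further
  one together with the norm, whence the source 3 N + m0.\<close>

lemma DD_bound:
 assumes init: "\<And>a. norm (D a (v 0)) \<le> norm a * m0" "\<And>a a'. norm (D a (D a' (v 0))) \<le> norm a * norm a' * m0"
  and m0: "0 \<le> m0" and m: "norm (v 0) \<le> m0" and t: "t \<in> {0..T}"
  and N: "\<And>a t. t \<in> {0..T} ==> norm (D a (v t)) \<le> N * norm a" "0 \<le> N"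
 shows "norm (D a (D a' (v t))) \<le> (2*(m0 + (3 * N + m0) * b) * exp (2*2 * b))*(norm a * norm a')"
proof -
 define w where "w i t = D (fst i) (D (snd i) (v t))" for i t
 define w' where "w' i t = D (fst i) (D (snd i) (H t (v t)))" for i t
 define q where "q i = norm (fst i) * norm (snd i)" for i :: "R3 \<times> R3"
 have "norm (w (a, a') t) \<le> (2*(m0 + (3 * N + m0) * b) * exp (2*2 * b)) * q (a, a')"
 proof (rule gronwall_family[where w'=w' and Kr="m0 + R*(2 * N + m0) * T", OF _ B \<beta>_pos _ _ m0 _ _ _ _ _ t])
  show "(w i has_vector_derivative w' i t) (at t within {0..T})" if "t \<in> {0..T}" for i t
   unfolding w_def w'_def by (rule DDd[OF that])
  show "norm (w i 0) \<le> q i * m0" for i unfolding w_def q_def by (rule init(2))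
  show "0 \<le> m0 + R*(2 * N + m0) * T" using m0 R_pos T N by simp
 next
  fix \<kappa> and i :: "R3 \<times> R3" and t assume t: "t \<in> {0..T}" and \<kappa>: "0 \<le> \<kappa>" "\<And>j. norm (w j t) \<le> \<kappa> * q j"
  obtain a a' where i: "i = (a, a')" by (cases i)
  have k: "norm (D b (D b' (v t))) \<le> \<kappa> * norm b' * norm b" for b b' using \<kappa>(2)[of "(b, b')"] by (simp add: w_def q_def mult_ac)
  have 1: "norm (dG1 b t (D b' (v t))) \<le> norm b * norm b'*(\<beta> t*(\<kappa> + N))" for b b'
  proof -
   have "norm (dG1 b t (D b' (v t))) \<le> norm b*(\<beta> t*(\<kappa> * norm b' + norm (D b' (v t))))"
    using \<kappa>(1) by (intro refined t k) auto
   also have "... \<le> norm b*(\<beta> t*(\<kappa> * norm b' + N * norm b'))" using \<beta>_pos[OF t] by (intro mult_left_mono add_left_mono N t) auto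
   finally show ?thesis by (simp add: algebra_simps)
  qed
  have "norm (dG2 a a' t (v t)) \<le> norm a * norm a'*(\<beta> t*(N + norm (v t)))" by (intro refined t N)
  also have "... \<le> norm a * norm a'*(\<beta> t*(N + m0))" using m norm_v[OF t] \<beta>_pos[OF t] by (intro mult_left_mono) auto
  finally have "inner (D a (D a' (v t))) (D a (D a' (H t (v t)))) \<le> norm (D a (D a' (v t))) *
    (norm a * norm a'*(\<beta> t*(\<kappa> + N)) + norm a' * norm a*(\<beta> t*(\<kappa> + N)) + norm a * norm a'*(\<beta> t*(N + m0)))"
   by (rule inner_DD[OF t 1 1])
  also have "norm a * norm a'*(\<beta> t*(\<kappa> + N)) + norm a' * norm a*(\<beta> t*(\<kappa> + N)) + norm a * norm a'*(\<beta> t*(N + m0)) = norm a * norm a'*(\<beta> t*(2*\<kappa> + (3 * N + m0)))"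
   by (simp add: algebra_simps)
  finally show "inner (w i t) (w' i t)
    \<le> norm (w i t)*(q i*(\<beta> t*(2*\<kappa> + (3 * N + m0))))"
   by (simp add: i w_def w'_def q_def)
 next
  fix i :: "R3 \<times> R3" and t assume t: "t \<in> {0..T}"
  obtain a a' where i: "i = (a, a')" by (cases i)
  define g where "g = norm a * norm a'*(R*(2 * N + m0))"
  have g0: "0 \<le> g" unfolding g_def using R_pos N m0 by (intro mult_nonneg_nonneg) auto
  have "norm (D a (D a' (v t))) \<le> norm (D a (D a' (v 0))) + (g * t - g*0)"
  proof (rule energy_le[OF DDd _ _ _ t])
   show "((*) g has_real_derivative g) (at s within {0..T})" for s by (auto intro!: derivative_eq_intros)
   show "inner (D a (D a' (v s))) (D a (D a' (H s (v s)))) \<le> norm (D a (D a' (v s))) * g" if s: "s \<in> {0..T}" for s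
   proof -
    have 1: "norm (dG1 b s (D b' (v s))) \<le> norm b*(R*(N * norm b'))" for b b'
     by (rule order_trans[OF crude1[OF s]]) (intro mult_left_mono N s R_pos norm_ge_zero)
    have 2: "norm (dG2 a a' s (v s)) \<le> norm a * norm a'*(R * m0)"
     by (rule order_trans[OF crude2[OF s]]) (use m norm_v[OF s] R_pos in \<open>intro mult_left_mono, auto\<close>)
    have "norm a*(R*(N * norm a')) + norm a'*(R*(N * norm a)) + norm a * norm a'*(R * m0) = g"
     by (simp add: g_def algebra_simps)
    thus ?thesis using inner_DD[OF s 1 1 2] by simp
   qed
  qed (use g0 in auto)
  also have "... \<le> norm a * norm a' * m0 + g * T" using init(2)[of a a'] t g0 by (simp add: add_mono mult_left_mono)
  finally show "norm (w i t) \<le> (m0 + R*(2 * N + m0) * T) * q i"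
   by (simp add: i w_def q_def g_def algebra_simps)
 qed (use N m0 in \<open>auto simp: q_def\<close>)
 thus ?thesis by (simp add: w_def q_def)
qed

end

end

section \<open>Weighted norms and interpolation\<close>

text \<open>The squared norm of <x>^r v with values in [0,\<infinity>], so that vectors outside the
  weighted space need no domain condition.\<close>

definition wn :: "real => l2 => ennreal" where
 "wn r v = (\<integral>\<^sup>+x. ennreal (japanese x powr (2 * r)*(norm (rep v x))^2) \<partial>lborel)"

lemma wn_0: "wn 0 v = ennreal ((norm v)^2)"
proof -
 have "japanese x \<noteq> 0" for x :: R3 using japanese_pos[of x] by simp
 thus ?thesis by (simp add: wn_def norm_l2_nn)
qed

lemma japanese_measurable[measurable]: "(japanese :: R3 => real) \<in> bmeas"
 unfolding japanese_def[abs_def] by measurable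

lemma japanese_powr4: "japanese x powr (2*2) = (1 + (norm x)^2)^2"
proof -
 have "japanese x powr (2*2) = (japanese x)^4" using japanese_pos[of x] powr_realpow[of "japanese x" 4] by simp
 also have "... = ((japanese x)^2)^2" by (simp add: power_mult[symmetric])
 finally show ?thesis using one_plus_sq_pos[of x] by (simp add: japanese_def)
qed

lemma norm_Mul_wn:
 assumes m: "bm m" "\<And>x. norm (m x) \<le> C*(1 + (norm x)^2)" and C: "C \<ge> 0" and c: "wn 2 u \<le> ennreal (c\<^sup>2)" "c \<ge> 0"
 shows "norm (Mul m u) \<le> C * c"
proof -
 have "ennreal ((norm (Mul m u))^2) = (\<integral>\<^sup>+x. ennreal ((norm (rep (Mul m u) x))^2) \<partial>lborel)" by (rule norm_l2_nn)
 also have "... \<le> (\<integral>\<^sup>+x. ennreal (C\<^sup>2) * ennreal (japanese x powr (2*2)*(norm (rep u x))^2) \<partial>lborel)"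
 proof (rule nn_integral_mono_AE)
  show "AE x in lborel. ennreal ((norm (rep (Mul m u) x))^2) \<le> ennreal (C\<^sup>2) * ennreal (japanese x powr (2*2)*(norm (rep u x))^2)"
   using rep_Mul[OF m(1), of u]
  proof eventually_elim
   case (elim x)
   have "(norm (rep (Mul m u) x))^2 \<le> (C*(1 + (norm x)^2) * norm (rep u x))^2"
    unfolding elim norm_mult by (intro power_mono mult_right_mono m) auto
   also have "... = C\<^sup>2*(japanese x powr (2*2)*(norm (rep u x))^2)" unfolding japanese_powr4 by (simp add: power_mult_distrib)
   finally show ?case by (simp add: ennreal_mult[symmetric] ennreal_leI)
  qed
 qed
 also have "... = ennreal (C\<^sup>2) * wn 2 u" unfolding wn_def by (rule nn_integral_cmult) measurable
 also have "... \<le> ennreal (C\<^sup>2) * ennreal (c\<^sup>2)" by (intro mult_left_mono c) simp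
 also have "... = ennreal ((C * c)^2)" by (simp add: ennreal_mult[symmetric] power_mult_distrib)
 finally have "(norm (Mul m u))^2 \<le> (C * c)^2" by (simp add: ennreal_le_iff)
 thus ?thesis by (rule power2_le_imp_le) (use C c(2) in simp)
qed

section \<open>Weights in space against differences of the transform\<close>

definition dm :: "R3 => R3 => complex" where "dm a x = cis ((- a)\<bullet>x) - 1"

lemma bm_dm: "bm (dm a)" unfolding dm_def[abs_def] by (intro bm_diff bm_cis bm_const) measurable
lemma D_Ft: "D a (Ft u) = Ft (Mul (dm a) u)"
proof -
 have b: "bm (\<lambda>x. cis ((- a)\<bullet>x))" by (intro bm_cis) measurable
 have "Mul (dm a) u = Mul (\<lambda>x. cis ((- a)\<bullet>x)) u - u" unfolding dm_def[abs_def] Mul_diff_fun[OF b bm_const, symmetric] Mul_one ..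
 thus ?thesis using Ft_modulate[of "- a" u] by (simp add: D_def Ft_diff)
qed
lemma norm_dm: "norm (dm a x) \<le> norm a * norm x"
 unfolding dm_def using norm_cis_minus_1_le[of "(- a)\<bullet>x"] Cauchy_Schwarz_ineq2[of a x] by simp

text \<open>Each increment costs one factor |x|, and two of them are still covered by the weight 1 +
  |x|^2 of \<open>wn 2\<close>.\<close>

lemma D_initial:
 assumes "wn 2 u \<le> ennreal (c\<^sup>2)" "c \<ge> 0"
 shows "norm u \<le> c" "norm (D a (Ft u)) \<le> norm a * c" "norm (D a (D a' (Ft u))) \<le> norm a * norm a' * c"
proof -
 have x: "norm x \<le> 1 + (norm x)^2" for x :: R3 using sum_squares_bound[of 1 "norm x"] by (simp add: power2_eq_square) (smt (verit) norm_ge_zero)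
 show "norm u \<le> c" using norm_Mul_wn[of "\<lambda>_. 1" 1, OF _ _ _ assms] by simp
 show "norm (D a (Ft u)) \<le> norm a * c" unfolding D_Ft norm_Ft
  by (rule norm_Mul_wn[OF bm_dm order_trans[OF norm_dm mult_left_mono[OF x]] _ assms]) auto
 have "norm (dm a x * dm a' x) \<le> norm a * norm a'*(1 + (norm x)^2)" for x
 proof -
  have "norm (dm a x * dm a' x) \<le> (norm a * norm x)*(norm a' * norm x)" unfolding norm_mult by (intro mult_mono norm_dm) auto
  also have "... = norm a * norm a'*(norm x)^2" by (simp add: power2_eq_square)
  also have "... \<le> norm a * norm a'*(1 + (norm x)^2)" by (intro mult_left_mono) auto
  finally show ?thesis .
 qed
 thus "norm (D a (D a' (Ft u))) \<le> norm a * norm a' * c" unfolding D_Ft norm_Ft Mul_Mul[OF bm_dm bm_dm]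
  by (intro norm_Mul_wn bm_mult bm_dm assms) auto
qed

text \<open>The symbol of a double difference along \<epsilon> e_j, divided by \<epsilon>^2, tends
  to x_j^2 in absolute value. Fatou's lemma passes the bound to the limit, so finiteness of the
  weighted integral comes out as a conclusion.\<close>

lemma D_final_coordinate:
 fixes u :: l2 and j :: 3
 assumes N: "\<And>a. norm (D a (D a (Ft u))) \<le> N*(norm a)^2" "N \<ge> 0"
 shows "(\<integral>\<^sup>+x. ennreal ((x $ j)^4*(norm (rep u x))^2) \<partial>lborel) \<le> ennreal (N\<^sup>2)"
proof -
 define \<epsilon> where "\<epsilon> k = inverse (real (Suc k))" for k
 have e0: "\<epsilon> k > 0" for k by (simp add: \<epsilon>_def)
 define F where "F k x = (norm (dm (\<epsilon> k *\<^sub>R axis j 1) x)/\<epsilon> k)^4*(norm (rep u x))^2" for k x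
 have lim: "(\<lambda>k. F k x) \<longlonglongrightarrow> (x $ j)^4*(norm (rep u x))^2" for x
 proof -
  have "((\<lambda>s. cis (- (s * x $ j))) has_vector_derivative - (\<i> * of_real (x $ j))) (at 0)"
   unfolding has_vector_derivative_def by (auto intro!: derivative_eq_intros simp: fun_eq_iff scaleR_conv_of_real)
  hence q: "\<forall>X. (\<forall>i. X i \<in> UNIV - {0}) \<longrightarrow> X \<longlonglongrightarrow> 0 \<longrightarrow>
    (\<lambda>k. (cis (- (X k * x $ j)) - cis (- (0 * x $ j))) /\<^sub>R (X k - 0)) \<longlonglongrightarrow> - (\<i> * of_real (x $ j))"
   unfolding has_vector_derivative_iff_quotient tendsto_at_iff_sequentially comp_def .
  have "\<epsilon> i \<noteq> 0" for i using e0[of i] by simp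
  hence "\<forall>i. \<epsilon> i \<in> UNIV - {0}" by simp
  moreover have "\<epsilon> \<longlonglongrightarrow> 0" unfolding \<epsilon>_def[abs_def] by (rule LIMSEQ_inverse_real_of_nat)
  ultimately have "(\<lambda>k. (cis (- (\<epsilon> k * x $ j)) - 1) /\<^sub>R \<epsilon> k) \<longlonglongrightarrow> - (\<i> * of_real (x $ j))"
   using q[rule_format, of \<epsilon>] by simp
  hence "(\<lambda>k. (norm ((cis (- (\<epsilon> k * x $ j)) - 1) /\<^sub>R \<epsilon> k))^4*(norm (rep u x))^2) \<longlonglongrightarrow> (norm (- (\<i> * of_real (x $ j))))^4*(norm (rep u x))^2"
   by (intro tendsto_intros)
  moreover have "norm ((cis (- (\<epsilon> k * x $ j)) - 1) /\<^sub>R \<epsilon> k) = norm (dm (\<epsilon> k *\<^sub>R axis j 1) x)/\<epsilon> k" for k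
   using e0[of k] by (simp add: dm_def inner_axis' divide_inverse mult.commute)
  ultimately show ?thesis by (simp add: F_def norm_mult power_even_abs)
 qed
 have le: "(\<integral>\<^sup>+x. ennreal (F k x) \<partial>lborel) \<le> ennreal (N\<^sup>2)" for k
 proof -
  define a :: R3 where "a = \<epsilon> k *\<^sub>R axis j 1"
  have na: "norm a = \<epsilon> k" using e0[of k] by (simp add: a_def)
  have Fe: "F k x = (1/\<epsilon> k)^4*(norm (dm a x * dm a x * rep u x))^2" for x
   unfolding F_def a_def[symmetric] norm_mult by (simp add: power_divide power_mult_distrib power2_eq_square power4_eq_xxxx)
  have "AE x in lborel. ennreal (F k x) = ennreal ((1/\<epsilon> k)^4) * ennreal ((norm (rep (Mul (\<lambda>x. dm a x * dm a x) u) x))^2)"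
   using rep_Mul[OF bm_mult[OF bm_dm bm_dm], of a a u]
   by eventually_elim (simp only: Fe, simp add: ennreal_mult[symmetric])
  hence "(\<integral>\<^sup>+x. ennreal (F k x) \<partial>lborel) = (\<integral>\<^sup>+x. ennreal ((1/\<epsilon> k)^4) * ennreal ((norm (rep (Mul (\<lambda>x. dm a x * dm a x) u) x))^2) \<partial>lborel)"
   by (rule nn_integral_cong_AE)
  also have "... = ennreal ((1/\<epsilon> k)^4) * ennreal ((norm (Mul (\<lambda>x. dm a x * dm a x) u))^2)"
   unfolding norm_l2_nn by (rule nn_integral_cmult) measurable
  also have "norm (Mul (\<lambda>x. dm a x * dm a x) u) = norm (D a (D a (Ft u)))" unfolding D_Ft norm_Ft Mul_Mul[OF bm_dm bm_dm] ..
  also have "ennreal ((1/\<epsilon> k)^4) * ennreal ((norm (D a (D a (Ft u))))^2) \<le> ennreal ((1/\<epsilon> k)^4) * ennreal ((N*(\<epsilon> k)^2)^2)"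
   using N(1)[of a] unfolding na by (intro mult_left_mono ennreal_leI power_mono) auto
  also have "... = ennreal (N\<^sup>2)" using e0[of k] by (simp add: ennreal_mult[symmetric] power_mult_distrib power_divide)
  finally show ?thesis .
 qed
 have Fm: "(\<lambda>x. ennreal (F k x)) \<in> borel_measurable lborel" for k
  unfolding F_def using bm_measurable[OF bm_dm, of "\<epsilon> k *\<^sub>R axis j 1"] by measurable
 have "(\<integral>\<^sup>+x. ennreal ((x $ j)^4*(norm (rep u x))^2) \<partial>lborel) = (\<integral>\<^sup>+x. liminf (\<lambda>k. ennreal (F k x)) \<partial>lborel)"
  by (rule nn_integral_cong) (intro lim_imp_Liminf[symmetric] tendsto_ennrealI lim trivial_limit_sequentially)
 also have "... \<le> liminf (\<lambda>k. \<integral>\<^sup>+x. ennreal (F k x) \<partial>lborel)" by (rule nn_integral_liminf[OF Fm])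
 also have "... \<le> ennreal (N\<^sup>2)" using Liminf_mono[of "\<lambda>k. \<integral>\<^sup>+x. ennreal (F k x) \<partial>lborel" "\<lambda>_. ennreal (N\<^sup>2)" sequentially] le
  by (simp add: Liminf_const)
 finally show ?thesis .
qed

lemma D_final:
 assumes N: "\<And>a. norm (D a (D a (Ft u))) \<le> N*(norm a)^2" "N \<ge> 0"
 shows "wn 2 u \<le> ennreal (2*(norm u)^2 + 18 * N\<^sup>2)"
proof -
 \<comment> \<open>The constant 6 is 2 from (1 + y)^2 \<le> 2 + 2 y^2 times 3 from the square of a
   sum of three terms; summing over the three coordinates then makes 18.\<close>
 have le: "japanese x powr (2*2) \<le> 2 + 6*(\<Sum>j\<in>UNIV. (x $ j)^4)" for x :: R3
 proof -
  have n: "(norm x)^2 = (x $ 1)^2 + (x $ 2)^2 + (x $ 3)^2"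
   by (simp add: power2_norm_eq_inner inner_vec_def sum_3) (simp add: power2_eq_square)
  have "(a + b + c)^2 \<le> 3*(a\<^sup>2 + b\<^sup>2 + c\<^sup>2)" for a b c :: real
   using sum_squares_ge_zero[of "a - b" "b - c"] zero_le_power2[of "a - c"] by (simp add: power2_eq_square algebra_simps)
  from this[of "(x $ 1)^2" "(x $ 2)^2" "(x $ 3)^2"] have 1: "((norm x)^2)^2 \<le> 3*(\<Sum>j\<in>UNIV. (x $ j)^4)"
   unfolding n sum_3 power_mult[symmetric] by simp
  have "(1 + y)^2 \<le> 2 + 2 * y\<^sup>2" for y :: real using zero_le_power2[of "1 - y"] by (simp add: power2_eq_square algebra_simps)
  from this[of "(norm x)^2"] show ?thesis unfolding japanese_powr4 using 1 by linarith
 qed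
 have e0: "0 \<le> (x $ j)^4*(norm (rep u x))^2" for x :: R3 and j by simp
 have cmb: "ennreal 2 * ennreal p + ennreal 6 * ennreal S = ennreal (2 * p + 6 * S)" if "0 \<le> p" "0 \<le> S" for p S
  using that by (simp add: ennreal_mult[symmetric] ennreal_plus[symmetric] del: ennreal_plus ennreal_numeral)
 have int: "(\<integral>\<^sup>+x. a * f x + b*(\<Sum>j\<in>UNIV. g j x) \<partial>lborel) = a*(\<integral>\<^sup>+x. f x \<partial>lborel) + b*(\<Sum>j\<in>UNIV. \<integral>\<^sup>+x. g j x \<partial>lborel)"
  if "f \<in> bmeas" "\<And>j. g j \<in> bmeas" for f :: "R3 => ennreal" and g :: "3 => R3 => ennreal" and a b
  using that by (simp add: nn_integral_add nn_integral_cmult nn_integral_sum)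
 have "wn 2 u \<le> (\<integral>\<^sup>+x. ennreal 2 * ennreal ((norm (rep u x))^2) + ennreal 6*(\<Sum>j\<in>UNIV. ennreal ((x $ j)^4*(norm (rep u x))^2)) \<partial>lborel)"
  unfolding wn_def
 proof (rule nn_integral_mono)
  fix x
  have "japanese x powr (2*2)*(norm (rep u x))^2 \<le> (2 + 6*(\<Sum>j\<in>UNIV. (x $ j)^4))*(norm (rep u x))^2"
   by (intro mult_right_mono le) simp
  also have "... = 2*(norm (rep u x))^2 + 6*(\<Sum>j\<in>UNIV. (x $ j)^4*(norm (rep u x))^2)"
   by (simp add: distrib_right sum_distrib_right)
  finally show "ennreal (japanese x powr (2*2)*(norm (rep u x))^2) \<le> ennreal 2 * ennreal ((norm (rep u x))^2) + ennreal 6*(\<Sum>j\<in>UNIV. ennreal ((x $ j)^4*(norm (rep u x))^2))"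
   unfolding sum_ennreal[OF e0] cmb[OF zero_le_power2 sum_nonneg[OF e0]] by (rule ennreal_leI)
 qed
 also have "... = ennreal 2 * ennreal ((norm u)^2) + ennreal 6*(\<Sum>j\<in>UNIV. (\<integral>\<^sup>+x. ennreal ((x $ j)^4*(norm (rep u x))^2) \<partial>lborel))"
  unfolding norm_l2_nn by (rule int) measurable
 also have "... \<le> ennreal 2 * ennreal ((norm u)^2) + ennreal 6*(\<Sum>j\<in>(UNIV :: 3 set). ennreal (N\<^sup>2))"
  by (intro add_left_mono mult_left_mono sum_mono D_final_coordinate N) auto
 also have "... = ennreal (2*(norm u)^2 + 18 * N\<^sup>2)"
  unfolding sum_ennreal[OF zero_le_power2] cmb[OF zero_le_power2 sum_nonneg[OF zero_le_power2]] by simp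
 finally show ?thesis .
qed

section \<open>Real interpolation between weights\<close>

definition kap :: "real => real" where "kap \<mu> = min 1 \<mu>"

lemma kap_measurable[measurable]: "kap \<in> bmeas" unfolding kap_def[abs_def] by measurable

text \<open>Scaling by \<rho> reduces the integral to \<rho> = 1, where the pieces below and above 1
  converge because 0 < \<theta> < 1 and give c = 1/(1 - \<theta>) + 1/\<theta>. In the interpolation
  c cancels, so its blow-up at the endpoints is harmless.\<close>

lemma kap_powr_integral:
 assumes \<theta>: "0 < \<theta>" "\<theta> < 1"
 obtains c where "0 < c" "c < \<infinity>"
  "\<And>\<rho>. \<rho> > 0 ==> (\<integral>\<^sup>+\<mu>. indicator {0<..} \<mu> * ennreal (\<mu> powr (-\<theta>-1) * kap (\<mu>*\<rho>)) \<partial>lborel) = c * ennreal (\<rho> powr \<theta>)"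
proof -
 define g where "g \<mu> = indicator {0<..} \<mu> * ennreal (\<mu> powr (-\<theta>-1) * kap \<mu>)" for \<mu> :: real
 have gm[measurable]: "g \<in> bmeas" unfolding g_def by measurable
 define c where "c = (\<integral>\<^sup>+\<mu>. g \<mu> \<partial>lborel)"
 have "c = (\<integral>\<^sup>+\<mu>. indicator {0..1} \<mu> * ennreal (\<mu> powr (-\<theta>)) + indicator {1..} \<mu> * ennreal (\<mu> powr (-\<theta>-1)) \<partial>lborel)"
  unfolding c_def
 proof (rule nn_integral_cong_AE, use AE_lborel_singleton[of 1] in eventually_elim)
  case (elim \<mu>)
  have "\<mu> powr (-\<theta>-1)*\<mu> = \<mu> powr (-\<theta>)" if "0 < \<mu>" using that powr_add[of \<mu> "-\<theta>-1" 1] by simp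
  thus ?case using elim by (auto simp: g_def kap_def indicator_def not_less)
 qed
 also have "... = (\<integral>\<^sup>+\<mu>. indicator {0..1} \<mu> * ennreal (\<mu> powr (-\<theta>)) \<partial>lborel) + (\<integral>\<^sup>+\<mu>. indicator {1..} \<mu> * ennreal (\<mu> powr (-\<theta>-1)) \<partial>lborel)"
  by (rule nn_integral_add) measurable
 also have "(\<integral>\<^sup>+\<mu>. indicator {0..1} \<mu> * ennreal (\<mu> powr (-\<theta>)) \<partial>lborel) = ennreal (1 powr (-\<theta>+1)/(-\<theta>+1))"
  using nn_integral_has_integral_lebesgue[OF _ has_integral_powr_from_0[of "-\<theta>" 1]] \<theta> by (simp add: nn_integral_completion ennreal_mult ennreal_indicator)
 also have "(\<integral>\<^sup>+\<mu>. indicator {1..} \<mu> * ennreal (\<mu> powr (-\<theta>-1)) \<partial>lborel) = ennreal (- (1 powr (-\<theta>-1+1))/(-\<theta>-1+1))"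
  using nn_integral_has_integral_lebesgue[OF _ has_integral_powr_to_inf[of "-\<theta>-1" 1]] \<theta> by (simp add: nn_integral_completion ennreal_mult ennreal_indicator)
 finally have c: "c = ennreal (1/(1 - \<theta>)) + ennreal (1/\<theta>)" by simp
 have c0: "0 < c" unfolding c using \<theta> by (intro add_pos_nonneg) auto
 have c1: "c < \<infinity>" unfolding c by simp
 show thesis
 proof (rule that[OF c0 c1])
  fix \<rho> :: real assume \<rho>: "\<rho> > 0"
  have "(\<integral>\<^sup>+\<mu>. indicator {0<..} \<mu> * ennreal (\<mu> powr (-\<theta>-1) * kap (\<mu>*\<rho>)) \<partial>lborel) = (\<integral>\<^sup>+\<mu>. ennreal (\<rho> powr (\<theta> + 1)) * g (0 + \<rho>*\<mu>) \<partial>lborel)"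
  proof (rule nn_integral_cong)
   fix \<mu> :: real
   show "indicator {0<..} \<mu> * ennreal (\<mu> powr (-\<theta>-1) * kap (\<mu>*\<rho>)) = ennreal (\<rho> powr (\<theta> + 1)) * g (0 + \<rho>*\<mu>)"
   proof (cases "\<mu> > 0")
    case True
    have "\<rho> powr (\<theta> + 1)*(\<rho>*\<mu>) powr (-\<theta>-1) = \<mu> powr (-\<theta>-1)"
     using \<rho> True powr_add[of \<rho> "\<theta> + 1" "-\<theta>-1"] by (simp add: powr_mult)
    thus ?thesis using True \<rho> by (simp add: g_def ennreal_mult'[symmetric] mult.assoc[symmetric] mult.commute[of \<rho> \<mu>])
   next
    case False
    hence "\<not> 0 < \<rho>*\<mu>" using \<rho> by (simp add: zero_less_mult_iff)
    thus ?thesis using False by (simp add: g_def)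
   qed
  qed
  also have "... = ennreal (\<rho> powr (\<theta> + 1))*(\<integral>\<^sup>+\<mu>. g (0 + \<rho>*\<mu>) \<partial>lborel)" by (rule nn_integral_cmult) measurable
  also have "ennreal (\<rho> powr (\<theta> + 1)) = ennreal (\<rho> powr \<theta>) * ennreal \<bar>\<rho>\<bar>" using \<rho> by (simp add: powr_add ennreal_mult)
  also have "... * (\<integral>\<^sup>+\<mu>. g (0 + \<rho>*\<mu>) \<partial>lborel) = c * ennreal (\<rho> powr \<theta>)"
   using nn_integral_real_affine[OF gm, of \<rho> 0] \<rho> by (simp add: c_def mult_ac)
  finally show "(\<integral>\<^sup>+\<mu>. indicator {0<..} \<mu> * ennreal (\<mu> powr (-\<theta>-1) * kap (\<mu>*\<rho>)) \<partial>lborel) = c * ennreal (\<rho> powr \<theta>)" .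
 qed
qed

text \<open>The real interpolation method: for every \<open>\<lambda> > 0\<close> the bound at the two endpoints is applied to the splitting
 of \<open>u\<close> at \<open>\<lambda>\<rho> = 1\<close> with \<open>\<rho> = \<langle>x\<rangle>\<^sup>4\<close>, and the result is integrated against \<open>\<lambda>\<^bsup>-s/2-1\<^esup> d\<lambda>\<close>.\<close>

theorem weighted_interpolation:
 fixes A :: "l2 => l2"
 assumes add: "\<And>u v. A (u + v) = A u + A v" and iso: "\<And>u. norm (A u) \<le> norm u"
  and w2: "\<And>u. wn 2 (A u) \<le> ennreal (C\<^sup>2) * wn 2 u" and C: "C \<ge> 1" and s: "s \<in> {0..2}"
 shows "wn s (A u) \<le> ennreal (2 * C\<^sup>2) * wn s u"
proof -
 have C2: "1 \<le> C\<^sup>2" using C by (simp add: one_le_power)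
 consider "s = 0" | "s = 2" | "0 < s" "s < 2" using s by fastforce
 thus ?thesis
 proof cases
  case 1
  have "(norm (A u))^2 \<le> 1*(norm u)^2" using iso by (simp add: power_mono)
  also have "... \<le> 2 * C\<^sup>2*(norm u)^2" using C2 by (intro mult_right_mono) auto
  finally show ?thesis unfolding 1 wn_0 using C2 by (simp add: ennreal_mult[symmetric] ennreal_leI)
 next
  case 2
  have "ennreal (C\<^sup>2) * wn 2 u \<le> ennreal (2 * C\<^sup>2) * wn 2 u" by (intro mult_right_mono ennreal_leI) auto
  with w2 show ?thesis unfolding 2 by (rule order_trans)
 next
  case 3
  define \<rho> :: "R3 => real" where "\<rho> x = japanese x powr (2*2)" for x
  have \<rho>0: "\<rho> x > 0" for x unfolding \<rho>_def using japanese_pos[of x] by simp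
  have [measurable]: "\<rho> \<in> bmeas" unfolding \<rho>_def by measurable
  define E where "E l v = (\<integral>\<^sup>+x. ennreal (kap (l*\<rho> x)*(norm (rep v x))^2) \<partial>lborel)" for l v
  have E: "E l (A u) \<le> ennreal (2 * C\<^sup>2) * E l u" if l: "l > 0" for l
  proof -
   have lr: "0 < l*\<rho> x" for x using l \<rho>0 by simp
   \<comment> \<open>The part of u where l \<rho> > 1 is estimated by the plain norm, the rest by
     the weighted one: on each piece the minimum of 1 and l \<rho> is exactly the weight of that
     norm.\<close>
   define m0 m1 where "m0 x = (if 1 < l*\<rho> x then 1 else 0 :: complex)" and "m1 x = (if 1 < l*\<rho> x then 0 else 1 :: complex)" for x
   have b0: "bm m0" unfolding m0_def by (rule bmI[where C=1]) auto
   have b1: "bm m1" unfolding m1_def by (rule bmI[where C=1]) auto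
   have "(\<lambda>x. m0 x + m1 x) = (\<lambda>x. 1)" by (simp add: fun_eq_iff m0_def m1_def)
   hence u: "u = Mul m0 u + Mul m1 u" using Mul_add_fun[OF b0 b1, of u] by simp
   have "E l (A u) = E l (A (Mul m0 u) + A (Mul m1 u))" unfolding add[symmetric] u[symmetric] ..
   also have "... \<le> (\<integral>\<^sup>+x. 2 * ennreal ((norm (rep (A (Mul m0 u)) x))^2) + ennreal (2 * l) * ennreal (\<rho> x*(norm (rep (A (Mul m1 u)) x))^2) \<partial>lborel)"
    unfolding E_def
   proof (rule nn_integral_mono_AE)
    show "AE x in lborel. ennreal (kap (l*\<rho> x)*(norm (rep (A (Mul m0 u) + A (Mul m1 u)) x))^2)
     \<le> 2 * ennreal ((norm (rep (A (Mul m0 u)) x))^2) + ennreal (2 * l) * ennreal (\<rho> x*(norm (rep (A (Mul m1 u)) x))^2)"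
     using rep_add[of "A (Mul m0 u)" "A (Mul m1 u)"]
    proof eventually_elim
     case (elim x)
     have k: "0 \<le> kap (l*\<rho> x)" "kap (l*\<rho> x) \<le> 1" "kap (l*\<rho> x) \<le> l*\<rho> x" using lr[of x] by (auto simp: kap_def)
     let ?a = "rep (A (Mul m0 u)) x" and ?b = "rep (A (Mul m1 u)) x"
     have "kap (l*\<rho> x)*(norm (?a + ?b))^2 \<le> kap (l*\<rho> x)*(2*(norm ?a)^2 + 2*(norm ?b)^2)"
      by (intro mult_left_mono norm_add_squared_le k)
     also have "... \<le> 1*(2*(norm ?a)^2) + (l*\<rho> x)*(2*(norm ?b)^2)"
      unfolding distrib_left by (intro add_mono mult_right_mono k) auto
     finally have "kap (l*\<rho> x)*(norm (?a + ?b))^2 \<le> 2*(norm ?a)^2 + (2 * l)*(\<rho> x*(norm ?b)^2)" by (simp add: mult_ac)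
     moreover have "2 * ennreal ((norm ?a)^2) + ennreal (2 * l) * ennreal (\<rho> x*(norm ?b)^2) = ennreal (2*(norm ?a)^2 + (2 * l)*(\<rho> x*(norm ?b)^2))"
      using l \<rho>0[of x] by (simp add: ennreal_plus ennreal_mult)
     ultimately show ?case unfolding elim by (simp only: ennreal_leI)
    qed
   qed
   also have "... = 2 * ennreal ((norm (A (Mul m0 u)))^2) + ennreal (2 * l) * wn 2 (A (Mul m1 u))"
    unfolding norm_l2_nn wn_def \<rho>_def by (simp add: nn_integral_add nn_integral_cmult)
   also have "... \<le> 2*(ennreal (C\<^sup>2) * ennreal ((norm (Mul m0 u))^2)) + ennreal (2 * l)*(ennreal (C\<^sup>2) * wn 2 (Mul m1 u))"
   proof (intro add_mono mult_left_mono w2)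
    have "(norm (A (Mul m0 u)))^2 \<le> (norm (Mul m0 u))^2" by (intro power_mono iso) simp
    also have "... \<le> C\<^sup>2*(norm (Mul m0 u))^2" using C2 mult_right_mono[of 1 "C\<^sup>2" "(norm (Mul m0 u))^2"] by simp
    finally show "ennreal ((norm (A (Mul m0 u)))^2) \<le> ennreal (C\<^sup>2) * ennreal ((norm (Mul m0 u))^2)"
     by (simp add: ennreal_mult[symmetric] ennreal_leI)
   qed auto
   also have "... = ennreal (2 * C\<^sup>2)*(ennreal ((norm (Mul m0 u))^2) + ennreal l * wn 2 (Mul m1 u))"
    using l by (simp add: ennreal_mult distrib_left mult_ac)
   also have "ennreal ((norm (Mul m0 u))^2) + ennreal l * wn 2 (Mul m1 u) =
     (\<integral>\<^sup>+x. ennreal ((norm (rep (Mul m0 u) x))^2) + ennreal l * ennreal (\<rho> x*(norm (rep (Mul m1 u) x))^2) \<partial>lborel)"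
    unfolding norm_l2_nn wn_def \<rho>_def by (simp add: nn_integral_add nn_integral_cmult)
   also have "... = E l u" unfolding E_def
   proof (rule nn_integral_cong_AE)
    show "AE x in lborel. ennreal ((norm (rep (Mul m0 u) x))^2) + ennreal l * ennreal (\<rho> x*(norm (rep (Mul m1 u) x))^2) = ennreal (kap (l*\<rho> x)*(norm (rep u x))^2)"
     using rep_Mul[OF b0, of u] rep_Mul[OF b1, of u]
    proof eventually_elim
     case (elim x)
     have "ennreal ((norm (rep (Mul m0 u) x))^2) + ennreal l * ennreal (\<rho> x*(norm (rep (Mul m1 u) x))^2) =
       ennreal ((norm (rep (Mul m0 u) x))^2 + l*(\<rho> x*(norm (rep (Mul m1 u) x))^2))"
      using l \<rho>0[of x] by (simp add: ennreal_plus ennreal_mult)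
     also have "(norm (rep (Mul m0 u) x))^2 + l*(\<rho> x*(norm (rep (Mul m1 u) x))^2) = kap (l*\<rho> x)*(norm (rep u x))^2"
      unfolding elim by (simp add: m0_def m1_def kap_def)
     finally show ?case .
    qed
   qed
   finally show ?thesis .
  qed
  \<comment> \<open>\<rho> is <x>^4 and the weight sought is <x>^(2s), hence the exponent
    s/2.\<close>
  define \<theta> where "\<theta> = s/2"
  have \<theta>: "0 < \<theta>" "\<theta> < 1" using 3 by (auto simp: \<theta>_def)
  obtain c where c: "0 < c" "c < \<infinity>"
   "\<And>\<rho>. \<rho> > 0 ==> (\<integral>\<^sup>+\<mu>. indicator {0<..} \<mu> * ennreal (\<mu> powr (-\<theta>-1) * kap (\<mu>*\<rho>)) \<partial>lborel) = c * ennreal (\<rho> powr \<theta>)"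
   using kap_powr_integral[OF \<theta>] by metis
  have cw: "c * wn s v = (\<integral>\<^sup>+l. indicator {0<..} l * ennreal (l powr (-\<theta>-1)) * E l v \<partial>lborel)" for v
  proof -
   have "c * wn s v = (\<integral>\<^sup>+x. c * ennreal (japanese x powr (2 * s)*(norm (rep v x))^2) \<partial>lborel)"
    unfolding wn_def by (rule nn_integral_cmult[symmetric]) measurable
   also have "... = (\<integral>\<^sup>+x. \<integral>\<^sup>+l. indicator {0<..} l * ennreal (l powr (-\<theta>-1) * kap (l*\<rho> x)) * ennreal ((norm (rep v x))^2) \<partial>lborel \<partial>lborel)"
   proof (rule nn_integral_cong)
    fix x
    have "japanese x powr (2 * s) = \<rho> x powr \<theta>" unfolding \<rho>_def powr_powr \<theta>_def by simp
    hence "c * ennreal (japanese x powr (2 * s)*(norm (rep v x))^2) = c * ennreal (\<rho> x powr \<theta>) * ennreal ((norm (rep v x))^2)"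
     by (simp add: ennreal_mult mult.assoc)
    thus "c * ennreal (japanese x powr (2 * s)*(norm (rep v x))^2) =
     (\<integral>\<^sup>+l. indicator {0<..} l * ennreal (l powr (-\<theta>-1) * kap (l*\<rho> x)) * ennreal ((norm (rep v x))^2) \<partial>lborel)"
     unfolding c(3)[OF \<rho>0, symmetric] by (simp add: nn_integral_multc)
   qed
   also have "... = (\<integral>\<^sup>+l. \<integral>\<^sup>+x. indicator {0<..} l * ennreal (l powr (-\<theta>-1) * kap (l*\<rho> x)) * ennreal ((norm (rep v x))^2) \<partial>lborel \<partial>lborel)"
    by (rule lborel_pair.Fubini') measurable
   also have "... = (\<integral>\<^sup>+l. indicator {0<..} l * ennreal (l powr (-\<theta>-1)) * E l v \<partial>lborel)"
   proof (rule nn_integral_cong)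
    fix l :: real
    show "(\<integral>\<^sup>+x. indicator {0<..} l * ennreal (l powr (-\<theta>-1) * kap (l*\<rho> x)) * ennreal ((norm (rep v x))^2) \<partial>lborel) = indicator {0<..} l * ennreal (l powr (-\<theta>-1)) * E l v"
    proof (cases "l > 0")
     case True
     have "ennreal (l powr (-\<theta>-1) * kap (l*\<rho> x)) * ennreal ((norm (rep v x))^2) = ennreal (l powr (-\<theta>-1)) * ennreal (kap (l*\<rho> x)*(norm (rep v x))^2)" for x
      using True \<rho>0[of x] by (simp add: kap_def ennreal_mult mult.assoc)
     thus ?thesis using True by (simp add: E_def nn_integral_cmult)
    qed simp
   qed
   finally show ?thesis .
  qed
  have Em: "(\<lambda>l. indicator {0<..} l * ennreal (l powr (-\<theta>-1)) * E l u) \<in> borel_measurable lborel"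
   unfolding E_def by measurable
  have "c * wn s (A u) \<le> (\<integral>\<^sup>+l. ennreal (2 * C\<^sup>2)*(indicator {0<..} l * ennreal (l powr (-\<theta>-1)) * E l u) \<partial>lborel)"
   unfolding cw
  proof (rule nn_integral_mono)
   fix l :: real
   show "indicator {0<..} l * ennreal (l powr (-\<theta>-1)) * E l (A u) \<le> ennreal (2 * C\<^sup>2)*(indicator {0<..} l * ennreal (l powr (-\<theta>-1)) * E l u)"
    using mult_left_mono[OF E[of l], of "ennreal (l powr (-\<theta>-1))"] by (cases "l > 0") (simp_all add: mult_ac)
  qed
  also have "... = ennreal (2 * C\<^sup>2)*(c * wn s u)" unfolding cw using Em by (rule nn_integral_cmult)
  finally have "c * wn s (A u) \<le> c*(ennreal (2 * C\<^sup>2) * wn s u)" by (simp add: mult_ac)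
  thus ?thesis using c(1,2) by (simp add: ennreal_mult_le_mult_iff)
 qed
qed

text \<open>The constant of \<open>DD_bound\<close> for m0 = 1, with that of \<open>D_bound\<close>
  inserted for N; b bounds the total mass of \<beta>.\<close>

definition DD_const :: "real => real" where
 "DD_const b = 2*(1 + (3*(2*(1 + b) * exp (2 * b)) + 1) * b) * exp (4 * b)"

text \<open>The root of the bound in \<open>D_final\<close>, for a vector of weighted norm
  1.\<close>

definition wave_const :: "real => real" where "wave_const b = sqrt (2 + 18*(DD_const b)^2)"

lemma wave_const_ge1: "1 \<le> wave_const b" unfolding wave_const_def by (rule real_le_rsqrt) simp

lemma wn_mk: assumes "f \<in> L2" shows "wn s (mk f) = (\<integral>\<^sup>+x. ennreal ((norm (of_real (japanese x powr s) * f x))^2) \<partial>lborel)"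
 unfolding wn_def
proof (rule nn_integral_cong_AE)
 have e: "japanese x powr (2 * s) = (japanese x powr s)^2" for x :: R3
  by (simp add: power2_eq_square powr_add[symmetric])
 show "AE x in lborel. ennreal (japanese x powr (2 * s)*(norm (rep (mk f) x))^2) = ennreal ((norm (of_real (japanese x powr s) * f x))^2)"
  using rep_mk[OF assms] by eventually_elim (simp add: norm_mult power_mult_distrib e)
qed

lemma L2_norm_nn: "f \<in> L2 ==> (\<integral>\<^sup>+x. ennreal ((norm (f x))^2) \<partial>lborel) = ennreal ((L2_norm f)^2)"
 by (subst nn_integral_eq_integral) (simp_all add: L2_def L2_norm_def)

context evo_est
begin

section \<open>The flow as a linear operator\<close>

lemma strong_diff: assumes "strong v" "strong w" shows "strong (\<lambda>t. v t - w t)"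
 using assms unfolding strong_def
 by (auto intro!: has_vector_derivative_diff simp: linear_diff[OF bounded_linear.linear[OF bl_H]])

lemma strong_unique: assumes "strong v" "strong w" "v 0 = w 0" "t \<in> {0..T}" shows "v t = w t"
 using norm_v[OF strong_diff[OF assms(1,2)] assms(4)] assms(3) by simp

text \<open>Conservation of the norm, applied to differences, makes the chosen solution unique on
  [0,T]; the additivity required by the interpolation follows from it.\<close>

definition flow :: "real => l2 => l2" where "flow t x = (SOME v. strong v \<and> v 0 = x) t"

lemma flow: "strong (\<lambda>t. flow t x)" "flow 0 x = x"
proof -
 have "strong (SOME v. strong v \<and> v 0 = x) \<and> (SOME v. strong v \<and> v 0 = x) 0 = x"
  using strong_exists[of x] by (intro someI_ex[of "\<lambda>v. strong v \<and> v 0 = x"]) metis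
 thus "strong (\<lambda>t. flow t x)" "flow 0 x = x" by (simp_all add: flow_def)
qed

lemma flow_add: assumes "t \<in> {0..T}" shows "flow t (x + y) = flow t x + flow t y"
proof -
 have "flow t (x + y) - flow t x = flow t y"
  by (rule strong_unique[OF strong_diff[OF flow(1) flow(1)] flow(1) _ assms]) (simp add: flow(2))
 thus ?thesis by (simp add: algebra_simps)
qed

lemma flow_weighted:
 assumes t: "t \<in> {0..T}" shows "wn 2 (Fi (flow t (Ft u))) \<le> ennreal ((wave_const b)^2) * wn 2 u"
proof (cases "wn 2 u = \<infinity>")
 case True
 have "0 < (wave_const b)^2" using wave_const_ge1[of b] by simp
 thus ?thesis unfolding True by (simp add: ennreal_mult_top)
next
 case False
 define c where "c = sqrt (enn2real (wn 2 u))"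
 have c: "0 \<le> c" "wn 2 u = ennreal (c\<^sup>2)" using False by (simp_all add: c_def less_top)
 note i = D_initial[OF eq_refl[OF c(2)] c(1)]
 have b0: "0 \<le> b" using B(3)[OF t] by auto
 note v = flow(1)[of "Ft u"] and v0 = flow(2)[of "Ft u"]
 define N where "N = 2*(c + c * b) * exp (2*1 * b)"
 have N0: "0 \<le> N" using c(1) b0 by (simp add: N_def)
 have N: "norm (D a (flow t (Ft u))) \<le> N * norm a" if "t \<in> {0..T}" for a t
  unfolding N_def by (rule D_bound[OF v _ c(1) _ that]) (use i v0 in auto)
 have e: "2*(c + (3 * N + c) * b) * exp (2*2 * b) = DD_const b * c" by (simp add: N_def DD_const_def algebra_simps)
 have "norm (D a (D a (flow t (Ft u)))) \<le> (2*(c + (3 * N + c) * b) * exp (2*2 * b))*(norm a * norm a)" for a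
  by (rule DD_bound[OF v _ _ c(1) _ t N N0]) (use i v0 in auto)
 hence "norm (D a (D a (Ft (Fi (flow t (Ft u)))))) \<le> (DD_const b * c)*(norm a)^2" for a
  unfolding e by (simp add: power2_eq_square)
 moreover have "0 \<le> DD_const b * c" unfolding e[symmetric] using c(1) b0 N0 by simp
 ultimately have "wn 2 (Fi (flow t (Ft u))) \<le> ennreal (2*(norm (Fi (flow t (Ft u))))^2 + 18*(DD_const b * c)^2)"
  by (rule D_final)
 also have "... \<le> ennreal ((wave_const b)^2 * c\<^sup>2)"
 proof (rule ennreal_leI)
  have "(norm (Fi (flow t (Ft u))))^2 \<le> c\<^sup>2" using norm_v[OF v t] i(1) c(1) by (simp add: v0 power_mono)
  moreover have "(wave_const b)^2 * c\<^sup>2 = 2 * c\<^sup>2 + 18*(DD_const b * c)^2"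
   unfolding wave_const_def by (simp add: algebra_simps power_mult_distrib)
  ultimately show "2*(norm (Fi (flow t (Ft u))))^2 + 18*(DD_const b * c)^2 \<le> (wave_const b)^2 * c\<^sup>2" by linarith
 qed
 also have "... = ennreal ((wave_const b)^2) * wn 2 u" unfolding c(2) by (simp add: ennreal_mult)
 finally show ?thesis .
qed

text \<open>The vector <x>^(-s) f is transported by the flow, and its \<open>wn s\<close> is the
  squared norm of f. The factor sqrt 2 is the loss of the interpolation.\<close>

theorem wave_opnorm:
 assumes t: "t \<in> {0..T}" and s: "s \<in> {0..2}"
 shows "L2_opnorm (weighted_wave_operator s h T V t) \<le> ennreal (sqrt 2 * wave_const b)"
proof -
 define C where "C = wave_const b"
 have C1: "1 \<le> C" using wave_const_ge1 by (simp add: C_def)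
 have C0: "0 \<le> sqrt 2 * C" using C1 by simp
 have "weighted_wave_operator s h T V t f \<in> L2 \<and> L2_norm (weighted_wave_operator s h T V t f) \<le> sqrt 2 * C * L2_norm f" if f: "f \<in> L2" for f
 proof -
  define \<phi> where "\<phi> y = of_real (japanese y powr (- s)) * f y" for y
  have "bm (\<lambda>y :: R3. of_real (japanese y powr (- s)))"
  proof (rule bmI[where C=1])
   show "norm (complex_of_real (japanese y powr (- s))) \<le> 1" for y :: R3
    using powr_mono[of "- s" 0 "japanese y"] s japanese_ge1[of y] by (auto split: if_splits)
  qed measurable
  hence \<phi>: "\<phi> \<in> L2" unfolding \<phi>_def[abs_def] using f by (rule bm_mult_L2)
  define g where "g = semiclassical_multiplier h (\<lambda>\<xi>. cis (phase h V t \<xi>)) (wave_operator h T V t \<phi>)"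
  obtain v where v: "strong v" "v 0 = Ft (mk \<phi>)" and g: "g \<in> L2 \<and> mk g = Fi (v t)"
   using wave_operator_strong[OF \<phi>] t unfolding g_def by metis
  have "v t = flow t (Ft (mk \<phi>))" by (rule strong_unique[OF v(1) flow(1) _ t]) (simp add: v(2) flow(2))
  hence gf: "mk g = Fi (flow t (Ft (mk \<phi>)))" using g by simp
  have w: "weighted_wave_operator s h T V t f = (\<lambda>x. of_real (japanese x powr s) * g x)"
   unfolding weighted_wave_operator_def g_def \<phi>_def ..
  have "wn s (mk g) \<le> ennreal (2 * C\<^sup>2) * wn s (mk \<phi>)" unfolding gf
  proof (rule weighted_interpolation[OF _ _ _ C1 s])
   show "Fi (flow t (Ft (u + v))) = Fi (flow t (Ft u)) + Fi (flow t (Ft v))" for u v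
    by (simp add: Ft_add flow_add[OF t] Fi_add)
   show "norm (Fi (flow t (Ft u))) \<le> norm u" for u using norm_v[OF flow(1) t, of "Ft u"] by (simp add: flow(2))
   show "wn 2 (Fi (flow t (Ft u))) \<le> ennreal (C\<^sup>2) * wn 2 u" for u unfolding C_def by (rule flow_weighted[OF t])
  qed
  moreover have "wn s (mk \<phi>) = ennreal ((L2_norm f)^2)"
  proof -
   have "of_real (japanese x powr s)*\<phi> x = f x" for x
   proof -
    have "japanese x powr s * japanese x powr (- s) = 1" using japanese_pos[of x] by (simp add: powr_add[symmetric])
    thus ?thesis unfolding \<phi>_def mult.assoc[symmetric] of_real_mult[symmetric] by simp
   qed
   thus ?thesis unfolding wn_mk[OF \<phi>] L2_norm_nn[OF f, symmetric] by simp
  qed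
  ultimately have n: "(\<integral>\<^sup>+x. ennreal ((norm (weighted_wave_operator s h T V t f x))^2) \<partial>lborel) \<le> ennreal ((sqrt 2 * C * L2_norm f)^2)"
   unfolding w wn_mk[OF conjunct1[OF g], symmetric] by (simp add: ennreal_mult[symmetric] power_mult_distrib)
  have m: "weighted_wave_operator s h T V t f \<in> bmeas"
   unfolding w using L2_measurable[of g] g by (intro borel_measurable_times) auto
  have L: "weighted_wave_operator s h T V t f \<in> L2" unfolding L2_iff_nn using m n by (auto intro: le_less_trans)
  note n[unfolded L2_norm_nn[OF L]]
  hence "(L2_norm (weighted_wave_operator s h T V t f))^2 \<le> (sqrt 2 * C * L2_norm f)^2" by (simp add: ennreal_le_iff)
  hence "L2_norm (weighted_wave_operator s h T V t f) \<le> sqrt 2 * C * L2_norm f"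
   by (rule power2_le_imp_le) (use C0 in \<open>simp add: L2_norm_def\<close>)
  with L show ?thesis by simp
 qed
 thus ?thesis unfolding L2_opnorm_def C_def[symmetric] using C0 by (intro Inf_lower) blast
qed

end

section \<open>Verification of the hypotheses\<close>

lemma nu_bound:
 assumes nu: "nu_rep \<nu> V n" and k: "k \<in> {1..3}" and i: "integrable lborel (\<lambda>\<eta>. \<nu> \<eta> * q \<eta>)"
  and q: "\<And>\<eta>. norm (q \<eta>) \<le> c * norm \<eta>^k" and c: "c \<ge> 0"
 shows "norm (LBINT \<eta>. \<nu> \<eta> * q \<eta>) \<le> n k * c"
proof -
 have m: "integrable lborel (\<lambda>\<eta>. norm \<eta>^k * norm (\<nu> \<eta>))" "(LBINT \<eta>. norm \<eta>^k * norm (\<nu> \<eta>)) \<le> n k"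
  using nu k unfolding nu_rep_def by blast+
 have "norm (LBINT \<eta>. \<nu> \<eta> * q \<eta>) \<le> (LBINT \<eta>. c*(norm \<eta>^k * norm (\<nu> \<eta>)))"
 proof (rule Bochner_Integration.integral_norm_bound_integral[OF i integrable_mult_right[OF m(1)]])
  show "norm (\<nu> \<eta> * q \<eta>) \<le> c*(norm \<eta>^k * norm (\<nu> \<eta>))" for \<eta>
   using mult_left_mono[OF q[of \<eta>], of "norm (\<nu> \<eta>)"] by (simp add: norm_mult mult_ac)
 qed
 also have "... \<le> c * n k" unfolding integral_mult_right_zero using m(2) c by (rule mult_left_mono)
 finally show ?thesis by (simp add: mult.commute)
qed

text \<open>Each difference of V puts a factor e^(i\<eta>a) - 1 under the integral, of size at most
  |\<eta>| |a|, so k differences are paid by the k-th moment.\<close>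

lemma nu_differences:
 assumes nu: "nu_rep \<nu> V n"
 defines "P \<equiv> \<lambda>y z. V (z + y) - V z"
 shows "\<bar>P y z\<bar> \<le> n 1 * norm y" "\<bar>P y (z + a) - P y z\<bar> \<le> n 2*(norm a * norm y)"
  "\<bar>P y (z + (a + b)) - P y (z + a) - P y (z + b) + P y z\<bar> \<le> n 3*(norm a * norm b * norm y)"
proof -
 define Q where "Q y z \<eta> = cis (\<eta>\<bullet>(z + y)) - cis (\<eta>\<bullet>z)" for y z \<eta> :: R3
 define e where "e a \<eta> = cis (\<eta>\<bullet>a) - 1" for a \<eta> :: R3
 have \<nu>m[measurable]: "\<nu> \<in> bmeas" using nu by (simp add: nu_rep_def)
 have ne: "norm (e a \<eta>) \<le> norm \<eta> * norm a" for a \<eta>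
  using norm_cis_minus_1_le[of "\<eta>\<bullet>a"] Cauchy_Schwarz_ineq2[of \<eta> a] by (simp add: e_def)
 have Qe: "Q y z \<eta> = cis (\<eta>\<bullet>z) * e y \<eta>" for y z \<eta>
  by (simp add: Q_def e_def inner_add_right cis_mult[symmetric] algebra_simps)
 have nQ: "norm (Q y z \<eta>) \<le> norm y * norm \<eta>^1" for y z \<eta> unfolding Qe norm_mult using ne[of y \<eta>] by (simp add: mult.commute)
 have cis_m[measurable]: "(\<lambda>\<eta>. cis (\<eta>\<bullet>z)) \<in> bmeas" for z :: R3
  by (intro borel_measurable_continuous_onI continuous_intros)
 have Qi: "integrable lborel (\<lambda>\<eta>. \<nu> \<eta> * Q y z \<eta>)" for y z
 proof (rule Bochner_Integration.integrable_bound)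
  show "integrable lborel (\<lambda>\<eta>. norm y*(norm \<eta>^1 * norm (\<nu> \<eta>)))"
  proof (rule integrable_mult_right)
   have "\<forall>k\<in>{1..3}. integrable lborel (\<lambda>\<eta>. norm \<eta>^k * norm (\<nu> \<eta>))" using nu unfolding nu_rep_def by blast
   thus "integrable lborel (\<lambda>\<eta>. norm \<eta>^1 * norm (\<nu> \<eta>))" by (rule bspec) simp
  qed
  show "AE \<eta> in lborel. norm (\<nu> \<eta> * Q y z \<eta>) \<le> norm (norm y*(norm \<eta>^1 * norm (\<nu> \<eta>)))"
  proof (intro AE_I2)
   fix \<eta>
   show "norm (\<nu> \<eta> * Q y z \<eta>) \<le> norm (norm y*(norm \<eta>^1 * norm (\<nu> \<eta>)))"
    using mult_left_mono[OF nQ[of y z \<eta>] norm_ge_zero[of "\<nu> \<eta>"]] by (simp add: norm_mult mult_ac)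
  qed
 qed (simp add: Q_def)
 have PQ: "of_real (P y z) = (LBINT \<eta>. \<nu> \<eta> * Q y z \<eta>)" for y z
  using nu unfolding P_def Q_def nu_rep_def by simp
 have "norm (complex_of_real (P y z)) \<le> n 1 * norm y"
  unfolding PQ by (rule nu_bound[OF nu _ Qi nQ]) auto
 thus "\<bar>P y z\<bar> \<le> n 1 * norm y" unfolding norm_of_real .
 have "complex_of_real (P y (z + a) - P y z) = (LBINT \<eta>. \<nu> \<eta> * Q y (z + a) \<eta> - \<nu> \<eta> * Q y z \<eta>)"
  unfolding of_real_diff PQ by (rule Bochner_Integration.integral_diff[OF Qi Qi, symmetric])
 also have "... = (LBINT \<eta>. \<nu> \<eta>*(Q y (z + a) \<eta> - Q y z \<eta>))" by (simp add: right_diff_distrib)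
 also have "norm ... \<le> n 2*(norm a * norm y)"
 proof (rule nu_bound[OF nu])
  show "integrable lborel (\<lambda>\<eta>. \<nu> \<eta>*(Q y (z + a) \<eta> - Q y z \<eta>))"
   unfolding right_diff_distrib by (intro Bochner_Integration.integrable_diff Qi)
  have "Q y (z + a) \<eta> - Q y z \<eta> = cis (\<eta>\<bullet>z)*(e y \<eta> * e a \<eta>)" for \<eta>
   unfolding Qe by (simp add: e_def inner_add_right cis_mult[symmetric] algebra_simps)
  thus "norm (Q y (z + a) \<eta> - Q y z \<eta>) \<le> (norm a * norm y) * norm \<eta>^2" for \<eta>
   using mult_mono[OF ne[of y \<eta>] ne[of a \<eta>]] by (simp add: norm_mult power2_eq_square mult_ac)
 qed auto
 finally show "\<bar>P y (z + a) - P y z\<bar> \<le> n 2*(norm a * norm y)" unfolding norm_of_real .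
 let ?q = "\<lambda>\<eta>. Q y (z + (a + b)) \<eta> - Q y (z + a) \<eta> - Q y (z + b) \<eta> + Q y z \<eta>"
 have i: "integrable lborel (\<lambda>\<eta>. \<nu> \<eta> * ?q \<eta>)"
  unfolding right_diff_distrib distrib_left by (intro Bochner_Integration.integrable_diff Bochner_Integration.integrable_add Qi)
 have "complex_of_real (P y (z + (a + b)) - P y (z + a) - P y (z + b) + P y z) = (LBINT \<eta>. \<nu> \<eta> * ?q \<eta>)"
  unfolding of_real_diff of_real_add PQ right_diff_distrib distrib_left by (simp add: Qi)
 also have "norm ... \<le> n 3*(norm a * norm b * norm y)"
 proof (rule nu_bound[OF nu _ i])
  have "?q \<eta> = cis (\<eta>\<bullet>z)*(e y \<eta>*(e a \<eta> * e b \<eta>))" for \<eta>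
   unfolding Qe by (simp add: e_def inner_add_right cis_mult[symmetric] algebra_simps)
  thus "norm (?q \<eta>) \<le> (norm a * norm b * norm y) * norm \<eta>^3" for \<eta>
   using mult_mono[OF ne[of y \<eta>] mult_mono[OF ne[of a \<eta>] ne[of b \<eta>]]] by (simp add: norm_mult power3_eq_cube mult_ac)
 qed auto
 finally show "\<bar>P y (z + (a + b)) - P y (z + a) - P y (z + b) + P y z\<bar> \<le> n 3*(norm a * norm b * norm y)" unfolding norm_of_real .
qed

context evo
begin

lemma \<Omega>_has_integral: assumes "t \<in> {0..T}"
 shows "((\<lambda>\<tau>. V \<tau> ((\<tau> * h) *\<^sub>R \<xi>)) has_integral h*\<Omega> t \<xi>) {0..t}"
proof -
 have "continuous_on {0..t} (\<lambda>s. V s ((s * h) *\<^sub>R \<xi>))" using assms by (intro V_comp continuous_intros) auto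
 hence "(\<lambda>\<tau>. V \<tau> ((\<tau> * h) *\<^sub>R \<xi>)) integrable_on {0..t}" by (rule integrable_continuous_real)
 from integrable_integral[OF this] show ?thesis unfolding \<Omega>_def phase_def using h by simp
qed

text \<open>Integration of (1 + \<tau>)^(p-1) gives at most (1 + t)^p / p, and 1/p \<le> 16 because
  the smallest exponent that occurs is \<delta> = 1/16. The factor h on both sides absorbs the 1/h
  of the phase.\<close>

lemma phase_integral_bound:
 assumes t: "t \<in> {0..T}" and f: "(f has_integral h * X) {0..t}" and le: "\<And>\<tau>. \<tau> \<in> {0..t} ==> \<bar>f \<tau>\<bar> \<le> h * Q*(1 + \<tau>) powr (p - 1)"
  and p: "1/16 \<le> p" and Q: "Q \<ge> 0"
 shows "\<bar>X\<bar> \<le> 16 * Q*(1 + t) powr p"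
proof -
 have "((\<lambda>\<tau>. (1 + \<tau>) powr (p - 1)) has_integral (1 + t) powr p/p - (1 + 0) powr p/p) {0..t}"
  using t p by (intro fundamental_theorem_of_calculus)
   (auto intro!: derivative_eq_intros simp: has_real_derivative_iff_has_vector_derivative[symmetric])
 from has_integral_mult_right[OF this, of "h * Q"]
 have g: "((\<lambda>\<tau>. h * Q*(1 + \<tau>) powr (p - 1)) has_integral h * Q*((1 + t) powr p/p - (1 + 0) powr p/p)) {0..t}" .
 have "\<bar>h * X\<bar> \<le> h * Q*((1 + t) powr p/p - (1 + 0) powr p/p)"
  using integral_norm_bound_integral[OF has_integral_integrable[OF f] has_integral_integrable[OF g]] le
  unfolding integral_unique[OF f] integral_unique[OF g] by simp
 also have "... \<le> h * Q*(16*(1 + t) powr p)"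
 proof (rule mult_left_mono)
  have "(1 + t) powr p/p \<le> (1 + t) powr p/(1/16)" using p by (intro divide_left_mono) auto
  also have "... = 16*(1 + t) powr p" by simp
  finally have "(1 + t) powr p/p \<le> 16*(1 + t) powr p" .
  moreover have "0 \<le> (1 + 0) powr p/p" using p by simp
  ultimately show "(1 + t) powr p/p - (1 + 0) powr p/p \<le> 16*(1 + t) powr p" by linarith
 qed (use h Q in simp)
 finally have "h*\<bar>X\<bar> \<le> h*(16 * Q*(1 + t) powr p)" using h by (simp add: abs_mult mult_ac)
 thus ?thesis using h by simp
qed

end

section \<open>Decay rates of the coefficients\<close>

lemma powr_calculus:
 fixes e :: real assumes e: "e \<ge> 1"
 shows powr_calc_mult: "[|x \<le> c * e powr r; y \<le> d * e powr s; 0 \<le> y; 0 \<le> c|] ==> x * y \<le> (c * d) * e powr (r + s)"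
  and powr_calc_weaken: "[|x \<le> c * e powr r; 0 \<le> c; r \<le> s|] ==> x \<le> c * e powr s"
proof -
 assume "x \<le> c * e powr r" "y \<le> d * e powr s" "0 \<le> y" "0 \<le> c"
 hence "x * y \<le> (c * e powr r)*(d * e powr s)" by (intro mult_mono) auto
 thus "x * y \<le> (c * d) * e powr (r + s)" by (simp add: powr_add mult_ac)
next
 assume x: "x \<le> c * e powr r" "0 \<le> c" "r \<le> s"
 have "c * e powr r \<le> c * e powr s" using e x by (intro mult_left_mono powr_mono) auto
 with x show "x \<le> c * e powr s" by linarith
qed

lemma powr_calc_add: "[|x \<le> c*(z::real); y \<le> d * z|] ==> x + y \<le> (c + d) * z" by (simp add: distrib_right)

text \<open>The assumed rates for \<delta> = 1/16, with 1 + t in place of <t>: the exponents are -2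
  + \<delta>, -3 + \<delta>, -7/2 + \<delta> and -4 + \<delta> in this order.\<close>

definition moments :: "real => real => real => nat => real" where
 "moments M h t k = M*(if k = 1 then (1 + t) powr (-31/16) else if k = 2 then (1 + t) powr (-47/16)
   else min ((1 + t) powr (-55/16)) (h powr (-3/2)*(1 + t) powr (-63/16)))"

text \<open>With \<Lambda> = 16 M this is M (2 + 4 \<Lambda> + \<Lambda>^2), the sum of the
  coefficients collected in the last of the four estimates below; it dominates the other
  three.\<close>

definition decay_const :: "real => real" where "decay_const M = M*(2 + 4*(16 * M) + (16 * M)^2)"

text \<open>The differences of the phase may grow, like (1 + t)^\<delta> in orders 1 and 2 and like
  (1 + t)^(1/2 + \<delta>) in order 3, but each further order carries one more factor h. Dividing
  \<open>l2\<close> and \<open>l3\<close> by h is therefore harmless, and the slowest products in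
  the last two estimates still decay like (1 + t)^(-11/8).\<close>

lemma coefficient_bounds:
 assumes h: "0 < h" "h \<le> 1" and t: "0 \<le> t" and M: "M \<ge> 0"
 defines "n \<equiv> moments M h t" and "l1 \<equiv> 16 * M*(1 + t) powr (1/16)" and "l2 \<equiv> 16*(h * M)*(1 + t) powr (1/16)"
  and "l3 \<equiv> 16*(h\<^sup>2 * M)*(1 + t) powr (9/16)" and "C \<equiv> decay_const M"
 shows "n 1*(2 * t + l2/h) \<le> C"
  and "n 2*(2 * t\<^sup>2 * h + 2 * t * l2 + l2\<^sup>2/h) + l3/h * n 1 \<le> C"
  and "t * n 2*(1 + l1 + sqrt (t * h)) + l2/h * n 1 \<le> C*(1 + t) powr (-5/4)"
  and "t\<^sup>2 * h * n 3*(1 + l1 + sqrt (t * h)) + n 2*(2 * t * l2 + l2\<^sup>2/h) + l3/h * n 1 \<le> C*(1 + t) powr (-5/4)"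
proof -
 define e where "e = 1 + t"
 have e: "e \<ge> 1" using t by (simp add: e_def)
 define \<Lambda> where "\<Lambda> = 16 * M"
 have \<Lambda>: "\<Lambda> \<ge> 0" using M by (simp add: \<Lambda>_def)
 note mul = powr_calc_mult[OF e] and weak = powr_calc_weaken[OF e]
 have n1: "n 1 \<le> M * e powr (-31/16)" "0 \<le> n 1" and n2: "n 2 \<le> M * e powr (-47/16)" "0 \<le> n 2"
  and n3: "n 3 \<le> M * e powr (-55/16)" "0 \<le> n 3" "n 3 \<le> (M * h powr (-3/2)) * e powr (-63/16)"
  using M by (auto simp: n_def moments_def e_def mult.assoc intro: mult_left_mono)
 have l: "l1 = \<Lambda> * e powr (1/16)" "l2 = h*(\<Lambda> * e powr (1/16))" "l3 = h\<^sup>2*(\<Lambda> * e powr (9/16))"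
  by (simp_all add: l1_def l2_def l3_def \<Lambda>_def e_def)
 have t1: "t \<le> 1 * e powr 1" using t by (simp add: e_def)
 have t2: "t\<^sup>2 \<le> 1 * e powr 2" using t by (simp add: e_def power_mono)
 have one: "1 \<le> 1 * e powr r" if "0 \<le> r" for r using e that by (simp add: ge_one_powr_ge_zero)
 have st: "sqrt t \<le> 1 * e powr (1/2)" using t by (simp add: e_def powr_half_sqrt)
 have sth: "sqrt (t * h) \<le> sqrt t" using h t by (simp add: mult_left_le)
 have l2h: "l2/h = \<Lambda> * e powr (1/16)" "l2\<^sup>2/h = h*(\<Lambda>\<^sup>2 * e powr (1/16 + 1/16))" "l3/h = h*(\<Lambda> * e powr (9/16))"
  using h unfolding powr_add by (simp_all add: l power2_eq_square)
 have hle: "h * x \<le> x" if "0 \<le> x" for x using h that by (simp add: mult_left_le_one_le)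
 have C: "C = M*2 + M*4*\<Lambda> + M*\<Lambda>\<^sup>2" by (simp add: C_def decay_const_def \<Lambda>_def algebra_simps)
 have p: "0 \<le> M*\<Lambda>" "0 \<le> M*\<Lambda>\<^sup>2" using M \<Lambda> by simp_all
 have fin: "x \<le> C * e powr s" if "x \<le> c * e powr r" "0 \<le> c" "c \<le> C" "r \<le> s" for x c r s
 proof -
  have "c * e powr s \<le> C * e powr s" using that by (intro mult_right_mono) auto
  with weak[OF that(1,2,4)] show ?thesis by linarith
 qed
 have d: "l2/h \<le> \<Lambda> * e powr (1/16)" "l2\<^sup>2/h \<le> \<Lambda>\<^sup>2 * e powr (1/8)" "l3/h \<le> \<Lambda> * e powr (9/16)" "l2 \<le> \<Lambda> * e powr (1/16)"
 proof -
  show "l2/h \<le> \<Lambda> * e powr (1/16)" unfolding l2h ..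
  show "l2\<^sup>2/h \<le> \<Lambda>\<^sup>2 * e powr (1/8)" unfolding l2h using hle[of "\<Lambda>\<^sup>2 * e powr (1/8)"] by simp
  show "l3/h \<le> \<Lambda> * e powr (9/16)" unfolding l2h using hle \<Lambda> by simp
  show "l2 \<le> \<Lambda> * e powr (1/16)" unfolding l using hle \<Lambda> by simp
 qed
 have l0: "0 \<le> l2/h" "0 \<le> l2" "0 \<le> l3/h" "0 \<le> l1" "0 \<le> l2\<^sup>2/h" using \<Lambda> h by (simp_all add: l)
 have b3: "l3/h * n 1 \<le> (\<Lambda> * M) * e powr (9/16 + -31/16)" by (rule mul[OF d(3) n1 \<Lambda>])
 have tl: "2 * t * l2 \<le> (2*\<Lambda>) * e powr (1 + 1/16)"
  using mul[OF t1 d(4) l0(2)] by simp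
 have u: "2 * t * l2 + l2\<^sup>2/h \<le> (2*\<Lambda> + \<Lambda>\<^sup>2) * e powr (17/16)"
  by (intro powr_calc_add weak[OF tl] weak[OF d(2)]) (use \<Lambda> in auto)
 have u0: "0 \<le> 2 * t * l2 + l2\<^sup>2/h" using l0 t by simp
 have "2 * t + l2/h \<le> (2 + \<Lambda>) * e powr 1"
  by (intro powr_calc_add weak[OF d(1)]) (use t1 \<Lambda> in auto)
 hence "n 1*(2 * t + l2/h) \<le> (M*(2 + \<Lambda>)) * e powr (-31/16 + 1)"
  by (rule mul[OF n1(1)]) (use l0 t M in auto)
 hence "n 1*(2 * t + l2/h) \<le> C * e powr 0"
  by (rule fin) (use M \<Lambda> p in \<open>auto simp: C algebra_simps\<close>)
 thus "n 1*(2 * t + l2/h) \<le> C" using e by simp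
 have "2 * t\<^sup>2 * h \<le> 2 * e powr 2" using hle[of "2 * t\<^sup>2"] t2 by (simp add: mult.commute)
 hence "2 * t\<^sup>2 * h + (2 * t * l2 + l2\<^sup>2/h) \<le> (2 + (2*\<Lambda> + \<Lambda>\<^sup>2)) * e powr 2"
  by (intro powr_calc_add weak[OF u]) (use \<Lambda> in auto)
 hence a2: "n 2*(2 * t\<^sup>2 * h + (2 * t * l2 + l2\<^sup>2/h)) \<le> (M*(2 + (2*\<Lambda> + \<Lambda>\<^sup>2))) * e powr (-47/16 + 2)"
  by (rule mul[OF n2(1)]) (use u0 h M in auto)
 have "n 2*(2 * t\<^sup>2 * h + (2 * t * l2 + l2\<^sup>2/h)) + l3/h * n 1 \<le> (M*(2 + (2*\<Lambda> + \<Lambda>\<^sup>2)) + \<Lambda> * M) * e powr 0"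
  by (intro powr_calc_add weak[OF b3] weak[OF a2]) (use M \<Lambda> in auto)
 hence "n 2*(2 * t\<^sup>2 * h + (2 * t * l2 + l2\<^sup>2/h)) + l3/h * n 1 \<le> C * e powr 0"
  by (rule fin) (use M \<Lambda> p in \<open>auto simp: C algebra_simps\<close>)
 thus "n 2*(2 * t\<^sup>2 * h + 2 * t * l2 + l2\<^sup>2/h) + l3/h * n 1 \<le> C" using e by (simp add: add.assoc)
 have tn0: "0 \<le> t * n 2" using t n2 by simp
 have "(1 + l1) + sqrt (t * h) \<le> ((1 + \<Lambda>) + 1) * e powr (1/2)"
 proof (intro powr_calc_add)
  show "1 \<le> 1 * e powr (1/2)" by (rule one) simp
  show "l1 \<le> \<Lambda> * e powr (1/2)" unfolding l(1) by (rule weak[OF order_refl \<Lambda>]) simp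
  show "sqrt (t * h) \<le> 1 * e powr (1/2)" using st sth by linarith
 qed
 hence a3: "t * n 2*((1 + l1) + sqrt (t * h)) \<le> (1 * M*((1 + \<Lambda>) + 1)) * e powr ((1 + -47/16) + 1/2)"
  by (rule mul[OF mul[OF t1 n2 zero_le_one]]) (use l0 t h M in auto)
 have "t * n 2*((1 + l1) + sqrt (t * h)) + l2/h * n 1 \<le> (1 * M*((1 + \<Lambda>) + 1) + \<Lambda> * M) * e powr (-5/4)"
  by (intro powr_calc_add weak[OF mul[OF d(1) n1 \<Lambda>]] weak[OF a3]) (use M \<Lambda> in auto)
 hence "t * n 2*((1 + l1) + sqrt (t * h)) + l2/h * n 1 \<le> C * e powr (-5/4)"
  by (rule fin) (use M \<Lambda> p in \<open>auto simp: C algebra_simps\<close>)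
 thus "t * n 2*(1 + l1 + sqrt (t * h)) + l2/h * n 1 \<le> C*(1 + t) powr (-5/4)" by (simp add: e_def)
 have hn3: "h * n 3 \<le> M * e powr (-55/16)" "0 \<le> h * n 3" using hle[OF n3(2)] n3 h by auto
 have "1 + l1 \<le> (1 + \<Lambda>) * e powr (1/16)" by (intro powr_calc_add one) (auto simp: l)
 hence s1: "t\<^sup>2*(h * n 3)*(1 + l1) \<le> (1 * M*(1 + \<Lambda>)) * e powr ((2 + -55/16) + 1/16)"
  by (rule mul[OF mul[OF t2 hn3 zero_le_one]]) (use l0 M in auto)
 \<comment> \<open>The root of the kinetic phase meets the third moment: t^2 h sqrt(t h) = t^(5/2)
   h^(3/2). The second branch of the minimum cancels h^(3/2) and decays fast enough; the first
   branch would leave only the non-integrable rate t^(-15/16).\<close>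
 have s2: "t\<^sup>2*(h * n 3 * sqrt h) * sqrt t \<le> (1 * M*1) * e powr ((2 + -63/16) + 1/2)"
 proof (rule mul[OF mul[OF t2] st])
  have q: "h * sqrt h * h powr (-3/2) = 1"
   using h powr_add[of h 1 "1/2"] powr_add[of h "3/2" "-3/2"] by (simp add: powr_half_sqrt[symmetric])
  have "h * n 3 * sqrt h = (h * sqrt h) * n 3" by simp
  also have "... \<le> (h * sqrt h)*((M * h powr (-3/2)) * e powr (-63/16))" by (rule mult_left_mono[OF n3(3)]) (use h in simp)
  also have "... = (h * sqrt h * h powr (-3/2))*(M * e powr (-63/16))" by (simp only: mult_ac)
  finally show "h * n 3 * sqrt h \<le> M * e powr (-63/16)" unfolding q by simp
 qed (use h t n3 M in auto)
 have "t\<^sup>2*(h * n 3)*(1 + l1) + t\<^sup>2*(h * n 3 * sqrt h) * sqrt t + n 2*(2 * t * l2 + l2\<^sup>2/h) + l3/h * n 1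
   \<le> (1 * M*(1 + \<Lambda>) + 1 * M*1 + M*(2*\<Lambda> + \<Lambda>\<^sup>2) + \<Lambda> * M) * e powr (-5/4)"
  by (intro powr_calc_add weak[OF s1] weak[OF s2] weak[OF b3] weak[OF mul[OF n2(1) u u0 M]]) (use M \<Lambda> in auto)
 hence "t\<^sup>2*(h * n 3)*(1 + l1) + t\<^sup>2*(h * n 3 * sqrt h) * sqrt t + n 2*(2 * t * l2 + l2\<^sup>2/h) + l3/h * n 1 \<le> C * e powr (-5/4)"
  by (rule fin) (use M \<Lambda> p in \<open>auto simp: C algebra_simps\<close>)
 moreover have "t\<^sup>2 * h * n 3*(1 + l1 + sqrt (t * h)) = t\<^sup>2*(h * n 3)*(1 + l1) + t\<^sup>2*(h * n 3 * sqrt h) * sqrt t"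
  by (simp add: real_sqrt_mult algebra_simps)
 ultimately show "t\<^sup>2 * h * n 3*(1 + l1 + sqrt (t * h)) + n 2*(2 * t * l2 + l2\<^sup>2/h) + l3/h * n 1 \<le> C*(1 + t) powr (-5/4)"
  by (simp add: e_def)
qed

text \<open>Assembles the estimates for one value of h. The constant is built from M alone, hence
  uniform in h and T.\<close>

lemma wave_bound:
 assumes h: "0 < h" "h \<le> 1" and T: "T > 0" and jc: "continuous_on ({0..T} \<times> UNIV) (\<lambda>p. V (fst p) (snd p))"
  and Bd: "\<And>t x. t \<in> {0..T} ==> \<bar>V t x\<bar> \<le> Bd" and M: "M \<ge> 0"
  and nu: "\<And>t. t \<in> {0..T} ==> nu_rep (\<nu> t) (V t) (moments M h t)" and t': "t' \<in> {0..T}" and s: "s \<in> {0..2}"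
 shows "L2_opnorm (weighted_wave_operator s h T V t') \<le> ennreal (sqrt 2 * wave_const (4 * decay_const M))"
proof -
 interpret E: evo h T V Bd using h T jc Bd by unfold_locales auto
 define l1 where "l1 t = 16 * M*(1 + t) powr (1/16)" for t
 define l2 where "l2 t = 16*(h * M)*(1 + t) powr (1/16)" for t
 define l3 where "l3 t = 16*(h\<^sup>2 * M)*(1 + t) powr (9/16)" for t
 define C where "C = decay_const M"
 have C0: "0 \<le> C" using M by (simp add: C_def decay_const_def)
 have sl: "slice h (t * h) (V t) (E.\<Omega> t) (\<nu> t) (moments M h t) Bd (l1 t) (l2 t) (l3 t)" if t: "t \<in> {0..T}" for t
 proof -
  let ?P = "\<lambda>\<tau> y z. V \<tau> (z + y) - V \<tau> z"
  \<comment> \<open>\<Omega> is 1/h times a time integral of V(\<tau>, \<tau> h \<xi>), so its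
    differences are integrals of differences of V with increments scaled by \<tau> h.\<close>
  have I: "((\<lambda>\<tau>. ?P \<tau> ((\<tau> * h) *\<^sub>R \<eta>) ((\<tau> * h) *\<^sub>R \<xi>)) has_integral h*(E.\<Omega> t (\<xi> + \<eta>) - E.\<Omega> t \<xi>)) {0..t}" for \<xi> \<eta>
   using has_integral_diff[OF E.\<Omega>_has_integral[OF t, of "\<xi> + \<eta>"] E.\<Omega>_has_integral[OF t, of \<xi>]]
   by (simp add: right_diff_distrib scaleR_add_right)
  have eta: "\<xi> = (\<xi> - \<eta>) + \<eta>" for \<xi> \<eta> :: R3 by simp
  have \<tau>h: "norm ((\<tau> * h) *\<^sub>R a) = h*(\<tau> * norm a)" if "\<tau> \<in> {0..t}" for \<tau> and a :: R3 using that h by simp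
  \<comment> \<open>k scaled increments give \<tau>^k times the k-th moment; 1 - 31/16 and 2 - 47/16
    equal 1/16 - 1, and 3 - 55/16 equals 9/16 - 1. For k = 3 the first branch of the minimum is
    taken, which has no negative power of h.\<close>
  have n1: "\<tau> * moments M h \<tau> 1 \<le> M*(1 + \<tau>) powr (1/16 - 1)"
   and n2: "\<tau>\<^sup>2 * moments M h \<tau> 2 \<le> M*(1 + \<tau>) powr (1/16 - 1)"
   and n3: "\<tau>^3 * moments M h \<tau> 3 \<le> M*(1 + \<tau>) powr (9/16 - 1)" if "\<tau> \<in> {0..t}" for \<tau>
  proof -
   have e: "1 + \<tau> \<ge> 1" "0 \<le> \<tau>" using that by auto
   have p: "\<tau>^k \<le> 1*(1 + \<tau>) powr real k" for k using e by (simp add: powr_realpow power_mono)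
   have m: "0 \<le> moments M h \<tau> k" for k using M by (simp add: moments_def)
   have "\<tau>^1 * moments M h \<tau> 1 \<le> (1 * M)*(1 + \<tau>) powr (real 1 + -31/16)"
    by (rule powr_calc_mult[OF e(1) p _ m]) (auto simp: moments_def)
   thus "\<tau> * moments M h \<tau> 1 \<le> M*(1 + \<tau>) powr (1/16 - 1)" by simp
   have "\<tau>^2 * moments M h \<tau> 2 \<le> (1 * M)*(1 + \<tau>) powr (real 2 + -47/16)"
    by (rule powr_calc_mult[OF e(1) p _ m]) (auto simp: moments_def)
   thus "\<tau>\<^sup>2 * moments M h \<tau> 2 \<le> M*(1 + \<tau>) powr (1/16 - 1)" by simp
   have "\<tau>^3 * moments M h \<tau> 3 \<le> (1 * M)*(1 + \<tau>) powr (real 3 + -55/16)"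
    by (rule powr_calc_mult[OF e(1) p _ m]) (auto simp: moments_def M intro: mult_left_mono)
   thus "\<tau>^3 * moments M h \<tau> 3 \<le> M*(1 + \<tau>) powr (9/16 - 1)" by simp
  qed
  show ?thesis
  proof (unfold_locales, goal_cases)
   case 3 show ?case using nu[OF t] .
  next
   case 4 show ?case using E.V_comp[of UNIV "\<lambda>_. t" "\<lambda>x. x"] t by simp
  next
   case 6 show ?case by (intro borel_measurable_continuous_onI E.\<Omega>_cont t)
  next
   case (7 \<xi> \<eta>)
   have "\<bar>E.\<Omega> t ((\<xi> - \<eta>) + \<eta>) - E.\<Omega> t (\<xi> - \<eta>)\<bar> \<le> 16*(M * norm \<eta>)*(1 + t) powr (1/16)"
   proof (rule E.phase_integral_bound[OF t I])
    fix \<tau> assume \<tau>: "\<tau> \<in> {0..t}"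
    hence "\<bar>?P \<tau> ((\<tau> * h) *\<^sub>R \<eta>) ((\<tau> * h) *\<^sub>R (\<xi> - \<eta>))\<bar> \<le> moments M h \<tau> 1 * norm ((\<tau> * h) *\<^sub>R \<eta>)"
     using t by (intro nu_differences(1)[OF nu]) auto
    also have "... = (h * norm \<eta>)*(\<tau> * moments M h \<tau> 1)" unfolding \<tau>h[OF \<tau>] by simp
    also have "... \<le> (h * norm \<eta>)*(M*(1 + \<tau>) powr (1/16 - 1))" using h by (intro mult_left_mono n1 \<tau>) auto
    finally show "\<bar>?P \<tau> ((\<tau> * h) *\<^sub>R \<eta>) ((\<tau> * h) *\<^sub>R (\<xi> - \<eta>))\<bar> \<le> h*(M * norm \<eta>)*(1 + \<tau>) powr (1/16 - 1)" by (simp add: mult_ac)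
   qed (use M in auto)
   thus ?case by (simp add: l1_def mult_ac)
  next
   case (8 \<xi> a \<eta>)
   have "\<bar>(E.\<Omega> t (((\<xi> - \<eta>) + a) + \<eta>) - E.\<Omega> t ((\<xi> - \<eta>) + a)) - (E.\<Omega> t ((\<xi> - \<eta>) + \<eta>) - E.\<Omega> t (\<xi> - \<eta>))\<bar> \<le> 16*(h*(M*(norm a * norm \<eta>)))*(1 + t) powr (1/16)"
   proof (rule E.phase_integral_bound[OF t has_integral_diff[OF I I, unfolded right_diff_distrib[symmetric]]])
    fix \<tau> assume \<tau>: "\<tau> \<in> {0..t}"
    let ?y = "(\<tau> * h) *\<^sub>R \<eta>" and ?z = "(\<tau> * h) *\<^sub>R (\<xi> - \<eta>)"
    have "\<bar>?P \<tau> ?y (?z + (\<tau> * h) *\<^sub>R a) - ?P \<tau> ?y ?z\<bar> \<le> moments M h \<tau> 2*(norm ((\<tau> * h) *\<^sub>R a) * norm ?y)"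
     using t \<tau> by (intro nu_differences(2)[OF nu]) auto
    also have "... = (h * h*(norm a * norm \<eta>))*(\<tau>\<^sup>2 * moments M h \<tau> 2)" unfolding \<tau>h[OF \<tau>] by (simp add: power2_eq_square)
    also have "... \<le> (h * h*(norm a * norm \<eta>))*(M*(1 + \<tau>) powr (1/16 - 1))" using h by (intro mult_left_mono n2 \<tau>) auto
    finally show "\<bar>?P \<tau> ?y ((\<tau> * h) *\<^sub>R ((\<xi> - \<eta>) + a)) - ?P \<tau> ?y ?z\<bar> \<le> h*(h*(M*(norm a * norm \<eta>)))*(1 + \<tau>) powr (1/16 - 1)"
     unfolding scaleR_add_right by (simp add: mult_ac)
   qed (use M h in auto)
   moreover have "((\<xi> - \<eta>) + a) + \<eta> = \<xi> + a" "(\<xi> - \<eta>) + a = \<xi> + a - \<eta>" "(\<xi> - \<eta>) + \<eta> = \<xi>" by (simp_all add: algebra_simps)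
   ultimately show ?case by (simp add: l2_def mult_ac)
  next
   case (9 \<xi> a b \<eta>)
   have "\<bar>(E.\<Omega> t (((\<xi> - \<eta>) + (a + b)) + \<eta>) - E.\<Omega> t ((\<xi> - \<eta>) + (a + b))) - (E.\<Omega> t (((\<xi> - \<eta>) + a) + \<eta>) - E.\<Omega> t ((\<xi> - \<eta>) + a))
     - (E.\<Omega> t (((\<xi> - \<eta>) + b) + \<eta>) - E.\<Omega> t ((\<xi> - \<eta>) + b)) + (E.\<Omega> t ((\<xi> - \<eta>) + \<eta>) - E.\<Omega> t (\<xi> - \<eta>))\<bar>
     \<le> 16*(h\<^sup>2*(M*(norm a * norm b * norm \<eta>)))*(1 + t) powr (9/16)"
   proof (rule E.phase_integral_bound[OF t has_integral_add[OF has_integral_diff[OF has_integral_diff[OF I I] I] I, unfolded right_diff_distrib[symmetric] distrib_left[symmetric]]])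
    fix \<tau> assume \<tau>: "\<tau> \<in> {0..t}"
    let ?y = "(\<tau> * h) *\<^sub>R \<eta>" and ?z = "(\<tau> * h) *\<^sub>R (\<xi> - \<eta>)" and ?a = "(\<tau> * h) *\<^sub>R a" and ?b = "(\<tau> * h) *\<^sub>R b"
    have "\<bar>?P \<tau> ?y (?z + (?a + ?b)) - ?P \<tau> ?y (?z + ?a) - ?P \<tau> ?y (?z + ?b) + ?P \<tau> ?y ?z\<bar> \<le> moments M h \<tau> 3*(norm ?a * norm ?b * norm ?y)"
     using t \<tau> by (intro nu_differences(3)[OF nu]) auto
    also have "... = (h * h\<^sup>2*(norm a * norm b * norm \<eta>))*(\<tau>^3 * moments M h \<tau> 3)" unfolding \<tau>h[OF \<tau>] by (simp add: power2_eq_square power3_eq_cube)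
    also have "... \<le> (h * h\<^sup>2*(norm a * norm b * norm \<eta>))*(M*(1 + \<tau>) powr (9/16 - 1))" using h by (intro mult_left_mono n3 \<tau>) auto
    finally show "\<bar>?P \<tau> ?y ((\<tau> * h) *\<^sub>R ((\<xi> - \<eta>) + (a + b))) - ?P \<tau> ?y ((\<tau> * h) *\<^sub>R ((\<xi> - \<eta>) + a)) - ?P \<tau> ?y ((\<tau> * h) *\<^sub>R ((\<xi> - \<eta>) + b)) + ?P \<tau> ?y ?z\<bar>
      \<le> h*(h\<^sup>2*(M*(norm a * norm b * norm \<eta>)))*(1 + \<tau>) powr (9/16 - 1)"
     unfolding scaleR_add_right by (simp add: mult_ac)
   qed (use M h in auto)
   moreover have "((\<xi> - \<eta>) + c) + \<eta> = \<xi> + c" "(\<xi> - \<eta>) + c = \<xi> + c - \<eta>" for c by (simp_all add: algebra_simps)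
   ultimately show ?case by (simp add: l3_def mult_ac)
  qed (use t h M Bd in \<open>auto simp: l1_def l2_def l3_def\<close>)
 qed
 \<comment> \<open>The antiderivative of the rate -5/4 that vanishes at 0 stays below 4 C for all
   times; this makes the final constant independent of T. The same C serves as crude
   constant.\<close>
 have "evo_est h T V Bd \<nu> (moments M h) l1 l2 l3 (\<lambda>t. C*(1 + t) powr (-5/4)) (\<lambda>t. 4 * C*(1 - (1 + t) powr (-1/4))) C (4 * C)"
 proof (rule evo_est.intro[OF E.evo_axioms], rule evo_est_axioms.intro, goal_cases)
  case (1 t)
  thus ?case by (rule sl)
 next
  case (6 t)
  have "((\<lambda>t. 4 * C*(1 - (1 + t) powr (-1/4))) has_real_derivative 4 * C*(0 - (-1/4)*(1 + t) powr (-1/4 - 1))) (at t within {0..T})"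
   using 6 by (auto intro!: derivative_eq_intros)
  thus ?case by simp
 next
  case (8 t)
  hence "(1 + t) powr (-1/4) \<le> 1" using powr_mono[of "-1/4" 0 "1 + t"] by simp
  thus ?case using C0 mult_left_mono[of "1 - (1 + t) powr (-1/4)" 1 "4 * C"] by simp
 qed (use coefficient_bounds[OF h _ M] in \<open>auto simp: l1_def l2_def l3_def C_def\<close>)
 thus ?thesis using evo_est.wave_opnorm t' s unfolding C_def by blast
qed

section \<open>Continuity and pointwise bounds from the hypotheses on V\<close>

lemma is_weak_deriv_0:
 assumes "continuous_on UNIV f" shows "is_weak_deriv 0 f f"
proof -
 have "set_integrable lborel S f" if "compact S" for S
  unfolding set_integrable_def using that assms by (intro borel_integrable_compact) (auto intro: continuous_on_subset)
 moreover have "f \<in> bmeas" using assms by (rule borel_measurable_continuous_onI)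
 ultimately show ?thesis by (simp add: is_weak_deriv_def locally_integrable_def pderivs_def mi_order_def)
qed

lemma W_inf_norm_bound:
 assumes f: "continuous_on UNIV f" and le: "W_inf_norm k f \<le> ennreal C" "0 \<le> C"
 shows "norm (f x) \<le> C"
proof (rule weak_deriv_0_bound[OF f _ _ le(2)])
 show "is_weak_deriv 0 f (weak_deriv 0 f)" unfolding weak_deriv_def by (rule someI[of "is_weak_deriv 0 f", OF is_weak_deriv_0[OF f]])
 have "Linf_norm (weak_deriv 0 f) \<le> W_inf_norm k f" unfolding W_inf_norm_def by (rule SUP_upper) (simp add: mi_order_def)
 thus "Linf_norm (weak_deriv 0 f) \<le> ennreal C" using le(1) by (rule order_trans)
qed

text \<open>For continuous representatives, convergence in the Sobolev norm is uniform in x, so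
  continuity in t holds uniformly in x and combines with continuity in x.\<close>

lemma C_W_inf_continuous:
 assumes V: "C_W_inf k T V"
 shows "continuous_on ({0..T} \<times> UNIV) (\<lambda>p. V (fst p) (snd p))"
 unfolding continuous_on_iff
proof (intro ballI allI impI)
 fix p :: "real \<times> R3" and \<epsilon> :: real assume p: "p \<in> {0..T} \<times> UNIV" and \<epsilon>: "0 < \<epsilon>"
 obtain t x where px: "p = (t, x)" by (cases p)
 have t: "t \<in> {0..T}" using p px by simp
 have c: "continuous_on UNIV (V \<tau>)" if "\<tau> \<in> {0..T}" for \<tau> using V that by (simp add: C_W_inf_def)
 have "((\<lambda>\<tau>. W_inf_norm k (\<lambda>x. of_real (V \<tau> x - V t x))) \<longlongrightarrow> 0) (at t within {0..T})" using V t by (simp add: C_W_inf_def)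
 hence "\<forall>\<^sub>F \<tau> in at t within {0..T}. W_inf_norm k (\<lambda>x. of_real (V \<tau> x - V t x)) < ennreal (\<epsilon>/2)"
  by (rule order_tendstoD) (use \<epsilon> in simp)
 then obtain d1 where d1: "d1 > 0" "\<And>\<tau>. \<tau> \<in> {0..T} ==> \<tau> \<noteq> t ==> dist \<tau> t < d1 ==> W_inf_norm k (\<lambda>x. of_real (V \<tau> x - V t x)) < ennreal (\<epsilon>/2)"
  unfolding eventually_at by blast
 have u: "\<bar>V \<tau> y - V t y\<bar> \<le> \<epsilon>/2" if "\<tau> \<in> {0..T}" "dist \<tau> t < d1" for \<tau> y
 proof (cases "\<tau> = t")
  case False
  have "norm (complex_of_real (V \<tau> y - V t y)) \<le> \<epsilon>/2"
   by (rule W_inf_norm_bound[OF _ less_imp_le[OF d1(2)[OF that(1) False that(2)]]])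
    (use \<epsilon> c that t in \<open>auto intro!: continuous_intros\<close>)
  thus ?thesis unfolding norm_of_real .
 qed (use \<epsilon> in simp)
 obtain d2 where d2: "d2 > 0" "\<And>y. dist y x < d2 ==> dist (V t y) (V t x) < \<epsilon>/2"
  using c[OF t] half_gt_zero[OF \<epsilon>] unfolding continuous_on_iff by blast
 show "\<exists>d>0. \<forall>q\<in>{0..T} \<times> UNIV. dist q p < d \<longrightarrow> dist (V (fst q) (snd q)) (V (fst p) (snd p)) < \<epsilon>"
 proof (intro exI[of _ "min d1 d2"] conjI ballI impI)
  fix q :: "real \<times> R3" assume q: "q \<in> {0..T} \<times> UNIV" "dist q p < min d1 d2"
  have 1: "dist (fst q) t < d1" using dist_fst_le[of q p] q(2) by (simp add: px)
  have 2: "dist (snd q) x < d2" using dist_snd_le[of q p] q(2) by (simp add: px)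
  have "\<bar>V (fst q) (snd q) - V t (snd q)\<bar> \<le> \<epsilon>/2" using u[of "fst q"] q 1 by auto
  thus "dist (V (fst q) (snd q)) (V (fst p) (snd p)) < \<epsilon>" using d2(2)[OF 2] unfolding px fst_conv snd_conv dist_real_def by linarith
 qed (use d1 d2 in simp)
qed

text \<open>Since (1 + t)/2 \<le> <t>, the negative power loses at most 2^p \<le> 2^4 = 16.\<close>

lemma japanese_powr_le:
 assumes "t \<ge> 0" "0 \<le> p" "p \<le> 4" shows "japanese (t::real) powr (- p) \<le> 16*(1 + t) powr (- p)"
proof -
 have "(1 + t)^2 \<le> 4*(1 + t\<^sup>2)"
 proof -
  have "(1 + t)^2 + (1 - t)^2 = 2*(1 + t\<^sup>2)" by (simp add: power2_eq_square algebra_simps)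
  hence "(1 + t)^2 \<le> 2*(1 + t\<^sup>2)" using zero_le_power2[of "1 - t"] by linarith
  also have "... \<le> 4*(1 + t\<^sup>2)" by (rule mult_right_mono) auto
  finally show ?thesis .
 qed
 hence "sqrt ((1 + t)^2) \<le> sqrt (4*(1 + t\<^sup>2))" by (rule real_sqrt_le_mono)
 hence "(1 + t)/2 \<le> japanese t" using assms unfolding real_sqrt_mult by (simp add: japanese_def)
 hence "japanese t powr (- p) \<le> ((1 + t)/2) powr (- p)" using assms by (intro powr_mono2') auto
 also have "... = 2 powr p*(1 + t) powr (- p)" using assms by (simp add: powr_divide powr_minus_divide)
 also have "... \<le> 2 powr 4*(1 + t) powr (- p)" using assms by (intro mult_right_mono powr_mono) auto
 finally show ?thesis by simp
qed

lemma FL1_norm_fourier: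
 assumes "FL1_norm f \<le> ennreal C"
 shows "is_fourier f (fourier f)" "(\<integral>\<^sup>+\<xi>. ennreal (norm (fourier f \<xi>)) \<partial>lborel) \<le> ennreal C"
proof -
 have ex: "\<exists>g. is_fourier f g"
 proof (rule ccontr)
  assume "\<nexists>g. is_fourier f g"
  thus False using assms by (simp add: FL1_norm_def top_unique)
 qed
 thus "is_fourier f (fourier f)" unfolding fourier_def by (rule someI_ex)
 show "(\<integral>\<^sup>+\<xi>. ennreal (norm (fourier f \<xi>)) \<partial>lborel) \<le> ennreal C" using assms ex by (simp add: FL1_norm_def)
qed

theorem proposition4p1:
  shows "\<exists>\<delta>>0::real. \<forall>K>0::real. \<exists>C>0::real.
    \<forall>(T::real) (V :: real \<Rightarrow> real \<Rightarrow> R3 \<Rightarrow> real).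
      T > 0 \<and>
      (\<forall>h\<in>{0<..1}. C_W_inf 4 T (V h)) \<and>
      (\<forall>h\<in>{0<..1}. \<forall>t\<in>{0..T}. \<forall>\<alpha>.
        let dV = weak_deriv \<alpha> (\<lambda>x. of_real (V h t x)) in
          (mi_order \<alpha> = 0 \<longrightarrow> Linf_norm dV \<le> ennreal (K * japanese t powr (-1))) \<and>
          (mi_order \<alpha> = 1 \<longrightarrow> Linf_norm dV \<le> ennreal (K * japanese t powr (-2))) \<and>
          (mi_order \<alpha> = 2 \<longrightarrow> Linf_norm dV \<le> ennreal (K * japanese t powr (-3 + \<delta>))) \<and>
          (mi_order \<alpha> = 3 \<longrightarrow> Linf_norm dV \<le> ennreal (K * japanese t powr (-4 + \<delta>))) \<and>
          (mi_order \<alpha> = 4 \<longrightarrow> Linf_norm dV \<le> ennreal (K * japanese t powr (-4 + \<delta>))) \<and>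
          (mi_order \<alpha> = 1 \<longrightarrow> FL1_norm dV \<le> ennreal (K * japanese t powr (-2 + \<delta>))) \<and>
          (mi_order \<alpha> = 2 \<longrightarrow> FL1_norm dV \<le> ennreal (K * japanese t powr (-3 + \<delta>))) \<and>
          (mi_order \<alpha> = 3 \<longrightarrow> FL1_norm dV \<le> ennreal (K *
             min (japanese t powr (-7/2 + \<delta>)) (h powr (-3/2) * japanese t powr (-4 + \<delta>)))))
      \<longrightarrow>
      (\<forall>s\<in>{0..2}.
        (SUP h\<in>{0<..1}. SUP t\<in>{0..T}. L2_opnorm (weighted_wave_operator s h T (V h) t))
          \<le> ennreal C)"
proof (rule exI[of _ "1/16"], rule conjI, simp, intro allI impI, goal_cases)
 \<comment> \<open>With \<delta> = 1/16 every rate entering \<beta> is at most -3/2 + 2 \<delta> =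
   -11/8, below the -5/4 that is integrated in time.\<close>
 case (1 K)
 hence K: "K > 0" .
 \<comment> \<open>The factor 27 \<open>c0\<close> is lost in passing from the derivatives to \<nu>,
   and 16 in replacing <t> by 1 + t.\<close>
 define M where "M = 27 * c0*(16 * K)"
 have M: "M \<ge> 0" using K c0_pos by (simp add: M_def)
 show ?case
 proof (intro exI[of _ "sqrt 2 * wave_const (4 * decay_const M)"] conjI allI impI ballI SUP_least, goal_cases)
  case 1
  show ?case using wave_const_ge1[of "4 * decay_const M"] by simp
 next
  case (2 T V s h t)
  hence T: "T > 0" and CW: "C_W_inf 4 T (V h)" and s: "s \<in> {0..2}" and h: "h \<in> {0<..1}" and t: "t \<in> {0..T}" by blast+
  have hyp: "(let dV = weak_deriv \<alpha> (\<lambda>x. of_real (V h t x)) in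
     (mi_order \<alpha> = 0 \<longrightarrow> Linf_norm dV \<le> ennreal (K * japanese t powr (-1))) \<and>
     (mi_order \<alpha> = 1 \<longrightarrow> FL1_norm dV \<le> ennreal (K * japanese t powr (-2 + 1/16))) \<and>
     (mi_order \<alpha> = 2 \<longrightarrow> FL1_norm dV \<le> ennreal (K * japanese t powr (-3 + 1/16))) \<and>
     (mi_order \<alpha> = 3 \<longrightarrow> FL1_norm dV \<le> ennreal (K *
       min (japanese t powr (-7/2 + 1/16)) (h powr (-3/2) * japanese t powr (-4 + 1/16)))))"
   if "t \<in> {0..T}" for t \<alpha>
   using 2(1) h that unfolding Let_def by blast
  have wd: "is_weak_deriv \<alpha> (\<lambda>x. of_real (V h t x)) (weak_deriv \<alpha> (\<lambda>x. of_real (V h t x)))"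
   if "t \<in> {0..T}" "mi_order \<alpha> \<le> 4" for t \<alpha>
  proof -
   have "\<exists>g. is_weak_deriv \<alpha> (\<lambda>x. of_real (V h t x)) g" using CW that unfolding C_W_inf_def W_inf_def by blast
   thus ?thesis unfolding weak_deriv_def by (rule someI_ex)
  qed
  have cV: "continuous_on UNIV (V h t)" if "t \<in> {0..T}" for t using CW that by (simp add: C_W_inf_def)
  have Bd: "\<bar>V h t x\<bar> \<le> K" if t: "t \<in> {0..T}" for t x
  proof -
   have "japanese t powr (-1) \<le> 1" using powr_mono[of "-1" 0 "japanese t"] japanese_ge1[of t] by (auto split: if_splits)
   hence "K * japanese t powr (-1) \<le> K" using K mult_left_mono[of "japanese t powr (-1)" 1 K] by simp
   moreover have "Linf_norm (weak_deriv 0 (\<lambda>x. of_real (V h t x))) \<le> ennreal (K * japanese t powr (-1))"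
    using hyp[OF t, of 0] by (simp add: Let_def mi_order_def)
   ultimately have "Linf_norm (weak_deriv 0 (\<lambda>x. of_real (V h t x))) \<le> ennreal K"
    using order_trans ennreal_leI by blast
   hence "norm (complex_of_real (V h t x)) \<le> K"
    using K by (intro weak_deriv_0_bound[OF _ wd[OF t]] continuous_on_of_real cV t) (auto simp: mi_order_def)
   thus ?thesis unfolding norm_of_real .
  qed
  have "\<exists>\<nu>. nu_rep \<nu> (V h t) (moments M h t)" if t: "t \<in> {0..T}" for t
  proof -
   have t0: "0 \<le> t" using t by simp
   note J = japanese_powr_le[OF t0]
   have bound: "FL1_norm (weak_deriv \<alpha> (\<lambda>x. of_real (V h t x))) \<le> ennreal (moments (16 * K) h t (mi_order \<alpha>))"
    if k: "mi_order \<alpha> \<in> {1..3}" for \<alpha>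
   proof -
    consider "mi_order \<alpha> = 1" | "mi_order \<alpha> = 2" | "mi_order \<alpha> = 3" using k by fastforce
    thus ?thesis
    proof cases
     case 1
     have "K * japanese t powr (-2 + 1/16) \<le> moments (16 * K) h t (mi_order \<alpha>)"
      using mult_left_mono[OF J[of "31/16"], of K] K by (simp add: moments_def 1)
     thus ?thesis using hyp[OF t, of \<alpha>] 1 order_trans[OF _ ennreal_leI] by (simp add: Let_def)
    next
     case 2
     have "K * japanese t powr (-3 + 1/16) \<le> moments (16 * K) h t (mi_order \<alpha>)"
      using mult_left_mono[OF J[of "47/16"], of K] K by (simp add: moments_def 2)
     thus ?thesis using hyp[OF t, of \<alpha>] 2 order_trans[OF _ ennreal_leI] by (simp add: Let_def)
    next
     case 3
     have "min (japanese t powr (-7/2 + 1/16)) (h powr (-3/2) * japanese t powr (-4 + 1/16))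
       \<le> min (16*(1 + t) powr (-55/16)) (h powr (-3/2)*(16*(1 + t) powr (-63/16)))"
      using J[of "55/16"] J[of "63/16"] by (intro min.mono mult_left_mono) auto
     also have "... = 16 * min ((1 + t) powr (-55/16)) (h powr (-3/2)*(1 + t) powr (-63/16))"
      by (simp add: min_mult_distrib_left mult_ac)
     finally have "K * min (japanese t powr (-7/2 + 1/16)) (h powr (-3/2) * japanese t powr (-4 + 1/16)) \<le> moments (16 * K) h t (mi_order \<alpha>)"
      using K by (simp add: moments_def 3 mult_left_mono)
     thus ?thesis using hyp[OF t, of \<alpha>] 3 order_trans[OF _ ennreal_leI] by (simp add: Let_def)
    qed
   qed
   obtain \<nu> where "nu_rep \<nu> (V h t) (\<lambda>k. 27 * c0 * moments (16 * K) h t k)"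
   proof (rule nu_representation[OF cV[OF t] wd[OF t] FL1_norm_fourier(1)[OF bound] FL1_norm_fourier(2)[OF bound]])
    show "0 \<le> moments (16 * K) h t k" for k using K by (simp add: moments_def)
   qed auto
   moreover have "(\<lambda>k. 27 * c0 * moments (16 * K) h t k) = moments M h t" by (simp add: fun_eq_iff moments_def M_def)
   ultimately show ?thesis by auto
  qed
  then obtain \<nu> where \<nu>: "\<And>t. t \<in> {0..T} ==> nu_rep (\<nu> t) (V h t) (moments M h t)" by metis
  show ?case
   by (rule wave_bound[OF _ _ T C_W_inf_continuous[OF CW] Bd M \<nu> t s]) (use h in auto)
 qed
qed

end
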